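(* Assume $\mathcal B\in \mathcal L\mathrm{is}(H_{0,\Gamma_-}(\mathbf b;\Omega),L_2(\Omega))$ (i.e. $\mathcal B$ is a boundedly invertible linear map between these spaces) and let $f\in L_2(\Omega)$, $u^{\rm ex}:=\mathcal B^{-1}f$. Let $\mathcal T\in\mathbb T$ and assume that $\mathbf b|_{K'}\in W^1_\infty(K')^n$ and $c|_{K'}\in W^1_\infty(K')$ for all $K'\in\mathcal T$. Let $\tilde{\mathbf b},\tilde c,\tilde f$ be the best approximations, by piecewise polynomials with respect to $\mathcal T$ of degrees $m_{\mathbf b}, m_c, m_f$, to $\mathbf b$ in $L_\infty(\Omega)^n$, to $c$ in $L_\infty(\Omega)$, and to $f$ in $L_2(\Omega)$, respectively, and set $$\mathrm{osc}_{\mathcal T}(\mathbf b,c,f):=\max\Big(\|f-\tilde f\|_{L_2(\Omega)},\ \max\big(\|c-\tilde c\|_{L_\infty(\Omega)},\ \max_{K'\in\mathcal T}\operatorname{diam}(K')^{-1}\||\mathbf b-\tilde{\mathbf b}|\|_{L_\infty(K')}\big)\,\|f\|_{L_2(\Omega)}\Big).$$ Let $m_v\ge \max\big(m_w+\max(m_c,1,m_{\mathbf b}-1),\,m_u+\max(m_c,1),\,m_f\big)$, and let $C_0>0$ be a constant. Then, for fixed sufficiently small $\sigma>0$, for any $(u,w)\in\breve{\mathbb U}^\delta_{\mathcal T}$ with $\max(\|u\|_{L_2(\Omega)},\|w\|_{L_2(\Omega)})\le C_0\|f\|_{L_2(\Omega)}$ it holds that $$\|R^\delta_{\mathcal T_s}\|_{H(\mathbf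 b;\mathcal T_s)}\lesssim \|(u^{\rm ex},u^{\rm ex})-(u,w)\|_{\breve{\mathbb U}}\lesssim \|R^\delta_{\mathcal T_s}\|_{H(\mathbf b;\mathcal T_s)}+\mathrm{osc}_{\mathcal T}(\mathbf b,c,f),$$ where $R^\delta_{\mathcal T_s}\in\bar{\mathbb V}^\delta_{\mathcal T_s}$ is defined by $$\langle R^\delta_{\mathcal T_s},v\rangle_{H(\mathbf b;\mathcal T_s)}=b_{\mathcal T_s}(u,w;v)-\int_\Omega f v\,d\mathbf x\qquad(v\in\bar{\mathbb V}^\delta_{\mathcal T_s}).$$ The constants hidden in $\lesssim$ depend only on the polynomial degrees, on $C_0$, on the fixed $\sigma$ and the comparability constant in the subgrid condition, and on (upper bounds for) $\varrho$, $\||\mathbf b|^{-1}\|_{L_\infty(\Omega)}$, $\sup_{K'\in\mathcal T}\|\mathbf b\|_{W^1_\infty(K')^n}$, $\sup_{K'\in\mathcal T}\|c\|_{W^1_\infty(K')}$, and $\|\mathcal B^{-1}\|_{\mathcal L(L_2(\Omega),H_{0,\Gamma_-}(\mathbf b;\Omega))}$.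
   Context: $\Omega\subset\mathbb R^n$ is a bounded polytopal domain; $\mathbf b\in L_\infty(\Omega)^n$ with $\operatorname{div}\mathbf b\in L_\infty(\Omega)$, $|\mathbf b|^{-1}\in L_\infty(\Omega)$; $c\in L_\infty(\Omega)$. $\Gamma_\pm$ is the closure of the set of points of $\partial\Omega$ at which the outward unit normal $\mathbf n$ is well defined and $\pm\mathbf n\cdot\mathbf b>0$. $H(\mathbf b;\Omega):=\{u\in L_2(\Omega):\mathbf b\cdot\nabla u\in L_2(\Omega)\}$ with $\|u\|^2_{H(\mathbf b;\Omega)}=\|u\|^2_{L_2(\Omega)}+\|\mathbf b\cdot\nabla u\|^2_{L_2(\Omega)}$; $H_{0,\Gamma_-}(\mathbf b;\Omega)$ is the closure in it of the smooth functions vanishing on $\Gamma_-$. $\mathcal B w:=\mathbf b\cdot\nabla w+cw$. $\mathbb T$ is an (infinite) family of partitions of $\bar\Omega$ into essentially disjoint closed $n$-simplices, all obtained from an initial partition $\mathcal T_\bot$ by repeated application, to individual simplices, of a refinement rule that splits a simplex into 2 or more subsimplices. The simplices are uniformly shape regular: $\varrho:=\sup_K \varrho_K<\infty$ over all simplices $K$ in all partitions of $\mathbb T$, where $\varrho_K:=\operatorname{diam}(K)/\sup\{\operatorname{diam}(B):B\text{ a ball in }K\}$. To each $\mathcal T\in\mathbb T$ a refinement $\mathcal T_s\in\mathbb T$ of $\mathcal T$ is assigned, and $$\sigma:=\sup_{\mathcal T\in\mathbb T}\max_{K'\in\mathcal T}\max\Big(\max_{\{K\in\mathcal T_s:K\subset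 K'\}}\frac{\operatorname{diam}(K)}{\operatorname{diam}(K')},\ \operatorname{diam}(K')\Big);$$ the subgrid condition $\inf_{\mathcal T\in\mathbb T}\min_{K'\in\mathcal T}\min_{\{K\in\mathcal T_s:K\subset K'\}}\operatorname{diam}(K)/\operatorname{diam}(K')\gtrsim\sigma$ is assumed. "Sufficiently small $\sigma$" means $\sigma\le\sigma_*$ for a $\sigma_*>0$ depending only on the polynomial degrees and the bounds listed in the claim. $\mathcal P_m(K)$ denotes polynomials of degree $\le m$ on $K$. For fixed $m_w\ge1$, $m_u\ge 0$ and $m_v$: $\breve{\mathbb U}:=L_2(\Omega)\times H_{0,\Gamma_-}(\mathbf b;\Omega)$ with the product norm $\|(u,w)\|_{\breve{\mathbb U}}^2=\|u\|_{L_2(\Omega)}^2+\|w\|_{H(\mathbf b;\Omega)}^2$, $$\breve{\mathbb U}^\delta_{\mathcal T}:=\prod_{K'\in\mathcal T}\mathcal P_{m_u}(K')\times\Big(H_{0,\Gamma_-}(\mathbf b;\Omega)\cap\prod_{K'\in\mathcal T}\mathcal P_{m_w}(K')\Big)\subset\breve{\mathbb U},\qquad \bar{\mathbb V}^\delta_{\mathcal T_s}:=\prod_{K\in\mathcal T_s}\mathcal P_{m_v}(K).$$ $H(\mathbf b;\mathcal T_s):=\{v\in L_2(\Omega):\mathbf b\cdot\nabla_{\mathcal T_s}v\in L_2(\Omega)\}$ ($\nabla_{\mathcal T_s}$ the piecewise gradient), with $\|v\|^2_{H(\mathbf b;\mathcal T_s)}=\|v\|^2_{L_2(\Omega)}+\|\mathbf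 b\cdot\nabla_{\mathcal T_s}v\|^2_{L_2(\Omega)}$ and the corresponding inner product. For $(u,w)\in\breve{\mathbb U}$, $v\in H(\mathbf b;\mathcal T_s)$, $b_{\mathcal T_s}(u,w;v):=\int_\Omega(cv-\mathbf b\cdot\nabla_{\mathcal T_s}v-v\operatorname{div}\mathbf b)u\,d\mathbf x+\int_{\partial\mathcal T_s}[\![v\mathbf b]\!]\,w\,d\mathbf s$, where $[\![v\mathbf b]\!]$ is the sum over the adjacent elements $K$ of $v\mathbf b|_K\cdot\mathbf n_K$ and the skeleton integral is understood as the bounded extension from smooth functions; equivalently $$b_{\mathcal T_s}(u,w;v)=\sum_{K\in\mathcal T_s}\int_K(cu+\mathbf b\cdot\nabla w)v+(w-u)(v\operatorname{div}\mathbf b+\mathbf b\cdot\nabla v)\,d\mathbf x.$$ *)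

theory Defs
  imports "HOL-Analysis.Analysis" "HOL-Probability.Essential_Supremum"
begin

section \<open>Lebesgue spaces\<close>

text \<open>Elements of the function spaces below are functions on all of \<open>real ^ 'n\<close>; only their values
  almost everywhere on the set in question matter, and equality is equality almost everywhere.\<close>

definition L2 :: "(real^'n) set \<Rightarrow> ((real^'n) \<Rightarrow> real) set" where
  "L2 S = {f \<in> borel_measurable (lebesgue_on S). integrable (lebesgue_on S) (\<lambda>x. (f x)\<^sup>2)}"

definition norm_L2 :: "(real^'n) set \<Rightarrow> ((real^'n) \<Rightarrow> real) \<Rightarrow> real" where
  "norm_L2 S f = sqrt (LINT x|lebesgue_on S. (f x)\<^sup>2)"

definition Linf :: "(real^'n) set \<Rightarrow> ((real^'n) \<Rightarrow> 'b::euclidean_space) set" where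
  "Linf S = {f \<in> borel_measurable (lebesgue_on S).
               esssup (lebesgue_on S) (\<lambda>x. ereal (norm (f x))) < \<infinity>}"

text \<open>For vector fields this is the \<open>L\<^sub>\<infinity>\<close>-norm of the pointwise Euclidean length.\<close>

definition norm_Linf :: "(real^'n) set \<Rightarrow> ((real^'n) \<Rightarrow> 'b::euclidean_space) \<Rightarrow> real" where
  "norm_Linf S f = real_of_ereal (esssup (lebesgue_on S) (\<lambda>x. ereal (norm (f x))))"

section \<open>Smooth functions and weak derivatives\<close>

definition grad :: "((real^'n) \<Rightarrow> real) \<Rightarrow> (real^'n) \<Rightarrow> real^'n" where
  "grad f x = (THE D. GDERIV f x :> D)"

primrec Ck :: "nat \<Rightarrow> ((real^'n) \<Rightarrow> real) \<Rightarrow> bool" where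
  "Ck 0 f \<longleftrightarrow> continuous_on UNIV f"
| "Ck (Suc k) f \<longleftrightarrow> (\<exists>g. (\<forall>x. GDERIV f x :> g x) \<and> (\<forall>i. Ck k (\<lambda>x. g x $ i)))"

definition smooth :: "((real^'n) \<Rightarrow> real) \<Rightarrow> bool" where
  "smooth f \<longleftrightarrow> (\<forall>k. Ck k f)"

definition test_fun :: "(real^'n) set \<Rightarrow> ((real^'n) \<Rightarrow> real) set" where
  "test_fun S = {\<phi>. smooth \<phi> \<and> compact (closure {x. \<phi> x \<noteq> 0}) \<and> closure {x. \<phi> x \<noteq> 0} \<subseteq> S}"

text \<open>In the weak notions below \<open>S\<close> is an open set. Weak derivatives are unique almost everywhere,
  so the choice operator merely picks a representative.\<close>

definition weak_partial :: "(real^'n) set \<Rightarrow> 'n \<Rightarrow> ((real^'n) \<Rightarrow> real) \<Rightarrow> ((real^'n) \<Rightarrow> real) \<Rightarrow> bool" where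
  "weak_partial S i g h \<longleftrightarrow>
     (\<forall>\<phi>\<in>test_fun S. (LINT x|lebesgue_on S. h x * \<phi> x) = - (LINT x|lebesgue_on S. g x * grad \<phi> x $ i))"

definition W1inf :: "(real^'n) set \<Rightarrow> ((real^'n) \<Rightarrow> real) set" where
  "W1inf S = {g \<in> Linf S. \<forall>i. \<exists>h\<in>Linf S. weak_partial S i g h}"

definition wpartial :: "(real^'n) set \<Rightarrow> 'n \<Rightarrow> ((real^'n) \<Rightarrow> real) \<Rightarrow> (real^'n) \<Rightarrow> real" where
  "wpartial S i g = (SOME h. h \<in> Linf S \<and> weak_partial S i g h)"

definition norm_W1inf :: "(real^'n) set \<Rightarrow> ((real^'n) \<Rightarrow> real) \<Rightarrow> real" where
  "norm_W1inf S g = max (norm_Linf S g) (MAX i. norm_Linf S (wpartial S i g))"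

definition norm_W1inf_vec :: "(real^'n) set \<Rightarrow> ((real^'n) \<Rightarrow> real^'n) \<Rightarrow> real" where
  "norm_W1inf_vec S b = (MAX i. norm_W1inf S (\<lambda>x. b x $ i))"

definition weak_div :: "(real^'n) set \<Rightarrow> ((real^'n) \<Rightarrow> real^'n) \<Rightarrow> ((real^'n) \<Rightarrow> real) \<Rightarrow> bool" where
  "weak_div S b d \<longleftrightarrow>
     (\<forall>\<phi>\<in>test_fun S. (LINT x|lebesgue_on S. d x * \<phi> x) = - (LINT x|lebesgue_on S. b x \<bullet> grad \<phi> x))"

definition wdiv :: "(real^'n) set \<Rightarrow> ((real^'n) \<Rightarrow> real^'n) \<Rightarrow> (real^'n) \<Rightarrow> real" where
  "wdiv S b = (SOME d. d \<in> Linf S \<and> weak_div S b d)"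

text \<open>\<open>g = b \<cdot> \<nabla>u\<close> in the sense of distributions on \<open>S\<close>: integrate against \<open>\<phi>\<close> and use
  \<open>div (\<phi> b) = b \<cdot> \<nabla>\<phi> + \<phi> div b\<close>.\<close>

definition weak_adv :: "(real^'n) set \<Rightarrow> ((real^'n) \<Rightarrow> real^'n) \<Rightarrow> ((real^'n) \<Rightarrow> real) \<Rightarrow> ((real^'n) \<Rightarrow> real) \<Rightarrow> bool" where
  "weak_adv S b u g \<longleftrightarrow>
     (\<forall>\<phi>\<in>test_fun S. (LINT x|lebesgue_on S. g x * \<phi> x)
        = - (LINT x|lebesgue_on S. u x * (b x \<bullet> grad \<phi> x + \<phi> x * wdiv S b x)))"

section \<open>The space \<open>H(b;\<Omega>)\<close> and the transport operator\<close>

definition Hb :: "(real^'n) set \<Rightarrow> ((real^'n) \<Rightarrow> real^'n) \<Rightarrow> ((real^'n) \<Rightarrow> real) set" where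
  "Hb \<Omega> b = {u \<in> L2 \<Omega>. \<exists>g\<in>L2 \<Omega>. weak_adv \<Omega> b u g}"

definition adv :: "(real^'n) set \<Rightarrow> ((real^'n) \<Rightarrow> real^'n) \<Rightarrow> ((real^'n) \<Rightarrow> real) \<Rightarrow> (real^'n) \<Rightarrow> real" where
  "adv \<Omega> b u = (SOME g. g \<in> L2 \<Omega> \<and> weak_adv \<Omega> b u g)"

definition norm_Hb :: "(real^'n) set \<Rightarrow> ((real^'n) \<Rightarrow> real^'n) \<Rightarrow> ((real^'n) \<Rightarrow> real) \<Rightarrow> real" where
  "norm_Hb \<Omega> b u = sqrt ((norm_L2 \<Omega> u)\<^sup>2 + (norm_L2 \<Omega> (adv \<Omega> b u))\<^sup>2)"

text \<open>At a boundary point of a polytopal domain the outward unit normal is well defined iff the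
  domain is locally a half space there.\<close>

definition outward_normal :: "(real^'n) set \<Rightarrow> real^'n \<Rightarrow> real^'n \<Rightarrow> bool" where
  "outward_normal \<Omega> x \<nu> \<longleftrightarrow> x \<in> frontier \<Omega> \<and> norm \<nu> = 1 \<and>
     (\<exists>r>0. \<Omega> \<inter> ball x r = {y \<in> ball x r. (y - x) \<bullet> \<nu> < 0})"

text \<open>A function defined almost everywhere on \<open>\<Omega>\<close> has the boundary value \<open>\<beta>\<close> at \<open>x\<close> if \<open>\<beta>\<close> is its
  Lebesgue value from within \<open>\<Omega>\<close>. This does not depend on the representative, and for a piecewise
  \<open>W\<^sup>1\<^sub>\<infinity>\<close> function it is the usual trace away from the interelement boundaries.\<close>

definition boundary_value :: "(real^'n) set \<Rightarrow> ((real^'n) \<Rightarrow> real) \<Rightarrow> real^'n \<Rightarrow> real \<Rightarrow> bool" where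
  "boundary_value \<Omega> g x \<beta> \<longleftrightarrow>
     ((\<lambda>r. (LINT y|lebesgue_on (\<Omega> \<inter> ball x r). \<bar>g y - \<beta>\<bar>) / measure lebesgue (\<Omega> \<inter> ball x r))
        \<longlongrightarrow> 0) (at_right 0)"

definition Gamma_minus :: "(real^'n) set \<Rightarrow> ((real^'n) \<Rightarrow> real^'n) \<Rightarrow> (real^'n) set" where
  "Gamma_minus \<Omega> b =
     closure {x. \<exists>\<nu> \<beta>. outward_normal \<Omega> x \<nu> \<and> boundary_value \<Omega> (\<lambda>y. \<nu> \<bullet> b y) x \<beta> \<and> - \<beta> > 0}"

definition H0b :: "(real^'n) set \<Rightarrow> ((real^'n) \<Rightarrow> real^'n) \<Rightarrow> ((real^'n) \<Rightarrow> real) set" where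
  "H0b \<Omega> b = {u \<in> Hb \<Omega> b. \<forall>\<epsilon>>0. \<exists>\<phi>. smooth \<phi> \<and> (\<forall>x\<in>Gamma_minus \<Omega> b. \<phi> x = 0)
                  \<and> norm_Hb \<Omega> b (\<lambda>x. u x - \<phi> x) < \<epsilon>}"

definition Bop :: "(real^'n) set \<Rightarrow> ((real^'n) \<Rightarrow> real^'n) \<Rightarrow> ((real^'n) \<Rightarrow> real)
    \<Rightarrow> ((real^'n) \<Rightarrow> real) \<Rightarrow> (real^'n) \<Rightarrow> real" where
  "Bop \<Omega> b c w x = adv \<Omega> b w x + c x * w x"

definition Binv :: "(real^'n) set \<Rightarrow> ((real^'n) \<Rightarrow> real^'n) \<Rightarrow> ((real^'n) \<Rightarrow> real)
    \<Rightarrow> ((real^'n) \<Rightarrow> real) \<Rightarrow> (real^'n) \<Rightarrow> real" where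
  "Binv \<Omega> b c f = (SOME w. w \<in> H0b \<Omega> b \<and> (AE x in lebesgue_on \<Omega>. Bop \<Omega> b c w x = f x))"

definition B_Lis :: "(real^'n) set \<Rightarrow> ((real^'n) \<Rightarrow> real^'n) \<Rightarrow> ((real^'n) \<Rightarrow> real) \<Rightarrow> bool" where
  "B_Lis \<Omega> b c \<longleftrightarrow>
     (\<exists>M. \<forall>w\<in>H0b \<Omega> b. norm_L2 \<Omega> (Bop \<Omega> b c w) \<le> M * norm_Hb \<Omega> b w)
   \<and> (\<forall>w1\<in>H0b \<Omega> b. \<forall>w2\<in>H0b \<Omega> b.
        (AE x in lebesgue_on \<Omega>. Bop \<Omega> b c w1 x = Bop \<Omega> b c w2 x) \<longrightarrow> (AE x in lebesgue_on \<Omega>. w1 x = w2 x))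
   \<and> (\<forall>f\<in>L2 \<Omega>. \<exists>w\<in>H0b \<Omega> b. AE x in lebesgue_on \<Omega>. Bop \<Omega> b c w x = f x)
   \<and> (\<exists>M. \<forall>f\<in>L2 \<Omega>. norm_Hb \<Omega> b (Binv \<Omega> b c f) \<le> M * norm_L2 \<Omega> f)"

definition norm_Binv :: "(real^'n) set \<Rightarrow> ((real^'n) \<Rightarrow> real^'n) \<Rightarrow> ((real^'n) \<Rightarrow> real) \<Rightarrow> real" where
  "norm_Binv \<Omega> b c = Inf {M. 0 \<le> M \<and> (\<forall>f\<in>L2 \<Omega>. norm_Hb \<Omega> b (Binv \<Omega> b c f) \<le> M * norm_L2 \<Omega> f)}"

section \<open>Domain and coefficients\<close>

definition polytopal_domain :: "(real^'n) set \<Rightarrow> bool" where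
  "polytopal_domain \<Omega> \<longleftrightarrow> \<Omega> \<noteq> {} \<and> open \<Omega> \<and> connected \<Omega> \<and> bounded \<Omega> \<and> interior (closure \<Omega>) = \<Omega>
     \<and> (\<exists>P. finite P \<and> (\<forall>p\<in>P. polytope p) \<and> closure \<Omega> = \<Union>P)"

text \<open>Since \<open>1 / 0 = 0\<close>, the condition \<open>|b|\<inverse> \<in> L\<^sub>\<infinity>(\<Omega>)\<close> needs \<open>b \<noteq> 0\<close> almost everywhere as a
  separate conjunct.\<close>

definition transport_data :: "(real^'n) set \<Rightarrow> ((real^'n) \<Rightarrow> real^'n) \<Rightarrow> ((real^'n) \<Rightarrow> real) \<Rightarrow> bool" where
  "transport_data \<Omega> b c \<longleftrightarrow> polytopal_domain \<Omega>
     \<and> b \<in> Linf \<Omega> \<and> (\<exists>d\<in>Linf \<Omega>. weak_div \<Omega> b d)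
     \<and> (AE x in lebesgue_on \<Omega>. b x \<noteq> 0) \<and> (\<lambda>x. 1 / norm (b x)) \<in> Linf \<Omega>
     \<and> c \<in> Linf \<Omega>"

section \<open>Families of partitions\<close>

definition simplicial_partition :: "(real^'n) set \<Rightarrow> (real^'n) set set \<Rightarrow> bool" where
  "simplicial_partition S T \<longleftrightarrow> finite T \<and> (\<forall>K\<in>T. int CARD('n) simplex K) \<and> \<Union>T = S
     \<and> (\<forall>K\<in>T. \<forall>L\<in>T. K \<noteq> L \<longrightarrow> negligible (K \<inter> L))"

text \<open>A rule maps a simplex to its children. Within the forest generated from an initial partition
  a simplex occurs only once, so it makes no difference whether a rule may in addition consult
  information attached to the simplex (such as an ordering of its vertices).\<close>

definition refinement_rule :: "((real^'n) set \<Rightarrow> (real^'n) set set) \<Rightarrow> bool" where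
  "refinement_rule rul \<longleftrightarrow>
     (\<forall>K. int CARD('n) simplex K \<longrightarrow> simplicial_partition K (rul K) \<and> 2 \<le> card (rul K))"

inductive obtained_from :: "((real^'n) set \<Rightarrow> (real^'n) set set) \<Rightarrow> (real^'n) set set \<Rightarrow> (real^'n) set set \<Rightarrow> bool"
  for rul T0 where
  initial: "obtained_from rul T0 T0"
| split: "obtained_from rul T0 T \<Longrightarrow> K \<in> T \<Longrightarrow> obtained_from rul T0 (T - {K} \<union> rul K)"

definition refinement_of :: "(real^'n) set set \<Rightarrow> (real^'n) set set \<Rightarrow> bool" where
  "refinement_of T' T \<longleftrightarrow> (\<forall>K\<in>T'. \<exists>K'\<in>T. K \<subseteq> K')"

definition shape_const :: "(real^'n) set \<Rightarrow> real" where
  "shape_const K = diameter K / Sup {diameter (cball x r) |x r. 0 \<le> r \<and> cball x r \<subseteq> K}"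

definition family_shape :: "(real^'n) set set set \<Rightarrow> real" where
  "family_shape TT = (SUP K\<in>\<Union>TT. shape_const K)"

definition mesh_family :: "(real^'n) set \<Rightarrow> (real^'n) set set \<Rightarrow> ((real^'n) set \<Rightarrow> (real^'n) set set)
    \<Rightarrow> (real^'n) set set set \<Rightarrow> ((real^'n) set set \<Rightarrow> (real^'n) set set) \<Rightarrow> bool" where
  "mesh_family \<Omega> Tbot rul TT sub \<longleftrightarrow>
     simplicial_partition (closure \<Omega>) Tbot \<and> refinement_rule rul
   \<and> infinite TT \<and> (\<forall>T\<in>TT. obtained_from rul Tbot T)
   \<and> bdd_above (shape_const ` \<Union>TT)
   \<and> (\<forall>T\<in>TT. sub T \<in> TT \<and> refinement_of (sub T) T)"

definition mesh_sigma :: "(real^'n) set set set \<Rightarrow> ((real^'n) set set \<Rightarrow> (real^'n) set set) \<Rightarrow> real" where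
  "mesh_sigma TT sub = (SUP T\<in>TT. MAX K'\<in>T.
     max (MAX K\<in>{K \<in> sub T. K \<subseteq> K'}. diameter K / diameter K') (diameter K'))"

definition mesh_ratio :: "(real^'n) set set set \<Rightarrow> ((real^'n) set set \<Rightarrow> (real^'n) set set) \<Rightarrow> real" where
  "mesh_ratio TT sub = (INF T\<in>TT. MIN K'\<in>T. MIN K\<in>{K \<in> sub T. K \<subseteq> K'}. diameter K / diameter K')"

section \<open>Piecewise polynomials and the discrete problem\<close>

definition Poly :: "nat \<Rightarrow> ((real^'n) \<Rightarrow> real) set" where
  "Poly m = {p. \<exists>a. p = (\<lambda>x. \<Sum>\<alpha> | (\<Sum>i\<in>UNIV. \<alpha> i) \<le> m. a \<alpha> * (\<Prod>i\<in>UNIV. (x $ i) ^ (\<alpha> i :: nat)))}"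

definition pw_poly :: "(real^'n) set set \<Rightarrow> nat \<Rightarrow> ((real^'n) \<Rightarrow> real) set" where
  "pw_poly T m = {u. \<forall>K\<in>T. \<exists>p\<in>Poly m. AE x in lebesgue_on K. u x = p x}"

definition pw_poly_vec :: "(real^'n) set set \<Rightarrow> nat \<Rightarrow> ((real^'n) \<Rightarrow> real^'n) set" where
  "pw_poly_vec T m = {p. \<forall>i. (\<lambda>x. p x $ i) \<in> pw_poly T m}"

definition best_approx :: "(('a \<Rightarrow> 'b::real_vector) \<Rightarrow> real) \<Rightarrow> ('a \<Rightarrow> 'b) set \<Rightarrow> ('a \<Rightarrow> 'b) \<Rightarrow> ('a \<Rightarrow> 'b) \<Rightarrow> bool" where
  "best_approx N V g q \<longleftrightarrow> q \<in> V \<and> (\<forall>p\<in>V. N (\<lambda>x. g x - q x) \<le> N (\<lambda>x. g x - p x))"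

definition osc :: "(real^'n) set \<Rightarrow> (real^'n) set set \<Rightarrow> ((real^'n) \<Rightarrow> real^'n) \<Rightarrow> ((real^'n) \<Rightarrow> real^'n)
    \<Rightarrow> ((real^'n) \<Rightarrow> real) \<Rightarrow> ((real^'n) \<Rightarrow> real) \<Rightarrow> ((real^'n) \<Rightarrow> real) \<Rightarrow> ((real^'n) \<Rightarrow> real) \<Rightarrow> real" where
  "osc \<Omega> T b bt c ct f ft =
     max (norm_L2 \<Omega> (\<lambda>x. f x - ft x))
         (max (norm_Linf \<Omega> (\<lambda>x. c x - ct x))
              (MAX K\<in>T. norm_Linf K (\<lambda>x. b x - bt x) / diameter K)
          * norm_L2 \<Omega> f)"

definition norm_U :: "(real^'n) set \<Rightarrow> ((real^'n) \<Rightarrow> real^'n) \<Rightarrow> ((real^'n) \<Rightarrow> real) \<Rightarrow> ((real^'n) \<Rightarrow> real) \<Rightarrow> real" where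
  "norm_U \<Omega> b u w = sqrt ((norm_L2 \<Omega> u)\<^sup>2 + (norm_Hb \<Omega> b w)\<^sup>2)"

definition U_discrete :: "(real^'n) set \<Rightarrow> ((real^'n) \<Rightarrow> real^'n) \<Rightarrow> (real^'n) set set \<Rightarrow> nat \<Rightarrow> nat
    \<Rightarrow> (((real^'n) \<Rightarrow> real) \<times> ((real^'n) \<Rightarrow> real)) set" where
  "U_discrete \<Omega> b T mu mw = pw_poly T mu \<times> (H0b \<Omega> b \<inter> pw_poly T mw)"

definition Hb_pw :: "(real^'n) set \<Rightarrow> (real^'n) set set \<Rightarrow> ((real^'n) \<Rightarrow> real^'n) \<Rightarrow> ((real^'n) \<Rightarrow> real) set" where
  "Hb_pw \<Omega> Ts b = {v \<in> L2 \<Omega>. \<exists>g\<in>L2 \<Omega>. \<forall>K\<in>Ts. weak_adv (interior K) b v g}"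

definition adv_pw :: "(real^'n) set \<Rightarrow> (real^'n) set set \<Rightarrow> ((real^'n) \<Rightarrow> real^'n) \<Rightarrow> ((real^'n) \<Rightarrow> real) \<Rightarrow> (real^'n) \<Rightarrow> real" where
  "adv_pw \<Omega> Ts b v = (SOME g. g \<in> L2 \<Omega> \<and> (\<forall>K\<in>Ts. weak_adv (interior K) b v g))"

definition inner_Hb_pw :: "(real^'n) set \<Rightarrow> (real^'n) set set \<Rightarrow> ((real^'n) \<Rightarrow> real^'n)
    \<Rightarrow> ((real^'n) \<Rightarrow> real) \<Rightarrow> ((real^'n) \<Rightarrow> real) \<Rightarrow> real" where
  "inner_Hb_pw \<Omega> Ts b v z = (LINT x|lebesgue_on \<Omega>. v x * z x)
     + (LINT x|lebesgue_on \<Omega>. adv_pw \<Omega> Ts b v x * adv_pw \<Omega> Ts b z x)"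

definition norm_Hb_pw :: "(real^'n) set \<Rightarrow> (real^'n) set set \<Rightarrow> ((real^'n) \<Rightarrow> real^'n) \<Rightarrow> ((real^'n) \<Rightarrow> real) \<Rightarrow> real" where
  "norm_Hb_pw \<Omega> Ts b v = sqrt ((norm_L2 \<Omega> v)\<^sup>2 + (norm_L2 \<Omega> (adv_pw \<Omega> Ts b v))\<^sup>2)"

text \<open>The elementwise form of the bilinear form: the skeleton integral of \<open>[[v b]] w\<close>, being the
  bounded extension from smooth functions, is the sum over \<open>K\<close> of the integrals of
  \<open>div (v w b) = w (v div b + b \<cdot> \<nabla>v) + v b \<cdot> \<nabla>w\<close> over \<open>K\<close>.\<close>

definition bform :: "(real^'n) set \<Rightarrow> (real^'n) set set \<Rightarrow> ((real^'n) \<Rightarrow> real^'n) \<Rightarrow> ((real^'n) \<Rightarrow> real)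
    \<Rightarrow> ((real^'n) \<Rightarrow> real) \<Rightarrow> ((real^'n) \<Rightarrow> real) \<Rightarrow> ((real^'n) \<Rightarrow> real) \<Rightarrow> real" where
  "bform \<Omega> Ts b c u w v = (\<Sum>K\<in>Ts. LINT x|lebesgue_on K.
     (c x * u x + adv \<Omega> b w x) * v x
       + (w x - u x) * (v x * wdiv \<Omega> b x + adv_pw \<Omega> Ts b v x))"

definition residual_rep :: "(real^'n) set \<Rightarrow> (real^'n) set set \<Rightarrow> nat \<Rightarrow> ((real^'n) \<Rightarrow> real^'n) \<Rightarrow> ((real^'n) \<Rightarrow> real)
    \<Rightarrow> ((real^'n) \<Rightarrow> real) \<Rightarrow> ((real^'n) \<Rightarrow> real) \<Rightarrow> ((real^'n) \<Rightarrow> real) \<Rightarrow> ((real^'n) \<Rightarrow> real) \<Rightarrow> bool" where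
  "residual_rep \<Omega> Ts mv b c f u w R \<longleftrightarrow> R \<in> pw_poly Ts mv \<and>
     (\<forall>v\<in>pw_poly Ts mv.
        inner_Hb_pw \<Omega> Ts b R v = bform \<Omega> Ts b c u w v - (LINT x|lebesgue_on \<Omega>. f x * v x))"

end

theory Submission
  imports Defs
begin

text \<open>Write \<open>r = c u + b \<bullet> \<nabla>w - f\<close> and \<open>e = w - u\<close>. Elementwise, the residual functional is
  \<open>v \<mapsto> \<integral> r v + e (v div b + b \<bullet> \<nabla>v)\<close>, so it is bounded by \<open>r\<close> and \<open>e\<close>, which in turn are bounded
  by the error; conversely \<open>B (B\<inverse> f - w) = - (r + c e)\<close>, so the error is bounded by \<open>r\<close> and \<open>e\<close>.
  It remains to bound both by the discrete residual. For \<open>e\<close>, test on each subgrid simplex \<open>K\<close> with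
  the polynomial \<open>v\<close> of one degree more that solves \<open>\<gamma> \<bullet> \<nabla>v = e\<close>, where \<open>\<gamma>\<close> is a constant at distance
  \<open>O(diam K)\<close> from \<open>b\<close>: then \<open>b \<bullet> \<nabla>v\<close> is close to \<open>e\<close> while \<open>v\<close> itself is \<open>O(diam K)\<close>, which gives
  \<open>|e| \<le> C (|R| + \<sigma> |r|)\<close>. For \<open>r\<close>, replace the data by polynomials, which costs an oscillation term, and
  test with the piecewise constant interpolant on the subgrid of the resulting piecewise polynomial
  on the coarse grid: its advective derivative vanishes and, by an inverse inequality, its relative
  error is \<open>O(\<sigma>)\<close>, which gives \<open>|r| \<le> C (|R| + osc + |e|)\<close>. For small \<open>\<sigma>\<close> the two estimates combine.\<close>

section \<open>Smooth functions and test functions\<close>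

text \<open>The loop between the two estimates closes because of an asymmetry. The bound for
  \<open>r\<close> contains \<open>e\<close> with a constant that is not small, so the bound for
  \<open>e\<close> must contain \<open>r\<close> with a factor \<sigma>. It does, because inverting
  the constant field \<gamma> gains one diameter: the test function is O(\<sigma>) although its
  advective derivative is O(1). Conversely, a general polynomial test function for \<open>r\<close>
  would meet \<open>e\<close> through its advective derivative, where an inverse inequality costs
  1/diam. Piecewise constants avoid this term, and they resolve coarse polynomials because the
  subgrid is finer by a factor \<sigma>. The weight 1/diam in the oscillation is the same inverse
  inequality, applied to (b - bt) . grad w. All constants must be uniform over domains and meshes.
  Polynomial inequalities are therefore proved for every compact convex set containing a ball of
  comparable size, by rescaling to two fixed balls. Only elementwise bounds on b may enter, so its
  divergence and its distance to constants are both extracted from weak partial derivatives.\<close>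

lemma gderiv_unique:
  assumes "GDERIV f x :> D" "GDERIV f x :> E" shows "D = E"
proof -
  have "(\<lambda>h. h \<bullet> D) = (\<lambda>h. h \<bullet> E)"
    using assms unfolding gderiv_def by (rule has_derivative_unique)
  then have "(D - E) \<bullet> D = (D - E) \<bullet> E" by metis
  then show ?thesis by (metis eq_iff_diff_eq_0 inner_diff_right inner_eq_zero_iff)
qed

lemma grad_eq: "GDERIV f x :> D \<Longrightarrow> grad f x = D"
  unfolding grad_def by (rule the_equality) (auto intro: gderiv_unique)

lemma gderiv_coord: "GDERIV (\<lambda>x. x $ i) x :> axis i 1" for x :: "real^'n"
  unfolding gderiv_def
  by (rule has_derivative_eq_rhs[OF bounded_linear.has_derivative[OF bounded_linear_vec_nth has_derivative_ident]])
     (simp add: inner_axis)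

lemma Ck_continuous: "Ck k f \<Longrightarrow> continuous_on UNIV f"
  by (cases k) (auto simp: gderiv_def continuous_on_eq_continuous_within intro!: has_derivative_continuous)

lemma Ck_Suc_imp: "Ck (Suc k) f \<Longrightarrow> Ck k f"
proof (induction k arbitrary: f)
  case 0 then show ?case using Ck_continuous by fastforce
next
  case (Suc k)
  then obtain g where "\<forall>x. GDERIV f x :> g x" "\<forall>i. Ck (Suc k) (\<lambda>x. g x $ i)" by auto
  then show ?case using Suc.IH by (auto simp del: Ck.simps(2) simp: Ck.simps(2)[of k f])
qed

lemma Ck_const: "Ck k (\<lambda>x. c)"
proof (induction k arbitrary: c)
  case (Suc k) then show ?case by (auto intro!: exI[of _ "\<lambda>x. 0"] GDERIV_const)
qed auto

lemma Ck_add: "Ck k f \<Longrightarrow> Ck k g \<Longrightarrow> Ck k (\<lambda>x. f x + g x)"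
proof (induction k arbitrary: f g)
  case 0 then show ?case by (auto intro!: continuous_intros)
next
  case (Suc k)
  then obtain f' g' where
    "\<forall>x. GDERIV f x :> f' x" "\<forall>i. Ck k (\<lambda>x. f' x $ i)"
    "\<forall>x. GDERIV g x :> g' x" "\<forall>i. Ck k (\<lambda>x. g' x $ i)" by auto
  then show ?case using Suc.IH by (auto intro!: exI[of _ "\<lambda>x. f' x + g' x"] GDERIV_add)
qed

lemma Ck_mult: "Ck k f \<Longrightarrow> Ck k g \<Longrightarrow> Ck k (\<lambda>x. f x * g x)"
proof (induction k arbitrary: f g)
  case 0 then show ?case by (auto intro!: continuous_intros)
next
  case (Suc k)
  then obtain f' g' where
    *: "\<forall>x. GDERIV f x :> f' x" "\<forall>i. Ck k (\<lambda>x. f' x $ i)"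
    "\<forall>x. GDERIV g x :> g' x" "\<forall>i. Ck k (\<lambda>x. g' x $ i)" by auto
  have "Ck k f" "Ck k g" using Suc.prems Ck_Suc_imp by blast+
  then show ?case using Suc.IH *
    by (auto intro!: exI[of _ "\<lambda>x. f x *\<^sub>R g' x + g x *\<^sub>R f' x"] GDERIV_mult Ck_add)
qed

lemma Ck_sum: "(\<And>i. i \<in> I \<Longrightarrow> Ck k (f i)) \<Longrightarrow> Ck k (\<lambda>x. \<Sum>i\<in>I. f i x)"
  by (induction I rule: infinite_finite_induct) (auto intro: Ck_const Ck_add)

lemma Ck_prod: "(\<And>i. i \<in> I \<Longrightarrow> Ck k (f i)) \<Longrightarrow> Ck k (\<lambda>x. \<Prod>i\<in>I. f i x)"
  by (induction I rule: infinite_finite_induct) (auto intro: Ck_const Ck_mult)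

lemma Ck_coord: "Ck k (\<lambda>x. x $ i)" for i :: "'n::finite"
proof (cases k)
  case (Suc k) then show ?thesis
    by (auto intro!: exI[of _ "\<lambda>x. axis i 1"] gderiv_coord Ck_const)
qed (auto intro!: continuous_intros)

lemma Ck_translate: "Ck k f \<Longrightarrow> Ck k (\<lambda>x. f (x - v))"
proof (induction k arbitrary: f)
  case 0 then show ?case
    by (auto intro!: continuous_on_compose2[of UNIV f] continuous_intros)
next
  case (Suc k)
  then obtain f' where f: "\<forall>x. GDERIV f x :> f' x" "\<forall>i. Ck k (\<lambda>x. f' x $ i)" by auto
  have "GDERIV (\<lambda>x. f (x - v)) x :> f' (x - v)" for x
    using f(1) unfolding gderiv_def
    by (auto intro!: has_derivative_compose[of "\<lambda>x. x - v" "\<lambda>x. x" x UNIV f, simplified]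
        derivative_eq_intros)
  then show ?case using f(2) Suc.IH by (auto intro!: exI[of _ "\<lambda>x. f' (x - v)"])
qed

lemma smooth_mult: "smooth f \<Longrightarrow> smooth g \<Longrightarrow> smooth (\<lambda>x. f x * g x)"
  and smooth_add: "smooth f \<Longrightarrow> smooth g \<Longrightarrow> smooth (\<lambda>x. f x + g x)"
  and smooth_const: "smooth (\<lambda>x. c)"
  and smooth_coord: "smooth (\<lambda>x. x $ i)"
  and smooth_translate: "smooth f \<Longrightarrow> smooth (\<lambda>x. f (x - v))"
  and smooth_sum: "(\<And>i. i \<in> I \<Longrightarrow> smooth (h i)) \<Longrightarrow> smooth (\<lambda>x. \<Sum>i\<in>I. h i x)"
  and smooth_prod: "(\<And>i. i \<in> I \<Longrightarrow> smooth (h i)) \<Longrightarrow> smooth (\<lambda>x. \<Prod>i\<in>I. h i x)"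
  by (auto simp: smooth_def intro: Ck_mult Ck_add Ck_const Ck_coord Ck_translate Ck_sum Ck_prod)

lemma smooth_diff: "smooth f \<Longrightarrow> smooth g \<Longrightarrow> smooth (\<lambda>x. f x - g x)"
  using smooth_add[of f "\<lambda>x. (-1) * g x"] smooth_mult[OF smooth_const[of "-1"], of g] by simp

lemma smooth_power: "smooth f \<Longrightarrow> smooth (\<lambda>x. f x ^ k)"
  by (induction k) (auto intro: smooth_const smooth_mult)

lemma smooth_continuous: "smooth f \<Longrightarrow> continuous_on S f"
  using Ck_continuous continuous_on_subset unfolding smooth_def by blast

lemma smooth_gderiv:
  assumes "smooth f" shows "GDERIV f x :> grad f x"
proof -
  have "Ck (Suc 0) f" using assms smooth_def by blast
  then show ?thesis using grad_eq by (metis Ck.simps(2))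
qed

lemma smooth_grad:
  assumes "smooth f" shows "smooth (\<lambda>x. grad f x $ i)"
  unfolding smooth_def
proof
  fix k have "Ck (Suc k) f" using assms smooth_def by blast
  then obtain g where g: "\<forall>x. GDERIV f x :> g x" "\<forall>i. Ck k (\<lambda>x. g x $ i)" by auto
  then have "grad f = g" using grad_eq by blast
  then show "Ck k (\<lambda>x. grad f x $ i)" using g by simp
qed

lemma smooth_grad_continuous: "smooth f \<Longrightarrow> continuous_on S (grad f)"
proof -
  assume "smooth f"
  then have "continuous_on S (\<lambda>x. \<chi> i. grad f x $ i)"
    by (intro continuous_on_vec_lambda smooth_continuous smooth_grad)
  then show ?thesis by simp
qed

lemma grad_mult: "smooth f \<Longrightarrow> smooth g \<Longrightarrow>
    grad (\<lambda>x. f x * g x) x = f x *\<^sub>R grad g x + g x *\<^sub>R grad f x"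
  by (intro grad_eq GDERIV_mult smooth_gderiv)

lemma grad_diff: "smooth f \<Longrightarrow> smooth g \<Longrightarrow> grad (\<lambda>x. f x - g x) x = grad f x - grad g x"
  by (intro grad_eq GDERIV_diff smooth_gderiv)

lemma grad_translate:
  assumes "smooth f" shows "grad (\<lambda>x. f (x - v)) x = grad f (x - v)"
proof (rule grad_eq)
  show "GDERIV (\<lambda>x. f (x - v)) x :> grad f (x - v)"
    using smooth_gderiv[OF assms, of "x - v"] unfolding gderiv_def
    by (auto intro!: has_derivative_compose[of "\<lambda>x. x - v" "\<lambda>x. x" x UNIV f, simplified]
        derivative_eq_intros)
qed

lemma grad_zero_outside:
  assumes "closed C" "\<And>x. x \<notin> C \<Longrightarrow> f x = 0" "x \<notin> C" shows "grad f x = 0"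
proof (rule grad_eq, unfold gderiv_def)
  show "(f has_derivative (\<lambda>h. h \<bullet> 0)) (at x)"
    by (rule has_derivative_transform_within_open[of "\<lambda>x. 0" _ _ _ "- C"])
      (use assms in \<open>auto simp: closed_def\<close>)
qed

text \<open>Any compact superset of the nonzero set will do, so supports never have to be computed
  exactly.\<close>

lemma test_funI:
  assumes "smooth \<phi>" "compact C" "C \<subseteq> S" "\<And>x. x \<notin> C \<Longrightarrow> \<phi> x = 0"
  shows "\<phi> \<in> test_fun S"
proof -
  have "closure {x. \<phi> x \<noteq> 0} \<subseteq> C"
    using assms by (intro closure_minimal) (auto intro: compact_imp_closed)
  moreover from this have "compact (closure {x. \<phi> x \<noteq> 0})"
    using assms(2) by (metis closed_closure compact_Int_closed inf.absorb2 inf_commute)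
  ultimately show ?thesis using assms unfolding test_fun_def by auto
qed

text \<open>Continuity on the compact support bounds the function and its gradient everywhere; this
  is what makes both of them \<open>Linf\<close> on every measurable set.\<close>

lemma test_funE:
  assumes "\<phi> \<in> test_fun S"
  obtains C B where "smooth \<phi>" "compact C" "C \<subseteq> S" "\<And>x. x \<notin> C \<Longrightarrow> \<phi> x = 0"
    "\<And>x. x \<notin> C \<Longrightarrow> grad \<phi> x = 0" "\<And>x. \<bar>\<phi> x\<bar> \<le> B" "\<And>x. norm (grad \<phi> x) \<le> B"
proof -
  let ?C = "closure {x. \<phi> x \<noteq> 0}"
  have s: "smooth \<phi>" and C: "compact ?C" "?C \<subseteq> S" using assms by (auto simp: test_fun_def)
  have z: "x \<notin> ?C \<Longrightarrow> \<phi> x = 0" for x using closure_subset[of "{x. \<phi> x \<noteq> 0}"] by auto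
  have gz: "x \<notin> ?C \<Longrightarrow> grad \<phi> x = 0" for x
    by (rule grad_zero_outside[OF closed_closure z])
  have "compact (\<phi> ` ?C)" "compact (grad \<phi> ` ?C)"
    using C s by (auto intro!: compact_continuous_image smooth_continuous smooth_grad_continuous)
  then obtain B1 B2 where B: "\<And>x. x \<in> ?C \<Longrightarrow> \<bar>\<phi> x\<bar> \<le> B1" "\<And>x. x \<in> ?C \<Longrightarrow> norm (grad \<phi> x) \<le> B2"
    by (fastforce dest!: compact_imp_bounded simp: bounded_iff)
  have "\<bar>\<phi> x\<bar> \<le> max 0 (max B1 B2)" for x using B(1)[of x] z[of x] by (cases "x \<in> ?C") auto
  moreover have "norm (grad \<phi> x) \<le> max 0 (max B1 B2)" for x using B(2)[of x] gz[of x] by (cases "x \<in> ?C") auto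
  ultimately show ?thesis using that s C z gz by blast
qed

lemma test_fun_mono: "S \<subseteq> S' \<Longrightarrow> test_fun S \<subseteq> test_fun S'"
  by (auto simp: test_fun_def)

lemma test_fun_mult: "\<phi> \<in> test_fun S \<Longrightarrow> smooth p \<Longrightarrow> (\<lambda>x. p x * \<phi> x) \<in> test_fun S"
  by (elim test_funE) (rule test_funI, auto intro: smooth_mult)

section \<open>Smooth functions supported in a box and converging to its indicator\<close>

definition flat :: "nat \<Rightarrow> real \<Rightarrow> real" where
  "flat j t = (if t > 0 then exp (- 1 / t) / t ^ j else 0)"

lemma flat_tendsto_0: "((flat j) \<longlongrightarrow> 0) (at 0)"
proof -
  have "((\<lambda>u::real. u ^ j / exp u) \<longlongrightarrow> 0) at_top"
    by (rule tendsto_power_div_exp_0)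
  then have "((\<lambda>t. (inverse t) ^ j / exp (inverse t)) \<longlongrightarrow> (0::real)) (at_right 0)"
    by (rule filterlim_compose[OF _ filterlim_inverse_at_top_right])
  then have "((flat j) \<longlongrightarrow> 0) (at_right 0)"
    by (rule Lim_transform_eventually)
      (auto simp: flat_def eventually_at_right_field exp_minus field_simps power_inverse intro!: exI[of _ 1])
  moreover have "((flat j) \<longlongrightarrow> 0) (at_left 0)"
    by (rule Lim_transform_eventually[OF tendsto_const])
      (auto simp: flat_def eventually_at_left_field intro!: exI[of _ "-1"])
  ultimately show ?thesis by (simp add: filterlim_at_split)
qed

text \<open>Dividing exp (- 1 / t) by powers of t yields a family closed under differentiation,
  since a derivative only raises the exponent \<open>j\<close>. Smoothness then is an induction on
  the order, for all \<open>j\<close> at once.\<close>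

lemma flat_deriv: "(flat j has_real_derivative (flat (j + 2) t - j * flat (j + 1) t)) (at t)"
proof -
  consider "t < 0" | "t = 0" | "t > 0" by linarith
  then show ?thesis
  proof cases
    case 1
    have "((\<lambda>t. 0) has_real_derivative 0) (at t)" by simp
    then have "(flat j has_real_derivative 0) (at t)"
      by (rule has_field_derivative_transform_within_open[of _ _ _ "{..<0}"]) (use 1 in \<open>auto simp: flat_def\<close>)
    then show ?thesis using 1 by (simp add: flat_def)
  next
    case 2
    \<comment> \<open>At the origin the difference quotient of \<open>flat j\<close> is
      \<open>flat (Suc j)\<close>, which tends to 0.\<close>
    have "((\<lambda>h. (flat j (0 + h) - flat j 0) / h) \<longlongrightarrow> 0) (at 0)"
      by (rule Lim_transform_eventually[OF flat_tendsto_0[of "Suc j"]])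
        (auto simp: flat_def eventually_at intro!: exI[of _ 1])
    then show ?thesis using 2 by (simp add: DERIV_def flat_def)
  next
    case 3
    have "((\<lambda>t. exp (- 1 / t) / t ^ j) has_real_derivative
        (exp (- 1 / t) * (1 / t^2) * t ^ j - exp (- 1 / t) * (real j * t ^ (j - 1))) / (t ^ j * t ^ j)) (at t)"
      using 3 by (auto intro!: derivative_eq_intros simp: power2_eq_square)
    also have "(exp (- 1 / t) * (1 / t^2) * t ^ j - exp (- 1 / t) * (real j * t ^ (j - 1))) / (t ^ j * t ^ j)
        = flat (j + 2) t - j * flat (j + 1) t"
    proof -
      have "exp (- 1 / t) * (1 / t^2) * t ^ j / (t ^ j * t ^ j) = flat (j + 2) t"
        using 3 by (simp add: flat_def divide_simps power_add power2_eq_square)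
      moreover have "exp (- 1 / t) * (real j * t ^ (j - 1)) / (t ^ j * t ^ j) = j * flat (j + 1) t"
        using 3 by (cases j) (auto simp: flat_def divide_simps power_add)
      ultimately show ?thesis by (simp add: diff_divide_distrib)
    qed
    finally have "((\<lambda>t. exp (- 1 / t) / t ^ j) has_real_derivative (flat (j + 2) t - j * flat (j + 1) t)) (at t)" .
    then show ?thesis
      by (rule has_field_derivative_transform_within_open[of _ _ _ "{0<..}"]) (use 3 in \<open>auto simp: flat_def\<close>)
  qed
qed

lemma Ck_flat: "Ck k (\<lambda>x. flat j (m * (x $ i) + c))" for i :: "'n::finite"
proof (induction k arbitrary: j)
  case 0
  have "continuous_on UNIV (flat j)"
    using flat_deriv by (meson DERIV_isCont continuous_at_imp_continuous_on)
  then show ?case by (auto intro!: continuous_on_compose2[of UNIV "flat j"] continuous_intros)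
next
  case (Suc k)
  have g: "GDERIV (\<lambda>x. flat j (m * (x $ i) + c)) x :>
      (flat (j + 2) (m * (x $ i) + c) - j * flat (j + 1) (m * (x $ i) + c)) *\<^sub>R (m *\<^sub>R axis i 1)" for x :: "real^'n"
  proof -
    have "GDERIV (\<lambda>x. m * (x $ i) + c) x :> m *\<^sub>R axis i 1 + 0"
      using GDERIV_add[OF GDERIV_mult[OF GDERIV_const[of m] gderiv_coord[of i x]] GDERIV_const[of c x]] by simp
    from GDERIV_DERIV_compose[OF this flat_deriv[of j]] show ?thesis by simp
  qed
  have "Ck k (\<lambda>x::real^'n. (flat (j + 2) (m * (x $ i) + c) + (- real j) * flat (j + 1) (m * (x $ i) + c)) * (m * axis i 1 $ i'))" for i'
    by (intro Ck_mult Ck_add Ck_const Suc.IH)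
  then show ?case using g
    by (auto simp: mult.assoc intro!: exI[of _ "\<lambda>x. (flat (j + 2) (m * (x $ i) + c) - j * flat (j + 1) (m * (x $ i) + c)) *\<^sub>R (m *\<^sub>R axis i 1)"])
qed

text \<open>A smooth stand-in for the indicator of an open box. The factor \<open>Suc N\<close>
  stretches the distance to each face, so every factor tends to 1 inside the box; outside, some
  factor is exactly 0, so the support never leaves the closed box.\<close>

definition bump :: "real^'n \<Rightarrow> real^'n \<Rightarrow> nat \<Rightarrow> real^'n \<Rightarrow> real" where
  "bump a b N x = (\<Prod>i\<in>UNIV. flat 0 (Suc N * (x $ i - a $ i)) * flat 0 (Suc N * (b $ i - x $ i)))"

lemma smooth_bump: "smooth (bump a b N)"
proof -
  have "smooth (\<lambda>x. \<Prod>i\<in>UNIV. flat 0 (Suc N * (x $ i) + - (Suc N * a $ i)) * flat 0 ((- real (Suc N)) * (x $ i) + Suc N * b $ i))"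
    by (intro smooth_prod smooth_mult; unfold smooth_def; intro allI Ck_flat)
  then show ?thesis unfolding bump_def by (simp add: algebra_simps)
qed

lemma flat0: "0 \<le> flat 0 t" "flat 0 t \<le> 1"
  by (auto simp: flat_def)

lemma bump_bounds: "0 \<le> bump a b N x" "bump a b N x \<le> 1"
  unfolding bump_def by (auto intro!: prod_nonneg prod_le_1 mult_le_one simp: flat0)

lemma bump_outside: "x \<notin> box a b \<Longrightarrow> bump a b N x = 0"
proof -
  assume "x \<notin> box a b"
  then obtain i where "\<not> (a $ i < x $ i \<and> x $ i < b $ i)" by (auto simp: mem_box_cart)
  then have "flat 0 (Suc N * (x $ i - a $ i)) * flat 0 (Suc N * (b $ i - x $ i)) = 0"
    by (auto simp: flat_def zero_less_mult_iff)
  then show ?thesis unfolding bump_def by (intro prod_zero) auto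
qed

lemma bump_tendsto: "(\<lambda>N. bump a b N x) \<longlonglongrightarrow> indicator (box a b) x"
  for x :: "real^'n"
proof (cases "x \<in> box a b")
  case False then show ?thesis by (simp add: bump_outside)
next
  case True
  have flat1: "(\<lambda>N. flat 0 (Suc N * t)) \<longlonglongrightarrow> 1" if "t > 0" for t :: real
  proof -
    have "(\<lambda>N. exp (- ((1 / t) * (1 / real (Suc N))))) \<longlonglongrightarrow> exp (- ((1 / t) * 0))"
      by (intro tendsto_intros LIMSEQ_Suc[OF lim_1_over_n])
    moreover have "exp (- ((1 / t) * (1 / real (Suc N)))) = flat 0 (Suc N * t)" for N
      using that by (simp add: flat_def zero_less_mult_iff del: of_nat_Suc)
    ultimately show ?thesis by simp
  qed
  have "(\<lambda>N. bump a b N x) \<longlonglongrightarrow> (\<Prod>i\<in>(UNIV::'n set). 1 * 1)"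
    unfolding bump_def
  proof (rule tendsto_prod)
    fix i show "(\<lambda>N. flat 0 (real (Suc N) * (x $ i - a $ i)) * flat 0 (real (Suc N) * (b $ i - x $ i))) \<longlonglongrightarrow> 1 * 1"
      using True by (intro tendsto_mult flat1) (auto simp: mem_box_cart)
  qed
  then show ?thesis using True by simp
qed

lemma bump_test_fun: "cbox a b \<subseteq> S \<Longrightarrow> bump a b N \<in> test_fun S"
  using bump_outside[of _ a b N] box_subset_cbox[of a b]
  by (intro test_funI[of _ "cbox a b"] smooth_bump) (auto simp: compact_cbox)

section \<open>The fundamental lemma of the calculus of variations\<close>

lemma LINT_on:
  fixes f :: "'a::euclidean_space \<Rightarrow> 'b::{banach, second_countable_topology}"
  shows "A \<in> sets lebesgue \<Longrightarrow> (LINT x|lebesgue_on A. f x) = (LINT x:A|lebesgue. f x)"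
  by (simp add: set_lebesgue_integral_def integral_restrict_space)

lemma integrable_on_iff:
  fixes f :: "'a::euclidean_space \<Rightarrow> 'b::{banach, second_countable_topology}"
  shows "A \<in> sets lebesgue \<Longrightarrow> integrable (lebesgue_on A) f \<longleftrightarrow> set_integrable lebesgue A f"
  by (simp add: set_integrable_def integrable_restrict_space)

lemma AE_on_iff: "A \<in> sets lebesgue \<Longrightarrow> (AE x in lebesgue_on A. P x) \<longleftrightarrow> (AE x in lebesgue. x \<in> A \<longrightarrow> P x)"
  by (simp add: AE_restrict_space_iff)

lemma measurable_on_iff:
  fixes f :: "'a::euclidean_space \<Rightarrow> 'b::real_normed_vector"
  shows "A \<in> sets lebesgue \<Longrightarrow>
    f \<in> borel_measurable (lebesgue_on A) \<longleftrightarrow> (\<lambda>x. indicator A x *\<^sub>R f x) \<in> borel_measurable lebesgue"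
  by (simp add: borel_measurable_restrict_space_iff)

lemma open_sets_lebesgue: "open S \<Longrightarrow> S \<in> sets lebesgue" for S :: "'a::euclidean_space set"
  by (simp add: borel_open)

lemma AE_not_negligible: "negligible N \<Longrightarrow> AE x in lebesgue. x \<notin> N"
  by (simp add: AE_not_in negligible_iff_null_sets)

lemma null_diff_sets:
  assumes "A \<in> sets lebesgue" "negligible N" "A \<subseteq> B" "B \<subseteq> A \<union> N"
  shows "B \<in> sets lebesgue"
proof -
  have "negligible (B - A)" by (rule negligible_subset[OF assms(2)]) (use assms in auto)
  then have "A \<union> (B - A) \<in> sets lebesgue" using assms(1) negligible_imp_sets by blast
  moreover have "A \<union> (B - A) = B" using assms by auto
  ultimately show ?thesis by simp
qed

section \<open>Dyadic cubes and sign conditions tested on them\<close>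

definition dcube :: "nat \<Rightarrow> ('n \<Rightarrow> int) \<Rightarrow> (real^'n) set" where
  "dcube k z = cbox (\<chi> i. z i / 2 ^ k) (\<chi> i. (real_of_int (z i) + 1) / 2 ^ k)"

text \<open>The half-open companion of \<open>dcube\<close>. Cells of one level are disjoint and
  cover the space, so integrals over their unions add up exactly; closed cubes are what bumps can
  approximate. The two differ by a null set.\<close>

definition dcell :: "nat \<Rightarrow> ('n \<Rightarrow> int) \<Rightarrow> (real^'n) set" where
  "dcell k z = {x. \<forall>i. \<lfloor>2 ^ k * x $ i\<rfloor> = z i}"

lemma dcell_iff: "x \<in> dcell k z \<longleftrightarrow> (\<forall>i. z i / 2 ^ k \<le> x $ i \<and> x $ i < (real_of_int (z i) + 1) / 2 ^ k)"
  by (auto simp: dcell_def floor_eq_iff field_simps)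

lemma dcell_subset: "dcell k z \<subseteq> dcube k z"
  unfolding subset_iff dcell_iff dcube_def mem_box_cart by (auto intro: less_imp_le)

lemma box_subset_dcell: "box (\<chi> i. z i / 2 ^ k) (\<chi> i. (real_of_int (z i) + 1) / 2 ^ k) \<subseteq> dcell k z"
  unfolding subset_iff dcell_iff mem_box_cart by (auto intro: less_imp_le)

lemma dcube_minus_dcell_negligible: "negligible (dcube k z - dcell k z)"
  by (rule negligible_subset[OF negligible_frontier_interval[of "(\<chi> i. z i / 2 ^ k)" "(\<chi> i. (real_of_int (z i) + 1) / 2 ^ k)"]])
    (use box_subset_dcell[of z k] in \<open>auto simp: dcube_def\<close>)

lemma dcell_sets: "dcell k z \<in> sets lebesgue"
proof -
  let ?b = "box (\<chi> i. z i / 2 ^ k) (\<chi> i. (real_of_int (z i) + 1) / 2 ^ k)"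
  have "dcell k z \<subseteq> ?b \<union> (dcube k z - ?b)" using dcell_subset by blast
  moreover have "negligible (dcube k z - ?b)"
    unfolding dcube_def by (rule negligible_frontier_interval)
  ultimately show ?thesis
    using null_diff_sets[OF open_sets_lebesgue[OF open_box] _ box_subset_dcell] by blast
qed

lemma dcube_sets [simp]: "dcube k z \<in> sets lebesgue"
  by (simp add: dcube_def)

lemma dcube_near:
  fixes x y :: "real^'n"
  assumes "x \<in> dcube k z" "y \<in> dcube k z" shows "dist x y \<le> CARD('n) / 2 ^ k"
proof -
  have "\<bar>(x - y) $ i\<bar> \<le> 1 / 2 ^ k" for i
  proof -
    have "z i / 2 ^ k \<le> x $ i" "x $ i \<le> z i / 2 ^ k + 1 / 2 ^ k" "z i / 2 ^ k \<le> y $ i" "y $ i \<le> z i / 2 ^ k + 1 / 2 ^ k"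
      using assms by (auto simp: dcube_def mem_box_cart add_divide_distrib)
    then show ?thesis by (simp add: abs_le_iff)
  qed
  then have "(\<Sum>i\<in>UNIV. \<bar>(x - y) $ i\<bar>) \<le> (\<Sum>i\<in>(UNIV::'n set). 1 / 2 ^ k)"
    by (intro sum_mono) auto
  then show ?thesis using norm_le_l1_cart[of "x - y"] by (simp add: dist_norm)
qed

lemma finite_dcubes:
  fixes U :: "(real^'n) set"
  assumes "bounded U" shows "finite {z. dcube k z \<subseteq> U}"
proof -
  obtain B where B: "\<And>x. x \<in> U \<Longrightarrow> norm x \<le> B" using assms by (auto simp: bounded_iff)
  have "{z. dcube k z \<subseteq> U} \<subseteq> {z. \<forall>i. z i \<in> {- \<lceil>2 ^ k * B\<rceil> .. \<lceil>2 ^ k * B\<rceil>}}"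
  proof safe
    fix z i assume "dcube k z \<subseteq> U"
    moreover have "(\<chi> i. z i / 2 ^ k) \<in> dcube k z"
      by (auto simp: dcube_def mem_box_cart field_simps)
    ultimately have "\<bar>(\<chi> i. z i / 2 ^ k) $ i\<bar> \<le> B"
      using B component_le_norm_cart order_trans by blast
    then have "\<bar>real_of_int (z i)\<bar> \<le> 2 ^ k * B" by (simp add: field_simps abs_divide)
    then show "z i \<in> {- \<lceil>2 ^ k * B\<rceil> .. \<lceil>2 ^ k * B\<rceil>}"
      by (auto; linarith)
  qed
  moreover have "finite {z. \<forall>i::'n. z i \<in> {- \<lceil>2 ^ k * B\<rceil> .. \<lceil>2 ^ k * B\<rceil>}}"
    using finite_PiE[of "UNIV::'n set" "\<lambda>i. {- \<lceil>2 ^ k * B\<rceil> .. \<lceil>2 ^ k * B\<rceil>}"]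
    by (simp add: PiE_def Pi_def)
  ultimately show ?thesis by (rule finite_subset)
qed

text \<open>The cells of level \<open>k\<close> whose closed cubes lie in \<open>U\<close> exhaust
  \<open>U\<close> as \<open>k\<close> grows. Any infinite set \<open>I\<close> of levels serves for
  this, which matters in \<open>weak_gradient_bound_near_const\<close>, where the hypothesis is
  available along a subsequence of levels.\<close>

lemma nonneg_integral_open_from_dcubes:
  fixes H :: "real^'n \<Rightarrow> real"
  assumes H: "integrable lebesgue H" and U: "open U" "bounded U" and I: "infinite I"
    and cubes: "\<And>k z. k \<in> I \<Longrightarrow> dcube k z \<subseteq> U \<Longrightarrow> 0 \<le> (LINT x:dcube k z|lebesgue. H x)"
  shows "0 \<le> (LINT x:U|lebesgue. H x)"
proof -
  define r where "r = enumerate I"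
  have r: "strict_mono r" "\<And>n. r n \<in> I"
    unfolding r_def using I by (auto simp: strict_mono_enumerate enumerate_in_set)
  define Z where "Z k = {z. dcube k z \<subseteq> U}" for k
  define W where "W k = (\<Union>z\<in>Z k. dcell k z)" for k
  have Zfin: "finite (Z k)" for k unfolding Z_def by (rule finite_dcubes[OF U(2)])
  have Wsub: "W k \<subseteq> U" for k unfolding W_def Z_def using dcell_subset by blast
  have Wsets: "W k \<in> sets lebesgue" for k unfolding W_def using Zfin dcell_sets by blast
  have HI: "set_integrable lebesgue A H" if "A \<in> sets lebesgue" for A
    unfolding set_integrable_def by (rule integrable_mult_indicator[OF that H])
  have HM: "(\<lambda>x. indicat_real A x *\<^sub>R H x) \<in> borel_measurable lebesgue" if "A \<in> sets lebesgue" for A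
    using HI[OF that] by (auto simp: set_integrable_def dest: borel_measurable_integrable)
  have "0 \<le> (LINT x:W k|lebesgue. H x)" if "k \<in> I" for k
  proof -
    have "(LINT x:W k|lebesgue. H x) = (\<Sum>z\<in>Z k. LINT x:dcell k z|lebesgue. H x)"
      unfolding W_def by (rule set_integral_finite_Union)
        (auto simp: Zfin HI dcell_sets disjoint_family_on_def dcell_def fun_eq_iff)
    also have "\<dots> = (\<Sum>z\<in>Z k. LINT x:dcube k z|lebesgue. H x)"
    proof (rule sum.cong[OF refl])
      fix z :: "'n \<Rightarrow> int"
      have "AE x in lebesgue. x \<notin> dcube k z - dcell k z"
        by (rule AE_not_negligible[OF dcube_minus_dcell_negligible])
      then have "AE x in lebesgue. x \<in> dcell k z \<longleftrightarrow> x \<in> dcube k z"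
        by eventually_elim (use dcell_subset in blast)
      then show "(LINT x:dcell k z|lebesgue. H x) = (LINT x:dcube k z|lebesgue. H x)"
        by (intro set_integral_cong_set) (use HI[OF dcell_sets[of k z]] HI[OF dcube_sets[of k z]]
            in \<open>auto simp: set_borel_measurable_def set_integrable_def dest: borel_measurable_integrable\<close>)
    qed
    also have "\<dots> \<ge> 0" by (intro sum_nonneg cubes that) (auto simp: Z_def)
    finally show ?thesis .
  qed
  then have pos: "0 \<le> (LINT x:W (r n)|lebesgue. H x)" for n using r by blast
  have ev: "eventually (\<lambda>n. x \<in> W (r n)) sequentially" if "x \<in> U" for x
  proof -
    obtain e where e: "e > 0" "ball x e \<subseteq> U" by (rule openE[OF U(1) \<open>x \<in> U\<close>])
    have "(\<lambda>n. CARD('n) * (1/2::real) ^ n) \<longlonglongrightarrow> real CARD('n) * 0"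
      by (intro tendsto_mult tendsto_const LIMSEQ_realpow_zero) auto
    then have "eventually (\<lambda>n. CARD('n) * (1/2::real) ^ n < e) sequentially"
      by (rule order_tendstoD(2)) (use e(1) in simp)
    then have "eventually (\<lambda>n. CARD('n) * (1/2::real) ^ (r n) < e) sequentially"
      by (rule eventually_compose_filterlim[OF _ filterlim_subseq[OF r(1)]])
    then show ?thesis
    proof eventually_elim
      case (elim n)
      define z where "z i = \<lfloor>2 ^ (r n) * x $ i\<rfloor>" for i
      have x: "x \<in> dcell (r n) z" by (simp add: dcell_def z_def)
      have "dcube (r n) z \<subseteq> ball x e"
      proof
        fix y assume "y \<in> dcube (r n) z"
        then have "dist x y \<le> CARD('n) / 2 ^ r n" using dcube_near x dcell_subset by blast
        then show "y \<in> ball x e" using elim by (simp add: power_one_over)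
      qed
      then show ?case using x e unfolding W_def Z_def by blast
    qed
  qed
  have lim: "(\<lambda>n. LINT x:W (r n)|lebesgue. H x) \<longlonglongrightarrow> (LINT x:U|lebesgue. H x)"
    unfolding set_lebesgue_integral_def
  proof (rule integral_dominated_convergence[where w = "\<lambda>x. \<bar>H x\<bar>"])
    show "AE x in lebesgue. (\<lambda>n. indicat_real (W (r n)) x *\<^sub>R H x) \<longlonglongrightarrow> indicat_real U x *\<^sub>R H x"
    proof (rule AE_I2)
      fix x
      show "(\<lambda>n. indicat_real (W (r n)) x *\<^sub>R H x) \<longlonglongrightarrow> indicat_real U x *\<^sub>R H x"
      proof (cases "x \<in> U")
        case True
        show ?thesis
          by (rule tendsto_eventually, rule eventually_mono[OF ev[OF True]]) (use True in simp)
      next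
        case False
        then have "x \<notin> W k" for k using Wsub by blast
        then show ?thesis using False by simp
      qed
    qed
      show "(\<lambda>x. indicat_real U x *\<^sub>R H x) \<in> borel_measurable lebesgue"
      "\<And>n. (\<lambda>x. indicat_real (W (r n)) x *\<^sub>R H x) \<in> borel_measurable lebesgue"
      "integrable lebesgue (\<lambda>x. \<bar>H x\<bar>)"
      by (intro HM Wsets open_sets_lebesgue U integrable_abs H)+
    show "AE x in lebesgue. norm (indicat_real (W (r n)) x *\<^sub>R H x) \<le> \<bar>H x\<bar>" for n
      by (auto simp: indicator_def)
  qed
  show ?thesis by (rule LIMSEQ_le_const[OF lim]) (use pos in auto)
qed

text \<open>By outer regularity the set \<open>E\<close> where \<open>h\<close> is negative is, up
  to a null set, a decreasing intersection of open sets, and the integral over each of them is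
  nonnegative. In the limit a negative function has a nonnegative integral over \<open>E\<close>, so
  \<open>E\<close> is null.\<close>

proposition AE_nonneg_from_dcubes:
  fixes h :: "real^'n \<Rightarrow> real"
  assumes S: "open S" "bounded S" and h: "integrable (lebesgue_on S) h" and I: "infinite I"
    and cubes: "\<And>k z. k \<in> I \<Longrightarrow> dcube k z \<subseteq> S \<Longrightarrow> 0 \<le> (LINT x|lebesgue_on (dcube k z). h x)"
  shows "AE x in lebesgue_on S. 0 \<le> h x"
proof -
  define H where "H x = indicator S x *\<^sub>R h x" for x
  have Ss: "S \<in> sets lebesgue" using S open_sets_lebesgue by blast
  have H: "integrable lebesgue H" unfolding H_def using h Ss by (simp add: integrable_on_iff set_integrable_def)
  have HI: "set_integrable lebesgue A H" if "A \<in> sets lebesgue" for A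
    unfolding set_integrable_def by (rule integrable_mult_indicator[OF that H])
  have HM: "(\<lambda>x. indicat_real A x *\<^sub>R H x) \<in> borel_measurable lebesgue" if "A \<in> sets lebesgue" for A
    using HI[OF that] by (auto simp: set_integrable_def dest: borel_measurable_integrable)
  have open_case: "0 \<le> (LINT x:U|lebesgue. H x)" if "open U" "U \<subseteq> S" for U
  proof (rule nonneg_integral_open_from_dcubes[OF H that(1) bounded_subset[OF S(2) that(2)] I])
    fix k z assume k: "k \<in> I" and z: "dcube k z \<subseteq> U"
    have "(LINT x:dcube k z|lebesgue. H x) = (LINT x:dcube k z|lebesgue. h x)"
      using z that by (intro set_lebesgue_integral_cong) (auto simp: H_def indicator_def)
    then show "0 \<le> (LINT x:dcube k z|lebesgue. H x)"
      using cubes[OF k] z that by (simp add: LINT_on)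
  qed
  define E where "E = {x. H x < 0}"
  have Es: "E \<in> sets lebesgue"
    using measurable_sets[OF borel_measurable_integrable[OF H], of "{..<0}"] by (simp add: E_def vimage_def)
  have ES: "E \<subseteq> S" unfolding E_def H_def by (auto simp: indicator_def split: if_splits)
  have "\<exists>T. open T \<and> E \<subseteq> T \<and> T - E \<in> sets lebesgue \<and> emeasure lebesgue (T - E) < ennreal (1 / Suc j)" for j
    by (rule sets_lebesgue_outer_open[OF Es, of "1 / Suc j"]) (auto simp: fmeasurable_def)
  then obtain T where T: "\<And>j. open (T j)" "\<And>j. E \<subseteq> T j" "\<And>j. T j - E \<in> sets lebesgue"
    "\<And>j. emeasure lebesgue (T j - E) < ennreal (1 / Suc j)" by metis
  \<comment> \<open>Finite intersections make the sequence decreasing: a point outside one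
    \<open>U j\<close> stays outside all later ones, which gives pointwise convergence of the
    indicators.\<close>
  define U where "U j = S \<inter> (\<Inter>i\<le>j. T i)" for j
  have Uo: "open (U j)" and US: "U j \<subseteq> S" and EU: "E \<subseteq> U j" for j
    unfolding U_def using S T ES by (auto intro!: open_Int open_INT)
  have null: "(\<Inter>j. U j) - E \<in> null_sets lebesgue"
  proof (rule null_setsI)
    show s: "(\<Inter>j. U j) - E \<in> sets lebesgue"
      by (intro sets.Diff Es sets.countable_INT) (use Uo open_sets_lebesgue in auto)
    have "emeasure lebesgue ((\<Inter>j. U j) - E) \<le> ennreal (1 / Suc j)" for j
    proof -
      have "emeasure lebesgue ((\<Inter>j. U j) - E) \<le> emeasure lebesgue (T j - E)"
        by (rule emeasure_mono[OF _ T(3)]) (auto simp: U_def)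
      then show ?thesis using T(4)[of j] by simp
    qed
    moreover have "(\<lambda>j. ennreal (1 / Suc j)) \<longlonglongrightarrow> ennreal 0"
      by (intro tendsto_ennrealI LIMSEQ_Suc[OF lim_1_over_n])
    ultimately have "emeasure lebesgue ((\<Inter>j. U j) - E) \<le> ennreal 0"
      by (intro LIMSEQ_le_const) auto
    then show "emeasure lebesgue ((\<Inter>j. U j) - E) = 0" by simp
  qed
  have lim: "(\<lambda>n. LINT x:U n|lebesgue. H x) \<longlonglongrightarrow> (LINT x:E|lebesgue. H x)"
    unfolding set_lebesgue_integral_def
  proof (rule integral_dominated_convergence[where w = "\<lambda>x. \<bar>H x\<bar>"])
    have "AE x in lebesgue. x \<notin> (\<Inter>j. U j) - E" using null by (rule AE_not_in)
    then show "AE x in lebesgue. (\<lambda>n. indicat_real (U n) x *\<^sub>R H x) \<longlonglongrightarrow> indicat_real E x *\<^sub>R H x"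
    proof eventually_elim
      case (elim x)
      show ?case
      proof (cases "x \<in> E")
        case True
        then have "x \<in> U n" for n using EU by blast
        then show ?thesis using True by simp
      next
        case False
        then obtain j where j: "x \<notin> U j" using elim by blast
        have "x \<notin> U n" if "n \<ge> j" for n
          using j that unfolding U_def by (auto intro: order_trans)
        then have "eventually (\<lambda>n. x \<notin> U n) sequentially" by (auto simp: eventually_sequentially)
        then show ?thesis
          by (intro tendsto_eventually, rule eventually_mono) (use False in simp)
      qed
    qed
      show "(\<lambda>x. indicat_real E x *\<^sub>R H x) \<in> borel_measurable lebesgue"
      "\<And>n. (\<lambda>x. indicat_real (U n) x *\<^sub>R H x) \<in> borel_measurable lebesgue"
      "integrable lebesgue (\<lambda>x. \<bar>H x\<bar>)"
      by (intro HM Es open_sets_lebesgue Uo integrable_abs H)+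
    show "AE x in lebesgue. norm (indicat_real (U n) x *\<^sub>R H x) \<le> \<bar>H x\<bar>" for n
      by (auto simp: indicator_def)
  qed
  have "0 \<le> (LINT x:E|lebesgue. H x)"
    by (rule LIMSEQ_le_const[OF lim]) (use open_case Uo US in auto)
  moreover have "(LINT x:E|lebesgue. H x) = - (LINT x|lebesgue. indicator E x * (- H x))"
    by (simp add: set_lebesgue_integral_def)
  moreover have nn: "0 \<le> indicator E x * (- H x)" for x by (auto simp: E_def indicator_def)
  moreover have "0 \<le> (LINT x|lebesgue. indicator E x * (- H x))"
    by (rule integral_nonneg_AE, rule AE_I2, rule nn)
  ultimately have z: "(LINT x|lebesgue. indicator E x * (- H x)) = 0" by linarith
  have int: "integrable lebesgue (\<lambda>x. indicator E x * (- H x))"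
    using HI[OF Es] by (simp add: set_integrable_def)
  have "AE x in lebesgue. indicator E x * (- H x) = 0"
    using integral_nonneg_eq_0_iff_AE[OF int] nn z by simp
  then have "AE x in lebesgue. x \<in> S \<longrightarrow> 0 \<le> h x"
    by eventually_elim (auto simp: E_def H_def indicator_def split: if_splits)
  then show ?thesis using Ss by (simp add: AE_on_iff)
qed

lemma LINT_bump_tendsto:
  fixes h :: "real^'n \<Rightarrow> real"
  assumes S: "S \<in> sets lebesgue" and h: "integrable (lebesgue_on S) h" and ab: "cbox a b \<subseteq> S"
  shows "(\<lambda>N. LINT x|lebesgue_on S. h x * bump a b N x) \<longlonglongrightarrow> (LINT x|lebesgue_on (cbox a b). h x)"
proof -
  have bm: "bump a b N \<in> borel_measurable (lebesgue_on S)" for N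
    using smooth_continuous[OF smooth_bump] S by (rule continuous_imp_measurable_on_sets_lebesgue)
  have "(\<lambda>N. LINT x|lebesgue_on S. h x * bump a b N x) \<longlonglongrightarrow> (LINT x|lebesgue_on S. h x * indicator (box a b) x)"
  proof (rule integral_dominated_convergence[where w = "\<lambda>x. \<bar>h x\<bar>"])
    show "AE x in lebesgue_on S. (\<lambda>N. h x * bump a b N x) \<longlonglongrightarrow> h x * indicat_real (box a b) x"
      by (intro AE_I2 tendsto_mult tendsto_const bump_tendsto)
    show "AE x in lebesgue_on S. norm (h x * bump a b N x) \<le> \<bar>h x\<bar>" for N
      by (intro AE_I2) (simp add: abs_mult bump_bounds mult_left_le)
    have "indicat_real (box a b) \<in> borel_measurable (lebesgue_on S)"
      by (intro measurable_restrict_space1 borel_measurable_indicator open_sets_lebesgue open_box)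
    then show "(\<lambda>x. h x * indicat_real (box a b) x) \<in> borel_measurable (lebesgue_on S)"
      using h by auto
  qed (use h bm in auto)
  moreover have "(LINT x|lebesgue_on S. h x * indicator (box a b) x) = (LINT x|lebesgue_on (cbox a b). h x)"
  proof -
    have "AE x in lebesgue. x \<notin> cbox a b - box a b"
      by (rule AE_not_negligible[OF negligible_frontier_interval])
    then have "AE x in lebesgue. indicator S x * (h x * indicator (box a b) x) = indicator (cbox a b) x * h x"
      by eventually_elim (use ab box_subset_cbox[of a b] in \<open>auto simp: indicator_def\<close>)
    moreover have "set_integrable lebesgue (cbox a b) h"
      by (rule set_integrable_subset[of _ S]) (use h S ab in \<open>auto simp: integrable_on_iff\<close>)
    moreover have "integrable lebesgue (\<lambda>x. indicator (box a b) x *\<^sub>R (indicator S x *\<^sub>R h x))"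
      by (rule integrable_mult_indicator) (use S h in \<open>auto simp: set_integrable_def integrable_on_iff\<close>)
    then have "(\<lambda>x. indicator S x * (h x * indicator (box a b) x)) \<in> borel_measurable lebesgue"
      by (auto simp: mult_ac dest: borel_measurable_integrable)
    ultimately have "(LINT x|lebesgue. indicator S x * (h x * indicator (box a b) x)) = (LINT x|lebesgue. indicator (cbox a b) x * h x)"
      by (intro integral_cong_AE) (auto simp: set_integrable_def dest: borel_measurable_integrable)
    then show ?thesis using S by (simp add: LINT_on set_lebesgue_integral_def)
  qed
  ultimately show ?thesis by simp
qed

text \<open>Bumps turn the hypothesis into vanishing integrals over all dyadic cubes inside
  \<open>S\<close>; the sign criterion is then applied to \<open>h\<close> and to its
  negative.\<close>

proposition AE_zero_from_test_fun:
  fixes h :: "real^'n \<Rightarrow> real"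
  assumes S: "open S" "bounded S" and h: "integrable (lebesgue_on S) h"
    and test: "\<And>\<phi>. \<phi> \<in> test_fun S \<Longrightarrow> (LINT x|lebesgue_on S. h x * \<phi> x) = 0"
  shows "AE x in lebesgue_on S. h x = 0"
proof -
  have Ss: "S \<in> sets lebesgue" using S open_sets_lebesgue by blast
  have z: "(LINT x|lebesgue_on (dcube k z). h x) = 0" if "dcube k z \<subseteq> S" for k z
    using LINT_bump_tendsto[OF Ss h that[unfolded dcube_def]] test bump_test_fun[OF that[unfolded dcube_def]]
    unfolding dcube_def by (simp add: LIMSEQ_const_iff)
  have "AE x in lebesgue_on S. 0 \<le> h x"
    by (rule AE_nonneg_from_dcubes[OF S h infinite_UNIV_nat]) (use z in auto)
  moreover have "AE x in lebesgue_on S. 0 \<le> - h x"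
    by (rule AE_nonneg_from_dcubes[OF S _ infinite_UNIV_nat]) (use z h in auto)
  ultimately show ?thesis by eventually_elim auto
qed

section \<open>Lebesgue spaces\<close>

text \<open>The essential supremum is itself an almost everywhere bound and lies below every other
  one, so explicit bounds can replace it from here on.\<close>

lemma Linf_iff:
  "f \<in> Linf S \<longleftrightarrow> f \<in> borel_measurable (lebesgue_on S) \<and> (\<exists>B. AE x in lebesgue_on S. norm (f x) \<le> B)"
proof safe
  assume f: "f \<in> Linf S"
  then show m: "f \<in> borel_measurable (lebesgue_on S)" by (simp add: Linf_def)
  let ?e = "esssup (lebesgue_on S) (\<lambda>x. ereal (norm (f x)))"
  have "?e < \<infinity>" using f by (simp add: Linf_def)
  then obtain B where "?e \<le> ereal B" by (cases ?e) auto
  moreover have "AE x in lebesgue_on S. ereal (norm (f x)) \<le> ?e" by (rule esssup_AE)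
  ultimately have "AE x in lebesgue_on S. norm (f x) \<le> B"
    by (auto elim!: eventually_mono dest: order_trans)
  then show "\<exists>B. AE x in lebesgue_on S. norm (f x) \<le> B" ..
next
  fix B assume m: "f \<in> borel_measurable (lebesgue_on S)" and B: "AE x in lebesgue_on S. norm (f x) \<le> B"
  have "esssup (lebesgue_on S) (\<lambda>x. ereal (norm (f x))) \<le> ereal B"
    using m B by (intro esssup_I) auto
  then show "f \<in> Linf S" using m by (auto simp: Linf_def)
qed

text \<open>Valid for arbitrary \<open>f\<close> and \<open>S\<close>. The infinite essential
  supremum of a nonmeasurable function and the value minus infinity over a null set are both read as
  0, and a finite negative value would force the underlying set to be null.\<close>

lemma norm_Linf_nonneg: "0 \<le> norm_Linf S f"
proof (rule ccontr)
  let ?e = "esssup (lebesgue_on S) (\<lambda>x. ereal (norm (f x)))"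
  assume *: "\<not> 0 \<le> norm_Linf S f"
  then have neg: "?e < 0" "?e \<noteq> - \<infinity>" by (cases ?e; auto simp: norm_Linf_def)+
  then have m: "(\<lambda>x. ereal (norm (f x))) \<in> borel_measurable (lebesgue_on S)"
    using esssup_non_measurable[of "\<lambda>x. ereal (norm (f x))"] by (fastforce simp: top_ereal_def)
  have "AE x in lebesgue_on S. ereal (norm (f x)) \<le> ?e" by (rule esssup_AE)
  then have "AE x in lebesgue_on S. ereal (norm (f x)) \<le> - \<infinity>"
  proof eventually_elim
    case (elim x)
    then have "ereal (norm (f x)) < 0" using neg by order
    then show ?case by simp
  qed
  then have "?e \<le> - \<infinity>" by (rule esssup_I[OF m])
  then show False using neg by simp
qed

lemma Linf_AE:
  assumes "f \<in> Linf S" shows "AE x in lebesgue_on S. norm (f x) \<le> norm_Linf S f"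
proof -
  let ?e = "esssup (lebesgue_on S) (\<lambda>x. ereal (norm (f x)))"
  have "AE x in lebesgue_on S. ereal (norm (f x)) \<le> ?e" by (rule esssup_AE)
  moreover have "?e \<noteq> \<infinity>" using assms by (auto simp: Linf_def)
  ultimately show ?thesis
    by (cases ?e) (auto simp: norm_Linf_def)
qed

lemma norm_Linf_le:
  assumes "f \<in> borel_measurable (lebesgue_on S)" "AE x in lebesgue_on S. norm (f x) \<le> B" "0 \<le> B"
  shows "norm_Linf S f \<le> B"
proof -
  have "esssup (lebesgue_on S) (\<lambda>x. ereal (norm (f x))) \<le> ereal B"
    using assms by (intro esssup_I) auto
  then show ?thesis using assms(3) unfolding norm_Linf_def
    by (cases "esssup (lebesgue_on S) (\<lambda>x. ereal (norm (f x)))") auto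
qed

lemma Linf_measurable: "f \<in> Linf S \<Longrightarrow> f \<in> borel_measurable (lebesgue_on S)"
  by (simp add: Linf_def)

lemma AE_on_subset:
  assumes "AE x in lebesgue_on S. P x" "T \<subseteq> S" "S \<in> sets lebesgue" "T \<in> sets lebesgue"
  shows "AE x in lebesgue_on T. P x"
  using assms by (auto simp: AE_on_iff elim: eventually_mono)

lemma Linf_subset:
  assumes "f \<in> Linf S" "T \<subseteq> S" "S \<in> sets lebesgue" "T \<in> sets lebesgue"
  shows "f \<in> Linf T"
  using assms measurable_restrict_mono[of f lebesgue S borel T] AE_on_subset[where S=S and T=T]
  unfolding Linf_iff by blast

lemma continuous_Linf:
  fixes p :: "real^'n \<Rightarrow> 'b::euclidean_space"
  assumes "continuous_on UNIV p" "bounded S" "S \<in> sets lebesgue" shows "p \<in> Linf S"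
  unfolding Linf_iff
proof
  show "p \<in> borel_measurable (lebesgue_on S)"
    using assms continuous_imp_measurable_on_sets_lebesgue continuous_on_subset by blast
  have "compact (p ` closure S)"
    using assms by (intro compact_continuous_image continuous_on_subset[OF assms(1)]) auto
  then obtain B where "\<And>x. x \<in> closure S \<Longrightarrow> norm (p x) \<le> B"
    by (fastforce dest!: compact_imp_bounded simp: bounded_iff)
  then have "\<And>x. x \<in> S \<Longrightarrow> norm (p x) \<le> B" using closure_subset by blast
  then show "\<exists>B. AE x in lebesgue_on S. norm (p x) \<le> B"
    by (intro exI[of _ B] AE_I2) auto
qed

lemma Linf_mult: "f \<in> Linf S \<Longrightarrow> g \<in> Linf S \<Longrightarrow> (\<lambda>x. f x * g x) \<in> Linf S" for f g :: "_ \<Rightarrow> real"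
proof -
  assume f: "f \<in> Linf S" and g: "g \<in> Linf S"
  have "AE x in lebesgue_on S. norm (f x * g x) \<le> norm_Linf S f * norm_Linf S g"
    using Linf_AE[OF f] Linf_AE[OF g]
    by eventually_elim (auto simp: abs_mult intro!: mult_mono norm_Linf_nonneg)
  then show ?thesis using f g unfolding Linf_iff by auto
qed

lemma Linf_inner: "f \<in> Linf S \<Longrightarrow> g \<in> Linf S \<Longrightarrow> (\<lambda>x. f x \<bullet> g x) \<in> Linf S"
proof -
  assume f: "f \<in> Linf S" and g: "g \<in> Linf S"
  have "AE x in lebesgue_on S. norm (f x \<bullet> g x) \<le> norm_Linf S f * norm_Linf S g"
    using Linf_AE[OF f] Linf_AE[OF g]
    by eventually_elim
      (auto intro!: order_trans[OF Cauchy_Schwarz_ineq2] mult_mono norm_Linf_nonneg)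
  then show ?thesis using f g unfolding Linf_iff by auto
qed

lemma Linf_add: "f \<in> Linf S \<Longrightarrow> g \<in> Linf S \<Longrightarrow> (\<lambda>x. f x + g x) \<in> Linf S"
proof -
  assume f: "f \<in> Linf S" and g: "g \<in> Linf S"
  have "AE x in lebesgue_on S. norm (f x + g x) \<le> norm_Linf S f + norm_Linf S g"
    using Linf_AE[OF f] Linf_AE[OF g]
    by eventually_elim (auto intro!: order_trans[OF norm_triangle_ineq])
  then show ?thesis using f g unfolding Linf_iff by auto
qed

lemma Linf_const: "(\<lambda>x. c) \<in> Linf S"
  unfolding Linf_iff by auto

lemma Linf_uminus: "f \<in> Linf S \<Longrightarrow> (\<lambda>x. - f x) \<in> Linf S"
  unfolding Linf_iff by auto

lemma Linf_diff: "f \<in> Linf S \<Longrightarrow> g \<in> Linf S \<Longrightarrow> (\<lambda>x. f x - g x) \<in> Linf S"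
  using Linf_add[of f S "\<lambda>x. - g x"] Linf_uminus[of g S] by simp

lemma Linf_sum: "(\<And>i. i \<in> I \<Longrightarrow> f i \<in> Linf S) \<Longrightarrow> (\<lambda>x. \<Sum>i\<in>I. f i x) \<in> Linf S"
  by (induction I rule: infinite_finite_induct) (auto intro: Linf_const Linf_add)

lemma Linf_component: "b \<in> Linf S \<Longrightarrow> (\<lambda>x. b x $ i) \<in> Linf S"
  for b :: "real^'n \<Rightarrow> real^'m"
  using Linf_inner[OF _ Linf_const[of "axis i 1"], of b S] by (simp add: inner_axis)

lemma Linf_integrable:
  assumes "f \<in> Linf S" "S \<in> lmeasurable" shows "integrable (lebesgue_on S) f"
proof -
  interpret finite_measure "lebesgue_on S" using assms(2) by (rule finite_measure_lebesgue_on)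
  show ?thesis using assms(1) integrable_const_bound unfolding Linf_iff by blast
qed

lemma test_fun_Linf: "\<phi> \<in> test_fun S \<Longrightarrow> \<phi> \<in> Linf T"
  and test_fun_grad_Linf: "\<phi> \<in> test_fun S \<Longrightarrow> grad \<phi> \<in> Linf T" if "T \<in> sets lebesgue"
proof -
  assume "\<phi> \<in> test_fun S"
  then obtain B where *: "smooth \<phi>" "\<And>x. \<bar>\<phi> x\<bar> \<le> B" "\<And>x. norm (grad \<phi> x) \<le> B" by (rule test_funE) blast
  show "\<phi> \<in> Linf T" "grad \<phi> \<in> Linf T" unfolding Linf_iff
    using * that by (auto intro!: exI[of _ B] AE_I2 continuous_imp_measurable_on_sets_lebesgue smooth_continuous smooth_grad_continuous)
qed

section \<open>Square integrable functions\<close>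

lemma L2_measurable: "f \<in> L2 S \<Longrightarrow> f \<in> borel_measurable (lebesgue_on S)"
  by (simp add: L2_def)

lemma L2_prod_integrable:
  assumes "f \<in> L2 S" "g \<in> L2 S" shows "integrable (lebesgue_on S) (\<lambda>x. f x * g x)"
proof (rule Bochner_Integration.integrable_bound[of _ "\<lambda>x. (f x)\<^sup>2 + (g x)\<^sup>2"])
  have "\<bar>a * b\<bar> \<le> a\<^sup>2 + b\<^sup>2" for a b :: real
  proof -
    have "2 * \<bar>a * b\<bar> \<le> a\<^sup>2 + b\<^sup>2"
      using sum_squares_bound[of "\<bar>a\<bar>" "\<bar>b\<bar>"] by (simp add: abs_mult mult.assoc)
    then show ?thesis using abs_ge_zero[of "a * b"] by linarith
  qed
  then show "AE x in lebesgue_on S. norm (f x * g x) \<le> norm ((f x)\<^sup>2 + (g x)\<^sup>2)" by (simp)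
qed (use assms in \<open>auto simp: L2_def\<close>)

lemma L2_mult_Linf:
  assumes f: "f \<in> L2 S" and g: "g \<in> Linf S" shows "(\<lambda>x. f x * g x) \<in> L2 S"
  unfolding L2_def
proof (safe)
  show m: "(\<lambda>x. f x * g x) \<in> borel_measurable (lebesgue_on S)" using f g by (auto simp: L2_def Linf_def)
  have f2: "integrable (lebesgue_on S) (\<lambda>x. (norm_Linf S g)\<^sup>2 * (f x)\<^sup>2)" using f by (auto simp: L2_def)
  have "AE x in lebesgue_on S. norm ((f x * g x)\<^sup>2) \<le> norm ((norm_Linf S g)\<^sup>2 * (f x)\<^sup>2)"
    using Linf_AE[OF g]
  proof eventually_elim
    case (elim x)
    then have "(g x)\<^sup>2 \<le> (norm_Linf S g)\<^sup>2" using power_mono[of "\<bar>g x\<bar>" _ 2] by simp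
    then show ?case by (simp add: power_mult_distrib mult.commute mult_left_mono)
  qed
  then show "integrable (lebesgue_on S) (\<lambda>x. (f x * g x)\<^sup>2)"
    by (rule Bochner_Integration.integrable_bound[OF f2 borel_measurable_power[OF m]])
qed

lemma L2_add:
  assumes "f \<in> L2 S" "g \<in> L2 S" shows "(\<lambda>x. f x + g x) \<in> L2 S"
proof -
  have "integrable (lebesgue_on S) (\<lambda>x. (f x)\<^sup>2 + 2 * (f x * g x) + (g x)\<^sup>2)"
    using assms L2_prod_integrable[OF assms] by (auto simp: L2_def)
  then show ?thesis using assms by (auto simp: L2_def power2_sum mult.assoc add.assoc add.left_commute add.commute)
qed

lemma L2_cmult: "f \<in> L2 S \<Longrightarrow> (\<lambda>x. c * f x) \<in> L2 S"
  using L2_mult_Linf[OF _ Linf_const[of c S], of f] by (simp add: mult.commute)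

lemma L2_diff: "f \<in> L2 S \<Longrightarrow> g \<in> L2 S \<Longrightarrow> (\<lambda>x. f x - g x) \<in> L2 S"
  using L2_add[of f S "\<lambda>x. -1 * g x"] L2_cmult[of g S "-1"] by simp

lemma Linf_L2:
  assumes "f \<in> Linf S" "S \<in> lmeasurable" shows "f \<in> L2 S"
  using Linf_integrable[OF Linf_mult[OF assms(1) assms(1)] assms(2)] assms(1)
  by (simp add: L2_def Linf_def power2_eq_square)

lemma L2_integrable:
  assumes "f \<in> L2 S" "S \<in> lmeasurable" shows "integrable (lebesgue_on S) f"
  using L2_prod_integrable[OF assms(1) Linf_L2[OF Linf_const[of 1] assms(2)]] by simp

lemma L2_Linf_integrable:
  assumes "f \<in> L2 S" "g \<in> Linf S" "S \<in> lmeasurable" shows "integrable (lebesgue_on S) (\<lambda>x. f x * g x)"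
  by (rule L2_integrable[OF L2_mult_Linf[OF assms(1,2)] assms(3)])

text \<open>Rests on completeness of Lebesgue measure. Piecewise polynomials are prescribed only
  almost everywhere, and this is how they become measurable.\<close>

lemma measurable_on_cong_AE:
  fixes f g :: "real^'n \<Rightarrow> 'b::euclidean_space"
  assumes g: "g \<in> borel_measurable (lebesgue_on S)" and eq: "AE x in lebesgue_on S. f x = g x"
    and S: "S \<in> sets lebesgue"
  shows "f \<in> borel_measurable (lebesgue_on S)"
proof -
  have "AE x in lebesgue. x \<in> S \<longrightarrow> f x = g x" using eq S by (simp add: AE_on_iff)
  then obtain N where N: "N \<in> null_sets lebesgue" "{x. \<not> (x \<in> S \<longrightarrow> f x = g x)} \<subseteq> N"
    unfolding eventually_ae_filter by auto
  have neg: "negligible N" using N(1) by (simp add: negligible_iff_null_sets)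
  show ?thesis
  proof (rule measurableI)
    fix A :: "'b set" assume A: "A \<in> sets borel"
    have G: "g -` A \<inter> S \<in> sets lebesgue"
      using measurable_sets[OF g A] S by (simp add: sets_restrict_space_iff)
    have "f -` A \<inter> S \<in> sets lebesgue"
    proof (rule null_diff_sets)
      show "g -` A \<inter> S - N \<in> sets lebesgue" using G N(1) by auto
      show "g -` A \<inter> S - N \<subseteq> f -` A \<inter> S" "f -` A \<inter> S \<subseteq> (g -` A \<inter> S - N) \<union> N"
        using N(2) by fastforce+
    qed (rule neg)
    then show "f -` A \<inter> space (lebesgue_on S) \<in> sets (lebesgue_on S)"
      using S by (simp add: sets_restrict_space_iff)
  qed simp
qed

lemma Linf_cong_AE:
  assumes "g \<in> Linf S" "AE x in lebesgue_on S. f x = g x" "S \<in> sets lebesgue" shows "f \<in> Linf S"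
proof -
  have m: "f \<in> borel_measurable (lebesgue_on S)" using assms measurable_on_cong_AE Linf_measurable by blast
  have "AE x in lebesgue_on S. norm (f x) \<le> norm_Linf S g"
    using assms(2) Linf_AE[OF assms(1)] by eventually_elim simp
  then show ?thesis using m unfolding Linf_iff by blast
qed

section \<open>Weak derivatives\<close>

lemma LINT_subset:
  fixes h :: "real^'n \<Rightarrow> real"
  assumes "T \<subseteq> S" "S \<in> sets lebesgue" "T \<in> sets lebesgue" "\<And>x. x \<in> S - T \<Longrightarrow> h x = 0"
  shows "(LINT x|lebesgue_on S. h x) = (LINT x|lebesgue_on T. h x)"
proof -
  have eq: "indicat_real S x *\<^sub>R h x = indicat_real T x *\<^sub>R h x" for x
    using assms(1) assms(4)[of x] by (auto simp: indicator_def)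
  show ?thesis
    unfolding LINT_on[OF assms(2)] LINT_on[OF assms(3)] set_lebesgue_integral_def by (simp only: eq)
qed

lemma LINT_test_fun_subset:
  assumes "open T" "T \<subseteq> S" "open S" "\<phi> \<in> test_fun T"
  shows "(LINT x|lebesgue_on S. h x * \<phi> x) = (LINT x|lebesgue_on T. h x * \<phi> x)"
    and "(LINT x|lebesgue_on S. h x * grad \<phi> x $ i) = (LINT x|lebesgue_on T. h x * grad \<phi> x $ i)"
    and "(LINT x|lebesgue_on S. b x \<bullet> grad \<phi> x) = (LINT x|lebesgue_on T. b x \<bullet> grad \<phi> x)"
    and "(LINT x|lebesgue_on S. u x * (b x \<bullet> grad \<phi> x + \<phi> x * d x))
       = (LINT x|lebesgue_on T. u x * (b x \<bullet> grad \<phi> x + \<phi> x * d x))"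
proof -
  obtain C where C: "C \<subseteq> T" "\<And>x. x \<notin> C \<Longrightarrow> \<phi> x = 0" "\<And>x. x \<notin> C \<Longrightarrow> grad \<phi> x = 0"
    using assms(4) by (rule test_funE) blast
  then have z: "\<phi> x = 0" "grad \<phi> x = 0" if "x \<in> S - T" for x using that by blast+
  have "S \<in> sets lebesgue" "T \<in> sets lebesgue" using assms open_sets_lebesgue by blast+
  note L = LINT_subset[OF assms(2) this]
  show "(LINT x|lebesgue_on S. h x * \<phi> x) = (LINT x|lebesgue_on T. h x * \<phi> x)"
    by (rule L) (simp add: z)
  show "(LINT x|lebesgue_on S. h x * grad \<phi> x $ i) = (LINT x|lebesgue_on T. h x * grad \<phi> x $ i)"
    by (rule L) (simp add: z)
  show "(LINT x|lebesgue_on S. b x \<bullet> grad \<phi> x) = (LINT x|lebesgue_on T. b x \<bullet> grad \<phi> x)"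
    by (rule L) (simp add: z)
  show "(LINT x|lebesgue_on S. u x * (b x \<bullet> grad \<phi> x + \<phi> x * d x))
       = (LINT x|lebesgue_on T. u x * (b x \<bullet> grad \<phi> x + \<phi> x * d x))"
    by (rule L) (simp add: z)
qed

lemma weak_div_subset:
  assumes "open T" "T \<subseteq> S" "open S" "weak_div S b d" shows "weak_div T b d"
  unfolding weak_div_def
proof
  fix \<phi> assume \<phi>: "\<phi> \<in> test_fun T"
  then have "\<phi> \<in> test_fun S" using test_fun_mono[OF assms(2)] by blast
  then show "(LINT x|lebesgue_on T. d x * \<phi> x) = - (LINT x|lebesgue_on T. b x \<bullet> grad \<phi> x)"
    using assms(4) by (simp add: weak_div_def LINT_test_fun_subset(1,3)[OF assms(1-3) \<phi>, symmetric])
qed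

lemma weak_partial_subset:
  assumes "open T" "T \<subseteq> S" "open S" "weak_partial S i g h" shows "weak_partial T i g h"
  unfolding weak_partial_def
proof
  fix \<phi> assume \<phi>: "\<phi> \<in> test_fun T"
  then have "\<phi> \<in> test_fun S" using test_fun_mono[OF assms(2)] by blast
  then show "(LINT x|lebesgue_on T. h x * \<phi> x) = - (LINT x|lebesgue_on T. g x * grad \<phi> x $ i)"
    using assms(4) by (simp add: weak_partial_def LINT_test_fun_subset(1,2)[OF assms(1-3) \<phi>, symmetric])
qed

lemma weak_unique_aux:
  assumes S: "open S" "bounded S" and d: "integrable (lebesgue_on S) d1" "integrable (lebesgue_on S) d2"
    and eq: "\<And>\<phi>. \<phi> \<in> test_fun S \<Longrightarrow> (LINT x|lebesgue_on S. d1 x * \<phi> x) = (LINT x|lebesgue_on S. d2 x * \<phi> x)"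
  shows "AE x in lebesgue_on S. d1 x = d2 x"
proof -
  have "AE x in lebesgue_on S. d1 x - d2 x = 0"
  proof (rule AE_zero_from_test_fun[OF S])
    fix \<phi> assume \<phi>: "\<phi> \<in> test_fun S"
    have Ss: "S \<in> sets lebesgue" using S open_sets_lebesgue by blast
    obtain B where B: "\<And>x. \<bar>\<phi> x\<bar> \<le> B" using \<phi> by (rule test_funE) blast
    have m: "\<phi> \<in> borel_measurable (lebesgue_on S)" using test_fun_Linf[OF Ss \<phi>] by (simp add: Linf_def)
    have int: "integrable (lebesgue_on S) (\<lambda>x. d x * \<phi> x)" if "integrable (lebesgue_on S) d" for d
    proof (rule Bochner_Integration.integrable_bound[of _ "\<lambda>x. B * d x"])
      have "\<bar>d x\<bar> * \<bar>\<phi> x\<bar> \<le> \<bar>d x\<bar> * \<bar>B\<bar>" for x by (intro mult_left_mono) (use B[of x] in auto)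
      then show "AE x in lebesgue_on S. norm (d x * \<phi> x) \<le> norm (B * d x)" by (simp add: abs_mult mult.commute)
    qed (use that m in auto)
    show "(LINT x|lebesgue_on S. (d1 x - d2 x) * \<phi> x) = 0"
      using int[OF d(1)] int[OF d(2)] eq[OF \<phi>] by (simp add: left_diff_distrib)
  qed (use d in auto)
  then show ?thesis by eventually_elim simp
qed

lemma weak_div_unique:
  assumes "open S" "bounded S" "d1 \<in> Linf S" "d2 \<in> Linf S" "weak_div S b d1" "weak_div S b d2"
  shows "AE x in lebesgue_on S. d1 x = d2 x"
  using assms by (intro weak_unique_aux) (auto simp: weak_div_def intro: Linf_integrable lmeasurable_open)

lemma wdiv_props:
  assumes "\<exists>d\<in>Linf S. weak_div S b d" shows "wdiv S b \<in> Linf S" "weak_div S b (wdiv S b)"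
  using someI_ex[of "\<lambda>d. d \<in> Linf S \<and> weak_div S b d"] assms unfolding wdiv_def by blast+

text \<open>\<open>weak_adv T\<close> refers to \<open>wdiv T b\<close>, which is chosen separately
  for each open set. Uniqueness of the weak divergence reconciles the choice on a subset with the
  one on the whole set.\<close>

lemma wdiv_subset:
  assumes S: "open S" "bounded S" and T: "open T" "T \<subseteq> S" and d: "\<exists>d\<in>Linf S. weak_div S b d"
  shows "wdiv T b \<in> Linf T" "weak_div T b (wdiv T b)"
    "AE x in lebesgue_on T. wdiv T b x = wdiv S b x" "\<exists>d\<in>Linf T. weak_div T b d"
proof -
  have 1: "wdiv S b \<in> Linf T" "weak_div T b (wdiv S b)"
    using wdiv_props[OF d] Linf_subset[OF _ T(2)] weak_div_subset[OF T S(1)] S T open_sets_lebesgue by blast+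
  then show ex: "\<exists>d\<in>Linf T. weak_div T b d" by blast
  show 2: "wdiv T b \<in> Linf T" "weak_div T b (wdiv T b)" using wdiv_props[OF ex] by auto
  show "AE x in lebesgue_on T. wdiv T b x = wdiv S b x"
    by (rule weak_div_unique[OF T(1) _ 2(1) 1(1) 2(2) 1(2)]) (use S T bounded_subset in blast)
qed

text \<open>Test the weak divergence of \<open>b\<close> with the product of \<open>p\<close> and
  the test function, and expand the gradient of the product.\<close>

lemma weak_adv_smooth:
  assumes S: "open S" "bounded S" and b: "b \<in> Linf S" and d: "\<exists>d\<in>Linf S. weak_div S b d"
    and p: "smooth p"
  shows "weak_adv S b p (\<lambda>x. b x \<bullet> grad p x)"
  unfolding weak_adv_def
proof
  fix \<phi> assume \<phi>: "\<phi> \<in> test_fun S"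
  have s: "smooth \<phi>" using \<phi> by (simp add: test_fun_def)
  have Ss: "S \<in> sets lebesgue" "S \<in> lmeasurable" using S open_sets_lebesgue lmeasurable_open by blast+
  note L = test_fun_Linf[OF Ss(1) \<phi>] test_fun_grad_Linf[OF Ss(1) \<phi>] wdiv_props(1)[OF d] b
    continuous_Linf[OF smooth_continuous[OF p] S(2) Ss(1)]
    continuous_Linf[OF smooth_grad_continuous[OF p] S(2) Ss(1)]
  have I: "integrable (lebesgue_on S) (\<lambda>x. wdiv S b x * (p x * \<phi> x))"
    "integrable (lebesgue_on S) (\<lambda>x. p x * (b x \<bullet> grad \<phi> x))"
    "integrable (lebesgue_on S) (\<lambda>x. \<phi> x * (b x \<bullet> grad p x))"
    by (intro Linf_integrable[OF _ Ss(2)] Linf_mult Linf_inner L)+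
  have "(LINT x|lebesgue_on S. wdiv S b x * (p x * \<phi> x))
      = - (LINT x|lebesgue_on S. b x \<bullet> grad (\<lambda>x. p x * \<phi> x) x)"
    using wdiv_props(2)[OF d] test_fun_mult[OF \<phi> p] by (simp add: weak_div_def)
  also have "(LINT x|lebesgue_on S. b x \<bullet> grad (\<lambda>x. p x * \<phi> x) x)
      = (LINT x|lebesgue_on S. p x * (b x \<bullet> grad \<phi> x)) + (LINT x|lebesgue_on S. \<phi> x * (b x \<bullet> grad p x))"
    using I by (simp add: grad_mult p s inner_add_right)
  finally have "(LINT x|lebesgue_on S. \<phi> x * (b x \<bullet> grad p x))
     = - ((LINT x|lebesgue_on S. p x * (b x \<bullet> grad \<phi> x)) + (LINT x|lebesgue_on S. wdiv S b x * (p x * \<phi> x)))"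
    by simp
  also have "\<dots> = - (LINT x|lebesgue_on S. p x * (b x \<bullet> grad \<phi> x) + wdiv S b x * (p x * \<phi> x))"
    using I by simp
  finally show "(LINT x|lebesgue_on S. b x \<bullet> grad p x * \<phi> x)
     = - (LINT x|lebesgue_on S. p x * (b x \<bullet> grad \<phi> x + \<phi> x * wdiv S b x))"
    by (simp add: algebra_simps)
qed

lemma weak_adv_unique:
  assumes "open S" "bounded S" "g1 \<in> L2 S" "g2 \<in> L2 S" "weak_adv S b u g1" "weak_adv S b u g2"
  shows "AE x in lebesgue_on S. g1 x = g2 x"
  using assms by (intro weak_unique_aux) (auto simp: weak_adv_def intro: L2_integrable lmeasurable_open)

lemma L2_subset:
  assumes "f \<in> L2 S" "T \<subseteq> S" "S \<in> sets lebesgue" "T \<in> sets lebesgue"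
  shows "f \<in> L2 T"
proof -
  have "set_integrable lebesgue T (\<lambda>x. (f x)\<^sup>2)"
    by (rule set_integrable_subset[of _ S]) (use assms in \<open>auto simp: L2_def integrable_on_iff\<close>)
  then have "integrable (lebesgue_on T) (\<lambda>x. (f x)\<^sup>2)"
    unfolding integrable_on_iff[OF assms(4)] .
  then show ?thesis
    using measurable_restrict_mono[OF L2_measurable[OF assms(1)] assms(2)] unfolding L2_def by blast
qed

lemma weak_adv_integrand:
  assumes "open S" "bounded S" "b \<in> Linf S" "d \<in> Linf S" "\<phi> \<in> test_fun S" "u \<in> L2 S"
  shows "integrable (lebesgue_on S) (\<lambda>x. u x * (b x \<bullet> grad \<phi> x + \<phi> x * d x))"
proof -
  have Ss: "S \<in> sets lebesgue" "S \<in> lmeasurable" using assms open_sets_lebesgue lmeasurable_open by blast+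
  show ?thesis
    by (intro L2_Linf_integrable Linf_add Linf_inner Linf_mult assms Ss
      test_fun_Linf[OF Ss(1) assms(5)] test_fun_grad_Linf[OF Ss(1) assms(5)])
qed

lemma weak_adv_cong:
  assumes S: "open S" "bounded S" and b: "b \<in> Linf S" and d: "\<exists>d\<in>Linf S. weak_div S b d"
    and u: "u1 \<in> L2 S" "u2 \<in> L2 S" "AE x in lebesgue_on S. u1 x = u2 x"
    and u1: "weak_adv S b u1 g"
  shows "weak_adv S b u2 g"
  unfolding weak_adv_def
proof
  fix \<phi> assume \<phi>: "\<phi> \<in> test_fun S"
  note I = weak_adv_integrand[OF S b wdiv_props(1)[OF d] \<phi>]
  have "(LINT x|lebesgue_on S. u1 x * (b x \<bullet> grad \<phi> x + \<phi> x * wdiv S b x))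
      = (LINT x|lebesgue_on S. u2 x * (b x \<bullet> grad \<phi> x + \<phi> x * wdiv S b x))"
    by (intro integral_cong_AE) (use I[OF u(1)] I[OF u(2)] u(3) in \<open>auto elim: eventually_mono\<close>)
  then show "(LINT x|lebesgue_on S. g x * \<phi> x)
      = - (LINT x|lebesgue_on S. u2 x * (b x \<bullet> grad \<phi> x + \<phi> x * wdiv S b x))"
    using u1 \<phi> by (simp add: weak_adv_def)
qed

lemma weak_adv_diff:
  assumes S: "open S" "bounded S" and b: "b \<in> Linf S" and d: "\<exists>d\<in>Linf S. weak_div S b d"
    and u: "u1 \<in> L2 S" "u2 \<in> L2 S" and g: "g1 \<in> L2 S" "g2 \<in> L2 S"
    and w: "weak_adv S b u1 g1" "weak_adv S b u2 g2"
  shows "weak_adv S b (\<lambda>x. u1 x - u2 x) (\<lambda>x. g1 x - g2 x)"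
  unfolding weak_adv_def
proof
  fix \<phi> assume \<phi>: "\<phi> \<in> test_fun S"
  note I = weak_adv_integrand[OF S b wdiv_props(1)[OF d] \<phi>]
  have Ss: "S \<in> sets lebesgue" "S \<in> lmeasurable" using S open_sets_lebesgue lmeasurable_open by blast+
  note G = L2_Linf_integrable[OF _ test_fun_Linf[OF Ss(1) \<phi>] Ss(2)]
  show "(LINT x|lebesgue_on S. (g1 x - g2 x) * \<phi> x)
      = - (LINT x|lebesgue_on S. (u1 x - u2 x) * (b x \<bullet> grad \<phi> x + \<phi> x * wdiv S b x))"
    unfolding left_diff_distrib
    using I[OF u(1)] I[OF u(2)] G[OF g(1)] G[OF g(2)] w \<phi> by (simp add: weak_adv_def)
qed

lemma weak_adv_subset:
  assumes S: "open S" "bounded S" and T: "open T" "T \<subseteq> S"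
    and b: "b \<in> Linf S" and d: "\<exists>d\<in>Linf S. weak_div S b d"
    and u: "u \<in> L2 S" and w: "weak_adv S b u g"
  shows "weak_adv T b u g"
  unfolding weak_adv_def
proof
  fix \<phi> assume \<phi>: "\<phi> \<in> test_fun T"
  have \<phi>': "\<phi> \<in> test_fun S" using \<phi> test_fun_mono[OF T(2)] by blast
  have sets: "S \<in> sets lebesgue" "T \<in> sets lebesgue" using S T open_sets_lebesgue by blast+
  have Tb: "bounded T" using S T bounded_subset by blast
  note D = wdiv_subset[OF S T d]
  note sub = Linf_subset[OF _ T(2) sets] L2_subset[OF u T(2) sets]
  note I1 = weak_adv_integrand[OF T(1) Tb sub(1)[OF b] D(1) \<phi> sub(2)]
  note I2 = weak_adv_integrand[OF T(1) Tb sub(1)[OF b] sub(1)[OF wdiv_props(1)[OF d]] \<phi> sub(2)]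
  have "(LINT x|lebesgue_on T. g x * \<phi> x) = (LINT x|lebesgue_on S. g x * \<phi> x)"
    using LINT_test_fun_subset[OF T S(1) \<phi>] by simp
  also have "\<dots> = - (LINT x|lebesgue_on S. u x * (b x \<bullet> grad \<phi> x + \<phi> x * wdiv S b x))"
    using w \<phi>' by (simp add: weak_adv_def)
  also have "\<dots> = - (LINT x|lebesgue_on T. u x * (b x \<bullet> grad \<phi> x + \<phi> x * wdiv S b x))"
    using LINT_test_fun_subset[OF T S(1) \<phi>] by simp
  also have "(LINT x|lebesgue_on T. u x * (b x \<bullet> grad \<phi> x + \<phi> x * wdiv S b x))
      = (LINT x|lebesgue_on T. u x * (b x \<bullet> grad \<phi> x + \<phi> x * wdiv T b x))"
    by (intro integral_cong_AE) (use I1 I2 D(3) in \<open>auto elim: eventually_mono\<close>)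
  finally show "(LINT x|lebesgue_on T. g x * \<phi> x)
      = - (LINT x|lebesgue_on T. u x * (b x \<bullet> grad \<phi> x + \<phi> x * wdiv T b x))" .
qed

text \<open>The bridge from chosen weak derivatives to formulas: restrict the weak identity to
  \<open>T\<close>, where \<open>u\<close> may be replaced by the smooth \<open>p\<close>, and
  compare with the classical derivative of \<open>p\<close> by uniqueness.\<close>

lemma weak_adv_eq_classical:
  assumes S: "open S" "bounded S" and T: "open T" "T \<subseteq> S"
    and b: "b \<in> Linf S" and d: "\<exists>d\<in>Linf S. weak_div S b d"
    and u: "u \<in> L2 S" and g: "g \<in> L2 S" and w: "weak_adv S b u g"
    and p: "smooth p" "AE x in lebesgue_on T. u x = p x"
  shows "AE x in lebesgue_on T. g x = b x \<bullet> grad p x"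
proof -
  have sets: "S \<in> sets lebesgue" "T \<in> sets lebesgue" using S T open_sets_lebesgue by blast+
  have Tb: "bounded T" using S T bounded_subset by blast
  have lm: "T \<in> lmeasurable" using T Tb lmeasurable_open by blast
  have bT: "b \<in> Linf T" using Linf_subset[OF b T(2) sets] .
  note dT = wdiv_subset(4)[OF S T d]
  have pL: "p \<in> Linf T" "grad p \<in> Linf T"
    using continuous_Linf[OF _ Tb sets(2)] p smooth_continuous smooth_grad_continuous by blast+
  have 1: "weak_adv T b u g" by (rule weak_adv_subset[OF S T b d u w])
  have 2: "weak_adv T b u (\<lambda>x. b x \<bullet> grad p x)"
    by (rule weak_adv_cong[OF T(1) Tb bT dT Linf_L2[OF pL(1) lm] L2_subset[OF u T(2) sets] _
          weak_adv_smooth[OF T(1) Tb bT dT p(1)]]) (use p(2) in \<open>auto elim: eventually_mono\<close>)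
  show ?thesis
    by (rule weak_adv_unique[OF T(1) Tb L2_subset[OF g T(2) sets] Linf_L2[OF Linf_inner[OF bT pL(2)] lm] 1 2])
qed

lemma weak_div_from_partials:
  assumes S: "open S" "bounded S" and b: "\<And>i. (\<lambda>x. b x $ i) \<in> Linf S"
    and h: "\<And>i. h i \<in> Linf S" "\<And>i. weak_partial S i (\<lambda>x. b x $ i) (h i)"
  shows "weak_div S b (\<lambda>x. \<Sum>i\<in>UNIV. h i x)"
  unfolding weak_div_def
proof
  fix \<phi> assume \<phi>: "\<phi> \<in> test_fun S"
  have Ss: "S \<in> sets lebesgue" "S \<in> lmeasurable" using S open_sets_lebesgue lmeasurable_open by blast+
  note L = test_fun_Linf[OF Ss(1) \<phi>] Linf_component[OF test_fun_grad_Linf[OF Ss(1) \<phi>]]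
  have "(LINT x|lebesgue_on S. (\<Sum>i\<in>UNIV. h i x) * \<phi> x) = (\<Sum>i\<in>UNIV. LINT x|lebesgue_on S. h i x * \<phi> x)"
    unfolding sum_distrib_right
    by (intro Bochner_Integration.integral_sum Linf_integrable[OF _ Ss(2)] Linf_mult h L)
  also have "\<dots> = (\<Sum>i\<in>UNIV. - (LINT x|lebesgue_on S. b x $ i * grad \<phi> x $ i))"
    using h(2) \<phi> by (simp add: weak_partial_def)
  also have "\<dots> = - (LINT x|lebesgue_on S. (\<Sum>i\<in>UNIV. b x $ i * grad \<phi> x $ i))"
    by (subst Bochner_Integration.integral_sum)
      (auto simp: sum_negf intro!: Linf_integrable[OF _ Ss(2)] Linf_mult b L)
  finally show "(LINT x|lebesgue_on S. (\<Sum>i\<in>UNIV. h i x) * \<phi> x) = - (LINT x|lebesgue_on S. b x \<bullet> grad \<phi> x)"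
    by (simp add: inner_vec_def)
qed

lemma wpartial_props:
  assumes "g \<in> W1inf S"
  shows "wpartial S i g \<in> Linf S" "weak_partial S i g (wpartial S i g)"
    "norm_Linf S (wpartial S i g) \<le> norm_W1inf S g" "norm_Linf S g \<le> norm_W1inf S g"
proof -
  have "\<exists>h. h \<in> Linf S \<and> weak_partial S i g h" using assms unfolding W1inf_def by blast
  from someI_ex[OF this] show "wpartial S i g \<in> Linf S" "weak_partial S i g (wpartial S i g)"
    unfolding wpartial_def by blast+
  have "norm_Linf S (wpartial S i g) \<le> (MAX i. norm_Linf S (wpartial S i g))"
    by (intro Max_ge) auto
  then show "norm_Linf S (wpartial S i g) \<le> norm_W1inf S g" "norm_Linf S g \<le> norm_W1inf S g"
    unfolding norm_W1inf_def by (auto simp: le_max_iff_disj)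
qed

text \<open>The divergence is an object on the whole domain, while the constants may depend only on
  elementwise W1inf norms. On \<open>T\<close> it coincides with the sum of the n weak partial
  derivatives, each bounded by \<open>M\<close>.\<close>

lemma wdiv_bound:
  fixes b :: "real^'n \<Rightarrow> real^'n" and M :: real
  assumes S: "open S" "bounded S" and T: "open T" "T \<subseteq> S" and d: "\<exists>d\<in>Linf S. weak_div S b d"
    and b: "\<And>i. (\<lambda>x. b x $ i) \<in> W1inf T" and M: "norm_W1inf_vec T b \<le> M"
  shows "AE x in lebesgue_on T. \<bar>wdiv S b x\<bar> \<le> CARD('n) * M"
proof -
  have Tb: "bounded T" using S T bounded_subset by blast
  let ?h = "\<lambda>i. wpartial T i (\<lambda>x. b x $ i)"
  have bL: "(\<lambda>x. b x $ i) \<in> Linf T" for i using b[of i] by (simp add: W1inf_def)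
  have w: "weak_div T b (\<lambda>x. \<Sum>i\<in>UNIV. ?h i x)"
    by (rule weak_div_from_partials[OF T(1) Tb bL]) (use wpartial_props[OF b] in auto)
  have hL: "(\<lambda>x. \<Sum>i\<in>UNIV. ?h i x) \<in> Linf T" by (intro Linf_sum wpartial_props b)
  note D = wdiv_subset[OF S T d]
  have 1: "AE x in lebesgue_on T. wdiv T b x = (\<Sum>i\<in>UNIV. ?h i x)"
    by (rule weak_div_unique[OF T(1) Tb D(1) hL D(2) w])
  have "norm_Linf T (?h i) \<le> M" for i
  proof -
    have "norm_W1inf T (\<lambda>x. b x $ i) \<le> norm_W1inf_vec T b" unfolding norm_W1inf_vec_def by (intro Max_ge) auto
    then show ?thesis using wpartial_props(3)[OF b, of i i] M by linarith
  qed
  then have "AE x in lebesgue_on T. \<bar>?h i x\<bar> \<le> M" for i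
    using Linf_AE[OF wpartial_props(1)[OF b, of i i]] by (auto elim!: eventually_mono intro: order_trans)
  then have "AE x in lebesgue_on T. \<forall>i\<in>UNIV. \<bar>?h i x\<bar> \<le> M"
    by (intro AE_finite_allI) auto
  with 1 D(3) show ?thesis
  proof eventually_elim
    case (elim x)
    have "\<bar>\<Sum>i\<in>UNIV. ?h i x\<bar> \<le> (\<Sum>i\<in>(UNIV::'n set). M)"
      using elim by (intro order_trans[OF sum_abs] sum_mono) auto
    then show ?case using elim by simp
  qed
qed

section \<open>Functions with bounded weak gradient on convex sets\<close>

lemma bump_translate: "bump (a + w) (b + w) N y = bump a b N (y - w)"
  by (simp add: bump_def algebra_simps)

text \<open>A point of the partly shifted box lies on the segment from a point of the first box to
  its translate by \<open>v\<close>; both endpoints are in \<open>S\<close>, and \<open>S\<close> is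
  convex.\<close>

lemma cbox_translate_subset:
  fixes a b v :: "real^'n"
  assumes "convex S" "cbox a b \<subseteq> S" "cbox (a + v) (b + v) \<subseteq> S" "0 \<le> s" "s \<le> 1"
  shows "cbox (a + s *\<^sub>R v) (b + s *\<^sub>R v) \<subseteq> S"
proof
  fix x assume x: "x \<in> cbox (a + s *\<^sub>R v) (b + s *\<^sub>R v)"
  let ?y = "x - s *\<^sub>R v"
  have "?y \<in> cbox a b" "?y + v \<in> cbox (a + v) (b + v)"
    using x by (auto simp: mem_box_cart algebra_simps)
  then have "(1 - s) *\<^sub>R ?y + s *\<^sub>R (?y + v) \<in> S"
    using assms by (intro convexD) auto
  moreover have "(1 - s) *\<^sub>R ?y + s *\<^sub>R (?y + v) = x" by (simp add: algebra_simps)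
  ultimately show "x \<in> S" by simp
qed

lemma measure_cbox_translate: "measure lebesgue (cbox (a + w) (b + w)) = measure lebesgue (cbox a b)"
  for a b w :: "real^'n"
  using measure_translation[of w "cbox a b"] cbox_translation[of w a b] by (simp add: add.commute)

text \<open>\<open>g\<close> has no classical derivative, so the translation is put on the smooth
  factor. Its difference quotients are bounded by \<open>B * norm v\<close>, which allows
  differentiation under the integral by dominated convergence.\<close>

lemma DERIV_LINT_translate:
  fixes v :: "real^'n"
  assumes S: "S \<in> lmeasurable" and g: "g \<in> Linf S" and \<psi>: "\<psi> \<in> test_fun UNIV"
  shows "((\<lambda>s. LINT y|lebesgue_on S. g y * \<psi> (y - s *\<^sub>R v)) has_real_derivative
          - (LINT y|lebesgue_on S. g y * (grad \<psi> (y - s *\<^sub>R v) \<bullet> v))) (at s)"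
proof -
  have Ss: "S \<in> sets lebesgue" using S by (simp add: fmeasurable_def)
  obtain B where sm: "smooth \<psi>" and B: "\<And>x. \<bar>\<psi> x\<bar> \<le> B" "\<And>x. norm (grad \<psi> x) \<le> B"
    using \<psi> by (rule test_funE) blast
  define q where "q y \<tau> = \<psi> (y - \<tau> *\<^sub>R v)" for y \<tau>
  have q: "(q y has_real_derivative - (grad \<psi> (y - \<tau> *\<^sub>R v) \<bullet> v)) (at \<tau>)" for y \<tau>
  proof -
    have "(\<psi> has_derivative (\<lambda>h. h \<bullet> grad \<psi> (y - \<tau> *\<^sub>R v))) (at (y - \<tau> *\<^sub>R v))"
      using smooth_gderiv[OF sm] by (simp add: gderiv_def)
    moreover have "((\<lambda>\<tau>. y - \<tau> *\<^sub>R v) has_derivative (\<lambda>h. - (h *\<^sub>R v))) (at \<tau>)"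
      by (auto intro!: derivative_eq_intros)
    ultimately have "((\<lambda>\<tau>. \<psi> (y - \<tau> *\<^sub>R v)) has_derivative (\<lambda>h. (- (h *\<^sub>R v)) \<bullet> grad \<psi> (y - \<tau> *\<^sub>R v))) (at \<tau>)"
      using has_derivative_compose by blast
    moreover have "(\<lambda>h. (- (h *\<^sub>R v)) \<bullet> grad \<psi> (y - \<tau> *\<^sub>R v)) = (*) (- (grad \<psi> (y - \<tau> *\<^sub>R v) \<bullet> v))"
      by (auto simp: inner_commute)
    ultimately show ?thesis unfolding q_def has_field_derivative_def by simp
  qed
  have qb: "\<bar>q y \<tau>1 - q y \<tau>2\<bar> \<le> B * norm v * \<bar>\<tau>1 - \<tau>2\<bar>" for y \<tau>1 \<tau>2
  proof -
    have "norm (q y \<tau>1 - q y \<tau>2) \<le> (B * norm v) * norm (\<tau>1 - \<tau>2)"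
    proof (rule field_differentiable_bound[of UNIV "q y" "\<lambda>\<tau>. - (grad \<psi> (y - \<tau> *\<^sub>R v) \<bullet> v)"])
      show "norm (- (grad \<psi> (y - z *\<^sub>R v) \<bullet> v)) \<le> B * norm v" for z
        using Cauchy_Schwarz_ineq2[of "grad \<psi> (y - z *\<^sub>R v)" v] mult_right_mono[OF B(2)[of "y - z *\<^sub>R v"], of "norm v"]
        by auto
    qed (use q in auto)
    then show ?thesis by simp
  qed
  have qL: "(\<lambda>y. q y \<tau>) \<in> Linf S" for \<tau>
    unfolding Linf_iff q_def
    using B Ss by (auto intro!: exI[of _ B] AE_I2 continuous_imp_measurable_on_sets_lebesgue smooth_continuous smooth_translate sm)
  have gL: "(\<lambda>y. grad \<psi> (y - \<tau> *\<^sub>R v) \<bullet> v) \<in> Linf S" for \<tau>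
  proof (rule Linf_inner[OF _ Linf_const])
    have "continuous_on S (\<lambda>y. grad \<psi> (y - \<tau> *\<^sub>R v))"
      using smooth_grad_continuous[OF smooth_translate[OF sm, of "\<tau> *\<^sub>R v"]] by (simp add: grad_translate[OF sm])
    then show "(\<lambda>y. grad \<psi> (y - \<tau> *\<^sub>R v)) \<in> Linf S" unfolding Linf_iff
      using B Ss by (auto intro!: exI[of _ B] AE_I2 continuous_imp_measurable_on_sets_lebesgue)
  qed
  have I: "integrable (lebesgue_on S) (\<lambda>y. g y * q y \<tau>)" for \<tau>
    by (intro Linf_integrable Linf_mult g qL S)
  have "((\<lambda>h. ((LINT y|lebesgue_on S. g y * q y (s + h)) - (LINT y|lebesgue_on S. g y * q y s)) / h)
     \<longlongrightarrow> (LINT y|lebesgue_on S. g y * - (grad \<psi> (y - s *\<^sub>R v) \<bullet> v))) (at 0)"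
    unfolding tendsto_at_iff_sequentially comp_def
  proof (intro allI impI)
    fix X :: "nat \<Rightarrow> real" assume X: "\<forall>i. X i \<in> UNIV - {0}" "X \<longlonglongrightarrow> 0"
    have eq: "((LINT y|lebesgue_on S. g y * q y (s + X n)) - (LINT y|lebesgue_on S. g y * q y s)) / X n
        = (LINT y|lebesgue_on S. g y * ((q y (s + X n) - q y s) / X n))" for n
      using I[of "s + X n"] I[of s] by (simp add: diff_divide_distrib right_diff_distrib)
    show "(\<lambda>n. ((LINT y|lebesgue_on S. g y * q y (s + X n)) - (LINT y|lebesgue_on S. g y * q y s)) / X n)
        \<longlonglongrightarrow> (LINT y|lebesgue_on S. g y * - (grad \<psi> (y - s *\<^sub>R v) \<bullet> v))"
      unfolding eq
    proof (rule integral_dominated_convergence[where w = "\<lambda>y. (B * norm v) * \<bar>g y\<bar>"])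
      show "(\<lambda>y. g y * - (grad \<psi> (y - s *\<^sub>R v) \<bullet> v)) \<in> borel_measurable (lebesgue_on S)"
        using Linf_measurable[OF g] Linf_measurable[OF gL[of s]] by auto
      show "(\<lambda>y. g y * ((q y (s + X n) - q y s) / X n)) \<in> borel_measurable (lebesgue_on S)" for n
        using Linf_measurable[OF g] Linf_measurable[OF qL] by auto
      show "integrable (lebesgue_on S) (\<lambda>y. (B * norm v) * \<bar>g y\<bar>)"
        using Linf_integrable[OF g S] by auto
      show "AE y in lebesgue_on S. (\<lambda>n. g y * ((q y (s + X n) - q y s) / X n)) \<longlonglongrightarrow> g y * - (grad \<psi> (y - s *\<^sub>R v) \<bullet> v)"
      proof (rule AE_I2, intro tendsto_mult tendsto_const)
        fix y
        have "((\<lambda>h. (q y (s + h) - q y s) / h) \<longlongrightarrow> - (grad \<psi> (y - s *\<^sub>R v) \<bullet> v)) (at 0)"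
          using q[of y s] by (simp add: DERIV_def)
        then show "(\<lambda>n. (q y (s + X n) - q y s) / X n) \<longlonglongrightarrow> - (grad \<psi> (y - s *\<^sub>R v) \<bullet> v)"
          using X unfolding tendsto_at_iff_sequentially comp_def by blast
      qed
      show "AE y in lebesgue_on S. norm (g y * ((q y (s + X n) - q y s) / X n)) \<le> B * norm v * \<bar>g y\<bar>" for n
      proof (rule AE_I2)
        fix y
        have "\<bar>q y (s + X n) - q y s\<bar> / \<bar>X n\<bar> \<le> B * norm v"
          using qb[of y "s + X n" s] X(1) by (simp add: divide_simps)
        then have "\<bar>g y\<bar> * (\<bar>q y (s + X n) - q y s\<bar> / \<bar>X n\<bar>) \<le> \<bar>g y\<bar> * (B * norm v)"
          by (intro mult_left_mono) auto
        then show "norm (g y * ((q y (s + X n) - q y s) / X n)) \<le> B * norm v * \<bar>g y\<bar>"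
          by (simp add: abs_mult mult.commute)
      qed
    qed
  qed
  then show ?thesis by (simp add: DERIV_def q_def)
qed

text \<open>A bump is moved from the first box to the second. The derivative along the path is the
  integral of \<open>g\<close> against the directional derivative of the moving bump, that is, of
  the weak partials against the bump itself, and is bounded by \<open>M\<close> times the box
  volume. Convexity keeps the moving bump a test function of \<open>S\<close>. The mean value
  theorem and the limit of sharp bumps finish.\<close>

lemma LINT_translate_bound:
  fixes v :: "real^'n"
  assumes S: "open S" "bounded S" "convex S" and g: "g \<in> Linf S"
    and h: "\<And>i. h i \<in> Linf S" "\<And>i. weak_partial S i g (h i)" "\<And>i. norm_Linf S (h i) \<le> M"
    and box: "cbox a b \<subseteq> S" "cbox (a + v) (b + v) \<subseteq> S"
  shows "\<bar>(LINT x|lebesgue_on (cbox (a + v) (b + v)). g x) - (LINT x|lebesgue_on (cbox a b). g x)\<bar>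
     \<le> (\<Sum>i\<in>UNIV. \<bar>v $ i\<bar>) * M * measure lebesgue (cbox a b)"
proof -
  have lm: "S \<in> lmeasurable" and Ss: "S \<in> sets lebesgue" using S lmeasurable_open open_sets_lebesgue by blast+
  define m where "m = measure lebesgue (cbox a b)"
  have M0: "0 \<le> M" using norm_Linf_nonneg h(3) order_trans by blast
  have step: "\<bar>(LINT y|lebesgue_on S. g y * bump (a + v) (b + v) N y) - (LINT y|lebesgue_on S. g y * bump a b N y)\<bar>
      \<le> (\<Sum>i\<in>UNIV. \<bar>v $ i\<bar>) * M * m" for N
  proof -
    let ?\<psi> = "bump a b N"
    define F where "F s = (LINT y|lebesgue_on S. g y * ?\<psi> (y - s *\<^sub>R v))" for s
    define F' where "F' s = - (LINT y|lebesgue_on S. g y * (grad ?\<psi> (y - s *\<^sub>R v) \<bullet> v))" for s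
    have D: "(F has_real_derivative F' s) (at s)" for s
      unfolding F_def F'_def by (intro DERIV_LINT_translate lm g bump_test_fun) auto
    have bnd: "\<bar>F' s\<bar> \<le> (\<Sum>i\<in>UNIV. \<bar>v $ i\<bar>) * M * m" if s: "s \<in> {0..1}" for s
    proof -
      let ?c = "\<lambda>y. bump (a + s *\<^sub>R v) (b + s *\<^sub>R v) N y"
      have sub: "cbox (a + s *\<^sub>R v) (b + s *\<^sub>R v) \<subseteq> S"
        by (rule cbox_translate_subset[OF S(3) box]) (use s in auto)
      have c: "?c \<in> test_fun S" by (rule bump_test_fun[OF sub])
      have ceq: "?c = (\<lambda>y. ?\<psi> (y - s *\<^sub>R v))" by (simp add: bump_translate)
      have gr: "grad ?c y = grad ?\<psi> (y - s *\<^sub>R v)" for y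
        unfolding ceq by (rule grad_translate[OF smooth_bump])
      note L = test_fun_Linf[OF Ss c] Linf_component[OF test_fun_grad_Linf[OF Ss c]]
      have "F' s = - (LINT y|lebesgue_on S. (\<Sum>i\<in>UNIV. v $ i * (g y * grad ?c y $ i)))"
        unfolding F'_def gr[symmetric] by (simp add: inner_vec_def sum_distrib_left mult_ac)
      also have "\<dots> = - (\<Sum>i\<in>UNIV. v $ i * (LINT y|lebesgue_on S. g y * grad ?c y $ i))"
        by (subst Bochner_Integration.integral_sum) (auto intro!: Linf_integrable[OF _ lm] Linf_mult g L Linf_const)
      also have "\<dots> = (\<Sum>i\<in>UNIV. v $ i * (LINT y|lebesgue_on S. h i y * ?c y))"
        using h(2) c by (simp add: weak_partial_def sum_negf)
      finally have F': "F' s = (\<Sum>i\<in>UNIV. v $ i * (LINT y|lebesgue_on S. h i y * ?c y))" .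
      have int: "\<bar>LINT y|lebesgue_on S. h i y * ?c y\<bar> \<le> M * m" for i
      proof -
        let ?Q = "cbox (a + s *\<^sub>R v) (b + s *\<^sub>R v)"
        have Q: "integrable (lebesgue_on S) (indicat_real ?Q)" "(LINT y|lebesgue_on S. indicat_real ?Q y) = m"
        proof -
          have eq: "indicat_real S y *\<^sub>R indicat_real ?Q y = indicat_real ?Q y" for y
            using sub by (auto simp: indicator_def)
          have "integrable lebesgue (indicat_real ?Q)"
            by (rule integrable_real_indicator) (auto simp: emeasure_lborel_cbox_eq)
          then show "integrable (lebesgue_on S) (indicat_real ?Q)"
            unfolding integrable_on_iff[OF Ss] set_integrable_def eq .
          show "(LINT y|lebesgue_on S. indicat_real ?Q y) = m"
            unfolding LINT_on[OF Ss] set_lebesgue_integral_def eq m_def measure_cbox_translate[symmetric, of a b "s *\<^sub>R v"]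
            by simp
        qed
        have "norm (LINT y|lebesgue_on S. h i y * ?c y) \<le> (LINT y|lebesgue_on S. norm (h i y * ?c y))"
          by (rule integral_norm_bound)
        also have "\<dots> \<le> (LINT y|lebesgue_on S. M * indicat_real ?Q y)"
        proof (rule integral_mono_AE)
          show "integrable (lebesgue_on S) (\<lambda>y. norm (h i y * ?c y))"
            by (intro integrable_norm Linf_integrable[OF _ lm] Linf_mult h L)
          show "integrable (lebesgue_on S) (\<lambda>y. M * indicat_real ?Q y)" using Q by auto
          have "AE y in lebesgue_on S. norm (h i y) \<le> norm_Linf S (h i)" by (rule Linf_AE[OF h(1)])
          then show "AE y in lebesgue_on S. norm (h i y * ?c y) \<le> M * indicat_real ?Q y"
          proof eventually_elim
            case (elim y)
            have "?c y \<le> indicat_real ?Q y"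
              using bump_outside[of y "a + s *\<^sub>R v" "b + s *\<^sub>R v" N] bump_bounds[of "a + s *\<^sub>R v" "b + s *\<^sub>R v" N y]
                box_subset_cbox[of "a + s *\<^sub>R v" "b + s *\<^sub>R v"] by (auto simp: indicator_def)
            moreover have "\<bar>h i y\<bar> \<le> M" using elim h(3)[of i] by simp
            ultimately have "\<bar>h i y\<bar> * ?c y \<le> M * indicat_real ?Q y"
              using bump_bounds[of "a + s *\<^sub>R v" "b + s *\<^sub>R v" N y] M0 by (intro mult_mono) auto
            then show ?case using bump_bounds[of "a + s *\<^sub>R v" "b + s *\<^sub>R v" N y] by (simp add: abs_mult)
          qed
        qed
        also have "\<dots> = M * m" using Q by simp
        finally show ?thesis by simp
      qed
      have "\<bar>F' s\<bar> \<le> (\<Sum>i\<in>UNIV. \<bar>v $ i\<bar> * (M * m))"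
        unfolding F' by (rule order_trans[OF sum_abs]) (auto simp: abs_mult intro!: sum_mono mult_left_mono int)
      then show ?thesis by (simp add: sum_distrib_right mult.assoc)
    qed
    have "norm (F 1 - F 0) \<le> ((\<Sum>i\<in>UNIV. \<bar>v $ i\<bar>) * M * m) * norm (1 - 0 :: real)"
      by (rule field_differentiable_bound[of "{0..1}" F F'])
        (use D bnd in \<open>auto intro: has_field_derivative_at_within\<close>)
    then show ?thesis by (simp add: F_def bump_translate)
  qed
  have gi: "integrable (lebesgue_on S) g" by (rule Linf_integrable[OF g lm])
  have lim: "(\<lambda>N. \<bar>(LINT y|lebesgue_on S. g y * bump (a + v) (b + v) N y) - (LINT y|lebesgue_on S. g y * bump a b N y)\<bar>)
    \<longlonglongrightarrow> \<bar>(LINT x|lebesgue_on (cbox (a + v) (b + v)). g x) - (LINT x|lebesgue_on (cbox a b). g x)\<bar>"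
    by (intro tendsto_rabs tendsto_diff LINT_bump_tendsto Ss gi box)
  show ?thesis unfolding m_def[symmetric]
    by (rule LIMSEQ_le_const2[OF lim]) (use step in auto)
qed

text \<open>Dyadic cubes of one level are translates of each other, so the means of \<open>g\<close>
  over any two of them inside \<open>S\<close> differ by at most the claimed bound. One mean per
  level is a candidate for the constant; since it depends on the level, a convergent subsequence
  supplies the final value.\<close>

proposition weak_gradient_bound_near_const:
  fixes S :: "(real^'n) set"
  assumes S: "open S" "bounded S" "convex S" and g: "g \<in> Linf S"
    and h: "\<And>i. h i \<in> Linf S" "\<And>i. weak_partial S i g (h i)" "\<And>i. norm_Linf S (h i) \<le> M"
  shows "\<exists>\<gamma>. AE x in lebesgue_on S. \<bar>g x - \<gamma>\<bar> \<le> CARD('n) * diameter S * M"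
proof -
  have lm: "S \<in> lmeasurable" and Ss: "S \<in> sets lebesgue" using S lmeasurable_open open_sets_lebesgue by blast+
  define L where "L = CARD('n) * diameter S * M"
  have M0: "0 \<le> M" using norm_Linf_nonneg h(3) order_trans by blast
  define m where "m k = measure lebesgue (dcube k (\<lambda>i. 0) :: (real^'n) set)" for k
  have cube_eq: "dcube k z = cbox ((\<chi> i. z' i / 2 ^ k) + (\<chi> i. (z i - z' i) / 2 ^ k)) ((\<chi> i. (real_of_int (z' i) + 1) / 2 ^ k) + (\<chi> i. (z i - z' i) / 2 ^ k))"
    for k and z z' :: "'n \<Rightarrow> int"
  proof -
    have "(\<chi> i. z i / 2 ^ k) = (\<chi> i. z' i / 2 ^ k) + (\<chi> i. (z i - z' i) / 2 ^ k)"
      "(\<chi> i. (real_of_int (z i) + 1) / 2 ^ k) = (\<chi> i. (real_of_int (z' i) + 1) / 2 ^ k) + (\<chi> i. (z i - z' i) / 2 ^ k)"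
      by (auto simp: vec_eq_iff add_divide_distrib diff_divide_distrib)
    then show ?thesis by (simp add: dcube_def)
  qed
  have mz: "measure lebesgue (dcube k z) = m k" for k and z :: "'n \<Rightarrow> int"
    unfolding m_def cube_eq[of k z "\<lambda>i. 0"] measure_cbox_translate by (simp add: dcube_def)
  have mpos: "0 < m k" for k
  proof -
    have "0 < measure lborel (cbox (\<chi> i. 0 / 2 ^ k) (\<chi> i. 1 / 2 ^ k) :: (real^'n) set)"
      by (rule content_pos_lt) (auto simp: Basis_vec_def inner_axis)
    then show ?thesis by (simp add: m_def dcube_def)
  qed
  have cmp: "\<bar>(LINT x|lebesgue_on (dcube k z). g x) - (LINT x|lebesgue_on (dcube k z'). g x)\<bar> \<le> L * m k"
    if "dcube k z \<subseteq> S" "dcube k z' \<subseteq> S" for k z z'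
  proof -
    let ?v = "(\<chi> i. (z i - z' i) / 2 ^ k) :: real^'n"
    let ?a = "(\<chi> i. z' i / 2 ^ k) :: real^'n"
    have "?a \<in> dcube k z'" by (auto simp: dcube_def mem_box_cart field_simps)
    then have "?a \<in> S" using that by blast
    moreover have "?a + ?v \<in> dcube k z"
      by (auto simp: dcube_def mem_box_cart field_simps)
    then have "?a + ?v \<in> S" using that by blast
    ultimately have "dist (?a + ?v) ?a \<le> diameter S" by (intro diameter_bounded_bound S)
    then have "\<bar>?v $ i\<bar> \<le> diameter S" for i
      using component_le_norm_cart[of ?v i] by (simp add: dist_norm)
    then have sv: "(\<Sum>i\<in>UNIV. \<bar>?v $ i\<bar>) \<le> CARD('n) * diameter S"
      using sum_bounded_above[of UNIV "\<lambda>i. \<bar>?v $ i\<bar>" "diameter S"] by simp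
    have "\<bar>(LINT x|lebesgue_on (dcube k z). g x) - (LINT x|lebesgue_on (dcube k z'). g x)\<bar>
        \<le> (\<Sum>i\<in>UNIV. \<bar>?v $ i\<bar>) * M * measure lebesgue (dcube k z')"
      unfolding cube_eq[of k z z'] unfolding dcube_def[of k z']
      by (rule LINT_translate_bound[OF S g h]) (use that cube_eq[of k z z'] in \<open>auto simp: dcube_def\<close>)
    also have "\<dots> \<le> L * m k" unfolding mz L_def
      using sv M0 mpos[of k] by (intro mult_right_mono) auto
    finally show ?thesis .
  qed
  define G where "G = norm_Linf S g"
  have gdc: "integrable (lebesgue_on (dcube k z)) g" "\<bar>LINT x|lebesgue_on (dcube k z). g x\<bar> \<le> G * m k" if "dcube k z \<subseteq> S" for k z
  proof -
    have cl: "dcube k z \<in> lmeasurable" by (simp add: dcube_def)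
    have gl: "g \<in> Linf (dcube k z)" using Linf_subset[OF g that Ss] by simp
    show i: "integrable (lebesgue_on (dcube k z)) g" by (rule Linf_integrable[OF gl cl])
    have ci: "integrable (lebesgue_on (dcube k z)) (\<lambda>x. G)" by (rule Linf_integrable[OF Linf_const cl])
    have "\<bar>LINT x|lebesgue_on (dcube k z). g x\<bar> \<le> (LINT x|lebesgue_on (dcube k z). \<bar>g x\<bar>)"
      using integral_norm_bound[of "lebesgue_on (dcube k z)" g] by simp
    also have "\<dots> \<le> (LINT x|lebesgue_on (dcube k z). G)"
      by (rule integral_mono_AE[OF _ ci])
        (use i AE_on_subset[OF Linf_AE[OF g] that Ss dcube_sets] in \<open>auto simp: G_def\<close>)
    also have "\<dots> = G * m k" using mz[of k z] by (simp add: measure_restrict_space)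
    finally show "\<bar>LINT x|lebesgue_on (dcube k z). g x\<bar> \<le> G * m k" .
  qed
  \<comment> \<open>Every mean lies between -G and G, which provides the compactness used below. If
    no cube of level \<open>k\<close> fits into \<open>S\<close>, the claim is vacuous and 0
    serves.\<close>
  have "\<exists>\<gamma>\<in>{-G..G}. \<forall>z. dcube k z \<subseteq> S \<longrightarrow> \<bar>(LINT x|lebesgue_on (dcube k z). g x) - \<gamma> * m k\<bar> \<le> L * m k" for k
  proof (cases "\<exists>z. dcube k z \<subseteq> S")
    case True
    then obtain z0 where z0: "dcube k z0 \<subseteq> S" by blast
    let ?c = "(LINT x|lebesgue_on (dcube k z0). g x) / m k"
    have "?c \<in> {-G..G}" using gdc(2)[OF z0] mpos[of k] by (auto simp: field_simps abs_le_iff)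
    moreover have "?c * m k = (LINT x|lebesgue_on (dcube k z0). g x)" using mpos[of k] by simp
    ultimately show ?thesis using cmp[OF _ z0] by metis
  next
    case False then show ?thesis using norm_Linf_nonneg[of S g] by (intro bexI[of _ 0]) (auto simp: G_def)
  qed
  then obtain \<gamma> where \<gamma>: "\<And>k. \<gamma> k \<in> {-G..G}"
    "\<And>k z. dcube k z \<subseteq> S \<Longrightarrow> \<bar>(LINT x|lebesgue_on (dcube k z). g x) - \<gamma> k * m k\<bar> \<le> L * m k" by metis
  obtain c r where r: "strict_mono (r::nat \<Rightarrow> nat)" "(\<gamma> \<circ> r) \<longlonglongrightarrow> c"
    using compact_imp_seq_compact[OF compact_Icc[of "-G" G]] \<gamma>(1) unfolding seq_compact_def by metis
  have gi: "integrable (lebesgue_on S) g" by (rule Linf_integrable[OF g lm])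
  \<comment> \<open>Only the levels of the subsequence with candidate closer than \<open>e\<close>
    to the limit are used; there are infinitely many of them, as the sign criterion requires. The
    slack \<open>e\<close> disappears at the end by a countable intersection.\<close>
  have bnd: "AE x in lebesgue_on S. \<bar>g x - c\<bar> \<le> L + e" if e: "0 < e" for e
  proof -
    define I where "I = r ` {n. \<bar>\<gamma> (r n) - c\<bar> < e}"
    have "eventually (\<lambda>n. \<bar>\<gamma> (r n) - c\<bar> < e) sequentially"
      using tendstoD[OF r(2) e] by (simp add: dist_real_def)
    then obtain n0 where "\<And>n. n \<ge> n0 \<Longrightarrow> \<bar>\<gamma> (r n) - c\<bar> < e" by (auto simp: eventually_sequentially)
    then have "r ` {n0..} \<subseteq> I" by (auto simp: I_def)
    moreover have "infinite (r ` {n0..})"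
      using finite_imageD[OF _ strict_mono_imp_inj_on[OF r(1), of "{n0..}"]] infinite_Ici[of n0] by blast
    ultimately have I: "infinite I" using finite_subset by blast
    have est: "\<bar>(LINT x|lebesgue_on (dcube k z). g x) - c * m k\<bar> \<le> (L + e) * m k" if k: "k \<in> I" and z: "dcube k z \<subseteq> S" for k and z :: "'n \<Rightarrow> int"
    proof -
      have "\<bar>\<gamma> k - c\<bar> \<le> e" using k by (auto simp: I_def)
      then have "\<bar>\<gamma> k * m k - c * m k\<bar> \<le> e * m k"
        using mpos[of k] by (simp add: left_diff_distrib[symmetric] abs_mult)
      then show ?thesis using \<gamma>(2)[OF z] by (simp add: algebra_simps)
    qed
    have cst: "integrable (lebesgue_on (dcube k z)) (\<lambda>x. t)" "(LINT x|lebesgue_on (dcube k z). t) = t * m k" for k and z :: "'n \<Rightarrow> int" and t :: real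
    proof -
      show "integrable (lebesgue_on (dcube k z)) (\<lambda>x. t)" by (rule Linf_integrable[OF Linf_const]) (simp add: dcube_def)
      show "(LINT x|lebesgue_on (dcube k z). t) = t * m k" using mz[of k z] by (simp add: measure_restrict_space)
    qed
    have ci: "integrable (lebesgue_on S) (\<lambda>x. t)" for t :: real by (rule Linf_integrable[OF Linf_const lm])
    have "AE x in lebesgue_on S. 0 \<le> (c + (L + e)) - g x"
    proof (rule AE_nonneg_from_dcubes[OF S(1,2) _ I])
      fix k and z :: "'n \<Rightarrow> int" assume k: "k \<in> I" "dcube k z \<subseteq> S"
      have "(LINT x|lebesgue_on (dcube k z). (c + (L + e)) - g x) = (c + (L + e)) * m k - (LINT x|lebesgue_on (dcube k z). g x)"
        unfolding Bochner_Integration.integral_diff[OF cst(1) gdc(1)[OF k(2)]] cst(2) ..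
      then show "0 \<le> (LINT x|lebesgue_on (dcube k z). (c + (L + e)) - g x)"
        using est[OF k] by (simp add: distrib_right abs_le_iff)
    qed (use gi ci in auto)
    moreover have "AE x in lebesgue_on S. 0 \<le> g x - (c - (L + e))"
    proof (rule AE_nonneg_from_dcubes[OF S(1,2) _ I])
      fix k and z :: "'n \<Rightarrow> int" assume k: "k \<in> I" "dcube k z \<subseteq> S"
      have "(LINT x|lebesgue_on (dcube k z). g x - (c - (L + e))) = (LINT x|lebesgue_on (dcube k z). g x) - (c - (L + e)) * m k"
        unfolding Bochner_Integration.integral_diff[OF gdc(1)[OF k(2)] cst(1)] cst(2) ..
      then show "0 \<le> (LINT x|lebesgue_on (dcube k z). g x - (c - (L + e)))"
        using est[OF k] by (simp add: left_diff_distrib distrib_right abs_le_iff)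
    qed (use gi ci in auto)
    ultimately show ?thesis by eventually_elim (simp add: abs_le_iff)
  qed
  have "AE x in lebesgue_on S. \<forall>j. \<bar>g x - c\<bar> \<le> L + 1 / Suc j"
    unfolding AE_all_countable using bnd by simp
  then have "AE x in lebesgue_on S. \<bar>g x - c\<bar> \<le> L"
  proof eventually_elim
    case (elim x)
    have "(\<lambda>j. L + 1 / Suc j) \<longlonglongrightarrow> L + 0" by (intro tendsto_add tendsto_const LIMSEQ_Suc[OF lim_1_over_n])
    then show ?case using elim by (intro LIMSEQ_le_const[of "\<lambda>j. L + 1 / Suc j" L]) auto
  qed
  then show ?thesis unfolding L_def by blast
qed

section \<open>Polynomials in several variables\<close>

lemma finite_multi_index: "finite {\<alpha> :: 'n::finite \<Rightarrow> nat. (\<Sum>i\<in>UNIV. \<alpha> i) \<le> m}"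
proof (rule finite_subset)
  show "{\<alpha> :: 'n \<Rightarrow> nat. (\<Sum>i\<in>UNIV. \<alpha> i) \<le> m} \<subseteq> UNIV \<rightarrow>\<^sub>E {..m}"
  proof
    fix \<alpha> :: "'n \<Rightarrow> nat" assume "\<alpha> \<in> {\<alpha>. (\<Sum>i\<in>UNIV. \<alpha> i) \<le> m}"
    moreover have "\<alpha> i \<le> (\<Sum>i\<in>UNIV. \<alpha> i)" for i by (rule member_le_sum) auto
    ultimately have "\<alpha> i \<le> m" for i by (metis (mono_tags) mem_Collect_eq order_trans)
    then show "\<alpha> \<in> UNIV \<rightarrow>\<^sub>E {..m}" by auto
  qed
  show "finite ((UNIV :: 'n set) \<rightarrow>\<^sub>E {..m})" by (intro finite_PiE) auto
qed

lemma Poly_zero: "(\<lambda>x. 0) \<in> Poly m"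
  unfolding Poly_def by (auto intro!: exI[of _ "\<lambda>\<alpha>. 0"])

lemma Poly_add: "p \<in> Poly m \<Longrightarrow> q \<in> Poly m \<Longrightarrow> (\<lambda>x. p x + q x) \<in> Poly m"
proof -
  assume "p \<in> Poly m" "q \<in> Poly m"
  then obtain a b where
    "p = (\<lambda>x. \<Sum>\<alpha> | (\<Sum>i\<in>UNIV. \<alpha> i) \<le> m. a \<alpha> * (\<Prod>i\<in>UNIV. (x $ i) ^ (\<alpha> i :: nat)))"
    "q = (\<lambda>x. \<Sum>\<alpha> | (\<Sum>i\<in>UNIV. \<alpha> i) \<le> m. b \<alpha> * (\<Prod>i\<in>UNIV. (x $ i) ^ (\<alpha> i :: nat)))"
    unfolding Poly_def by blast
  then have "(\<lambda>x. p x + q x) = (\<lambda>x. \<Sum>\<alpha> | (\<Sum>i\<in>UNIV. \<alpha> i) \<le> m. (a \<alpha> + b \<alpha>) * (\<Prod>i\<in>UNIV. (x $ i) ^ (\<alpha> i :: nat)))"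
    by (simp add: distrib_right sum.distrib)
  then show ?thesis unfolding Poly_def by (intro CollectI exI[of _ "\<lambda>\<alpha>. a \<alpha> + b \<alpha>"])
qed

lemma Poly_cmult: "p \<in> Poly m \<Longrightarrow> (\<lambda>x. c * p x) \<in> Poly m"
proof -
  assume "p \<in> Poly m"
  then obtain a where
    "p = (\<lambda>x. \<Sum>\<alpha> | (\<Sum>i\<in>UNIV. \<alpha> i) \<le> m. a \<alpha> * (\<Prod>i\<in>UNIV. (x $ i) ^ (\<alpha> i :: nat)))"
    unfolding Poly_def by blast
  then have "(\<lambda>x. c * p x) = (\<lambda>x. \<Sum>\<alpha> | (\<Sum>i\<in>UNIV. \<alpha> i) \<le> m. (c * a \<alpha>) * (\<Prod>i\<in>UNIV. (x $ i) ^ (\<alpha> i :: nat)))"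
    by (simp add: sum_distrib_left mult.assoc)
  then show ?thesis unfolding Poly_def by (intro CollectI exI[of _ "\<lambda>\<alpha>. c * a \<alpha>"])
qed

lemma Poly_sum: "(\<And>i. i \<in> I \<Longrightarrow> p i \<in> Poly m) \<Longrightarrow> (\<lambda>x. \<Sum>i\<in>I. p i x) \<in> Poly m"
  by (induction I rule: infinite_finite_induct) (auto intro: Poly_zero Poly_add)

lemma Poly_monomial:
  fixes \<alpha> :: "'n::finite \<Rightarrow> nat"
  assumes "(\<Sum>i\<in>UNIV. \<alpha> i) \<le> m" shows "(\<lambda>x. \<Prod>i\<in>UNIV. (x $ i) ^ \<alpha> i) \<in> Poly m"
proof -
  have "(\<lambda>x::real^'n. \<Prod>i\<in>UNIV. (x $ i) ^ \<alpha> i)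
     = (\<lambda>x. \<Sum>\<beta> | (\<Sum>i\<in>UNIV. \<beta> i) \<le> m. (if \<beta> = \<alpha> then 1 else 0) * (\<Prod>i\<in>UNIV. (x $ i) ^ (\<beta> i :: nat)))"
  proof
    fix x :: "real^'n"
    have "(\<Sum>\<beta> | (\<Sum>i\<in>UNIV. \<beta> i) \<le> m. (if \<beta> = \<alpha> then 1 else 0) * (\<Prod>i\<in>UNIV. (x $ i) ^ (\<beta> i :: nat)))
      = (\<Sum>\<beta> | (\<Sum>i\<in>UNIV. \<beta> i) \<le> m. if \<beta> = \<alpha> then \<Prod>i\<in>UNIV. (x $ i) ^ \<alpha> i else 0)"
      by (rule sum.cong) auto
    then show "(\<Prod>i\<in>UNIV. (x $ i) ^ \<alpha> i)
      = (\<Sum>\<beta> | (\<Sum>i\<in>UNIV. \<beta> i) \<le> m. (if \<beta> = \<alpha> then 1 else 0) * (\<Prod>i\<in>UNIV. (x $ i) ^ (\<beta> i :: nat)))"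
      using assms finite_multi_index[of m, where 'n='n] by simp
  qed
  then show ?thesis unfolding Poly_def by (intro CollectI exI[of _ "\<lambda>\<beta>. if \<beta> = \<alpha> then 1 else 0"])
qed

lemma Poly_induct [consumes 1, case_names monomial zero add cmult]:
  assumes "p \<in> Poly m"
    and "\<And>\<alpha>. (\<Sum>i\<in>UNIV. \<alpha> i) \<le> m \<Longrightarrow> Q (\<lambda>x::real^'n. \<Prod>i\<in>UNIV. (x $ i) ^ \<alpha> i)"
    and "Q (\<lambda>x. 0)" and "\<And>p q. Q p \<Longrightarrow> Q q \<Longrightarrow> Q (\<lambda>x. p x + q x)" and "\<And>c p. Q p \<Longrightarrow> Q (\<lambda>x. c * p x)"
  shows "Q p"
proof -
  obtain a where p: "p = (\<lambda>x. \<Sum>\<alpha> | (\<Sum>i\<in>UNIV. \<alpha> i) \<le> m. a \<alpha> * (\<Prod>i\<in>UNIV. (x $ i) ^ (\<alpha> i :: nat)))"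
    using assms(1) unfolding Poly_def by blast
  have "Q (\<lambda>x. \<Sum>\<alpha>\<in>A. a \<alpha> * (\<Prod>i\<in>UNIV. (x $ i) ^ (\<alpha> i :: nat)))" if "A \<subseteq> {\<alpha>. (\<Sum>i\<in>UNIV. \<alpha> i) \<le> m}" for A
    using that
  proof (induction A rule: infinite_finite_induct)
    case (insert \<alpha> A)
    have "Q (\<lambda>x. a \<alpha> * (\<Prod>i\<in>UNIV. (x $ i) ^ \<alpha> i) + (\<Sum>\<alpha>\<in>A. a \<alpha> * (\<Prod>i\<in>UNIV. (x $ i) ^ (\<alpha> i :: nat))))"
      by (rule assms(4)[OF assms(5)[OF assms(2)]]) (use insert in auto)
    then show ?case using insert by simp
  qed (use assms(3) in auto)
  then show ?thesis unfolding p by blast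
qed

lemma Poly_mono: "p \<in> Poly m \<Longrightarrow> m \<le> m' \<Longrightarrow> p \<in> Poly m'"
  by (induction p rule: Poly_induct) (auto intro: Poly_monomial Poly_zero Poly_add Poly_cmult)

lemma Poly_mult: "p \<in> Poly m \<Longrightarrow> q \<in> Poly m' \<Longrightarrow> (\<lambda>x. p x * q x) \<in> Poly (m + m')"
proof (induction p rule: Poly_induct)
  case (monomial \<alpha>)
  show ?case using monomial(2)
  proof (induction q rule: Poly_induct)
    case (monomial \<beta>)
    have "(\<lambda>x. \<Prod>i\<in>UNIV. (x $ i) ^ (\<alpha> i + \<beta> i)) \<in> Poly (m + m')"
      using \<open>sum \<alpha> UNIV \<le> m\<close> monomial by (intro Poly_monomial) (simp add: sum.distrib)
    then show ?case by (simp add: power_add prod.distrib)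
  next
    case (add p q) then show ?case using Poly_add by (fastforce simp: distrib_left)
  next
    case (cmult c p) then show ?case using Poly_cmult[OF cmult] by (simp add: mult.left_commute)
  qed (auto intro: Poly_zero)
next
  case (add p q') then show ?case using Poly_add[OF add(1)[OF add(3)] add(2)[OF add(3)]] by (simp add: distrib_right)
next
  case (cmult c p) then show ?case using Poly_cmult[OF cmult(1)[OF cmult(2)]] by (simp add: mult.assoc)
qed (auto intro: Poly_zero)

lemma Poly_const: "(\<lambda>x. c) \<in> Poly m"
  using Poly_cmult[OF Poly_monomial[of "\<lambda>i. 0" m], of c] by simp

lemma Poly_diff: "p \<in> Poly m \<Longrightarrow> q \<in> Poly m \<Longrightarrow> (\<lambda>x. p x - q x) \<in> Poly m"
  using Poly_add[of p m "\<lambda>x. -1 * q x"] Poly_cmult[of q m "-1"] by simp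

lemma Poly_coord: "(\<lambda>x. x $ i) \<in> Poly 1"
proof -
  have "(\<Prod>j\<in>UNIV. (x $ j) ^ (if j = i then 1 else 0)) = x $ i" for x :: "real^'a"
    by (simp add: if_distrib[of "\<lambda>k. _ ^ k"] cong: if_cong)
  then show ?thesis using Poly_monomial[of "\<lambda>j. if j = i then 1 else 0" 1] by simp
qed

lemma Poly_power: "p \<in> Poly m \<Longrightarrow> (\<lambda>x. p x ^ k) \<in> Poly (m * k)"
  by (induction k) (auto intro: Poly_const dest: Poly_mult)

lemma Poly_prod: "finite I \<Longrightarrow> (\<And>i. i \<in> I \<Longrightarrow> p i \<in> Poly (m i)) \<Longrightarrow> (\<lambda>x. \<Prod>i\<in>I. p i x) \<in> Poly (\<Sum>i\<in>I. m i)"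
  by (induction I rule: finite_induct) (auto intro: Poly_const Poly_mult)

lemma Poly_affine: "p \<in> Poly m \<Longrightarrow> (\<lambda>y. p (t + c *\<^sub>R y)) \<in> Poly m"
proof (induction p rule: Poly_induct)
  case (monomial \<alpha>)
  have "(\<lambda>y. t $ i + c * y $ i) \<in> Poly 1" for i
    by (intro Poly_add Poly_cmult Poly_coord Poly_const)
  then have "(\<lambda>y. \<Prod>i\<in>UNIV. (t $ i + c * y $ i) ^ \<alpha> i) \<in> Poly (\<Sum>i\<in>UNIV. 1 * \<alpha> i)"
    by (intro Poly_prod Poly_power) auto
  then show ?case using monomial Poly_mono by auto
qed (auto intro: Poly_zero Poly_add Poly_cmult)

lemma Poly_inner: "(\<lambda>x. (x - x0) \<bullet> \<beta>) \<in> Poly 1"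
  unfolding inner_vec_def
proof (rule Poly_sum)
  fix i have "(\<lambda>x. \<beta> $ i * (x $ i - x0 $ i)) \<in> Poly 1"
    by (intro Poly_cmult Poly_diff Poly_coord Poly_const)
  then show "(\<lambda>x. (x - x0) $ i \<bullet> \<beta> $ i) \<in> Poly 1" by (simp add: mult.commute)
qed

lemma Poly_smooth: "p \<in> Poly m \<Longrightarrow> smooth p"
  by (induction p rule: Poly_induct)
    (auto intro!: smooth_prod smooth_power smooth_coord smooth_const smooth_add smooth_mult)

lemma Poly_continuous: "p \<in> Poly m \<Longrightarrow> continuous_on S p"
  using Poly_smooth smooth_continuous by blast

text \<open>Induction on the degree, splitting off one coordinate. The separate clause for degree 0
  compensates for the truncated subtraction: without it, multiplying the gradient of a constant by a
  coordinate would count as degree 1.\<close>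

lemma monomial_grad:
  fixes \<alpha> :: "'n::finite \<Rightarrow> nat"
  assumes "(\<Sum>i\<in>UNIV. \<alpha> i) = k"
  shows "(\<forall>j. (\<lambda>x. grad (\<lambda>x. \<Prod>i\<in>UNIV. (x $ i) ^ \<alpha> i) x $ j) \<in> Poly (k - 1))
    \<and> (k = 0 \<longrightarrow> (\<forall>x. grad (\<lambda>x. \<Prod>i\<in>UNIV. (x $ i) ^ \<alpha> i) x = 0))"
  using assms
proof (induction k arbitrary: \<alpha>)
  case 0
  then have "\<alpha> = (\<lambda>i. 0)" by (auto simp: fun_eq_iff)
  then show ?case by (simp add: grad_eq[OF GDERIV_const] Poly_zero)
next
  case (Suc k)
  then obtain i where i: "\<alpha> i \<noteq> 0" by (metis nat.distinct(1) sum.neutral)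
  define \<beta> where "\<beta> = \<alpha>(i := \<alpha> i - 1)"
  define q where "q = (\<lambda>x::real^'n. \<Prod>i\<in>UNIV. (x $ i) ^ \<beta> i)"
  have "(\<Sum>i\<in>UNIV. \<alpha> i) = \<alpha> i + (\<Sum>j\<in>UNIV - {i}. \<alpha> j)" "(\<Sum>i\<in>UNIV. \<beta> i) = \<beta> i + (\<Sum>j\<in>UNIV - {i}. \<beta> j)"
    by (rule sum.remove; simp)+
  moreover have "(\<Sum>j\<in>UNIV - {i}. \<beta> j) = (\<Sum>j\<in>UNIV - {i}. \<alpha> j)" by (rule sum.cong) (auto simp: \<beta>_def)
  ultimately have sb: "(\<Sum>i\<in>UNIV. \<beta> i) = k" using Suc.prems i by (simp add: \<beta>_def)
  have eq: "(\<Prod>i\<in>UNIV. (x $ i) ^ \<alpha> i) = x $ i * q x" for x :: "real^'n"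
  proof -
    have "(\<Prod>j\<in>UNIV. (x $ j) ^ \<alpha> j) = (x $ i) ^ \<alpha> i * (\<Prod>j\<in>UNIV - {i}. (x $ j) ^ \<alpha> j)"
      "q x = (x $ i) ^ \<beta> i * (\<Prod>j\<in>UNIV - {i}. (x $ j) ^ \<beta> j)"
      unfolding q_def by (rule prod.remove; simp)+
    moreover have "(\<Prod>j\<in>UNIV - {i}. (x $ j) ^ \<beta> j) = (\<Prod>j\<in>UNIV - {i}. (x $ j) ^ \<alpha> j)"
      by (rule prod.cong) (auto simp: \<beta>_def)
    moreover have "(x $ i) ^ \<alpha> i = x $ i * (x $ i) ^ \<beta> i" using i by (simp add: \<beta>_def flip: power_Suc)
    ultimately show ?thesis by simp
  qed
  have qP: "q \<in> Poly k" unfolding q_def by (rule Poly_monomial) (simp add: sb)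
  have g: "grad (\<lambda>x. x $ i * q x) x = x $ i *\<^sub>R grad q x + q x *\<^sub>R axis i 1" for x :: "real^'n"
    by (intro grad_eq GDERIV_mult gderiv_coord smooth_gderiv Poly_smooth[OF qP])
  note IH = Suc.IH[OF sb, folded q_def]
  have "(\<lambda>x. x $ i * grad q x $ j) \<in> Poly k" for j
  proof (cases k)
    case 0 then show ?thesis using IH by (simp add: Poly_zero)
  next
    case (Suc k') then show ?thesis using Poly_mult[OF Poly_coord[of i] conjunct1[OF IH, rule_format, of j]] by simp
  qed
  moreover have "(\<lambda>x. axis i 1 $ j * q x) \<in> Poly k" for j by (rule Poly_cmult[OF qP])
  ultimately have "(\<lambda>x. x $ i * grad q x $ j + axis i 1 $ j * q x) \<in> Poly k" for j by (rule Poly_add)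
  then show ?case unfolding eq g by (simp add: mult.commute)
qed

lemma grad_add: "smooth f \<Longrightarrow> smooth g \<Longrightarrow> grad (\<lambda>x. f x + g x) x = grad f x + grad g x"
  by (intro grad_eq GDERIV_add smooth_gderiv)

lemma grad_cmult: "smooth f \<Longrightarrow> grad (\<lambda>x. c * f x) x = c *\<^sub>R grad f x"
  using grad_mult[OF smooth_const[of c], of f x] by (simp add: grad_eq[OF GDERIV_const])

lemma grad_const [simp]: "grad (\<lambda>x. c) x = 0"
  by (rule grad_eq[OF GDERIV_const])

lemma grad_sum: "(\<And>i. i \<in> I \<Longrightarrow> smooth (f i)) \<Longrightarrow> grad (\<lambda>x. \<Sum>i\<in>I. f i x) x = (\<Sum>i\<in>I. grad (f i) x)"
  by (induction I rule: infinite_finite_induct) (auto simp: grad_add smooth_sum)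

lemma Poly_grad:
  assumes "p \<in> Poly m"
  shows "(\<lambda>x. grad p x $ j) \<in> Poly (m - 1)" and "m = 0 \<Longrightarrow> grad p x = 0"
proof -
  have "smooth p \<and> (\<forall>j. (\<lambda>x. grad p x $ j) \<in> Poly (m - 1)) \<and> (m = 0 \<longrightarrow> (\<forall>x. grad p x = 0))"
    using assms
  proof (induction p rule: Poly_induct)
    case (monomial \<alpha>)
    then show ?case using monomial_grad[OF refl, of \<alpha>] Poly_smooth[OF Poly_monomial[OF monomial]]
      by (auto intro: Poly_mono[OF _ diff_le_mono])
  qed (auto simp: grad_add grad_cmult intro: Poly_zero Poly_add Poly_cmult smooth_add smooth_mult smooth_const)
  then show "(\<lambda>x. grad p x $ j) \<in> Poly (m - 1)" "m = 0 \<Longrightarrow> grad p x = 0" by auto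
qed

lemma Poly_dir_deriv: "p \<in> Poly m \<Longrightarrow> (\<lambda>x. grad p x \<bullet> \<beta>) \<in> Poly (m - 1)"
proof -
  assume p: "p \<in> Poly m"
  have "(\<lambda>x. \<Sum>i\<in>UNIV. \<beta> $ i * grad p x $ i) \<in> Poly (m - 1)"
    by (intro Poly_sum Poly_cmult Poly_grad[OF p])
  then show ?thesis by (simp add: inner_vec_def mult.commute)
qed

text \<open>Restrict to the line from the centre to \<open>x\<close>: a polynomial in one variable
  that vanishes on an interval is zero.\<close>

lemma Poly_zero_on_ball:
  assumes p: "p \<in> Poly m" and r: "0 < r" and z: "\<And>x. x \<in> cball x0 r \<Longrightarrow> p x = 0"
  shows "p x = 0"
proof -
  define v where "v = x - x0"
  have "\<exists>P. \<forall>t. p (x0 + t *\<^sub>R v) = poly P t" using p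
  proof (induction p rule: Poly_induct)
    case (monomial \<alpha>)
    show ?case by (rule exI[of _ "\<Prod>i\<in>UNIV. [:x0 $ i, v $ i:] ^ \<alpha> i"]) (simp add: poly_prod)
  next
    case zero then show ?case by (intro exI[of _ 0]) simp
  next
    case (add p q) then show ?case by (metis poly_add)
  next
    case (cmult c p) then show ?case by (metis poly_smult)
  qed
  then obtain P where P: "\<And>t. p (x0 + t *\<^sub>R v) = poly P t" by blast
  define \<epsilon> where "\<epsilon> = r / (1 + norm v)"
  have e: "0 < \<epsilon>" using r by (simp add: \<epsilon>_def add_pos_nonneg)
  have "poly P t = 0" if "t \<in> {0..\<epsilon>}" for t
  proof -
    have "norm (t *\<^sub>R v) \<le> \<epsilon> * (1 + norm v)" using that e by (simp) (intro mult_mono; simp)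
    also have "\<dots> = r" by (simp add: \<epsilon>_def) (metis add_pos_nonneg norm_ge_zero order_less_irrefl zero_less_one)
    finally have "x0 + t *\<^sub>R v \<in> cball x0 r" by (simp add: dist_norm)
    then show ?thesis using z P by metis
  qed
  then have "{0..\<epsilon>} \<subseteq> {t. poly P t = 0}" by blast
  then have "infinite {t. poly P t = 0}" using e infinite_Icc infinite_super by blast
  then have "P = 0" using poly_roots_finite by blast
  then show ?thesis using P[of 1] by (simp add: v_def)
qed

section \<open>Equivalence of norms on spaces of polynomials\<close>

text \<open>Prepares norm equivalence on a finite-dimensional space of functions. The result is
  phrased through the expansion of every combination with coefficients \<open>ip q e\<close>, where
  each \<open>e\<close> has unit length: point values and gradients of \<open>q\<close> are then
  linear in coefficients that its norm controls.\<close>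

lemma gram_schmidt:
  fixes V :: "('a \<Rightarrow> real) set"
  assumes V: "\<And>p q. p \<in> V \<Longrightarrow> q \<in> V \<Longrightarrow> (\<lambda>x. p x + q x) \<in> V" "\<And>c p. p \<in> V \<Longrightarrow> (\<lambda>x. c * p x) \<in> V" "(\<lambda>x. 0) \<in> V"
    and sym: "\<And>p q. p \<in> V \<Longrightarrow> q \<in> V \<Longrightarrow> ip p q = ip q p"
    and add: "\<And>p q r. p \<in> V \<Longrightarrow> q \<in> V \<Longrightarrow> r \<in> V \<Longrightarrow> ip (\<lambda>x. p x + q x) r = ip p r + ip q r"
    and cmult: "\<And>c p r. p \<in> V \<Longrightarrow> r \<in> V \<Longrightarrow> ip (\<lambda>x. c * p x) r = c * ip p r"
    and pos: "\<And>p. p \<in> V \<Longrightarrow> 0 \<le> ip p p"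
    and definite: "\<And>p x. p \<in> V \<Longrightarrow> ip p p = 0 \<Longrightarrow> p x = 0"
    and A: "finite A" "\<And>i. i \<in> A \<Longrightarrow> f i \<in> V"
  shows "\<exists>E. finite E \<and> E \<subseteq> V \<and> (\<forall>e\<in>E. ip e e = 1) \<and>
     (\<forall>a. (let q = (\<lambda>x. \<Sum>i\<in>A. a i * f i x) in q \<in> V \<and> q = (\<lambda>x. \<Sum>e\<in>E. ip q e * e x)))"
proof -
  \<comment> \<open>\<open>R E\<close> collects the functions that \<open>E\<close> reproduces from
    their coefficients. The invariant of the induction is that \<open>E\<close> reproduces itself
    and all vectors processed so far.\<close>
  define R where "R E = {q \<in> V. q = (\<lambda>x. \<Sum>e\<in>E. ip q e * e x)}" for E
  have sumV: "(\<lambda>x. \<Sum>i\<in>I. c i * g i x) \<in> V" if "finite I" "\<And>i. i \<in> I \<Longrightarrow> g i \<in> V" for I :: "('a \<Rightarrow> real) set" and c g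
    using that
  proof (induction I rule: finite_induct)
    case (insert i I)
    have "(\<lambda>x. c i * g i x + (\<Sum>i\<in>I. c i * g i x)) \<in> V"
      by (rule V(1)[OF V(2)]) (use insert in auto)
    then show ?case using insert by simp
  qed (use V(3) in simp)
  have ip0: "ip (\<lambda>x. 0) r = 0" if "r \<in> V" for r using cmult[OF V(3) that, of 0] by simp
  have ipsum: "ip (\<lambda>x. \<Sum>i\<in>I. c i * g i x) r = (\<Sum>i\<in>I. c i * ip (g i) r)"
    if "finite I" "\<And>i. i \<in> I \<Longrightarrow> g i \<in> V" "r \<in> V" for I :: "('a \<Rightarrow> real) set" and c g r
    using that
  proof (induction I rule: finite_induct)
    case (insert i I)
    have "ip (\<lambda>x. c i * g i x + (\<Sum>i\<in>I. c i * g i x)) r = c i * ip (g i) r + ip (\<lambda>x. \<Sum>i\<in>I. c i * g i x) r"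
      by (subst add[OF V(2) sumV]) (use insert in \<open>auto simp: cmult\<close>)
    then show ?case using insert by simp
  qed (use ip0 in simp)
  have R_add: "(\<lambda>x. p x + q x) \<in> R E" if "p \<in> R E" "q \<in> R E" "E \<subseteq> V" for p q E
  proof -
    have pq: "p \<in> V" "q \<in> V" and p: "p = (\<lambda>x. \<Sum>e\<in>E. ip p e * e x)" and q: "q = (\<lambda>x. \<Sum>e\<in>E. ip q e * e x)"
      using that(1,2) by (simp_all add: R_def)
    have r: "p x + q x = (\<Sum>e\<in>E. ip (\<lambda>x. p x + q x) e * e x)" for x
    proof -
      have "(\<Sum>e\<in>E. ip (\<lambda>x. p x + q x) e * e x) = (\<Sum>e\<in>E. ip p e * e x + ip q e * e x)"
        by (rule sum.cong) (use that pq in \<open>auto simp: add distrib_right subset_iff\<close>)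
      then show ?thesis using fun_cong[OF p, of x] fun_cong[OF q, of x] by (simp add: sum.distrib)
    qed
    show ?thesis unfolding R_def by (intro CollectI conjI V(1)[OF pq] ext r)
  qed
  have R_cmult: "(\<lambda>x. c * p x) \<in> R E" if "p \<in> R E" "E \<subseteq> V" for p c E
  proof -
    have pq: "p \<in> V" and p: "p = (\<lambda>x. \<Sum>e\<in>E. ip p e * e x)"
      using that(1) by (simp_all add: R_def)
    have r: "c * p x = (\<Sum>e\<in>E. ip (\<lambda>x. c * p x) e * e x)" for x
    proof -
      have "(\<Sum>e\<in>E. ip (\<lambda>x. c * p x) e * e x) = (\<Sum>e\<in>E. c * (ip p e * e x))"
        by (rule sum.cong) (use that pq in \<open>auto simp: cmult subset_iff\<close>)
      then show ?thesis using fun_cong[OF p, of x] by (simp add: sum_distrib_left)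
    qed
    show ?thesis unfolding R_def by (intro CollectI conjI V(2)[OF pq] ext r)
  qed
  have R_zero: "(\<lambda>x. 0) \<in> R E" if "E \<subseteq> V" for E
  proof -
    have "(0::real) = (\<Sum>e\<in>E. ip (\<lambda>x. 0) e * e x)" for x
      by (rule sum.neutral[symmetric]) (use that ip0 in auto)
    then show ?thesis unfolding R_def by (intro CollectI conjI V(3) ext)
  qed
  have "\<exists>E. finite E \<and> E \<subseteq> V \<and> (\<forall>e\<in>E. ip e e = 1) \<and> E \<subseteq> R E \<and> f ` A \<subseteq> R E"
    using A
  proof (induction A rule: finite_induct)
    case empty then show ?case by (intro exI[of _ "{}"]) auto
  next
    case (insert i A)
    then obtain E where E: "finite E" "E \<subseteq> V" "\<forall>e\<in>E. ip e e = 1" "E \<subseteq> R E" "f ` A \<subseteq> R E" by auto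
    have fi: "f i \<in> V" using insert by simp
    define P where "P = (\<lambda>x. \<Sum>e\<in>E. ip (f i) e * e x)"
    have P: "P \<in> V" unfolding P_def by (rule sumV) (use E in auto)
    define g where "g = (\<lambda>x. f i x + (-1) * P x)"
    have g: "g \<in> V" unfolding g_def by (intro V fi P)
    \<comment> \<open>Expanding \<open>q\<close> in \<open>E\<close>, the symmetry of
      \<open>ip\<close> makes the sums for \<open>ip q (f i)\<close> and \<open>ip P q\<close>
      agree, so the remainder \<open>g\<close> is orthogonal to everything reproduced by
      \<open>E\<close>.\<close>
    have orth: "ip q g = 0" if q: "q \<in> R E" for q
    proof -
      have qV: "q \<in> V" and qe: "q = (\<lambda>x. \<Sum>e\<in>E. ip q e * e x)" using q by (simp_all add: R_def)
      have "ip g q = ip (f i) q + (-1) * ip P q"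
        unfolding g_def using add[OF fi V(2)[OF P, of "-1"] qV] cmult[OF P qV, of "-1"] by simp
      moreover have "ip P q = (\<Sum>e\<in>E. ip (f i) e * ip e q)"
        unfolding P_def by (rule ipsum) (use E qV in auto)
      moreover have "ip q (f i) = (\<Sum>e\<in>E. ip q e * ip e (f i))"
        using ipsum[of E "\<lambda>e. e" "f i" "\<lambda>e. ip q e"] qe E(1,2) fi by auto
      moreover have "(\<Sum>e\<in>E. ip q e * ip e (f i)) = (\<Sum>e\<in>E. ip (f i) e * ip e q)"
        by (rule sum.cong) (use E(2) fi qV in \<open>auto simp: sym subset_iff mult.commute\<close>)
      ultimately show ?thesis using sym[OF qV fi] sym[OF qV g] by simp
    qed
    show ?case
    proof (cases "ip g g = 0")
      case True
      then have "f i x = P x" for x using definite[OF g, of x] by (simp add: g_def)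
      then have "f i = P" by blast
      then have "f i \<in> R E" unfolding R_def P_def by (intro CollectI conjI fi)
      then show ?thesis using E by (intro exI[of _ E]) auto
    next
      case False
      define s where "s = sqrt (ip g g)"
      have s: "s > 0" "s * s = ip g g" using False pos[OF g] by (auto simp: s_def)
      define h where "h = (\<lambda>x. (1 / s) * g x)"
      have h: "h \<in> V" unfolding h_def by (rule V(2)[OF g])
      have iph: "ip q h = ip q g / s" if "q \<in> V" for q
        using sym[OF that h] sym[OF that g] cmult[OF g that, of "1 / s"] by (simp add: h_def)
      have gh: "ip g h = s" using iph[OF g] s(1) by (simp add: s(2)[symmetric])
      have hh: "ip h h = 1"
        using iph[OF h] sym[OF h g] gh s by simp
      have hE: "h \<notin> E" using orth[of h] E(4) hh iph[OF h] s by auto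
      have ext: "q \<in> R (insert h E)" if q: "q \<in> R E" for q
      proof -
        have "ip q h = 0" using iph[of q] orth[OF q] q by (simp add: R_def)
        then show ?thesis using q E(1) hE by (simp add: R_def)
      qed
      have "g = (\<lambda>x. \<Sum>e\<in>insert h E. ip g e * e x)"
      proof -
        have "ip g e = 0" if "e \<in> E" for e by (metis orth sym[OF g] subsetD[OF E(2)] subsetD[OF E(4)] that)
        then show ?thesis using gh s E(1) hE by (simp add: h_def)
      qed
      then have gR: "g \<in> R (insert h E)" using g by (simp add: R_def)
      have hR: "h \<in> R (insert h E)" unfolding h_def[abs_def]
        using R_cmult[OF gR, of "1 / s"] E h by (simp add: h_def)
      have "P \<in> R E" unfolding P_def
      proof -
        have "(\<lambda>x. \<Sum>e\<in>F. ip (f i) e * e x) \<in> R E" if "finite F" "F \<subseteq> E" for F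
          using that by (induction F rule: finite_induct) (use E in \<open>auto intro!: R_zero R_add R_cmult\<close>)
        then show "(\<lambda>x. \<Sum>e\<in>E. ip (f i) e * e x) \<in> R E" using E by blast
      qed
      then have "(\<lambda>x. g x + P x) \<in> R (insert h E)" using R_add[OF gR ext] E h by auto
      then have "f i \<in> R (insert h E)" by (simp add: g_def)
      then show ?thesis using E h hh ext hR by (intro exI[of _ "insert h E"]) auto
    qed
  qed
  then obtain E where E: "finite E" "E \<subseteq> V" "\<forall>e\<in>E. ip e e = 1" "f ` A \<subseteq> R E" by blast
  have "(\<lambda>x. \<Sum>i\<in>A. a i * f i x) \<in> R E" for a
    using A(1) E(4) by (induction A rule: finite_induct) (use E(2) in \<open>auto intro!: R_zero R_add R_cmult\<close>)
  then show ?thesis using E by (intro exI[of _ E]) (auto simp: R_def Let_def)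
qed

text \<open>Scale-invariant shape regularity: an inscribed ball whose radius is a fixed fraction of
  the diameter. In the polynomial estimates it takes the place of an affine map to a reference
  simplex.\<close>

definition fat :: "real \<Rightarrow> (real^'n) set \<Rightarrow> bool" where
  "fat \<eta> K \<longleftrightarrow> compact K \<and> convex K \<and> 0 < diameter K \<and> (\<exists>x. cball x (\<eta> * diameter K) \<subseteq> K)"

lemma compact_lmeasurable: "compact K \<Longrightarrow> K \<in> lmeasurable" for K :: "'a::euclidean_space set"
  by (rule lmeasurable_compact)

lemma compact_sets_lebesgue: "compact K \<Longrightarrow> K \<in> sets lebesgue" for K :: "'a::euclidean_space set"
  using lmeasurable_compact by (auto simp: fmeasurable_def)

lemma continuous_integrable_on_compact:
  fixes f :: "real^'n \<Rightarrow> real"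
  assumes "continuous_on UNIV f" "compact K" shows "integrable (lebesgue_on K) f"
  using assms by (intro Linf_integrable continuous_Linf compact_lmeasurable compact_sets_lebesgue compact_imp_bounded)

lemma LINT_cball_scale:
  fixes f :: "real^'n \<Rightarrow> real"
  assumes f: "continuous_on UNIV f" and c: "0 < c"
  shows "(LINT x|lebesgue_on (cball x0 (c * \<eta>)). f x) = c ^ CARD('n) * (LINT y|lebesgue_on (cball 0 \<eta>). f (x0 + c *\<^sub>R y))"
proof -
  let ?F = "\<lambda>x. indicator (cball x0 (c * \<eta>)) x *\<^sub>R f x"
  have fm: "f \<in> borel_measurable borel" using f by (rule borel_measurable_continuous_onI)
  have ci: "indicat_real (cball z r) \<in> borel_measurable borel" for z :: "real^'n" and r
    by (intro borel_measurable_indicator borel_closed closed_cball)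
  have Fm: "?F \<in> borel_measurable lborel" using borel_measurable_scaleR[OF ci fm] by simp
  have ind: "indicat_real (cball x0 (c * \<eta>)) (x0 + c *\<^sub>R y) = indicator (cball 0 \<eta>) y" for y
    using c by (simp add: indicator_def dist_norm)
  have f': "continuous_on UNIV (\<lambda>y. f (x0 + c *\<^sub>R y))"
    by (intro continuous_on_compose2[OF f] continuous_intros) auto
  have Gm: "(\<lambda>y. indicator (cball 0 \<eta>) y *\<^sub>R f (x0 + c *\<^sub>R y)) \<in> borel_measurable lborel"
    using borel_measurable_scaleR[OF ci borel_measurable_continuous_onI[OF f']] by simp
  have "(LINT x|lebesgue_on (cball x0 (c * \<eta>)). f x) = integral\<^sup>L lebesgue ?F"
    by (simp add: LINT_on set_lebesgue_integral_def)
  also have "\<dots> = integral\<^sup>L lborel ?F" by (rule integral_completion[OF Fm])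
  also have "\<dots> = integral\<^sup>L (density (distr lborel borel (\<lambda>x. x0 + c *\<^sub>R x)) (\<lambda>_. ennreal (c ^ CARD('n)))) ?F"
    using lborel_affine[of c x0] c by (simp add: ennreal_power)
  also have "\<dots> = (LINT x|distr lborel borel (\<lambda>x. x0 + c *\<^sub>R x). c ^ CARD('n) *\<^sub>R ?F x)"
    by (rule integral_density) (use Fm c in auto)
  also have "\<dots> = (LINT y|lborel. c ^ CARD('n) *\<^sub>R ?F (x0 + c *\<^sub>R y))"
    by (rule integral_distr) (use Fm in auto)
  also have "\<dots> = c ^ CARD('n) * (LINT y|lborel. indicator (cball 0 \<eta>) y *\<^sub>R f (x0 + c *\<^sub>R y))"
    by (simp add: ind)
  also have "(LINT y|lborel. indicator (cball 0 \<eta>) y *\<^sub>R f (x0 + c *\<^sub>R y))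
      = (LINT y|lebesgue. indicator (cball 0 \<eta>) y *\<^sub>R f (x0 + c *\<^sub>R y))"
    by (rule integral_completion[OF Gm, symmetric])
  also have "\<dots> = (LINT y|lebesgue_on (cball 0 \<eta>). f (x0 + c *\<^sub>R y))"
    by (simp add: LINT_on set_lebesgue_integral_def)
  finally show ?thesis .
qed

lemma AE_zero_continuous_cball:
  fixes f :: "real^'n \<Rightarrow> real"
  assumes f: "continuous_on UNIV f" and r: "0 < r" and z: "AE x in lebesgue_on (cball x0 r). f x = 0"
    and x: "x \<in> ball x0 r"
  shows "f x = 0"
proof -
  let ?U = "{x. f x \<noteq> 0} \<inter> ball x0 r"
  have "open {x. f x \<noteq> 0}" by (rule open_Collect_neq[OF f continuous_on_const])
  then have o: "open ?U" by blast
  have "AE x in lebesgue. x \<in> cball x0 r \<longrightarrow> f x = 0" using z by (simp add: AE_on_iff)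
  then have "AE x in lebesgue. x \<notin> ?U" by eventually_elim auto
  then have "negligible ?U"
    using o open_sets_lebesgue by (simp add: negligible_iff_null_sets AE_iff_null_sets)
  then have "?U = {}" using o open_not_negligible by blast
  then show ?thesis using x by blast
qed

text \<open>Expand \<open>q\<close> in a system of unit vectors for the inner product on the small
  ball. Every coefficient is at most the norm of \<open>q\<close>, so values and gradients on the
  unit ball are bounded by that norm times \<open>S\<close>, the sum of the bounds for the finitely
  many basis functions.\<close>

lemma Poly_bound_unit_ball:
  assumes \<eta>: "0 < \<eta>"
  shows "\<exists>C\<ge>0. \<forall>q\<in>Poly m. \<forall>y\<in>cball (0::real^'n) 1.
     (q y)\<^sup>2 \<le> C * (LINT x|lebesgue_on (cball 0 \<eta>). (q x)\<^sup>2) \<and>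
     (\<forall>i. (grad q y $ i)\<^sup>2 \<le> C * (LINT x|lebesgue_on (cball 0 \<eta>). (q x)\<^sup>2))"
proof -
  let ?B = "cball (0::real^'n) \<eta>"
  define ip where "ip p q = (LINT x|lebesgue_on ?B. p x * q x)" for p q :: "real^'n \<Rightarrow> real"
  define A where "A = {\<alpha> :: 'n \<Rightarrow> nat. (\<Sum>i\<in>UNIV. \<alpha> i) \<le> m}"
  define f where "f \<alpha> = (\<lambda>x::real^'n. \<Prod>i\<in>UNIV. (x $ i) ^ \<alpha> i)" for \<alpha> :: "'n \<Rightarrow> nat"
  have int: "integrable (lebesgue_on ?B) (\<lambda>x. p x * q x)" if "p \<in> Poly m" "q \<in> Poly m" for p q
    using that by (intro continuous_integrable_on_compact continuous_intros Poly_continuous[of _ m]) auto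
  have nn: "0 \<le> ip p p" for p unfolding ip_def by (rule integral_nonneg_AE) simp
  have def0: "p x = 0" if p: "p \<in> Poly m" and z: "ip p p = 0" for p x
  proof (rule Poly_zero_on_ball[OF p, of "\<eta> / 2" 0])
    have "AE x in lebesgue_on ?B. p x * p x = 0"
      using integral_nonneg_eq_0_iff_AE[OF int[OF p p]] z unfolding ip_def by simp
    then have "AE x in lebesgue_on ?B. p x = 0" by eventually_elim simp
    then show "p x = 0" if "x \<in> cball 0 (\<eta> / 2)" for x
      by (rule AE_zero_continuous_cball[OF Poly_continuous[OF p] \<eta>]) (use that \<eta> in auto)
  qed (use \<eta> in auto)
  have fP: "f \<alpha> \<in> Poly m" if "\<alpha> \<in> A" for \<alpha>
    using that Poly_monomial unfolding f_def A_def by blast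
  obtain E where E: "finite E" "E \<subseteq> Poly m" "\<forall>e\<in>E. ip e e = 1"
    and rep: "\<And>a. (let q = (\<lambda>x. \<Sum>\<alpha>\<in>A. a \<alpha> * f \<alpha> x) in q \<in> Poly m \<and> q = (\<lambda>x. \<Sum>e\<in>E. ip q e * e x))"
  proof -
    have "\<exists>E. finite E \<and> E \<subseteq> Poly m \<and> (\<forall>e\<in>E. ip e e = 1) \<and>
     (\<forall>a. (let q = (\<lambda>x. \<Sum>i\<in>A. a i * f i x) in q \<in> Poly m \<and> q = (\<lambda>x. \<Sum>e\<in>E. ip q e * e x)))"
    proof (rule gram_schmidt[OF Poly_add Poly_cmult Poly_zero])
      show "ip p q = ip q p" for p q by (simp add: ip_def mult.commute)
      show "ip (\<lambda>x. p x + q x) r = ip p r + ip q r" if "p \<in> Poly m" "q \<in> Poly m" "r \<in> Poly m" for p q r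
        using int[OF that(1,3)] int[OF that(2,3)] by (simp add: ip_def distrib_right)
      show "ip (\<lambda>x. c * p x) r = c * ip p r" for c p r by (simp add: ip_def mult.assoc)
      show "finite A" unfolding A_def by (rule finite_multi_index)
    qed (use nn def0 fP in auto)
    then show ?thesis using that by blast
  qed
  have rep': "q = (\<lambda>x. \<Sum>e\<in>E. ip q e * e x)" if q: "q \<in> Poly m" for q
  proof -
    obtain a where "q = (\<lambda>x. \<Sum>\<alpha>\<in>A. a \<alpha> * f \<alpha> x)"
      using q unfolding Poly_def A_def f_def by blast
    then show ?thesis using rep[of a] by (simp add: Let_def)
  qed
  \<comment> \<open>Bessel's inequality for a single unit vector, from expanding the square of q - t
    e with t = \<open>ip q e\<close>.\<close>
  have bes: "(ip q e)\<^sup>2 \<le> ip q q" if q: "q \<in> Poly m" and e: "e \<in> E" for q e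
  proof -
    have eP: "e \<in> Poly m" and e1: "ip e e = 1" using E e by auto
    let ?t = "ip q e"
    have I: "integrable (lebesgue_on ?B) (\<lambda>x. q x * q x)" "integrable (lebesgue_on ?B) (\<lambda>x. q x * e x)" "integrable (lebesgue_on ?B) (\<lambda>x. e x * e x)"
      using int q eP by auto
    have "0 \<le> ip (\<lambda>x. q x - ?t * e x) (\<lambda>x. q x - ?t * e x)" by (rule nn)
    also have "\<dots> = (LINT x|lebesgue_on ?B. q x * q x - (2 * ?t) * (q x * e x) + ?t\<^sup>2 * (e x * e x))"
      unfolding ip_def[of "\<lambda>x. q x - ?t * e x"] by (intro Bochner_Integration.integral_cong refl) (simp add: algebra_simps power2_eq_square)
    also have "\<dots> = ip q q - 2 * ?t * ?t + ?t\<^sup>2 * 1"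
      using I e1 unfolding ip_def[of q q] by (simp add: ip_def)
    finally show ?thesis by (simp add: power2_eq_square)
  qed
  have "\<exists>M\<ge>0. \<forall>y\<in>cball 0 1. \<bar>e y\<bar> \<le> M \<and> norm (grad e y) \<le> M" if "e \<in> E" for e
  proof -
    have s: "smooth e" using that E Poly_smooth by blast
    have "compact (e ` cball 0 1)" "compact (grad e ` cball 0 1)"
      by (auto intro!: compact_continuous_image smooth_continuous smooth_grad_continuous s)
    then obtain M1 M2 where "\<forall>y\<in>cball 0 1. \<bar>e y\<bar> \<le> M1" "\<forall>y\<in>cball 0 1. norm (grad e y) \<le> M2"
      by (fastforce dest!: compact_imp_bounded simp: bounded_iff)
    then show ?thesis by (intro exI[of _ "max 0 (max M1 M2)"]) fastforce
  qed
  then obtain M where M: "\<And>e. e \<in> E \<Longrightarrow> 0 \<le> M e"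
    "\<And>e y. e \<in> E \<Longrightarrow> y \<in> cball 0 1 \<Longrightarrow> \<bar>e y\<bar> \<le> M e" "\<And>e y. e \<in> E \<Longrightarrow> y \<in> cball 0 1 \<Longrightarrow> norm (grad e y) \<le> M e"
    by metis
  define S where "S = (\<Sum>e\<in>E. M e)"
  have S0: "0 \<le> S" unfolding S_def by (rule sum_nonneg) (rule M)
  have lin: "(\<Sum>e\<in>E. ip q e * z e)\<^sup>2 \<le> S\<^sup>2 * (LINT x|lebesgue_on ?B. (q x)\<^sup>2)"
    if q: "q \<in> Poly m" and z: "\<And>e. e \<in> E \<Longrightarrow> \<bar>z e\<bar> \<le> M e" for q z
  proof -
    define s where "s = sqrt (ip q q)"
    have s: "0 \<le> s" "s\<^sup>2 = ip q q" using nn by (auto simp: s_def)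
    have "\<bar>\<Sum>e\<in>E. ip q e * z e\<bar> \<le> (\<Sum>e\<in>E. s * M e)"
    proof (rule order_trans[OF sum_abs], rule sum_mono)
      fix e assume e: "e \<in> E"
      have "\<bar>ip q e\<bar> \<le> s" using bes[OF q e] s by (metis abs_le_square_iff abs_of_nonneg)
      then show "\<bar>ip q e * z e\<bar> \<le> s * M e" using z[OF e] s by (simp add: abs_mult mult_mono)
    qed
    then have "\<bar>\<Sum>e\<in>E. ip q e * z e\<bar> \<le> \<bar>s * S\<bar>" using s S0 by (simp add: S_def sum_distrib_left)
    then have "(\<Sum>e\<in>E. ip q e * z e)\<^sup>2 \<le> (s * S)\<^sup>2" by (simp add: abs_le_square_iff)
    moreover have "(s * S)\<^sup>2 = S\<^sup>2 * (LINT x|lebesgue_on ?B. (q x)\<^sup>2)"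
      using s(2) by (simp add: power_mult_distrib ip_def power2_eq_square[of "q _"])
    ultimately show ?thesis by simp
  qed
  show ?thesis
  proof (intro exI[of _ "S\<^sup>2"] conjI ballI allI)
    fix q :: "real^'n \<Rightarrow> real" and y :: "real^'n" assume q: "q \<in> Poly m" and y: "y \<in> cball 0 1"
    show "(q y)\<^sup>2 \<le> S\<^sup>2 * (LINT x|lebesgue_on ?B. (q x)\<^sup>2)"
      using lin[OF q, of "\<lambda>e. e y"] M(2) y fun_cong[OF rep'[OF q], of y] by simp
    fix i
    have "grad (\<lambda>x. \<Sum>e\<in>E. ip q e * e x) y = (\<Sum>e\<in>E. grad (\<lambda>x. ip q e * e x) y)"
      by (rule grad_sum, rule Poly_smooth[of _ m], rule Poly_cmult) (use E in auto)
    also have "\<dots> = (\<Sum>e\<in>E. ip q e *\<^sub>R grad e y)"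
      by (rule sum.cong[OF refl], rule grad_cmult) (use E in \<open>auto intro!: Poly_smooth[of _ m]\<close>)
    finally have "grad q y $ i = (\<Sum>e\<in>E. ip q e * grad e y $ i)"
      using rep'[OF q] by simp
    then show "(grad q y $ i)\<^sup>2 \<le> S\<^sup>2 * (LINT x|lebesgue_on ?B. (q x)\<^sup>2)"
      using lin[OF q, of "\<lambda>e. grad e y $ i"] M(3) y component_le_norm_cart order_trans by metis
  qed simp
qed

lemma grad_affine:
  assumes "smooth p" shows "grad (\<lambda>y. p (t + c *\<^sub>R y)) y = c *\<^sub>R grad p (t + c *\<^sub>R y)"
proof (rule grad_eq, unfold gderiv_def)
  have "(p has_derivative (\<lambda>h. h \<bullet> grad p (t + c *\<^sub>R y))) (at (t + c *\<^sub>R y))"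
    using smooth_gderiv[OF assms] by (simp add: gderiv_def)
  moreover have "((\<lambda>y. t + c *\<^sub>R y) has_derivative (\<lambda>h. c *\<^sub>R h)) (at y)"
    by (auto intro!: derivative_eq_intros)
  ultimately have "((\<lambda>y. p (t + c *\<^sub>R y)) has_derivative (\<lambda>h. (c *\<^sub>R h) \<bullet> grad p (t + c *\<^sub>R y))) (at y)"
    using has_derivative_compose by blast
  then show "((\<lambda>y. p (t + c *\<^sub>R y)) has_derivative (\<lambda>h. h \<bullet> c *\<^sub>R grad p (t + c *\<^sub>R y))) (at y)" by simp
qed

lemma fat_near:
  assumes "fat \<eta> K" "x \<in> K" "y \<in> K" shows "dist x y \<le> diameter K"
  using assms by (intro diameter_bounded_bound compact_imp_bounded) (auto simp: fat_def)

text \<open>Dilate by the diameter about the centre of the inscribed ball. Then \<open>K\<close>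
  lands in the unit ball and its inscribed ball becomes the ball of radius \<eta>, so one constant
  serves all shapes. The power of the diameter is the Jacobian, and each derivative contributes one
  further diameter.\<close>

proposition Poly_bound_fat:
  assumes \<eta>: "0 < \<eta>"
  shows "\<exists>C\<ge>0. \<forall>(K :: (real^'n) set) p. fat \<eta> K \<longrightarrow> p \<in> Poly m \<longrightarrow> (\<forall>x\<in>K.
     (p x)\<^sup>2 * diameter K ^ CARD('n) \<le> C * (LINT x|lebesgue_on K. (p x)\<^sup>2) \<and>
     (\<forall>i. (diameter K * grad p x $ i)\<^sup>2 * diameter K ^ CARD('n) \<le> C * (LINT x|lebesgue_on K. (p x)\<^sup>2)))"
proof -
  obtain C where C: "C \<ge> 0" "\<And>q y i. q \<in> Poly m \<Longrightarrow> y \<in> cball (0::real^'n) 1 \<Longrightarrow>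
     (q y)\<^sup>2 \<le> C * (LINT x|lebesgue_on (cball 0 \<eta>). (q x)\<^sup>2) \<and>
     (grad q y $ i)\<^sup>2 \<le> C * (LINT x|lebesgue_on (cball 0 \<eta>). (q x)\<^sup>2)"
    using Poly_bound_unit_ball[OF \<eta>, of m, where 'n='n] by blast
  have "(p x)\<^sup>2 * diameter K ^ CARD('n) \<le> C * (LINT x|lebesgue_on K. (p x)\<^sup>2) \<and>
     (diameter K * grad p x $ i)\<^sup>2 * diameter K ^ CARD('n) \<le> C * (LINT x|lebesgue_on K. (p x)\<^sup>2)"
    if K: "fat \<eta> K" and p: "p \<in> Poly m" and x: "x \<in> K" for K :: "(real^'n) set" and p x i
  proof -
    define d where "d = diameter K"
    obtain x0 where x0: "cball x0 (\<eta> * d) \<subseteq> K" using K by (auto simp: fat_def d_def)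
    have d: "0 < d" using K by (simp add: fat_def d_def)
    have cK: "compact K" using K by (simp add: fat_def)
    have x0K: "x0 \<in> K" using x0 d \<eta> by auto
    define q where "q y = p (x0 + d *\<^sub>R y)" for y
    have q: "q \<in> Poly m" unfolding q_def by (rule Poly_affine[OF p])
    define y where "y = (1 / d) *\<^sub>R (x - x0)"
    have "norm (x - x0) \<le> d" using fat_near[OF K x x0K] by (simp add: d_def dist_norm)
    then have y: "y \<in> cball 0 1" using d by (simp add: y_def)
    have yx: "x0 + d *\<^sub>R y = x" using d by (simp add: y_def)
    have pc: "continuous_on UNIV (\<lambda>x. (p x)\<^sup>2)" by (intro continuous_intros Poly_continuous[OF p])
    have "d ^ CARD('n) * (LINT z|lebesgue_on (cball 0 \<eta>). (q z)\<^sup>2) = (LINT x|lebesgue_on (cball x0 (\<eta> * d)). (p x)\<^sup>2)"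
      using LINT_cball_scale[OF pc d, of x0 \<eta>] by (simp add: q_def mult.commute)
    also have "\<dots> \<le> (LINT x|lebesgue_on K. (p x)\<^sup>2)"
      unfolding LINT_on[OF compact_sets_lebesgue[OF cK]] LINT_on[OF compact_sets_lebesgue[OF compact_cball]] set_lebesgue_integral_def
    proof (rule integral_mono)
      show "integrable lebesgue (\<lambda>x. indicator (cball x0 (\<eta> * d)) x *\<^sub>R (p x)\<^sup>2)" "integrable lebesgue (\<lambda>x. indicator K x *\<^sub>R (p x)\<^sup>2)"
        using continuous_integrable_on_compact[OF pc cK] continuous_integrable_on_compact[OF pc compact_cball]
        unfolding integrable_on_iff[OF compact_sets_lebesgue[OF cK]] integrable_on_iff[OF compact_sets_lebesgue[OF compact_cball]] set_integrable_def
        by blast+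
      show "indicator (cball x0 (\<eta> * d)) x *\<^sub>R (p x)\<^sup>2 \<le> indicator K x *\<^sub>R (p x)\<^sup>2" for x
        using x0 by (auto simp: indicator_def)
    qed
    finally have I: "(LINT z|lebesgue_on (cball 0 \<eta>). (q z)\<^sup>2) * d ^ CARD('n) \<le> (LINT x|lebesgue_on K. (p x)\<^sup>2)"
      by (simp add: mult.commute)
    have mono: "t * d ^ CARD('n) \<le> C * (LINT x|lebesgue_on K. (p x)\<^sup>2)"
      if "t \<le> C * (LINT z|lebesgue_on (cball 0 \<eta>). (q z)\<^sup>2)" for t
    proof -
      have "t * d ^ CARD('n) \<le> C * (LINT z|lebesgue_on (cball 0 \<eta>). (q z)\<^sup>2) * d ^ CARD('n)"
        using that d by (intro mult_right_mono) auto
      also have "\<dots> \<le> C * (LINT x|lebesgue_on K. (p x)\<^sup>2)"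
        using I C(1) by (simp add: mult.assoc mult_left_mono)
      finally show ?thesis .
    qed
    have "grad q y = d *\<^sub>R grad p x"
      using grad_affine[OF Poly_smooth[OF p], of x0 d y] yx by (simp add: q_def[abs_def])
    moreover have "q y = p x" by (simp add: q_def yx)
    ultimately show ?thesis using C(2)[OF q y, of i] mono by (simp add: d_def[symmetric])
  qed
  then show ?thesis using C(1) by blast
qed

lemma measure_fat_le:
  fixes K :: "(real^'n) set"
  assumes "fat \<eta> K" "0 < \<eta>"
  shows "measure lebesgue K \<le> measure lebesgue (cball (0::real^'n) 1) * diameter K ^ CARD('n)"
proof -
  define d where "d = diameter K"
  obtain x0 where x0: "cball x0 (\<eta> * d) \<subseteq> K" using assms by (auto simp: fat_def d_def)
  have d: "0 < d" using assms by (simp add: fat_def d_def)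
  have x0K: "x0 \<in> K" using x0 d assms by auto
  have "K \<subseteq> cball x0 d" using fat_near[OF assms(1) x0K] by (auto simp: d_def)
  then have "measure lebesgue K \<le> measure lebesgue (cball x0 d)"
    using assms by (intro measure_mono_fmeasurable compact_sets_lebesgue compact_lmeasurable) (auto simp: fat_def)
  moreover have "measure lebesgue (cball x0 d) = d ^ CARD('n) * measure lebesgue (cball (0::real^'n) 1)"
    using LINT_cball_scale[of "\<lambda>x. 1" d x0 1] d by (simp add: measure_restrict_space)
  ultimately show ?thesis by (simp add: d_def mult.commute)
qed

lemma LINT_square_le_sup:
  fixes K :: "(real^'n) set"
  assumes K: "compact K" and p: "continuous_on UNIV p" and s: "\<And>x. x \<in> K \<Longrightarrow> \<bar>p x\<bar> \<le> s"
  shows "(LINT x|lebesgue_on K. (p x)\<^sup>2) \<le> s\<^sup>2 * measure lebesgue K"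
proof -
  have "(LINT x|lebesgue_on K. (p x)\<^sup>2) \<le> (LINT x|lebesgue_on K. s\<^sup>2)"
  proof (rule integral_mono)
    fix x assume "x \<in> space (lebesgue_on K)"
    then have "\<bar>p x\<bar> \<le> s" using s by simp
    then show "(p x)\<^sup>2 \<le> s\<^sup>2" using power_mono[of "\<bar>p x\<bar>" s 2] by simp
  qed (auto intro!: continuous_integrable_on_compact K continuous_intros p)
  also have "\<dots> = s\<^sup>2 * measure lebesgue K"
    using compact_sets_lebesgue[OF K] by (simp add: measure_restrict_space)
  finally show ?thesis .
qed

text \<open>A sup bound \<open>s\<close> bounds the squared L2 norm by s^2 times the volume, and the
  volume by \<omega> times the n-th power of the diameter; this power cancels the one in
  \<open>Poly_bound_fat\<close>.\<close>

lemma Poly_inverse_sup: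
  assumes \<eta>: "0 < \<eta>"
  shows "\<exists>C\<ge>0. \<forall>(K :: (real^'n) set) p s. fat \<eta> K \<longrightarrow> p \<in> Poly m \<longrightarrow> (\<forall>x\<in>K. \<bar>p x\<bar> \<le> s) \<longrightarrow>
     (\<forall>x\<in>K. norm (grad p x) \<le> C * s / diameter K)"
proof -
  obtain C where C: "C \<ge> 0" "\<And>(K :: (real^'n) set) p x i. fat \<eta> K \<Longrightarrow> p \<in> Poly m \<Longrightarrow> x \<in> K \<Longrightarrow>
     (diameter K * grad p x $ i)\<^sup>2 * diameter K ^ CARD('n) \<le> C * (LINT x|lebesgue_on K. (p x)\<^sup>2)"
    using Poly_bound_fat[OF \<eta>, of m, where 'n='n] by blast
  define \<omega> where "\<omega> = measure lebesgue (cball (0::real^'n) 1)"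
  define C' where "C' = CARD('n) * sqrt (C * \<omega>)"
  have "norm (grad p x) \<le> C' * s / diameter K"
    if K: "fat \<eta> K" and p: "p \<in> Poly m" and s: "\<forall>x\<in>K. \<bar>p x\<bar> \<le> s" and x: "x \<in> K" for K :: "(real^'n) set" and p s x
  proof -
    have d: "0 < diameter K" using K by (simp add: fat_def)
    have s0: "0 \<le> s" using s x by fastforce
    have g: "\<bar>grad p x $ i\<bar> \<le> sqrt (C * \<omega>) * s / diameter K" for i
    proof -
      have "(LINT x|lebesgue_on K. (p x)\<^sup>2) \<le> s\<^sup>2 * measure lebesgue K"
        using K s by (intro LINT_square_le_sup Poly_continuous[OF p]) (auto simp: fat_def)
      also have "\<dots> \<le> s\<^sup>2 * (\<omega> * diameter K ^ CARD('n))"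
        using measure_fat_le[OF K \<eta>] by (intro mult_left_mono) (auto simp: \<omega>_def)
      finally have "C * (LINT x|lebesgue_on K. (p x)\<^sup>2) \<le> C * (s\<^sup>2 * (\<omega> * diameter K ^ CARD('n)))"
        using C(1) by (rule mult_left_mono)
      then have "(diameter K * grad p x $ i)\<^sup>2 * diameter K ^ CARD('n) \<le> (C * \<omega> * s\<^sup>2) * diameter K ^ CARD('n)"
        using C(2)[OF K p x, of i] by (simp add: mult_ac)
      then have "(diameter K * grad p x $ i)\<^sup>2 \<le> C * \<omega> * s\<^sup>2" using d by simp
      then have "sqrt ((diameter K * grad p x $ i)\<^sup>2) \<le> sqrt (C * \<omega> * s\<^sup>2)" by (rule real_sqrt_le_mono)
      then have "diameter K * \<bar>grad p x $ i\<bar> \<le> sqrt (C * \<omega>) * s" using d s0 by (simp add: abs_mult real_sqrt_mult)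
      then show ?thesis using d by (simp add: field_simps)
    qed
    have "norm (grad p x) \<le> (\<Sum>i\<in>UNIV. \<bar>grad p x $ i\<bar>)" by (rule norm_le_l1_cart)
    also have "\<dots> \<le> (\<Sum>i\<in>(UNIV::'n set). sqrt (C * \<omega>) * s / diameter K)" by (intro sum_mono g)
    finally show ?thesis by (simp add: C'_def)
  qed
  moreover have "0 \<le> C'" using C(1) by (simp add: C'_def \<omega>_def)
  ultimately show ?thesis by blast
qed

text \<open>Integration by parts along the streamline variable \<open>l x = (x - x0) \<bullet> \<beta>\<close>: if \<open>Q'\<close> solves
  \<open>\<beta> \<bullet> grad Q' = l ^ (k + 1) * (\<beta> \<bullet> grad q)\<close>, then \<open>(l ^ (k + 1) * q - Q') / (k + 1)\<close> solves the
  problem for \<open>l ^ k * q\<close>, and the degree of \<open>q\<close> has dropped.\<close>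

lemma Poly_streamline_primitive:
  assumes \<eta>: "0 < \<eta>"
  shows "\<exists>C\<ge>0. \<forall>(K :: (real^'n) set) x0 \<beta> q s. fat \<eta> K \<longrightarrow> x0 \<in> K \<longrightarrow> norm \<beta> = 1 \<longrightarrow> q \<in> Poly m \<longrightarrow>
     (\<forall>x\<in>K. \<bar>q x\<bar> \<le> s) \<longrightarrow>
     (\<exists>Q\<in>Poly (m + k + 1). (\<forall>x. grad Q x \<bullet> \<beta> = ((x - x0) \<bullet> \<beta>) ^ k * q x) \<and>
        (\<forall>x\<in>K. \<bar>Q x\<bar> \<le> C * s * diameter K ^ (k + 1)))"
proof (induction m arbitrary: k)
  have l_grad: "grad (\<lambda>x. ((x - x0) \<bullet> \<beta>) ^ (k + 1) * q x) x \<bullet> \<beta>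
      = real (k + 1) * (((x - x0) \<bullet> \<beta>) ^ k * q x) + ((x - x0) \<bullet> \<beta>) ^ (k + 1) * (grad q x \<bullet> \<beta>)"
    if "norm \<beta> = 1" "smooth q" for x0 \<beta> :: "real^'n" and k q x
  proof -
    have "GDERIV (\<lambda>x. (x - x0) \<bullet> \<beta>) x :> \<beta>"
      unfolding gderiv_def by (auto intro!: derivative_eq_intros)
    then have "GDERIV (\<lambda>x. ((x - x0) \<bullet> \<beta>) ^ (k + 1)) x :> (real (k + 1) * ((x - x0) \<bullet> \<beta>) ^ k) *\<^sub>R \<beta>"
      by (rule GDERIV_DERIV_compose) (use DERIV_pow[of "k + 1" "(x - x0) \<bullet> \<beta>"] in simp)
    then have eq: "grad (\<lambda>x. ((x - x0) \<bullet> \<beta>) ^ (k + 1) * q x) x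
      = ((x - x0) \<bullet> \<beta>) ^ (k + 1) *\<^sub>R grad q x + q x *\<^sub>R ((real (k + 1) * ((x - x0) \<bullet> \<beta>) ^ k) *\<^sub>R \<beta>)"
      by (intro grad_eq GDERIV_mult smooth_gderiv[OF that(2)])
    have "\<beta> \<bullet> \<beta> = 1" using that(1) by (simp add: dot_square_norm)
    then show ?thesis by (simp only: eq inner_add_left inner_scaleR_left) (simp add: mult_ac)
  qed
  have l_le: "\<bar>(x - x0) \<bullet> \<beta>\<bar> \<le> diameter K" if "fat \<eta> K" "x0 \<in> K" "x \<in> K" "norm \<beta> = 1"
    for K and x x0 \<beta> :: "real^'n"
    using Cauchy_Schwarz_ineq2[of "x - x0" \<beta>] fat_near[OF that(1,3,2)] that(4) by (simp add: dist_norm)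
  have l_sup: "\<bar>((x - x0) \<bullet> \<beta>) ^ (k + 1) * q x\<bar> \<le> s * diameter K ^ (k + 1)"
    if "fat \<eta> K" "x0 \<in> K" "x \<in> K" "norm \<beta> = 1" "\<bar>q x\<bar> \<le> s" for K and x x0 \<beta> :: "real^'n" and k q s
  proof -
    have "\<bar>(x - x0) \<bullet> \<beta>\<bar> ^ (k + 1) \<le> diameter K ^ (k + 1)"
      by (rule power_mono[OF l_le[OF that(1-4)]]) simp
    then have "\<bar>(x - x0) \<bullet> \<beta>\<bar> ^ (k + 1) * \<bar>q x\<bar> \<le> diameter K ^ (k + 1) * s"
      using that(5) by (rule mult_mono) (use that(1) in \<open>auto simp: fat_def\<close>)
    then show ?thesis by (simp add: abs_mult power_abs mult.commute)
  qed
  have l_Poly: "(\<lambda>x. ((x - x0) \<bullet> \<beta>) ^ (k + 1) * q x) \<in> Poly (m + k + 1)" if "q \<in> Poly m"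
    for x0 \<beta> :: "real^'n" and k q m
    using Poly_mult[OF Poly_power[OF Poly_inner[of x0 \<beta>], of "k + 1"] that] by (simp add: add_ac)
  {
    case 0
    show ?case
    proof (intro exI[of _ 1] conjI allI impI)
      fix K :: "(real^'n) set" and x0 \<beta> :: "real^'n" and q :: "real^'n \<Rightarrow> real" and s :: real
      assume K: "fat \<eta> K" "x0 \<in> K" and \<beta>: "norm \<beta> = 1" and q: "q \<in> Poly 0" and s: "\<forall>x\<in>K. \<bar>q x\<bar> \<le> s"
      define Q where "Q = (\<lambda>x. (1 / real (k + 1)) * (((x - x0) \<bullet> \<beta>) ^ (k + 1) * q x))"
      note lP = l_Poly[OF q, of x0 \<beta> k]
      have g: "grad Q x \<bullet> \<beta> = ((x - x0) \<bullet> \<beta>) ^ k * q x" for x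
        unfolding Q_def grad_cmult[OF Poly_smooth[OF lP]] inner_scaleR_left l_grad[OF \<beta> Poly_smooth[OF q]]
        using Poly_grad(2)[OF q] by simp
      have b: "\<bar>Q x\<bar> \<le> 1 * s * diameter K ^ (k + 1)" if x: "x \<in> K" for x
      proof -
        have "\<bar>Q x\<bar> \<le> \<bar>((x - x0) \<bullet> \<beta>) ^ (k + 1) * q x\<bar>"
          unfolding Q_def by (simp only: abs_mult) (intro mult_left_le_one_le; simp)
        then show ?thesis using l_sup[OF K x \<beta>, of q s k] s x by auto
      qed
      show "\<exists>Q\<in>Poly (0 + k + 1). (\<forall>x. grad Q x \<bullet> \<beta> = ((x - x0) \<bullet> \<beta>) ^ k * q x) \<and> (\<forall>x\<in>K. \<bar>Q x\<bar> \<le> 1 * s * diameter K ^ (k + 1))"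
        using Poly_cmult[OF lP, of "1 / real (k + 1)"] g b unfolding Q_def by blast
    qed simp
  next
    case (Suc m)
    obtain C1 where C1: "0 \<le> C1" "\<forall>(K :: (real^'n) set) p s. fat \<eta> K \<longrightarrow> p \<in> Poly (Suc m) \<longrightarrow> (\<forall>x\<in>K. \<bar>p x\<bar> \<le> s) \<longrightarrow>
       (\<forall>x\<in>K. norm (grad p x) \<le> C1 * s / diameter K)"
      using Poly_inverse_sup[OF \<eta>, of "Suc m", where 'n='n] by (elim exE conjE) (rule that; assumption)
    obtain C2 where C2: "0 \<le> C2" and C2': "\<forall>(K :: (real^'n) set) x0 \<beta> q s. fat \<eta> K \<longrightarrow> x0 \<in> K \<longrightarrow> norm \<beta> = 1 \<longrightarrow> q \<in> Poly m \<longrightarrow>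
       (\<forall>x\<in>K. \<bar>q x\<bar> \<le> s) \<longrightarrow>
       (\<exists>Q\<in>Poly (m + (k + 1) + 1). (\<forall>x. grad Q x \<bullet> \<beta> = ((x - x0) \<bullet> \<beta>) ^ (k + 1) * q x) \<and>
          (\<forall>x\<in>K. \<bar>Q x\<bar> \<le> C2 * s * diameter K ^ (k + 1 + 1)))"
      using Suc.IH[of "k + 1"] by (elim exE conjE) (rule that; assumption)
    show ?case
    \<comment> \<open>The 1 stands for the term with \<open>l ^ (k + 1) * q\<close>, the product for
      \<open>Q'\<close>. The induction hypothesis is applied to the directional derivative, whose
      sup bound C1 * s / diameter loses one diameter; exponent k + 2 instead of k + 1 regains
      it.\<close>
    proof (intro exI[of _ "1 + C2 * C1"] conjI allI impI)
      fix K :: "(real^'n) set" and x0 \<beta> :: "real^'n" and q :: "real^'n \<Rightarrow> real" and s :: real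
      assume K: "fat \<eta> K" "x0 \<in> K" and \<beta>: "norm \<beta> = 1" and q: "q \<in> Poly (Suc m)" and s: "\<forall>x\<in>K. \<bar>q x\<bar> \<le> s"
      have d: "0 < diameter K" using K by (simp add: fat_def)
      have "(\<lambda>x. grad q x \<bullet> \<beta>) \<in> Poly m" using Poly_dir_deriv[OF q, of \<beta>] by simp
      moreover have "\<forall>x\<in>K. \<bar>grad q x \<bullet> \<beta>\<bar> \<le> C1 * s / diameter K"
      proof
        fix x assume "x \<in> K"
        then have "norm (grad q x) \<le> C1 * s / diameter K"
          using C1(2)[rule_format, OF K(1) q, of s x] s by blast
        then show "\<bar>grad q x \<bullet> \<beta>\<bar> \<le> C1 * s / diameter K"
          using Cauchy_Schwarz_ineq2[of "grad q x" \<beta>] \<beta> by simp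
      qed
      ultimately obtain Q' where Q': "Q' \<in> Poly (m + (k + 1) + 1)"
        "\<And>x. grad Q' x \<bullet> \<beta> = ((x - x0) \<bullet> \<beta>) ^ (k + 1) * (grad q x \<bullet> \<beta>)"
        "\<And>x. x \<in> K \<Longrightarrow> \<bar>Q' x\<bar> \<le> C2 * (C1 * s / diameter K) * diameter K ^ (k + 1 + 1)"
        using C2'[THEN spec, THEN spec, THEN spec, THEN spec, THEN spec, THEN mp, OF K(1), THEN mp, OF K(2), THEN mp, OF \<beta>,
            of "\<lambda>x. grad q x \<bullet> \<beta>" "C1 * s / diameter K"] by blast
      define Q where "Q = (\<lambda>x. (1 / real (k + 1)) * (((x - x0) \<bullet> \<beta>) ^ (k + 1) * q x - Q' x))"
      note lP = l_Poly[OF q, of x0 \<beta> k]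
      have Q'P: "Q' \<in> Poly (Suc m + k + 1)" using Q'(1) by simp
      note dP = Poly_diff[OF lP Q'P]
      have g: "grad Q x \<bullet> \<beta> = ((x - x0) \<bullet> \<beta>) ^ k * q x" for x
      proof -
        let ?l = "\<lambda>x. ((x - x0) \<bullet> \<beta>) ^ (k + 1) * q x"
        have "grad Q x = (1 / real (k + 1)) *\<^sub>R (grad ?l x - grad Q' x)"
          unfolding Q_def using grad_cmult[OF Poly_smooth[OF dP]] grad_diff[OF Poly_smooth[OF lP] Poly_smooth[OF Q'P]] by metis
        then have "grad Q x \<bullet> \<beta> = (1 / real (k + 1)) * (grad ?l x \<bullet> \<beta> - grad Q' x \<bullet> \<beta>)"
          by (simp only: inner_scaleR_left inner_diff_left)
        then show ?thesis unfolding l_grad[OF \<beta> Poly_smooth[OF q]] Q'(2) by simp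
      qed
      have b: "\<bar>Q x\<bar> \<le> (1 + C2 * C1) * s * diameter K ^ (k + 1)" if x: "x \<in> K" for x
      proof -
        have "\<bar>Q x\<bar> \<le> \<bar>((x - x0) \<bullet> \<beta>) ^ (k + 1) * q x - Q' x\<bar>"
          unfolding Q_def abs_mult by (intro mult_left_le_one_le) auto
        also have "\<dots> \<le> \<bar>((x - x0) \<bullet> \<beta>) ^ (k + 1) * q x\<bar> + \<bar>Q' x\<bar>" by (rule abs_triangle_ineq4)
        also have "\<dots> \<le> s * diameter K ^ (k + 1) + C2 * (C1 * s / diameter K) * diameter K ^ (k + 1 + 1)"
          using l_sup[OF K x \<beta>, of q s k] s x Q'(3)[OF x] by (intro add_mono) auto
        also have "\<dots> = (1 + C2 * C1) * s * diameter K ^ (k + 1)" using d by (simp add: field_simps)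
        finally show ?thesis .
      qed
      show "\<exists>Q\<in>Poly (Suc m + k + 1). (\<forall>x. grad Q x \<bullet> \<beta> = ((x - x0) \<bullet> \<beta>) ^ k * q x) \<and> (\<forall>x\<in>K. \<bar>Q x\<bar> \<le> (1 + C2 * C1) * s * diameter K ^ (k + 1))"
        using Poly_cmult[OF dP, of "1 / real (k + 1)"] g b unfolding Q_def by blast
    qed (use C1 C2 in auto)
  }
qed

text \<open>The streamline primitive for the unit vector in direction \<beta>, divided by
  \<open>norm \<beta>\<close>; sup bounds are converted to L2 by norm equivalence. The gradient
  bound stays pointwise because it will be multiplied by coefficients that are merely bounded almost
  everywhere.\<close>

proposition Poly_advection_solvable:
  assumes \<eta>: "0 < \<eta>"
  shows "\<exists>C\<ge>0. \<forall>(K :: (real^'n) set) \<beta> e. fat \<eta> K \<longrightarrow> \<beta> \<noteq> 0 \<longrightarrow> e \<in> Poly m \<longrightarrow>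
     (\<exists>v\<in>Poly (m + 1). (\<forall>x. grad v x \<bullet> \<beta> = e x) \<and>
        (LINT x|lebesgue_on K. (v x)\<^sup>2) \<le> (C * diameter K / norm \<beta>)\<^sup>2 * (LINT x|lebesgue_on K. (e x)\<^sup>2) \<and>
        (\<forall>x\<in>K. (norm (grad v x))\<^sup>2 * measure lebesgue K \<le> (C / norm \<beta>)\<^sup>2 * (LINT x|lebesgue_on K. (e x)\<^sup>2)))"
proof -
  obtain C1 where C1: "0 \<le> C1" and C1': "\<forall>(K :: (real^'n) set) p. fat \<eta> K \<longrightarrow> p \<in> Poly m \<longrightarrow> (\<forall>x\<in>K.
     (p x)\<^sup>2 * diameter K ^ CARD('n) \<le> C1 * (LINT x|lebesgue_on K. (p x)\<^sup>2) \<and>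
     (\<forall>i. (diameter K * grad p x $ i)\<^sup>2 * diameter K ^ CARD('n) \<le> C1 * (LINT x|lebesgue_on K. (p x)\<^sup>2)))"
    using Poly_bound_fat[OF \<eta>, of m, where 'n='n] by (elim exE conjE) (rule that; assumption)
  obtain C2 where C2: "0 \<le> C2" "\<forall>(K :: (real^'n) set) p s. fat \<eta> K \<longrightarrow> p \<in> Poly (m + 1) \<longrightarrow> (\<forall>x\<in>K. \<bar>p x\<bar> \<le> s) \<longrightarrow>
     (\<forall>x\<in>K. norm (grad p x) \<le> C2 * s / diameter K)"
    using Poly_inverse_sup[OF \<eta>, of "m + 1", where 'n='n] by (elim exE conjE) (rule that; assumption)
  obtain C3 where C3: "0 \<le> C3" "\<forall>(K :: (real^'n) set) x0 \<beta> q s. fat \<eta> K \<longrightarrow> x0 \<in> K \<longrightarrow> norm \<beta> = 1 \<longrightarrow> q \<in> Poly m \<longrightarrow>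
     (\<forall>x\<in>K. \<bar>q x\<bar> \<le> s) \<longrightarrow>
     (\<exists>Q\<in>Poly (m + 0 + 1). (\<forall>x. grad Q x \<bullet> \<beta> = ((x - x0) \<bullet> \<beta>) ^ 0 * q x) \<and>
        (\<forall>x\<in>K. \<bar>Q x\<bar> \<le> C3 * s * diameter K ^ (0 + 1)))"
    using Poly_streamline_primitive[OF \<eta>, of m 0, where 'n='n] by (elim exE conjE) (rule that; assumption)
  define \<omega> where "\<omega> = measure lebesgue (cball (0::real^'n) 1)"
  \<comment> \<open>The cost of passing from the L2 norm of \<open>e\<close> to its sup bound
    \<open>s\<close> and back: \<open>s\<^sup>2 * measure lebesgue K\<close> is at most
    \<open>c\<^sup>2 * J\<close>. The two summands of \<open>C\<close> serve \<open>v\<close> and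
    its gradient.\<close>
  define c where "c = sqrt (C1 * \<omega>)"
  have w0: "0 \<le> \<omega>" by (simp add: \<omega>_def)
  have c0: "0 \<le> c" "c\<^sup>2 = C1 * \<omega>" using C1 w0 by (auto simp: c_def)
  define C where "C = c * C3 + c * (C2 * C3)"
  have C0: "0 \<le> C" "c * C3 \<le> C" "c * (C2 * C3) \<le> C" using c0 C2(1) C3(1) by (auto simp: C_def)
  have "\<exists>v\<in>Poly (m + 1). (\<forall>x. grad v x \<bullet> \<beta> = e x) \<and>
        (LINT x|lebesgue_on K. (v x)\<^sup>2) \<le> (C * diameter K / norm \<beta>)\<^sup>2 * (LINT x|lebesgue_on K. (e x)\<^sup>2) \<and>
        (\<forall>x\<in>K. (norm (grad v x))\<^sup>2 * measure lebesgue K \<le> (C / norm \<beta>)\<^sup>2 * (LINT x|lebesgue_on K. (e x)\<^sup>2))"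
    if K: "fat \<eta> K" and \<beta>: "\<beta> \<noteq> 0" and e: "e \<in> Poly m" for K :: "(real^'n) set" and \<beta> e
  proof -
    define d where "d = diameter K"
    define J where "J = (LINT x|lebesgue_on K. (e x)\<^sup>2)"
    have d: "0 < d" using K by (simp add: fat_def d_def)
    have J: "0 \<le> J" unfolding J_def by (rule integral_nonneg_AE) simp
    have cK: "compact K" using K by (simp add: fat_def)
    obtain x0 where "cball x0 (\<eta> * diameter K) \<subseteq> K" using K by (auto simp: fat_def)
    then have x0: "x0 \<in> K" using d \<eta> by (auto simp: d_def)
    define s where "s = sqrt (C1 * J / d ^ CARD('n))"
    have s: "0 \<le> s" "s\<^sup>2 * d ^ CARD('n) = C1 * J" using C1 J d by (auto simp: s_def)
    have es: "\<bar>e x\<bar> \<le> s" if "x \<in> K" for x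
    proof -
      have "(e x)\<^sup>2 \<le> C1 * J / d ^ CARD('n)" using C1'[THEN spec, THEN spec, THEN mp, OF K, THEN mp, OF e, THEN bspec, OF that] d by (simp add: J_def d_def pos_le_divide_eq)
      then have "sqrt ((e x)\<^sup>2) \<le> s" unfolding s_def by (rule real_sqrt_le_mono)
      then show ?thesis by simp
    qed
    let ?b = "(1 / norm \<beta>) *\<^sub>R \<beta>"
    have nb: "norm ?b = 1" using \<beta> by simp
    obtain Q where Q: "Q \<in> Poly (m + 1)" "\<And>x. grad Q x \<bullet> ?b = e x" "\<And>x. x \<in> K \<Longrightarrow> \<bar>Q x\<bar> \<le> C3 * s * d"
    proof -
      have "\<exists>Q\<in>Poly (m + 0 + 1). (\<forall>x. grad Q x \<bullet> ?b = ((x - x0) \<bullet> ?b) ^ 0 * e x) \<and>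
          (\<forall>x\<in>K. \<bar>Q x\<bar> \<le> C3 * s * diameter K ^ (0 + 1))"
        by (rule C3(2)[THEN spec, THEN spec, THEN spec, THEN spec, THEN spec, THEN mp, OF K, THEN mp, OF x0, THEN mp, OF nb, THEN mp, OF e, THEN mp])
          (use es in blast)
      then show ?thesis using that by (auto simp: d_def)
    qed
    define v where "v = (\<lambda>x. (1 / norm \<beta>) * Q x)"
    have gv: "grad v x = (1 / norm \<beta>) *\<^sub>R grad Q x" for x
      unfolding v_def by (rule grad_cmult[OF Poly_smooth[OF Q(1)]])
    have vP: "v \<in> Poly (m + 1)" unfolding v_def by (rule Poly_cmult[OF Q(1)])
    have mK: "measure lebesgue K \<le> \<omega> * d ^ CARD('n)" using measure_fat_le[OF K \<eta>] by (simp add: \<omega>_def d_def)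
    have s2: "s\<^sup>2 * measure lebesgue K \<le> c\<^sup>2 * J"
    proof -
      have "s\<^sup>2 * measure lebesgue K \<le> s\<^sup>2 * (\<omega> * d ^ CARD('n))" by (intro mult_left_mono mK) simp
      also have "\<dots> = \<omega> * (s\<^sup>2 * d ^ CARD('n))" by (simp add: mult_ac)
      also have "\<dots> = c\<^sup>2 * J" unfolding s(2) c0(2) by (simp add: mult_ac)
      finally show ?thesis .
    qed
    \<comment> \<open>Common conversion of a sup bound \<open>t * s\<close> into an L2 bound, used
      with r = d / norm \<beta> for the solution and r = 1 / norm \<beta> for its gradient.\<close>
    have fin: "(t * s)\<^sup>2 * measure lebesgue K \<le> (u * r)\<^sup>2 * J" if "t = u' * r" "c * u' \<le> u" "0 \<le> u'" for t u u' r
    proof -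
      have "(t * s)\<^sup>2 * measure lebesgue K = t\<^sup>2 * (s\<^sup>2 * measure lebesgue K)" by (simp add: power_mult_distrib)
      also have "\<dots> \<le> t\<^sup>2 * (c\<^sup>2 * J)" by (intro mult_left_mono s2) simp
      also have "\<dots> = (c * u')\<^sup>2 * (r\<^sup>2 * J)" by (simp add: that(1) power_mult_distrib mult_ac)
      also have "\<dots> \<le> u\<^sup>2 * (r\<^sup>2 * J)"
        using that c0 J by (intro mult_right_mono power_mono) auto
      finally show ?thesis by (simp add: power_mult_distrib mult_ac)
    qed
    have "(LINT x|lebesgue_on K. (v x)\<^sup>2) \<le> ((C3 * (d / norm \<beta>)) * s)\<^sup>2 * measure lebesgue K"
    proof (rule LINT_square_le_sup[OF cK Poly_continuous[OF vP]])
      fix x assume "x \<in> K"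
      then show "\<bar>v x\<bar> \<le> (C3 * (d / norm \<beta>)) * s"
        using Q(3)[of x] \<beta> by (simp add: v_def abs_mult divide_right_mono mult_ac)
    qed
    also have "\<dots> \<le> (C * (d / norm \<beta>))\<^sup>2 * J" by (rule fin[OF refl C0(2) C3(1)])
    finally have 1: "(LINT x|lebesgue_on K. (v x)\<^sup>2) \<le> (C * d / norm \<beta>)\<^sup>2 * J" by simp
    have 2: "(norm (grad v x))\<^sup>2 * measure lebesgue K \<le> (C / norm \<beta>)\<^sup>2 * J" if x: "x \<in> K" for x
    proof -
      have "norm (grad Q x) \<le> C2 * (C3 * s * d) / d" unfolding d_def
        by (rule C2(2)[THEN spec, THEN spec, THEN spec, THEN mp, OF K, THEN mp, OF Q(1), THEN mp, THEN bspec, OF _ x])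
          (use Q(3) in \<open>auto simp: d_def\<close>)
      then have "norm (grad Q x) \<le> C2 * C3 * s" using d by simp
      then have "norm (grad v x) \<le> ((C2 * C3) * (1 / norm \<beta>)) * s"
        unfolding gv using \<beta> by (simp add: divide_right_mono mult_ac)
      then have "(norm (grad v x))\<^sup>2 * measure lebesgue K \<le> (((C2 * C3) * (1 / norm \<beta>)) * s)\<^sup>2 * measure lebesgue K"
        by (intro mult_right_mono power_mono) auto
      also have "\<dots> \<le> (C * (1 / norm \<beta>))\<^sup>2 * J" by (rule fin[OF refl C0(3)]) (use C2(1) C3(1) in auto)
      finally show ?thesis by simp
    qed
    have "grad v x \<bullet> \<beta> = e x" for x using Q(2)[of x] by (simp add: gv)
    then show ?thesis using vP 1 2 unfolding J_def d_def by blast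
  qed
  then show ?thesis using C0(1) by blast
qed

section \<open>Simplices and triangulations\<close>

lemma simplex_props:
  fixes K :: "(real^'n) set"
  assumes "int CARD('n) simplex K"
  shows "compact K" "convex K" "interior K \<noteq> {}" "negligible (frontier K)" "0 < diameter K"
proof -
  show cK: "compact K" and vK: "convex K" using assms compact_simplex convex_simplex by blast+
  have "aff_dim K = int CARD('n)" using aff_dim_simplex[OF assms] .
  then show i: "interior K \<noteq> {}" using interior_rel_interior_gen[of K] rel_interior_eq_empty[OF vK]
    by (metis DIM_cart DIM_real aff_dim_empty mult.right_neutral nat_int of_nat_0_le_iff of_nat_less_0_iff less_minus_one_simps(1) linorder_not_less)
  show "negligible (frontier K)" by (rule negligible_convex_frontier[OF vK])
  obtain x r where r: "0 < r" "cball x r \<subseteq> K"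
    using i by (metis ex_in_conv mem_interior_cball)
  have "diameter (cball x r) \<le> diameter K"
    using r cK by (intro diameter_subset compact_imp_bounded)
  then show "0 < diameter K" using r by simp
qed

text \<open>The 4 has two sources: a ball is taken whose diameter exceeds half the supremum,
  avoiding the question whether it is attained, and a diameter is twice a radius.\<close>

lemma shape_const_fat:
  fixes K :: "(real^'n) set"
  assumes K: "int CARD('n) simplex K" and \<rho>: "shape_const K \<le> \<rho>" "1 \<le> \<rho>"
  shows "fat (1 / (4 * \<rho>)) K"
proof -
  note S = simplex_props[OF K]
  define A where "A = {diameter (cball x r) |x r. 0 \<le> r \<and> cball x r \<subseteq> K}"
  have bdd: "bdd_above A"
    unfolding A_def bdd_above_def
    using diameter_subset[OF _ compact_imp_bounded[OF S(1)]] by blast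
  obtain x r where r: "0 < r" "cball x r \<subseteq> K"
    using S(3) by (metis ex_in_conv mem_interior_cball)
  then have rA: "diameter (cball x r) \<in> A" unfolding A_def
    by (intro CollectI exI[of _ x] exI[of _ r]) auto
  then have pos: "0 < Sup A" using cSup_upper[OF rA bdd] r by simp
  have "diameter K / Sup A \<le> \<rho>" using \<rho>(1) by (simp add: shape_const_def A_def)
  then have le: "diameter K \<le> \<rho> * Sup A" using pos by (simp add: divide_le_eq)
  have "Sup A / 2 < Sup A" using pos by simp
  then obtain a where a: "a \<in> A" "Sup A / 2 < a" using less_cSup_iff[OF _ bdd] rA by blast
  then obtain z s where z: "a = diameter (cball z s)" "0 \<le> s" "cball z s \<subseteq> K" unfolding A_def by blast
  have "Sup A < 4 * s" using a z by simp
  then have "\<rho> * Sup A \<le> \<rho> * (4 * s)" using \<rho>(2) by (intro mult_left_mono) auto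
  then have "diameter K \<le> \<rho> * (4 * s)" using le by linarith
  then have "1 / (4 * \<rho>) * diameter K \<le> s" using \<rho>(2) by (simp add: field_simps)
  then have "cball z (1 / (4 * \<rho>) * diameter K) \<subseteq> K" using z(3) subset_cball by blast
  then show ?thesis using S unfolding fat_def by blast
qed

lemma obtained_from_partition:
  assumes "obtained_from rul T0 T" "simplicial_partition S T0" "refinement_rule rul"
  shows "simplicial_partition S T"
  using assms
proof (induction rule: obtained_from.induct)
  case initial then show ?case by simp
next
  case (split T K)
  then have T: "simplicial_partition S T" by simp
  then have "int CARD('a) simplex K" using split(2) by (simp add: simplicial_partition_def)
  then have R: "simplicial_partition K (rul K)" using split.prems(2) by (simp add: refinement_rule_def)
  have fin: "finite (T - {K} \<union> rul K)" and sim: "\<forall>L\<in>T - {K} \<union> rul K. int CARD('a) simplex L"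
    using T R by (auto simp: simplicial_partition_def)
  have un: "\<Union>(T - {K} \<union> rul K) = S"
  proof -
    have "\<Union>(rul K) = K" "\<Union>T = S" using T R by (simp_all add: simplicial_partition_def)
    then show ?thesis using split(2) by auto
  qed
  have neg: "negligible (L \<inter> M)" if LM: "L \<in> T - {K} \<union> rul K" "M \<in> T - {K} \<union> rul K" "L \<noteq> M" for L M
  proof -
    have sub: "L' \<subseteq> K" if "L' \<in> rul K" for L' using R that by (auto simp: simplicial_partition_def)
    have TT: "negligible (L' \<inter> M')" if "L' \<in> T" "M' \<in> T" "L' \<noteq> M'" for L' M'
      using T that by (auto simp: simplicial_partition_def)
    have RR: "negligible (L' \<inter> M')" if "L' \<in> rul K" "M' \<in> rul K" "L' \<noteq> M'" for L' M'
      using R that by (auto simp: simplicial_partition_def)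
    consider "L \<in> T" "M \<in> T" | "L \<in> rul K" "M \<in> rul K" | "L \<in> rul K" "M \<in> T - {K}" | "L \<in> T - {K}" "M \<in> rul K"
      using LM by blast
    then show ?thesis
    proof cases
      case 3
      then have "negligible (K \<inter> M)" using TT split(2) by blast
      then show ?thesis by (rule negligible_subset) (use sub 3 in blast)
    next
      case 4
      then have "negligible (L \<inter> K)" using TT split(2) by blast
      then show ?thesis by (rule negligible_subset) (use sub 4 in blast)
    qed (use TT RR LM in auto)
  qed
  show ?case unfolding simplicial_partition_def using fin sim un neg by blast
qed

section \<open>Integration over the elements of a triangulation\<close>

lemma AE_null_diff:
  assumes "negligible (A - B)" "negligible (B - A)"
  shows "AE x in lebesgue. x \<in> A \<longleftrightarrow> x \<in> B"
  using AE_not_negligible[OF assms(1)] AE_not_negligible[OF assms(2)] by eventually_elim auto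

lemma integrable_null_diff:
  fixes F :: "real^'n \<Rightarrow> real"
  assumes AB: "A \<in> sets lebesgue" "B \<in> sets lebesgue" and n: "negligible (A - B)" "negligible (B - A)"
    and F: "integrable (lebesgue_on A) F"
  shows "integrable (lebesgue_on B) F" "(LINT x|lebesgue_on B. F x) = (LINT x|lebesgue_on A. F x)"
proof -
  have FA: "integrable lebesgue (\<lambda>x. indicator A x *\<^sub>R F x)"
    using F AB by (simp add: integrable_on_iff set_integrable_def)
  have eq: "AE x in lebesgue. indicator B x *\<^sub>R F x = indicator A x *\<^sub>R F x"
    using AE_null_diff[OF n] by eventually_elim (auto simp: indicator_def)
  have m: "(\<lambda>x. indicator B x *\<^sub>R F x) \<in> borel_measurable lebesgue"
    by (rule measurable_on_cong_AE[where S = UNIV, unfolded lebesgue_on_UNIV_eq, OF borel_measurable_integrable[OF FA] eq]) simp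
  have "integrable lebesgue (\<lambda>x. indicator B x *\<^sub>R F x)"
    by (rule integrable_cong_AE_imp[OF FA m]) (use eq in \<open>auto elim: eventually_mono\<close>)
  then show "integrable (lebesgue_on B) F" using AB by (simp add: integrable_on_iff set_integrable_def)
  show "(LINT x|lebesgue_on B. F x) = (LINT x|lebesgue_on A. F x)"
    unfolding LINT_on[OF AB(1)] LINT_on[OF AB(2)] set_lebesgue_integral_def
    by (rule integral_cong_AE[OF m _ eq]) (use FA in auto)
qed

text \<open>Regularity of the domain is what puts the interior of each closed element inside
  \<Omega>. Element boundaries being null, closed elements, on which piecewise polynomials are
  prescribed, and open interiors, on which weak derivatives live, are interchangeable almost
  everywhere.\<close>

locale triangulation =
  fixes \<Omega> :: "(real^'n) set" and T :: "(real^'n) set set"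
  assumes open_dom: "open \<Omega>" and bounded_dom: "bounded \<Omega>" and regular_dom: "interior (closure \<Omega>) = \<Omega>"
    and partition: "simplicial_partition (closure \<Omega>) T"
begin

lemma finite_T: "finite T" and simplex_T: "K \<in> T \<Longrightarrow> int CARD('n) simplex K"
  and Union_T: "\<Union>T = closure \<Omega>"
  and inter_T: "K \<in> T \<Longrightarrow> L \<in> T \<Longrightarrow> K \<noteq> L \<Longrightarrow> negligible (K \<inter> L)"
  using partition by (auto simp: simplicial_partition_def)

lemmas element = simplex_props[OF simplex_T]

lemma dom_sets: "\<Omega> \<in> sets lebesgue" and dom_lmeasurable: "\<Omega> \<in> lmeasurable"
  using open_dom bounded_dom open_sets_lebesgue lmeasurable_open by blast+

lemma element_sets: "K \<in> T \<Longrightarrow> K \<in> sets lebesgue" and element_lmeasurable: "K \<in> T \<Longrightarrow> K \<in> lmeasurable"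
  using element(1) compact_sets_lebesgue compact_lmeasurable by blast+

lemma interior_subset_dom: "K \<in> T \<Longrightarrow> interior K \<subseteq> \<Omega>"
  using Union_T interior_mono[of K "closure \<Omega>"] regular_dom by auto

lemma interior_sets: "interior K \<in> sets lebesgue"
  using open_sets_lebesgue by blast

lemma interior_bounded: "K \<in> T \<Longrightarrow> bounded (interior K)"
  using interior_subset_dom bounded_dom bounded_subset by blast

lemma element_boundary: "K \<in> T \<Longrightarrow> negligible (K - interior K)"
  by (rule negligible_subset[OF element(4)]) (auto simp: frontier_def closure_subset[THEN subsetD])

text \<open>A point of the closure outside \<Omega> lies in some element but not in its interior,
  and the frontier of a convex set is null.\<close>

lemma closure_boundary: "negligible (closure \<Omega> - \<Omega>)"
proof (rule negligible_subset)
  show "negligible (\<Union>K\<in>T. K - interior K)"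
    using finite_T element_boundary by (intro negligible_Union) auto
  show "closure \<Omega> - \<Omega> \<subseteq> (\<Union>K\<in>T. K - interior K)"
    using Union_T interior_subset_dom by blast
qed

lemma element_minus_dom: "K \<in> T \<Longrightarrow> negligible (K - \<Omega>)"
  by (rule negligible_subset[OF element_boundary]) (use interior_subset_dom in auto)

lemma AE_element_from_interior:
  assumes "K \<in> T" "AE x in lebesgue_on (interior K). P x" shows "AE x in lebesgue_on K. P x"
proof -
  have "AE x in lebesgue. x \<in> interior K \<longrightarrow> P x" using assms interior_sets by (simp add: AE_on_iff)
  then have "AE x in lebesgue. x \<in> K \<longrightarrow> P x"
    using AE_not_negligible[OF element_boundary[OF assms(1)]] by eventually_elim auto
  then show ?thesis using element_sets[OF assms(1)] by (simp add: AE_on_iff)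
qed

lemma AE_interior_from_element:
  assumes "K \<in> T" "AE x in lebesgue_on K. P x" shows "AE x in lebesgue_on (interior K). P x"
  by (rule AE_on_subset[OF assms(2) interior_subset element_sets[OF assms(1)] interior_sets])

lemma AE_element_from_dom:
  assumes "K \<in> T" "AE x in lebesgue_on \<Omega>. P x" shows "AE x in lebesgue_on K. P x"
  by (rule AE_element_from_interior[OF assms(1)], rule AE_on_subset[OF assms(2) _ dom_sets interior_sets])
    (rule interior_subset_dom[OF assms(1)])

lemma AE_dom_from_elements:
  assumes "\<And>K. K \<in> T \<Longrightarrow> AE x in lebesgue_on K. P x" shows "AE x in lebesgue_on \<Omega>. P x"
proof -
  have "AE x in lebesgue. \<forall>K\<in>T. x \<in> K \<longrightarrow> P x"
    using assms element_sets by (intro AE_finite_allI finite_T) (simp add: AE_on_iff)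
  then have "AE x in lebesgue. x \<in> \<Omega> \<longrightarrow> P x"
    by eventually_elim (use Union_T closure_subset in blast)
  then show ?thesis using dom_sets by (simp add: AE_on_iff)
qed

lemma element_null_diff:
  assumes "K \<in> T" shows "negligible (K \<inter> \<Omega> - K)" "negligible (K - K \<inter> \<Omega>)" "K \<inter> \<Omega> \<in> sets lebesgue"
  using element_minus_dom[OF assms] element_sets[OF assms] dom_sets by (auto simp: Diff_Int_distrib Diff_Int)

lemma integrable_element:
  fixes F :: "real^'n \<Rightarrow> real"
  assumes "K \<in> T" "integrable (lebesgue_on \<Omega>) F" shows "integrable (lebesgue_on K) F"
proof -
  have "integrable (lebesgue_on (K \<inter> \<Omega>)) F"
    unfolding integrable_on_iff[OF element_null_diff(3)[OF assms(1)]]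
    by (rule set_integrable_subset[of _ \<Omega>]) (use assms dom_sets element_null_diff(3) in \<open>auto simp: integrable_on_iff\<close>)
  then show ?thesis
    using integrable_null_diff(1)[OF element_null_diff(3) element_sets element_null_diff(1,2)] assms(1) by blast
qed

lemma LINT_partition:
  fixes F :: "real^'n \<Rightarrow> real"
  assumes F: "integrable (lebesgue_on \<Omega>) F"
  shows "(LINT x|lebesgue_on \<Omega>. F x) = (\<Sum>K\<in>T. LINT x|lebesgue_on K. F x)"
proof -
  have cs: "closure \<Omega> \<in> sets lebesgue" by (simp add: borel_closed)
  have "negligible (\<Omega> - closure \<Omega>)" using closure_subset[of \<Omega>] by (simp add: Diff_eq_empty_iff[THEN iffD2])
  then have "(LINT x|lebesgue_on \<Omega>. F x) = (LINT x|lebesgue_on (closure \<Omega>). F x)"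
    using integrable_null_diff(2)[OF dom_sets cs _ closure_boundary F] by simp
  also have "\<dots> = (LINT x:(\<Union>K\<in>T. K)|lebesgue. F x)" using LINT_on[OF cs] Union_T by simp
  also have "\<dots> = (\<Sum>K\<in>T. LINT x:K|lebesgue. F x)"
  proof (rule set_integral_finite_UN_AE[OF finite_T])
    fix K L assume KL: "K \<in> T" "L \<in> T"
    show "AE x in lebesgue. x \<in> K \<and> x \<in> L \<longrightarrow> K = L"
    proof (cases "K = L")
      case False
      show ?thesis using AE_not_negligible[OF inter_T[OF KL False]] by eventually_elim auto
    qed simp
  next
    fix K assume K: "K \<in> T"
    show "K \<in> sets lebesgue" by (rule element_sets[OF K])
    show "set_integrable lebesgue K F" using integrable_element[OF K F] integrable_on_iff[OF element_sets[OF K]] by blast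
  qed
  also have "\<dots> = (\<Sum>K\<in>T. LINT x|lebesgue_on K. F x)" by (intro sum.cong refl) (simp only: LINT_on[OF element_sets])
  finally show ?thesis .
qed

text \<open>A closed element may stick out of \<Omega>, where nothing is known about
  \<open>h\<close>. Cutting \<open>h\<close> off to the interior alters it on \<open>K\<close> only
  in a null set.\<close>

lemma Linf_element:
  assumes "K \<in> T" "h \<in> Linf \<Omega>" shows "h \<in> Linf K"
proof (rule Linf_cong_AE[OF _ _ element_sets[OF assms(1)]])
  let ?g = "\<lambda>x. indicator (interior K) x *\<^sub>R h x"
  have hi: "h \<in> Linf (interior K)"
    by (rule Linf_subset[OF assms(2) interior_subset_dom[OF assms(1)] dom_sets interior_sets])
  have "?g \<in> borel_measurable lebesgue"
    using Linf_measurable[OF hi] measurable_on_iff[OF interior_sets] by blast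
  then have m: "?g \<in> borel_measurable (lebesgue_on K)" by (rule measurable_restrict_space1)
  have "AE x in lebesgue_on (interior K). norm (?g x) \<le> norm_Linf (interior K) h"
    using Linf_AE[OF hi] by eventually_elim (auto simp: indicator_def intro: norm_Linf_nonneg)
  then show "?g \<in> Linf K" unfolding Linf_iff using m AE_element_from_interior[OF assms(1)] by blast
  show "AE x in lebesgue_on K. h x = ?g x"
    by (rule AE_element_from_interior[OF assms(1)]) (use interior_sets in \<open>simp add: AE_on_iff\<close>)
qed

text \<open>A sum of cut-offs, so that measurability is immediate; almost everywhere on an element
  exactly one summand survives. The general codomain allows gluing gradients as well.\<close>

definition glue :: "((real^'n) set \<Rightarrow> real^'n \<Rightarrow> 'b::euclidean_space) \<Rightarrow> real^'n \<Rightarrow> 'b" where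
  "glue p x = (\<Sum>K\<in>T. indicator (interior K) x *\<^sub>R p K x)"

lemma glue_AE:
  assumes K: "K \<in> T" shows "AE x in lebesgue_on K. glue p x = p K x"
proof (rule AE_element_from_interior[OF K])
  have "AE x in lebesgue. \<forall>L\<in>T. L \<noteq> K \<longrightarrow> x \<notin> K \<inter> L"
    by (intro AE_finite_allI finite_T) (use AE_not_negligible[OF inter_T[OF K]] in fastforce)
  then have "AE x in lebesgue. x \<in> interior K \<longrightarrow> glue p x = p K x"
  proof eventually_elim
    case (elim x)
    show ?case
    proof
      assume x: "x \<in> interior K"
      have "(\<Sum>L\<in>T. indicator (interior L) x *\<^sub>R p L x) = (\<Sum>L\<in>T. if L = K then p K x else 0)"
      proof (rule sum.cong[OF refl])
        fix L assume "L \<in> T"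
        then show "indicator (interior L) x *\<^sub>R p L x = (if L = K then p K x else 0)"
          using elim x interior_subset[of K] interior_subset[of L] by (auto simp: indicator_def)
      qed
      then show "glue p x = p K x" using K finite_T by (simp add: glue_def)
    qed
  qed
  then show "AE x in lebesgue_on (interior K). glue p x = p K x" using interior_sets by (simp add: AE_on_iff)
qed

lemma glue_Linf:
  assumes "\<And>K. K \<in> T \<Longrightarrow> continuous_on UNIV (p K)" shows "glue p \<in> Linf \<Omega>"
  unfolding glue_def
proof (rule Linf_sum)
  fix K assume K: "K \<in> T"
  have pL: "p K \<in> Linf \<Omega>" by (rule continuous_Linf[OF assms[OF K] bounded_dom dom_sets])
  have i: "indicat_real (interior K) \<in> borel_measurable (lebesgue_on \<Omega>)"
    by (intro measurable_restrict_space1 borel_measurable_indicator interior_sets)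
  have "(\<lambda>x. indicat_real (interior K) x *\<^sub>R p K x) \<in> borel_measurable (lebesgue_on \<Omega>)"
    by (rule borel_measurable_scaleR[OF i Linf_measurable[OF pL]])
  moreover have "AE x in lebesgue_on \<Omega>. norm (indicat_real (interior K) x *\<^sub>R p K x) \<le> norm_Linf \<Omega> (p K)"
    using Linf_AE[OF pL] by eventually_elim (auto simp: indicator_def intro: norm_Linf_nonneg)
  ultimately show "(\<lambda>x. indicator (interior K) x *\<^sub>R p K x) \<in> Linf \<Omega>" unfolding Linf_iff by blast
qed

lemma pw_polyE:
  assumes "v \<in> pw_poly T m"
  obtains p where "\<And>K. K \<in> T \<Longrightarrow> p K \<in> Poly m" "\<And>K. K \<in> T \<Longrightarrow> AE x in lebesgue_on K. v x = p K x"
proof -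
  have "\<forall>K\<in>T. \<exists>p. p \<in> Poly m \<and> (AE x in lebesgue_on K. v x = p x)" using assms by (auto simp: pw_poly_def)
  then show ?thesis using that by metis
qed

text \<open>\<open>pw_poly\<close> contains no measurability condition; measurability and the bound
  come from the glued polynomials, with which the function agrees almost everywhere.\<close>

lemma pw_poly_Linf:
  assumes "v \<in> pw_poly T m" shows "v \<in> Linf \<Omega>"
proof -
  obtain p where p: "\<And>K. K \<in> T \<Longrightarrow> p K \<in> Poly m" "\<And>K. K \<in> T \<Longrightarrow> AE x in lebesgue_on K. v x = p K x"
    using pw_polyE[OF assms] by blast
  have "AE x in lebesgue_on \<Omega>. v x = glue p x"
    by (rule AE_dom_from_elements) (use p(2) glue_AE[of _ p] in \<open>fastforce elim: eventually_elim2\<close>)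
  then show ?thesis using Linf_cong_AE[OF glue_Linf _ dom_sets] p(1) Poly_continuous by blast
qed

lemma pw_poly_L2: "v \<in> pw_poly T m \<Longrightarrow> v \<in> L2 \<Omega>"
  using Linf_L2[OF pw_poly_Linf dom_lmeasurable] .

lemma glue_pw_poly:
  assumes "\<And>K. K \<in> T \<Longrightarrow> p K \<in> Poly m" shows "glue p \<in> pw_poly T m"
  unfolding pw_poly_def using assms glue_AE by blast

end

section \<open>Advective derivatives relative to a triangulation\<close>

locale transport_mesh = triangulation \<Omega> T for \<Omega> :: "(real^'n) set" and T +
  fixes b :: "real^'n \<Rightarrow> real^'n"
  assumes b_Linf: "b \<in> Linf \<Omega>" and div_ex: "\<exists>d\<in>Linf \<Omega>. weak_div \<Omega> b d"
begin

text \<open>The product of \<open>b\<close> with the glued gradients is a square integrable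
  candidate, so the choice in \<open>adv_pw\<close> is meaningful; uniqueness on each interior then
  identifies the chosen function with the classical derivative.\<close>

lemma adv_pw_props:
  assumes v: "v \<in> pw_poly T m"
  shows "adv_pw \<Omega> T b v \<in> L2 \<Omega>"
    and "K \<in> T \<Longrightarrow> smooth p \<Longrightarrow> AE x in lebesgue_on K. v x = p x \<Longrightarrow>
      AE x in lebesgue_on K. adv_pw \<Omega> T b v x = b x \<bullet> grad p x"
proof -
  obtain q where q: "\<And>K. K \<in> T \<Longrightarrow> q K \<in> Poly m" "\<And>K. K \<in> T \<Longrightarrow> AE x in lebesgue_on K. v x = q K x"
    using pw_polyE[OF v] by blast
  have qs: "\<And>K. K \<in> T \<Longrightarrow> smooth (q K)" using q(1) Poly_smooth by blast
  let ?G = "\<lambda>x. b x \<bullet> glue (\<lambda>K. grad (q K)) x"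
  have "glue (\<lambda>K. grad (q K)) \<in> Linf \<Omega>" by (intro glue_Linf smooth_grad_continuous qs)
  then have G2: "?G \<in> L2 \<Omega>" by (intro Linf_L2 Linf_inner b_Linf dom_lmeasurable)
  have bK: "b \<in> Linf (interior K)" "\<exists>d\<in>Linf (interior K). weak_div (interior K) b d" "v \<in> L2 (interior K)" if K: "K \<in> T" for K
    using Linf_subset[OF b_Linf interior_subset_dom[OF K] dom_sets interior_sets]
      wdiv_subset(4)[OF open_dom bounded_dom open_interior interior_subset_dom[OF K] div_ex]
      L2_subset[OF pw_poly_L2[OF v] interior_subset_dom[OF K] dom_sets interior_sets] by blast+
  have classical: "AE x in lebesgue_on K. g x = b x \<bullet> grad p x"
    if K: "K \<in> T" and g: "g \<in> L2 \<Omega>" "weak_adv (interior K) b v g" and p: "smooth p" "AE x in lebesgue_on K. v x = p x" for K g p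
    by (rule AE_element_from_interior[OF K], rule weak_adv_eq_classical[OF open_interior interior_bounded[OF K]
          open_interior order_refl bK[OF K] L2_subset[OF g(1) interior_subset_dom[OF K] dom_sets interior_sets] g(2) p(1)])
      (rule AE_interior_from_element[OF K p(2)])
  have "weak_adv (interior K) b v ?G" if K: "K \<in> T" for K
  proof -
    have "q K \<in> Linf (interior K)" "grad (q K) \<in> Linf (interior K)"
      using continuous_Linf[OF _ interior_bounded[OF K] interior_sets] qs[OF K] smooth_continuous smooth_grad_continuous by blast+
    then have qL: "q K \<in> L2 (interior K)" "(\<lambda>x. b x \<bullet> grad (q K) x) \<in> L2 (interior K)"
      using Linf_L2[OF _ lmeasurable_open] Linf_inner[OF bK(1)[OF K]] interior_bounded[OF K] by blast+
    have 1: "weak_adv (interior K) b v (\<lambda>x. b x \<bullet> grad (q K) x)"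
    proof (rule weak_adv_cong[OF open_interior interior_bounded[OF K] bK(1,2)[OF K] qL(1) bK(3)[OF K] _
            weak_adv_smooth[OF open_interior interior_bounded[OF K] bK(1,2)[OF K] qs[OF K]]])
      show "AE x in lebesgue_on (interior K). q K x = v x"
        using AE_interior_from_element[OF K q(2)[OF K]] by eventually_elim simp
    qed
    have 2: "AE x in lebesgue_on (interior K). b x \<bullet> grad (q K) x = ?G x"
      using AE_interior_from_element[OF K glue_AE[OF K, of "\<lambda>K. grad (q K)"]] by eventually_elim simp
    show ?thesis unfolding weak_adv_def
    proof
      fix \<phi> assume \<phi>: "\<phi> \<in> test_fun (interior K)"
      have "(LINT x|lebesgue_on (interior K). ?G x * \<phi> x) = (LINT x|lebesgue_on (interior K). (b x \<bullet> grad (q K) x) * \<phi> x)"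
        by (rule integral_cong_AE)
          (use 2 L2_measurable[OF qL(2)] L2_measurable[OF L2_subset[OF G2 interior_subset_dom[OF K] dom_sets interior_sets]]
            Linf_measurable[OF test_fun_Linf[OF interior_sets \<phi>]] in \<open>auto elim: eventually_mono\<close>)
      then show "(LINT x|lebesgue_on (interior K). ?G x * \<phi> x)
          = - (LINT x|lebesgue_on (interior K). v x * (b x \<bullet> grad \<phi> x + \<phi> x * wdiv (interior K) b x))"
        using 1 \<phi> by (simp add: weak_adv_def)
    qed
  qed
  then have "\<exists>g. g \<in> L2 \<Omega> \<and> (\<forall>K\<in>T. weak_adv (interior K) b v g)" using G2 by blast
  from someI_ex[OF this] have A: "adv_pw \<Omega> T b v \<in> L2 \<Omega>" "\<And>K. K \<in> T \<Longrightarrow> weak_adv (interior K) b v (adv_pw \<Omega> T b v)"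
    unfolding adv_pw_def by blast+
  show "adv_pw \<Omega> T b v \<in> L2 \<Omega>" by (rule A(1))
  show "AE x in lebesgue_on K. adv_pw \<Omega> T b v x = b x \<bullet> grad p x"
    if "K \<in> T" "smooth p" "AE x in lebesgue_on K. v x = p x"
    by (rule classical[OF that(1) A(1) A(2)[OF that(1)] that(2,3)])
qed

lemma adv_props: "u \<in> Hb \<Omega> b \<Longrightarrow> adv \<Omega> b u \<in> L2 \<Omega>" "u \<in> Hb \<Omega> b \<Longrightarrow> weak_adv \<Omega> b u (adv \<Omega> b u)"
  using someI_ex[of "\<lambda>g. g \<in> L2 \<Omega> \<and> weak_adv \<Omega> b u g"] unfolding Hb_def adv_def by blast+

lemma adv_eq_classical:
  assumes K: "K \<in> T" and u: "u \<in> Hb \<Omega> b" and p: "smooth p" "AE x in lebesgue_on K. u x = p x"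
  shows "AE x in lebesgue_on K. adv \<Omega> b u x = b x \<bullet> grad p x"
proof (rule AE_element_from_interior[OF K], rule weak_adv_eq_classical[OF open_dom bounded_dom open_interior
      interior_subset_dom[OF K] b_Linf div_ex _ adv_props(1)[OF u] adv_props(2)[OF u] p(1)])
  show "u \<in> L2 \<Omega>" using u by (simp add: Hb_def)
  show "AE x in lebesgue_on (interior K). u x = p x" by (rule AE_interior_from_element[OF K p(2)])
qed

lemma adv_diff:
  assumes "u \<in> Hb \<Omega> b" "w \<in> Hb \<Omega> b"
  shows "(\<lambda>x. u x - w x) \<in> Hb \<Omega> b"
    and "AE x in lebesgue_on \<Omega>. adv \<Omega> b (\<lambda>x. u x - w x) x = adv \<Omega> b u x - adv \<Omega> b w x"
proof -
  have uw: "u \<in> L2 \<Omega>" "w \<in> L2 \<Omega>" using assms by (auto simp: Hb_def)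
  have 1: "weak_adv \<Omega> b (\<lambda>x. u x - w x) (\<lambda>x. adv \<Omega> b u x - adv \<Omega> b w x)"
    by (rule weak_adv_diff[OF open_dom bounded_dom b_Linf div_ex uw adv_props(1)[OF assms(1)] adv_props(1)[OF assms(2)]
          adv_props(2)[OF assms(1)] adv_props(2)[OF assms(2)]])
  have g: "(\<lambda>x. adv \<Omega> b u x - adv \<Omega> b w x) \<in> L2 \<Omega>" by (intro L2_diff adv_props assms)
  show H: "(\<lambda>x. u x - w x) \<in> Hb \<Omega> b" unfolding Hb_def using L2_diff[OF uw] 1 g by blast
  show "AE x in lebesgue_on \<Omega>. adv \<Omega> b (\<lambda>x. u x - w x) x = adv \<Omega> b u x - adv \<Omega> b w x"
    by (rule weak_adv_unique[OF open_dom bounded_dom adv_props(1)[OF H] g adv_props(2)[OF H] 1])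
qed

text \<open>The predicates under the choice operator coincide, so the chosen functions are equal
  outright and not merely almost everywhere.\<close>

lemma adv_cong:
  assumes "u \<in> L2 \<Omega>" "w \<in> L2 \<Omega>" "AE x in lebesgue_on \<Omega>. u x = w x"
  shows "adv \<Omega> b u = adv \<Omega> b w"
proof -
  have "weak_adv \<Omega> b u g \<longleftrightarrow> weak_adv \<Omega> b w g" for g
  proof
    have "AE x in lebesgue_on \<Omega>. w x = u x" using assms(3) by eventually_elim simp
    then show "weak_adv \<Omega> b w g \<Longrightarrow> weak_adv \<Omega> b u g"
      by (rule weak_adv_cong[OF open_dom bounded_dom b_Linf div_ex assms(2,1)])
  qed (rule weak_adv_cong[OF open_dom bounded_dom b_Linf div_ex assms])
  then show ?thesis unfolding adv_def by simp
qed

lemma smooth_Hb: "smooth \<phi> \<Longrightarrow> \<phi> \<in> Hb \<Omega> b"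
proof -
  assume s: "smooth \<phi>"
  have L: "\<phi> \<in> Linf \<Omega>" "grad \<phi> \<in> Linf \<Omega>"
    using continuous_Linf[OF _ bounded_dom dom_sets] s smooth_continuous smooth_grad_continuous by blast+
  show ?thesis unfolding Hb_def
    using weak_adv_smooth[OF open_dom bounded_dom b_Linf div_ex s] Linf_L2[OF L(1) dom_lmeasurable]
      Linf_L2[OF Linf_inner[OF b_Linf L(2)] dom_lmeasurable] by blast
qed

end

section \<open>The \<open>L\<^sub>2\<close>-norm\<close>

lemma norm_L2_nonneg: "0 \<le> norm_L2 S f"
  unfolding norm_L2_def by (intro real_sqrt_ge_zero integral_nonneg_AE) simp

lemma norm_L2_sq: "(norm_L2 S f)\<^sup>2 = (LINT x|lebesgue_on S. (f x)\<^sup>2)"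
proof -
  have "0 \<le> (LINT x|lebesgue_on S. (f x)\<^sup>2)" by (rule integral_nonneg_AE) simp
  then show ?thesis by (simp add: norm_L2_def)
qed

lemma L2_sq_integrable: "f \<in> L2 S \<Longrightarrow> integrable (lebesgue_on S) (\<lambda>x. (f x)\<^sup>2)"
  by (simp add: L2_def)

text \<open>Nonnegativity of the quadratic polynomial t -> |f - t g|^2, evaluated at its
  minimum.\<close>

lemma L2_Cauchy_Schwarz:
  assumes f: "f \<in> L2 S" and g: "g \<in> L2 S"
  shows "\<bar>LINT x|lebesgue_on S. f x * g x\<bar> \<le> norm_L2 S f * norm_L2 S g"
proof -
  define A where "A = (norm_L2 S f)\<^sup>2"
  define B where "B = (LINT x|lebesgue_on S. f x * g x)"
  define C where "C = (norm_L2 S g)\<^sup>2"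
  have pos: "0 \<le> A - 2 * t * B + t\<^sup>2 * C" for t
  proof -
    have "0 \<le> (LINT x|lebesgue_on S. (f x - t * g x)\<^sup>2)" by (rule integral_nonneg_AE) simp
    also have "\<dots> = (LINT x|lebesgue_on S. (f x)\<^sup>2 - (2 * t) * (f x * g x) + t\<^sup>2 * (g x)\<^sup>2)"
      by (intro Bochner_Integration.integral_cong refl) (simp add: power2_eq_square algebra_simps)
    also have "\<dots> = A - 2 * t * B + t\<^sup>2 * C"
      using L2_sq_integrable[OF f] L2_sq_integrable[OF g] L2_prod_integrable[OF f g]
      by (simp add: A_def B_def C_def norm_L2_sq)
    finally show ?thesis .
  qed
  have "B\<^sup>2 \<le> A * C"
  proof (cases "C = 0")
    case True
    have "B = 0"
    proof (rule ccontr)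
      assume "B \<noteq> 0"
      \<comment> \<open>With C = 0 the polynomial is affine in t; this t would make it negative
        unless B = 0.\<close>
      then have "A - 2 * ((A + 1) / (2 * B)) * B = - 1" by (simp add: field_simps)
      then show False using pos[of "(A + 1) / (2 * B)"] True by simp
    qed
    then show ?thesis using True by simp
  next
    case False
    then have C: "0 < C" by (simp add: C_def)
    have "0 \<le> A - B\<^sup>2 / C" using pos[of "B / C"] C by (simp add: power2_eq_square field_simps)
    then show ?thesis using C by (simp add: field_simps)
  qed
  then have "B\<^sup>2 \<le> (norm_L2 S f * norm_L2 S g)\<^sup>2" by (simp add: A_def C_def power_mult_distrib)
  then show ?thesis
    using norm_L2_nonneg[of S f] norm_L2_nonneg[of S g] by (simp add: B_def abs_le_square_iff[symmetric])
qed

lemma norm_L2_add: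
  assumes f: "f \<in> L2 S" and g: "g \<in> L2 S"
  shows "norm_L2 S (\<lambda>x. f x + g x) \<le> norm_L2 S f + norm_L2 S g"
proof (rule power2_le_imp_le)
  have "(norm_L2 S (\<lambda>x. f x + g x))\<^sup>2 = (LINT x|lebesgue_on S. (f x)\<^sup>2 + 2 * (f x * g x) + (g x)\<^sup>2)"
    unfolding norm_L2_sq by (intro Bochner_Integration.integral_cong refl) (simp add: power2_eq_square algebra_simps)
  also have "\<dots> = (norm_L2 S f)\<^sup>2 + 2 * (LINT x|lebesgue_on S. f x * g x) + (norm_L2 S g)\<^sup>2"
    using L2_sq_integrable[OF f] L2_sq_integrable[OF g] L2_prod_integrable[OF f g] by (simp add: norm_L2_sq)
  also have "\<dots> \<le> (norm_L2 S f + norm_L2 S g)\<^sup>2"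
    using L2_Cauchy_Schwarz[OF f g] by (simp add: power2_sum)
  finally show "(norm_L2 S (\<lambda>x. f x + g x))\<^sup>2 \<le> (norm_L2 S f + norm_L2 S g)\<^sup>2" .
qed (simp add: norm_L2_nonneg)

lemma norm_L2_cmult: "norm_L2 S (\<lambda>x. c * f x) = \<bar>c\<bar> * norm_L2 S f"
  by (simp add: norm_L2_def power_mult_distrib real_sqrt_mult)

lemma norm_L2_uminus: "norm_L2 S (\<lambda>x. - f x) = norm_L2 S f"
  by (simp add: norm_L2_def)

lemma norm_L2_diff:
  assumes "f \<in> L2 S" "g \<in> L2 S"
  shows "norm_L2 S (\<lambda>x. f x - g x) \<le> norm_L2 S f + norm_L2 S g"
  using norm_L2_add[OF assms(1) L2_cmult[OF assms(2), of "-1"]] norm_L2_uminus[of S g] by simp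

lemma norm_L2_AE_mono:
  assumes "f \<in> L2 S" "g \<in> L2 S" "AE x in lebesgue_on S. \<bar>f x\<bar> \<le> \<bar>g x\<bar>"
  shows "norm_L2 S f \<le> norm_L2 S g"
  unfolding norm_L2_def
  by (intro real_sqrt_le_mono integral_mono_AE L2_sq_integrable assms(1,2))
    (use assms(3) in \<open>auto simp: abs_le_square_iff elim: eventually_mono\<close>)

lemma norm_L2_AE_cong:
  assumes "f \<in> L2 S" "g \<in> L2 S" "AE x in lebesgue_on S. f x = g x"
  shows "norm_L2 S f = norm_L2 S g"
  by (intro antisym norm_L2_AE_mono assms(1,2)) (use assms(3) in \<open>auto elim: eventually_mono\<close>)

lemma norm_L2_mult_le:
  assumes f: "f \<in> L2 S" and g: "g \<in> Linf S" "AE x in lebesgue_on S. \<bar>g x\<bar> \<le> B" and B: "0 \<le> B"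
  shows "norm_L2 S (\<lambda>x. f x * g x) \<le> B * norm_L2 S f"
proof -
  have "norm_L2 S (\<lambda>x. f x * g x) \<le> norm_L2 S (\<lambda>x. B * f x)"
  proof (rule norm_L2_AE_mono[OF L2_mult_Linf[OF f g(1)] L2_cmult[OF f]])
    show "AE x in lebesgue_on S. \<bar>f x * g x\<bar> \<le> \<bar>B * f x\<bar>"
      using g(2)
    proof eventually_elim
      case (elim x)
      then have "\<bar>f x\<bar> * \<bar>g x\<bar> \<le> \<bar>f x\<bar> * B" by (rule mult_left_mono) simp
      then show ?case using B by (simp add: abs_mult mult.commute)
    qed
  qed
  then show ?thesis using B by (simp add: norm_L2_cmult)
qed

context triangulation
begin

lemma norm_L2_elementwise:
  assumes F: "F \<in> L2 \<Omega>" and G: "G \<in> L2 \<Omega>" and k: "0 \<le> k"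
    and le: "\<And>K. K \<in> T \<Longrightarrow> (LINT x|lebesgue_on K. (F x)\<^sup>2) \<le> k\<^sup>2 * (LINT x|lebesgue_on K. (G x)\<^sup>2)"
  shows "norm_L2 \<Omega> F \<le> k * norm_L2 \<Omega> G"
proof (rule power2_le_imp_le)
  have "(norm_L2 \<Omega> F)\<^sup>2 = (\<Sum>K\<in>T. LINT x|lebesgue_on K. (F x)\<^sup>2)"
    unfolding norm_L2_sq by (rule LINT_partition[OF L2_sq_integrable[OF F]])
  also have "\<dots> \<le> (\<Sum>K\<in>T. k\<^sup>2 * (LINT x|lebesgue_on K. (G x)\<^sup>2))" by (rule sum_mono[OF le])
  also have "\<dots> = (k * norm_L2 \<Omega> G)\<^sup>2"
    unfolding power_mult_distrib norm_L2_sq LINT_partition[OF L2_sq_integrable[OF G]] by (simp add: sum_distrib_left)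
  finally show "(norm_L2 \<Omega> F)\<^sup>2 \<le> (k * norm_L2 \<Omega> G)\<^sup>2" .
qed (intro mult_nonneg_nonneg k norm_L2_nonneg)

lemma LINT_element_sq_le:
  assumes K: "K \<in> T" and F: "F \<in> L2 \<Omega>" and g: "AE x in lebesgue_on K. (F x)\<^sup>2 \<le> g"
  shows "(LINT x|lebesgue_on K. (F x)\<^sup>2) \<le> g * measure lebesgue K"
proof -
  have ci: "integrable (lebesgue_on K) (\<lambda>x. g)"
    by (rule Linf_integrable[OF Linf_const element_lmeasurable[OF K]])
  have "(LINT x|lebesgue_on K. (F x)\<^sup>2) \<le> (LINT x|lebesgue_on K. g)"
    by (rule integral_mono_AE[OF integrable_element[OF K L2_sq_integrable[OF F]] ci g])
  also have "\<dots> = g * measure lebesgue K"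
    using element_sets[OF K] by (simp add: measure_restrict_space)
  finally show ?thesis .
qed

lemma LINT_element_cong:
  assumes K: "K \<in> T" and F: "F \<in> L2 \<Omega>" and p: "continuous_on UNIV p" and eq: "AE x in lebesgue_on K. F x = p x"
  shows "(LINT x|lebesgue_on K. (F x)\<^sup>2) = (LINT x|lebesgue_on K. (p x)\<^sup>2)"
proof (rule integral_cong_AE)
  show "(\<lambda>x. (F x)\<^sup>2) \<in> borel_measurable (lebesgue_on K)"
    using integrable_element[OF K L2_sq_integrable[OF F]] by auto
  have "continuous_on K (\<lambda>x. (p x)\<^sup>2)"
    using continuous_on_subset[OF p, of K] by (intro continuous_intros) auto
  then show "(\<lambda>x. (p x)\<^sup>2) \<in> borel_measurable (lebesgue_on K)"
    using element_sets[OF K] by (rule continuous_imp_measurable_on_sets_lebesgue)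
qed (use eq in \<open>auto elim: eventually_mono\<close>)

end

section \<open>The operator \<open>B\<close> and its inverse\<close>

context transport_mesh
begin

lemma norm_Hb_nonneg: "0 \<le> norm_Hb \<Omega> b u"
  by (simp add: norm_Hb_def)

lemma norm_L2_le_norm_Hb: "norm_L2 \<Omega> u \<le> norm_Hb \<Omega> b u" "norm_L2 \<Omega> (adv \<Omega> b u) \<le> norm_Hb \<Omega> b u"
  unfolding norm_Hb_def by (intro real_le_rsqrt; simp)+

lemma norm_Hb_diff:
  assumes u: "u \<in> Hb \<Omega> b" and w: "w \<in> Hb \<Omega> b"
  shows "norm_Hb \<Omega> b (\<lambda>x. u x - w x) \<le> norm_Hb \<Omega> b u + norm_Hb \<Omega> b w"
proof -
  have uw: "u \<in> L2 \<Omega>" "w \<in> L2 \<Omega>" using u w by (auto simp: Hb_def)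
  note A = adv_diff[OF u w] adv_props(1)[OF u] adv_props(1)[OF w]
  have "norm_L2 \<Omega> (adv \<Omega> b (\<lambda>x. u x - w x)) = norm_L2 \<Omega> (\<lambda>x. adv \<Omega> b u x - adv \<Omega> b w x)"
    by (rule norm_L2_AE_cong[OF adv_props(1)[OF A(1)] L2_diff[OF A(3,4)] A(2)])
  also have "\<dots> \<le> norm_L2 \<Omega> (adv \<Omega> b u) + norm_L2 \<Omega> (adv \<Omega> b w)" by (rule norm_L2_diff[OF A(3,4)])
  finally have "norm_Hb \<Omega> b (\<lambda>x. u x - w x) \<le> sqrt ((norm_L2 \<Omega> u + norm_L2 \<Omega> w)\<^sup>2
      + (norm_L2 \<Omega> (adv \<Omega> b u) + norm_L2 \<Omega> (adv \<Omega> b w))\<^sup>2)"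
    unfolding norm_Hb_def using norm_L2_diff[OF uw]
    by (intro real_sqrt_le_mono add_mono power_mono) (auto intro: norm_L2_nonneg)
  also have "\<dots> \<le> norm_Hb \<Omega> b u + norm_Hb \<Omega> b w"
    unfolding norm_Hb_def by (rule real_sqrt_sum_squares_triangle_ineq)
  finally show ?thesis .
qed

text \<open>Subtracting the approximants keeps the zero values on the inflow boundary. It places the
  error in the space on which the operator is injective.\<close>

lemma H0b_diff:
  assumes u: "u \<in> H0b \<Omega> b" and w: "w \<in> H0b \<Omega> b" shows "(\<lambda>x. u x - w x) \<in> H0b \<Omega> b"
proof -
  have uH: "u \<in> Hb \<Omega> b" and wH: "w \<in> Hb \<Omega> b" using u w by (auto simp: H0b_def)
  have "\<exists>\<phi>. smooth \<phi> \<and> (\<forall>x\<in>Gamma_minus \<Omega> b. \<phi> x = 0) \<and> norm_Hb \<Omega> b (\<lambda>x. (u x - w x) - \<phi> x) < \<epsilon>"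
    if e: "0 < \<epsilon>" for \<epsilon>
  proof -
    have "0 < \<epsilon> / 2" using e by simp
    then obtain \<phi> \<psi> where p: "smooth \<phi>" "\<forall>x\<in>Gamma_minus \<Omega> b. \<phi> x = 0" "norm_Hb \<Omega> b (\<lambda>x. u x - \<phi> x) < \<epsilon> / 2"
      and q: "smooth \<psi>" "\<forall>x\<in>Gamma_minus \<Omega> b. \<psi> x = 0" "norm_Hb \<Omega> b (\<lambda>x. w x - \<psi> x) < \<epsilon> / 2"
      using u w unfolding H0b_def by blast
    have "norm_Hb \<Omega> b (\<lambda>x. (u x - \<phi> x) - (w x - \<psi> x)) < \<epsilon>"
      using norm_Hb_diff[OF adv_diff(1)[OF uH smooth_Hb[OF p(1)]] adv_diff(1)[OF wH smooth_Hb[OF q(1)]]] p(3) q(3)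
      by simp
    moreover have "(\<lambda>x. (u x - \<phi> x) - (w x - \<psi> x)) = (\<lambda>x. (u x - w x) - (\<phi> x - \<psi> x))" by auto
    ultimately show ?thesis using p q by (intro exI[of _ "\<lambda>x. \<phi> x - \<psi> x"]) (auto intro: smooth_diff)
  qed
  then show ?thesis using adv_diff(1)[OF uH wH] by (simp add: H0b_def)
qed

lemma Binv_props:
  assumes "B_Lis \<Omega> b c" "f \<in> L2 \<Omega>"
  shows "Binv \<Omega> b c f \<in> H0b \<Omega> b" "AE x in lebesgue_on \<Omega>. Bop \<Omega> b c (Binv \<Omega> b c f) x = f x"
  using someI_ex[of "\<lambda>w. w \<in> H0b \<Omega> b \<and> (AE x in lebesgue_on \<Omega>. Bop \<Omega> b c w x = f x)"] assms
  unfolding B_Lis_def Binv_def by blast+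

text \<open>The infimum in \<open>norm_Binv\<close> is itself admissible: for \<open>f\<close> of
  positive norm it is bounded below by the quotient of the two norms, and for \<open>f\<close> of
  norm 0 any admissible constant already gives the claim.\<close>

lemma norm_Binv_bound:
  assumes B: "B_Lis \<Omega> b c" and f: "f \<in> L2 \<Omega>"
  shows "norm_Hb \<Omega> b (Binv \<Omega> b c f) \<le> norm_Binv \<Omega> b c * norm_L2 \<Omega> f"
proof -
  let ?S = "{M. 0 \<le> M \<and> (\<forall>f\<in>L2 \<Omega>. norm_Hb \<Omega> b (Binv \<Omega> b c f) \<le> M * norm_L2 \<Omega> f)}"
  obtain M where M: "\<forall>f\<in>L2 \<Omega>. norm_Hb \<Omega> b (Binv \<Omega> b c f) \<le> M * norm_L2 \<Omega> f"
    using B unfolding B_Lis_def by blast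
  have "M * norm_L2 \<Omega> f \<le> max 0 M * norm_L2 \<Omega> f" for f
    by (intro mult_right_mono norm_L2_nonneg) simp
  then have ne: "max 0 M \<in> ?S" using M order_trans by fastforce
  show ?thesis
  proof (cases "norm_L2 \<Omega> f = 0")
    case True then show ?thesis using M f by fastforce
  next
    case False
    then have N: "0 < norm_L2 \<Omega> f" using norm_L2_nonneg[of \<Omega> f] by simp
    have "norm_Hb \<Omega> b (Binv \<Omega> b c f) / norm_L2 \<Omega> f \<le> Inf ?S"
    proof (rule cInf_greatest)
      show "?S \<noteq> {}" using ne by blast
      show "norm_Hb \<Omega> b (Binv \<Omega> b c f) / norm_L2 \<Omega> f \<le> x" if "x \<in> ?S" for x
        using that f N by (simp add: divide_le_eq)
    qed
    then show ?thesis using N by (simp add: norm_Binv_def divide_le_eq)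
  qed
qed

text \<open>The bound on the inverse speaks of the chosen preimage
  \<open>Binv \<Omega> b c g\<close>, not of the error. Both solve the same equation in
  \<open>H0b\<close>, hence agree almost everywhere by injectivity and have the same graph norm by
  \<open>adv_cong\<close>.\<close>

lemma error_le_residual:
  assumes B: "B_Lis \<Omega> b c" and c: "c \<in> Linf \<Omega>" and f: "f \<in> L2 \<Omega>" and w: "w \<in> H0b \<Omega> b"
  shows "norm_Hb \<Omega> b (\<lambda>x. Binv \<Omega> b c f x - w x) \<le> norm_Binv \<Omega> b c * norm_L2 \<Omega> (\<lambda>x. f x - Bop \<Omega> b c w x)"
proof -
  define g where "g = (\<lambda>x. f x - Bop \<Omega> b c w x)"
  let ?z = "Binv \<Omega> b c g"
  let ?d = "\<lambda>x. Binv \<Omega> b c f x - w x"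
  note P = Binv_props[OF B f]
  have H: "Binv \<Omega> b c f \<in> Hb \<Omega> b" "w \<in> Hb \<Omega> b" using P w by (auto simp: H0b_def)
  have BL: "Bop \<Omega> b c w \<in> L2 \<Omega>"
    unfolding Bop_def[abs_def] using L2_add[OF adv_props(1)[OF H(2)] L2_mult_Linf[OF _ c, of w]] H(2)
    by (simp add: Hb_def mult.commute)
  have g: "g \<in> L2 \<Omega>" unfolding g_def by (rule L2_diff[OF f BL])
  note Z = Binv_props[OF B g]
  have d0: "?d \<in> H0b \<Omega> b" by (rule H0b_diff[OF P(1) w])
  have "AE x in lebesgue_on \<Omega>. Bop \<Omega> b c ?d x = g x"
    using adv_diff(2)[OF H] P(2) by eventually_elim (simp add: Bop_def g_def algebra_simps)
  then have "AE x in lebesgue_on \<Omega>. Bop \<Omega> b c ?z x = Bop \<Omega> b c ?d x"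
    using Z(2) by eventually_elim simp
  then have eq: "AE x in lebesgue_on \<Omega>. ?z x = ?d x"
    using B Z(1) d0 unfolding B_Lis_def by blast
  have L: "?z \<in> L2 \<Omega>" "?d \<in> L2 \<Omega>" using Z(1) d0 by (auto simp: H0b_def Hb_def)
  have "norm_Hb \<Omega> b ?d = norm_Hb \<Omega> b ?z"
    using adv_cong[OF L eq] norm_L2_AE_cong[OF L eq] by (simp add: norm_Hb_def)
  then show ?thesis using norm_Binv_bound[OF B g] by (simp add: g_def)
qed

section \<open>The residual\<close>

lemma wdiv_Linf: "wdiv \<Omega> b \<in> Linf \<Omega>"
  by (rule wdiv_props[OF div_ex])

text \<open>The elements overlap in null sets, so the elementwise form collapses to integrals over
  \<Omega>, to which Cauchy-Schwarz applies globally.\<close>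

lemma residual_eq:
  assumes u: "u \<in> L2 \<Omega>" and w: "w \<in> Hb \<Omega> b" and c: "c \<in> Linf \<Omega>" and f: "f \<in> L2 \<Omega>"
    and R: "residual_rep \<Omega> T m b c f u w R" and v: "v \<in> pw_poly T m"
  shows "inner_Hb_pw \<Omega> T b R v = (LINT x|lebesgue_on \<Omega>. (c x * u x + adv \<Omega> b w x - f x) * v x)
     + (LINT x|lebesgue_on \<Omega>. (w x - u x) * (v x * wdiv \<Omega> b x + adv_pw \<Omega> T b v x))"
proof -
  note vL = pw_poly_Linf[OF v] pw_poly_L2[OF v]
  have w2: "w \<in> L2 \<Omega>" using w by (simp add: Hb_def)
  have cu: "(\<lambda>x. c x * u x + adv \<Omega> b w x) \<in> L2 \<Omega>"
    using L2_add[OF L2_mult_Linf[OF u c] adv_props(1)[OF w]] by (simp add: mult.commute)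
  have I1: "integrable (lebesgue_on \<Omega>) (\<lambda>x. (c x * u x + adv \<Omega> b w x) * v x)"
    by (rule L2_prod_integrable[OF cu vL(2)])
  have I2: "integrable (lebesgue_on \<Omega>) (\<lambda>x. (w x - u x) * (v x * wdiv \<Omega> b x + adv_pw \<Omega> T b v x))"
    by (intro L2_prod_integrable L2_diff w2 u L2_add L2_mult_Linf vL wdiv_Linf adv_pw_props(1)[OF v])
  have I3: "integrable (lebesgue_on \<Omega>) (\<lambda>x. f x * v x)" by (rule L2_prod_integrable[OF f vL(2)])
  have "bform \<Omega> T b c u w v = (LINT x|lebesgue_on \<Omega>. (c x * u x + adv \<Omega> b w x) * v x
       + (w x - u x) * (v x * wdiv \<Omega> b x + adv_pw \<Omega> T b v x))"
    unfolding bform_def by (rule LINT_partition[symmetric]) (use I1 I2 in auto)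
  then have "inner_Hb_pw \<Omega> T b R v = (LINT x|lebesgue_on \<Omega>. (c x * u x + adv \<Omega> b w x) * v x)
      + (LINT x|lebesgue_on \<Omega>. (w x - u x) * (v x * wdiv \<Omega> b x + adv_pw \<Omega> T b v x)) - (LINT x|lebesgue_on \<Omega>. f x * v x)"
    using R v I1 I2 by (simp add: residual_rep_def)
  moreover have "(LINT x|lebesgue_on \<Omega>. (c x * u x + adv \<Omega> b w x - f x) * v x)
      = (LINT x|lebesgue_on \<Omega>. (c x * u x + adv \<Omega> b w x) * v x) - (LINT x|lebesgue_on \<Omega>. f x * v x)"
    unfolding left_diff_distrib by (rule Bochner_Integration.integral_diff[OF I1 I3])
  ultimately show ?thesis by simp
qed

lemma norm_Hb_pw_sq: "(norm_Hb_pw \<Omega> T b v)\<^sup>2 = inner_Hb_pw \<Omega> T b v v"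
  by (simp add: norm_Hb_pw_def inner_Hb_pw_def norm_L2_sq flip: power2_eq_square)

lemma norm_Hb_pw_nonneg: "0 \<le> norm_Hb_pw \<Omega> T b v"
  by (simp add: norm_Hb_pw_def)

lemma norm_L2_le_norm_Hb_pw:
  "norm_L2 \<Omega> v \<le> norm_Hb_pw \<Omega> T b v" "norm_L2 \<Omega> (adv_pw \<Omega> T b v) \<le> norm_Hb_pw \<Omega> T b v"
  unfolding norm_Hb_pw_def by (intro real_le_rsqrt; simp)+

text \<open>The two norms of \<open>v\<close> are kept apart because the test functions come with
  separate bounds for \<open>v\<close> and for its advective derivative.\<close>

lemma inner_Hb_pw_le:
  assumes "R \<in> pw_poly T m" "v \<in> pw_poly T m"
  shows "\<bar>inner_Hb_pw \<Omega> T b R v\<bar> \<le> norm_Hb_pw \<Omega> T b R * (norm_L2 \<Omega> v + norm_L2 \<Omega> (adv_pw \<Omega> T b v))"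
proof -
  have "\<bar>inner_Hb_pw \<Omega> T b R v\<bar> \<le> norm_L2 \<Omega> R * norm_L2 \<Omega> v + norm_L2 \<Omega> (adv_pw \<Omega> T b R) * norm_L2 \<Omega> (adv_pw \<Omega> T b v)"
    unfolding inner_Hb_pw_def
    by (intro order_trans[OF abs_triangle_ineq] add_mono L2_Cauchy_Schwarz
        pw_poly_L2[OF assms(1)] pw_poly_L2[OF assms(2)] adv_pw_props(1)[OF assms(1)] adv_pw_props(1)[OF assms(2)])
  also have "\<dots> \<le> norm_Hb_pw \<Omega> T b R * norm_L2 \<Omega> v + norm_Hb_pw \<Omega> T b R * norm_L2 \<Omega> (adv_pw \<Omega> T b v)"
    by (intro add_mono mult_right_mono norm_L2_le_norm_Hb_pw norm_L2_nonneg)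
  finally show ?thesis by (simp add: distrib_left)
qed

text \<open>Test with \<open>R\<close> itself, so that the left side is the squared estimator, and
  cancel one factor.\<close>

lemma estimator_le_residuals:
  assumes u: "u \<in> L2 \<Omega>" and w: "w \<in> Hb \<Omega> b" and c: "c \<in> Linf \<Omega>" and f: "f \<in> L2 \<Omega>"
    and R: "residual_rep \<Omega> T m b c f u w R"
    and D: "AE x in lebesgue_on \<Omega>. \<bar>wdiv \<Omega> b x\<bar> \<le> D" "0 \<le> D"
  shows "norm_Hb_pw \<Omega> T b R \<le> norm_L2 \<Omega> (\<lambda>x. c x * u x + adv \<Omega> b w x - f x) + (D + 1) * norm_L2 \<Omega> (\<lambda>x. w x - u x)"
proof -
  let ?r = "\<lambda>x. c x * u x + adv \<Omega> b w x - f x" and ?e = "\<lambda>x. w x - u x"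
  let ?N = "norm_Hb_pw \<Omega> T b R" and ?A = "adv_pw \<Omega> T b R"
  have Rp: "R \<in> pw_poly T m" using R by (simp add: residual_rep_def)
  note RL = pw_poly_Linf[OF Rp] pw_poly_L2[OF Rp]
  have w2: "w \<in> L2 \<Omega>" using w by (simp add: Hb_def)
  have e: "?e \<in> L2 \<Omega>" by (rule L2_diff[OF w2 u])
  have r: "?r \<in> L2 \<Omega>"
    using L2_diff[OF L2_add[OF L2_mult_Linf[OF u c] adv_props(1)[OF w]] f] by (simp add: mult.commute)
  have RA: "?A \<in> L2 \<Omega>" by (rule adv_pw_props(1)[OF Rp])
  have Rd: "(\<lambda>x. R x * wdiv \<Omega> b x) \<in> L2 \<Omega>" by (rule L2_mult_Linf[OF RL(2) wdiv_Linf])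
  have "norm_L2 \<Omega> (\<lambda>x. R x * wdiv \<Omega> b x + ?A x) \<le> D * norm_L2 \<Omega> R + norm_L2 \<Omega> ?A"
    using norm_L2_add[OF Rd RA] norm_L2_mult_le[OF RL(2) wdiv_Linf D] by linarith
  also have "\<dots> \<le> D * ?N + ?N"
    by (intro add_mono mult_left_mono norm_L2_le_norm_Hb_pw D)
  finally have t: "norm_L2 \<Omega> (\<lambda>x. R x * wdiv \<Omega> b x + ?A x) \<le> (D + 1) * ?N" by (simp add: distrib_right)
  have "?N\<^sup>2 = (LINT x|lebesgue_on \<Omega>. ?r x * R x) + (LINT x|lebesgue_on \<Omega>. ?e x * (R x * wdiv \<Omega> b x + ?A x))"
    unfolding norm_Hb_pw_sq by (rule residual_eq[OF u w c f R Rp])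
  also have "\<dots> \<le> norm_L2 \<Omega> ?r * norm_L2 \<Omega> R + norm_L2 \<Omega> ?e * norm_L2 \<Omega> (\<lambda>x. R x * wdiv \<Omega> b x + ?A x)"
    using L2_Cauchy_Schwarz[OF r RL(2)] L2_Cauchy_Schwarz[OF e L2_add[OF Rd RA]] by linarith
  also have "\<dots> \<le> norm_L2 \<Omega> ?r * ?N + norm_L2 \<Omega> ?e * ((D + 1) * ?N)"
    by (intro add_mono mult_left_mono norm_L2_le_norm_Hb_pw t norm_L2_nonneg)
  finally have "?N * ?N \<le> (norm_L2 \<Omega> ?r + (D + 1) * norm_L2 \<Omega> ?e) * ?N"
    by (simp add: power2_eq_square algebra_simps)
  moreover have "0 \<le> norm_L2 \<Omega> ?r + (D + 1) * norm_L2 \<Omega> ?e"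
    using D(2) norm_L2_nonneg by (intro add_nonneg_nonneg mult_nonneg_nonneg) auto
  ultimately show ?thesis
    using norm_Hb_pw_nonneg[of R] by (cases "?N = 0") (auto simp: mult_le_cancel_right)
qed

end

section \<open>Test functions for the two residual components\<close>

lemma fat_measure_pos:
  fixes K :: "(real^'n) set"
  assumes "fat \<eta> K" "0 < \<eta>" shows "0 < measure lebesgue K"
proof -
  obtain x where x: "cball x (\<eta> * diameter K) \<subseteq> K" and d: "0 < diameter K" and K: "compact K"
    using assms by (auto simp: fat_def)
  have "0 < measure lebesgue (cball x (\<eta> * diameter K))"
    using content_cball_pos[of "\<eta> * diameter K" x] d assms(2) by simp
  also have "\<dots> \<le> measure lebesgue K"
    by (rule measure_mono_fmeasurable[OF x _ compact_lmeasurable[OF K]]) simp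
  finally show ?thesis .
qed

text \<open>The power of the diameter is traded for the volume, so that integrating the pointwise
  bound over \<open>K\<close> returns exactly the L2 norm of \<open>p\<close>.\<close>

lemma Poly_grad_bound:
  assumes \<eta>: "0 < \<eta>"
  shows "\<exists>A\<ge>0. \<forall>(K :: (real^'n) set) p. fat \<eta> K \<longrightarrow> p \<in> Poly m \<longrightarrow> (\<forall>x\<in>K.
     (diameter K * norm (grad p x))\<^sup>2 * measure lebesgue K \<le> A\<^sup>2 * (LINT x|lebesgue_on K. (p x)\<^sup>2))"
proof -
  obtain C where C: "0 \<le> C" "\<forall>(K :: (real^'n) set) p. fat \<eta> K \<longrightarrow> p \<in> Poly m \<longrightarrow> (\<forall>x\<in>K.
     (p x)\<^sup>2 * diameter K ^ CARD('n) \<le> C * (LINT x|lebesgue_on K. (p x)\<^sup>2) \<and>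
     (\<forall>i. (diameter K * grad p x $ i)\<^sup>2 * diameter K ^ CARD('n) \<le> C * (LINT x|lebesgue_on K. (p x)\<^sup>2)))"
    using Poly_bound_fat[OF \<eta>, of m, where 'n='n] by (elim exE conjE) (rule that; assumption)
  define \<omega> where "\<omega> = measure lebesgue (cball (0::real^'n) 1)"
  have w0: "0 \<le> \<omega>" by (simp add: \<omega>_def)
  define A where "A = CARD('n) * sqrt (C * \<omega>)"
  have A: "0 \<le> A" "A\<^sup>2 = (CARD('n))\<^sup>2 * (C * \<omega>)" using C(1) w0 by (auto simp: A_def power_mult_distrib)
  have "(diameter K * norm (grad p x))\<^sup>2 * measure lebesgue K \<le> A\<^sup>2 * (LINT x|lebesgue_on K. (p x)\<^sup>2)"
    if K: "fat \<eta> K" and p: "p \<in> Poly m" and x: "x \<in> K" for K :: "(real^'n) set" and p x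
  proof -
    define d where "d = diameter K"
    define J where "J = (LINT x|lebesgue_on K. (p x)\<^sup>2)"
    have J: "0 \<le> J" unfolding J_def by (rule integral_nonneg_AE) simp
    have d: "0 < d" using K by (simp add: fat_def d_def)
    define s where "s = sqrt (C * J / d ^ CARD('n))"
    have s: "0 \<le> s" "s\<^sup>2 * d ^ CARD('n) = C * J" using C(1) J d by (auto simp: s_def)
    have "\<bar>d * grad p x $ i\<bar> \<le> s" for i
    proof -
      have "(d * grad p x $ i)\<^sup>2 \<le> C * J / d ^ CARD('n)"
        using C(2)[THEN spec, THEN spec, THEN mp, OF K, THEN mp, OF p, THEN bspec, OF x] d
        by (simp add: J_def d_def pos_le_divide_eq)
      then have "sqrt ((d * grad p x $ i)\<^sup>2) \<le> s" unfolding s_def by (rule real_sqrt_le_mono)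
      then show ?thesis by simp
    qed
    then have "(\<Sum>i\<in>UNIV. \<bar>(d *\<^sub>R grad p x) $ i\<bar>) \<le> (\<Sum>i\<in>(UNIV::'n set). s)" by (intro sum_mono) simp
    then have "norm (d *\<^sub>R grad p x) \<le> CARD('n) * s" using norm_le_l1_cart[of "d *\<^sub>R grad p x"] by simp
    then have "d * norm (grad p x) \<le> CARD('n) * s" using d by simp
    then have "(d * norm (grad p x))\<^sup>2 * measure lebesgue K \<le> (CARD('n) * s)\<^sup>2 * measure lebesgue K"
      using d by (intro mult_right_mono power_mono) auto
    also have "\<dots> \<le> (CARD('n) * s)\<^sup>2 * (\<omega> * d ^ CARD('n))"
      using measure_fat_le[OF K \<eta>] by (intro mult_left_mono) (auto simp: \<omega>_def d_def)
    also have "\<dots> = (CARD('n))\<^sup>2 * \<omega> * (s\<^sup>2 * d ^ CARD('n))" by (simp add: power_mult_distrib mult_ac)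
    also have "\<dots> = A\<^sup>2 * J" unfolding s(2) A(2) by (simp add: mult_ac)
    finally show ?thesis by (simp add: d_def J_def)
  qed
  then show ?thesis using A(1) by blast
qed

lemma norm_Linf_subset:
  assumes "f \<in> Linf S" "T \<subseteq> S" "S \<in> sets lebesgue" "T \<in> sets lebesgue"
  shows "norm_Linf T f \<le> norm_Linf S f"
  by (rule norm_Linf_le[OF Linf_measurable[OF Linf_subset[OF assms]] AE_on_subset[OF Linf_AE[OF assms(1)] assms(2-)] norm_Linf_nonneg])

lemma norm_W1inf_component_le: "norm_W1inf S (\<lambda>x. b x $ i) \<le> norm_W1inf_vec S b"
  unfolding norm_W1inf_vec_def by (intro Max_ge) auto

text \<open>The Sobolev bound is given on a coarse element \<open>K'\<close>, but the deviation
  scales with the diameter of the subgrid element \<open>K\<close>, since weak derivatives restrict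
  to smaller open sets. One factor n comes from the estimate for each component, the other from
  summing the components.\<close>

lemma (in triangulation) W1inf_near_const:
  fixes b :: "real^'n \<Rightarrow> real^'n" and M :: real
  assumes K: "K \<in> T" and K': "interior K \<subseteq> interior K'"
    and b: "\<And>i. (\<lambda>x. b x $ i) \<in> W1inf (interior K')" and M: "norm_W1inf_vec (interior K') b \<le> M"
  shows "\<exists>\<gamma>. AE x in lebesgue_on K. norm (b x - \<gamma>) \<le> (CARD('n))\<^sup>2 * M * diameter K"
proof -
  have M0: "0 \<le> M"
    using norm_Linf_nonneg wpartial_props(4)[OF b] norm_W1inf_component_le[of "interior K'" b] M order_trans by metis
  have "\<exists>\<gamma>. AE x in lebesgue_on (interior K). \<bar>b x $ i - \<gamma>\<bar> \<le> CARD('n) * diameter (interior K) * M" for i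
  proof (rule weak_gradient_bound_near_const[OF open_interior interior_bounded[OF K] convex_interior[OF element(2)[OF K]]])
    show "(\<lambda>x. b x $ i) \<in> Linf (interior K)"
      by (rule Linf_subset[OF _ K' interior_sets interior_sets]) (use b[of i] in \<open>simp add: W1inf_def\<close>)
    fix j
    note P = wpartial_props(1-3)[OF b[of i], of j]
    show "wpartial (interior K') j (\<lambda>x. b x $ i) \<in> Linf (interior K)"
      by (rule Linf_subset[OF P(1) K' interior_sets interior_sets])
    show "weak_partial (interior K) j (\<lambda>x. b x $ i) (wpartial (interior K') j (\<lambda>x. b x $ i))"
      by (rule weak_partial_subset[OF open_interior K' open_interior P(2)])
    show "norm_Linf (interior K) (wpartial (interior K') j (\<lambda>x. b x $ i)) \<le> M"
      using norm_Linf_subset[OF P(1) K' interior_sets interior_sets] P(3)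
        norm_W1inf_component_le[of "interior K'" b i] M by linarith
  qed
  then obtain \<gamma> where \<gamma>: "\<And>i. AE x in lebesgue_on (interior K). \<bar>b x $ i - \<gamma> i\<bar> \<le> CARD('n) * diameter (interior K) * M"
    by metis
  have dd: "diameter (interior K) \<le> diameter K"
    by (rule diameter_subset[OF interior_subset compact_imp_bounded[OF element(1)[OF K]]])
  have "AE x in lebesgue_on (interior K). \<forall>i\<in>UNIV. \<bar>b x $ i - \<gamma> i\<bar> \<le> CARD('n) * diameter (interior K) * M"
    using \<gamma> by (intro AE_finite_allI) auto
  then have "AE x in lebesgue_on (interior K). norm (b x - (\<chi> i. \<gamma> i)) \<le> (CARD('n))\<^sup>2 * M * diameter K"
  proof eventually_elim
    case (elim x)
    have "norm (b x - (\<chi> i. \<gamma> i)) \<le> (\<Sum>i\<in>UNIV. \<bar>(b x - (\<chi> i. \<gamma> i)) $ i\<bar>)" by (rule norm_le_l1_cart)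
    also have "\<dots> \<le> (\<Sum>i\<in>(UNIV::'n set). CARD('n) * diameter (interior K) * M)"
      using elim by (intro sum_mono) auto
    also have "\<dots> = (CARD('n))\<^sup>2 * M * diameter (interior K)" by (simp add: power2_eq_square)
    also have "\<dots> \<le> (CARD('n))\<^sup>2 * M * diameter K" using dd M0 by (intro mult_left_mono) auto
    finally show ?case .
  qed
  then show ?thesis using AE_element_from_interior[OF K] by blast
qed

context transport_mesh
begin

text \<open>On each element \<open>b\<close> is replaced by a constant \<gamma>. The condition
  \<open>small\<close> keeps the length of \<gamma> above 1 / (2 * \<beta>), so inverting the
  derivative along \<gamma> costs at most 2 * \<beta>. The solution gains one diameter; its gradient
  does not, and multiplied by \<open>b\<close> it gives the second bound. The third comes from b .
  grad v - e = (b - \<gamma>) . grad v.\<close>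

lemma streamline_test_function:
  assumes \<eta>: "0 < \<eta>" and C: "0 \<le> C" "\<forall>(K :: (real^'n) set) \<beta> e. fat \<eta> K \<longrightarrow> \<beta> \<noteq> 0 \<longrightarrow> e \<in> Poly m \<longrightarrow>
     (\<exists>v\<in>Poly (m + 1). (\<forall>x. grad v x \<bullet> \<beta> = e x) \<and>
        (LINT x|lebesgue_on K. (v x)\<^sup>2) \<le> (C * diameter K / norm \<beta>)\<^sup>2 * (LINT x|lebesgue_on K. (e x)\<^sup>2) \<and>
        (\<forall>x\<in>K. (norm (grad v x))\<^sup>2 * measure lebesgue K \<le> (C / norm \<beta>)\<^sup>2 * (LINT x|lebesgue_on K. (e x)\<^sup>2)))"
    and fat: "\<And>K. K \<in> T \<Longrightarrow> fat \<eta> K" and \<sigma>: "\<And>K. K \<in> T \<Longrightarrow> diameter K \<le> \<sigma>" "0 \<le> \<sigma>"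
    and near: "\<And>K. K \<in> T \<Longrightarrow> \<exists>\<gamma>. AE x in lebesgue_on K. norm (b x - \<gamma>) \<le> L * diameter K" and L: "0 \<le> L"
    and upper: "AE x in lebesgue_on \<Omega>. norm (b x) \<le> Bb" and Bb: "0 \<le> Bb"
    and lower: "AE x in lebesgue_on \<Omega>. 1 / \<beta> \<le> norm (b x)" and \<beta>: "0 < \<beta>" and small: "L * \<sigma> \<le> 1 / (2 * \<beta>)"
    and e: "e \<in> pw_poly T m"
  shows "\<exists>v\<in>pw_poly T (m + 1). norm_L2 \<Omega> v \<le> 2 * \<beta> * C * \<sigma> * norm_L2 \<Omega> e \<and>
     norm_L2 \<Omega> (adv_pw \<Omega> T b v) \<le> Bb * (2 * \<beta> * C) * norm_L2 \<Omega> e \<and>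
     norm_L2 \<Omega> (\<lambda>x. adv_pw \<Omega> T b v x - e x) \<le> L * \<sigma> * (2 * \<beta> * C) * norm_L2 \<Omega> e"
proof -
  obtain q where q: "\<And>K. K \<in> T \<Longrightarrow> q K \<in> Poly m" "\<And>K. K \<in> T \<Longrightarrow> AE x in lebesgue_on K. e x = q K x"
    using pw_polyE[OF e] by blast
  define J where "J K = (LINT x|lebesgue_on K. (e x)\<^sup>2)" for K
  have J0: "0 \<le> J K" for K unfolding J_def by (rule integral_nonneg_AE) simp
  have Jq: "J K = (LINT x|lebesgue_on K. (q K x)\<^sup>2)" if K: "K \<in> T" for K
    unfolding J_def by (rule LINT_element_cong[OF K pw_poly_L2[OF e] Poly_continuous[OF q(1)[OF K]] q(2)[OF K]])
  have mpos: "0 < measure lebesgue K" if "K \<in> T" for K using fat_measure_pos[OF fat[OF that] \<eta>] .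
  \<comment> \<open>Collecting all properties in one predicate lets the constant and the polynomial
    be chosen for all elements simultaneously.\<close>
  define good where "good K \<gamma> v \<longleftrightarrow> v \<in> Poly (m + 1) \<and> (AE x in lebesgue_on K. norm (b x - \<gamma>) \<le> L * \<sigma>) \<and> (\<forall>x. grad v x \<bullet> \<gamma> = q K x)
      \<and> (LINT x|lebesgue_on K. (v x)\<^sup>2) \<le> (2 * \<beta> * C * \<sigma>)\<^sup>2 * J K
      \<and> (\<forall>x\<in>K. (norm (grad v x))\<^sup>2 * measure lebesgue K \<le> (2 * \<beta> * C)\<^sup>2 * J K)" for K \<gamma> v
  have "\<exists>\<gamma> v. good K \<gamma> v" if K: "K \<in> T" for K
  proof -
    obtain \<gamma> where "AE x in lebesgue_on K. norm (b x - \<gamma>) \<le> L * diameter K" using near[OF K] by blast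
    then have g: "AE x in lebesgue_on K. norm (b x - \<gamma>) \<le> L * \<sigma>"
      using \<sigma>(1)[OF K] L by (auto elim!: eventually_mono intro: order_trans mult_left_mono)
    have "AE x in lebesgue_on K. 1 / (2 * \<beta>) \<le> norm \<gamma>"
      using g AE_element_from_dom[OF K lower]
    proof eventually_elim
      case (elim x)
      have "norm (b x) \<le> norm \<gamma> + norm (b x - \<gamma>)" by (metis add.commute norm_triangle_sub)
      then show ?case using elim small by (simp add: field_simps)
    qed
    \<comment> \<open>The inequality does not depend on \<open>x\<close>; it holds outright because
      the element has positive measure.\<close>
    then have gb: "1 / (2 * \<beta>) \<le> norm \<gamma>"
    proof -
      assume "AE x in lebesgue_on K. 1 / (2 * \<beta>) \<le> norm \<gamma>"
      then have "AE x in lebesgue. x \<in> K \<longrightarrow> 1 / (2 * \<beta>) \<le> norm \<gamma>" using element_sets[OF K] by (simp add: AE_on_iff)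
      then have "\<not> 1 / (2 * \<beta>) \<le> norm \<gamma> \<Longrightarrow> AE x in lebesgue. x \<notin> K" by (auto elim: eventually_mono)
      then have "\<not> 1 / (2 * \<beta>) \<le> norm \<gamma> \<Longrightarrow> K \<in> null_sets lebesgue"
        using element_sets[OF K] by (simp add: AE_iff_null_sets)
      then show ?thesis using mpos[OF K]
        by (cases "1 / (2 * \<beta>) \<le> norm \<gamma>") (auto simp: null_sets_def measure_def)
    qed
    have gpos: "0 < norm \<gamma>" using gb \<beta> by (metis divide_pos_pos less_le_trans mult_pos_pos zero_less_numeral zero_less_one)
    have inv: "1 / norm \<gamma> \<le> 2 * \<beta>" using gb gpos \<beta> by (simp add: field_simps)
    obtain v where v: "v \<in> Poly (m + 1)" "\<forall>x. grad v x \<bullet> \<gamma> = q K x"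
      "(LINT x|lebesgue_on K. (v x)\<^sup>2) \<le> (C * diameter K / norm \<gamma>)\<^sup>2 * J K"
      "\<forall>x\<in>K. (norm (grad v x))\<^sup>2 * measure lebesgue K \<le> (C / norm \<gamma>)\<^sup>2 * J K"
      using C(2)[THEN spec, THEN spec, THEN spec, THEN mp, OF fat[OF K], THEN mp, of \<gamma>, THEN mp, OF _ q(1)[OF K]] gpos
      unfolding Jq[OF K] by auto
    have d0: "0 < diameter K" by (rule element(5)[OF K])
    have 1: "C / norm \<gamma> \<le> 2 * \<beta> * C"
      using mult_left_mono[OF inv C(1)] by (simp add: mult_ac)
    have 2: "C * diameter K / norm \<gamma> \<le> 2 * \<beta> * C * \<sigma>"
    proof -
      have "C * diameter K / norm \<gamma> = (C / norm \<gamma>) * diameter K" by simp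
      also have "\<dots> \<le> (2 * \<beta> * C) * \<sigma>"
        using 1 \<sigma>(1)[OF K] d0 \<beta> C(1) gpos by (intro mult_mono) auto
      finally show ?thesis .
    qed
    have "(C * diameter K / norm \<gamma>)\<^sup>2 * J K \<le> (2 * \<beta> * C * \<sigma>)\<^sup>2 * J K"
      using 2 J0 C(1) d0 gpos by (intro mult_right_mono power_mono) auto
    moreover have "(C / norm \<gamma>)\<^sup>2 * J K \<le> (2 * \<beta> * C)\<^sup>2 * J K"
      using 1 J0 C(1) gpos by (intro mult_right_mono power_mono) auto
    ultimately have "good K \<gamma> v" unfolding good_def using v g by (auto intro: order_trans)
    then show ?thesis by blast
  qed
  then obtain \<gamma> p where good: "\<And>K. K \<in> T \<Longrightarrow> good K (\<gamma> K) (p K)" by metis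
  then have p: "\<And>K. K \<in> T \<Longrightarrow> p K \<in> Poly (m + 1)"
    and \<gamma>: "\<And>K. K \<in> T \<Longrightarrow> AE x in lebesgue_on K. norm (b x - \<gamma> K) \<le> L * \<sigma>"
    and pg: "\<And>K x. K \<in> T \<Longrightarrow> grad (p K) x \<bullet> \<gamma> K = q K x"
    and p1: "\<And>K. K \<in> T \<Longrightarrow> (LINT x|lebesgue_on K. (p K x)\<^sup>2) \<le> (2 * \<beta> * C * \<sigma>)\<^sup>2 * J K"
    and p2: "\<And>K x. K \<in> T \<Longrightarrow> x \<in> K \<Longrightarrow> (norm (grad (p K) x))\<^sup>2 * measure lebesgue K \<le> (2 * \<beta> * C)\<^sup>2 * J K"
    unfolding good_def by blast+
  define v where "v = glue p"
  have v: "v \<in> pw_poly T (m + 1)" unfolding v_def by (rule glue_pw_poly[OF p])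
  have vp: "AE x in lebesgue_on K. v x = p K x" if "K \<in> T" for K unfolding v_def by (rule glue_AE[OF that])
  let ?A = "adv_pw \<Omega> T b v"
  have A: "?A \<in> L2 \<Omega>" by (rule adv_pw_props(1)[OF v])
  have Ap: "AE x in lebesgue_on K. ?A x = b x \<bullet> grad (p K) x" if K: "K \<in> T" for K
    by (rule adv_pw_props(2)[OF v K Poly_smooth[OF p[OF K]] vp[OF K]])
  have nonneg: "0 \<le> 2 * \<beta> * C" "0 \<le> 2 * \<beta> * C * \<sigma>" "0 \<le> Bb * (2 * \<beta> * C)" "0 \<le> L * \<sigma> * (2 * \<beta> * C)"
    using \<beta> C(1) \<sigma>(2) Bb L by simp_all
  \<comment> \<open>A function dominated by \<open>k\<close> times the gradient inherits the L2
    bound: the pointwise gradient estimate, divided by the volume, is integrated over the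
    element.\<close>
  have gen: "(LINT x|lebesgue_on K. (F x)\<^sup>2) \<le> (k * (2 * \<beta> * C))\<^sup>2 * J K"
    if K: "K \<in> T" and F: "F \<in> L2 \<Omega>" and k: "0 \<le> k" and le: "AE x in lebesgue_on K. x \<in> K \<longrightarrow> \<bar>F x\<bar> \<le> k * norm (grad (p K) x)" for K F k
  proof -
    have "AE x in lebesgue_on K. x \<in> K" using element_sets[OF K] by (simp add: AE_on_iff)
    then have "AE x in lebesgue_on K. (F x)\<^sup>2 \<le> (k * (2 * \<beta> * C))\<^sup>2 * J K / measure lebesgue K"
      using le
    proof eventually_elim
      case (elim x)
      then have "\<bar>F x\<bar>\<^sup>2 \<le> (k * norm (grad (p K) x))\<^sup>2" by (intro power_mono) auto
      also have "\<dots> = k\<^sup>2 * (norm (grad (p K) x))\<^sup>2" by (simp add: power_mult_distrib)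
      also have "\<dots> \<le> k\<^sup>2 * ((2 * \<beta> * C)\<^sup>2 * J K / measure lebesgue K)"
        using p2[OF K, of x] elim mpos[OF K] by (intro mult_left_mono) (auto simp: pos_le_divide_eq)
      finally show ?case by (simp add: power_mult_distrib mult_ac)
    qed
    from LINT_element_sq_le[OF K F this] show ?thesis using mpos[OF K] by simp
  qed
  have 1: "norm_L2 \<Omega> v \<le> 2 * \<beta> * C * \<sigma> * norm_L2 \<Omega> e"
  proof (rule norm_L2_elementwise[OF pw_poly_L2[OF v] pw_poly_L2[OF e] nonneg(2)])
    fix K assume K: "K \<in> T"
    show "(LINT x|lebesgue_on K. (v x)\<^sup>2) \<le> (2 * \<beta> * C * \<sigma>)\<^sup>2 * (LINT x|lebesgue_on K. (e x)\<^sup>2)"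
      unfolding LINT_element_cong[OF K pw_poly_L2[OF v] Poly_continuous[OF p[OF K]] vp[OF K]]
      using p1[OF K] by (simp add: J_def)
  qed
  have 2: "norm_L2 \<Omega> ?A \<le> Bb * (2 * \<beta> * C) * norm_L2 \<Omega> e"
  proof (rule norm_L2_elementwise[OF A pw_poly_L2[OF e] nonneg(3)])
    fix K assume K: "K \<in> T"
    have "AE x in lebesgue_on K. x \<in> K \<longrightarrow> \<bar>?A x\<bar> \<le> Bb * norm (grad (p K) x)"
      using Ap[OF K] AE_element_from_dom[OF K upper]
    proof eventually_elim
      case (elim x)
      have "\<bar>b x \<bullet> grad (p K) x\<bar> \<le> norm (b x) * norm (grad (p K) x)" by (rule Cauchy_Schwarz_ineq2)
      also have "\<dots> \<le> Bb * norm (grad (p K) x)" using elim by (intro mult_right_mono) auto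
      finally show ?case using elim by simp
    qed
    from gen[OF K A Bb this] show "(LINT x|lebesgue_on K. (?A x)\<^sup>2) \<le> (Bb * (2 * \<beta> * C))\<^sup>2 * (LINT x|lebesgue_on K. (e x)\<^sup>2)"
      by (simp add: J_def)
  qed
  have Ae: "(\<lambda>x. ?A x - e x) \<in> L2 \<Omega>" by (rule L2_diff[OF A pw_poly_L2[OF e]])
  have 3: "norm_L2 \<Omega> (\<lambda>x. ?A x - e x) \<le> L * \<sigma> * (2 * \<beta> * C) * norm_L2 \<Omega> e"
  proof (rule norm_L2_elementwise[OF Ae pw_poly_L2[OF e] nonneg(4)])
    fix K assume K: "K \<in> T"
    have "AE x in lebesgue_on K. x \<in> K \<longrightarrow> \<bar>?A x - e x\<bar> \<le> L * \<sigma> * norm (grad (p K) x)"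
      using Ap[OF K] q(2)[OF K] \<gamma>[OF K]
    proof eventually_elim
      case (elim x)
      have "?A x - e x = (b x - \<gamma> K) \<bullet> grad (p K) x"
        using elim pg[OF K, of x] inner_commute[of "\<gamma> K" "grad (p K) x"] by (simp add: inner_diff_left)
      also have "\<bar>\<dots>\<bar> \<le> norm (b x - \<gamma> K) * norm (grad (p K) x)" by (rule Cauchy_Schwarz_ineq2)
      also have "\<dots> \<le> L * \<sigma> * norm (grad (p K) x)" using elim by (intro mult_right_mono) auto
      finally show ?case by simp
    qed
    from gen[OF K Ae _ this] show "(LINT x|lebesgue_on K. (?A x - e x)\<^sup>2) \<le> (L * \<sigma> * (2 * \<beta> * C))\<^sup>2 * (LINT x|lebesgue_on K. (e x)\<^sup>2)"
      using L \<sigma>(2) by (simp add: J_def)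
  qed
  show ?thesis using v 1 2 3 by blast
qed

text \<open>A piecewise constant is annihilated by the piecewise advective derivative, and on the
  subgrid it resolves a coarse piecewise polynomial up to a relative error \<open>O(\<sigma>)\<close>.\<close>

lemma piecewise_constant_test_function:
  assumes coarse: "triangulation \<Omega> T'"
    and A: "0 \<le> A" "\<forall>(K :: (real^'n) set) p. fat \<eta> K \<longrightarrow> p \<in> Poly m \<longrightarrow> (\<forall>x\<in>K.
     (diameter K * norm (grad p x))\<^sup>2 * measure lebesgue K \<le> A\<^sup>2 * (LINT x|lebesgue_on K. (p x)\<^sup>2))"
    and \<eta>: "0 < \<eta>" and fat: "\<And>K. K \<in> T' \<Longrightarrow> fat \<eta> K" and \<sigma>: "0 \<le> \<sigma>"
    and par: "\<And>K. K \<in> T \<Longrightarrow> \<exists>K'\<in>T'. K \<subseteq> K' \<and> diameter K \<le> \<sigma> * diameter K'"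
    and g: "g \<in> pw_poly T' m"
  shows "\<exists>v\<in>pw_poly T 0. (AE x in lebesgue_on \<Omega>. adv_pw \<Omega> T b v x = 0) \<and>
     norm_L2 \<Omega> (\<lambda>x. g x - v x) \<le> A * \<sigma> * norm_L2 \<Omega> g"
proof -
  interpret C: triangulation \<Omega> T' by (rule coarse)
  obtain q where q: "\<And>K. K \<in> T' \<Longrightarrow> q K \<in> Poly m" "\<And>K. K \<in> T' \<Longrightarrow> AE x in lebesgue_on K. g x = q K x"
    using C.pw_polyE[OF g] by blast
  obtain P where P: "\<And>K. K \<in> T \<Longrightarrow> P K \<in> T'" "\<And>K. K \<in> T \<Longrightarrow> K \<subseteq> P K" "\<And>K. K \<in> T \<Longrightarrow> diameter K \<le> \<sigma> * diameter (P K)"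
    using par by metis
  have "\<exists>z. z \<in> K" if "K \<in> T" for K using element(3)[OF that] interior_subset by blast
  then obtain z where z: "\<And>K. K \<in> T \<Longrightarrow> z K \<in> K" by metis
  have g2: "g \<in> L2 \<Omega>" by (rule C.pw_poly_L2[OF g])
  define J where "J K = (LINT x|lebesgue_on K. (g x)\<^sup>2)" for K
  have J0: "0 \<le> J K" for K unfolding J_def by (rule integral_nonneg_AE) simp
  have Jq: "J K = (LINT x|lebesgue_on K. (q K x)\<^sup>2)" if K: "K \<in> T'" for K
    unfolding J_def by (rule C.LINT_element_cong[OF K g2 Poly_continuous[OF q(1)[OF K]] q(2)[OF K]])
  have mpos: "0 < measure lebesgue K" if "K \<in> T'" for K using fat_measure_pos[OF fat[OF that] \<eta>] .
  \<comment> \<open>Up to the constant \<open>A\<close>, the root mean square of \<open>g\<close> on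
    a coarse element. It is scaled so that the gradient is at most s / diameter there; across a
    subgrid element of relative size \<sigma> the polynomial then varies by at most \<sigma> *
    s.\<close>
  define s where "s K = A * sqrt (J K / measure lebesgue K)" for K
  have s0: "0 \<le> s K" if "K \<in> T'" for K unfolding s_def using A(1) J0 mpos[OF that] by simp
  have s2: "(s K)\<^sup>2 = A\<^sup>2 * J K / measure lebesgue K" if "K \<in> T'" for K
    unfolding s_def using J0[of K] mpos[OF that] by (simp add: power_mult_distrib)
  have grad_le: "norm (grad (q K) x) \<le> s K / diameter K" if K: "K \<in> T'" and x: "x \<in> K" for K x
  proof -
    have d: "0 < diameter K" by (rule C.element(5)[OF K])
    have "(diameter K * norm (grad (q K) x))\<^sup>2 * measure lebesgue K \<le> A\<^sup>2 * J K"
      unfolding Jq[OF K] using A(2)[THEN spec, THEN spec, THEN mp, OF fat[OF K], THEN mp, OF q(1)[OF K], THEN bspec, OF x] .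
    then have "(diameter K * norm (grad (q K) x))\<^sup>2 \<le> (s K)\<^sup>2"
      unfolding s2[OF K] using mpos[OF K] by (simp add: pos_le_divide_eq)
    then have "diameter K * norm (grad (q K) x) \<le> s K" by (rule power2_le_imp_le[OF _ s0[OF K]])
    then show ?thesis using d by (simp add: pos_le_divide_eq mult.commute)
  qed
  have osc: "\<bar>q (P K) x - q (P K) (z K)\<bar> \<le> \<sigma> * s (P K)" if K: "K \<in> T" and x: "x \<in> K" for K x
  proof -
    let ?K = "P K"
    have d: "0 < diameter ?K" by (rule C.element(5)[OF P(1)[OF K]])
    have "norm (q ?K x - q ?K (z K)) \<le> (s ?K / diameter ?K) * norm (x - z K)"
    proof (rule differentiable_bound[OF C.element(2)[OF P(1)[OF K]]])
      show "(q ?K has_derivative (\<lambda>h. h \<bullet> grad (q ?K) y)) (at y within ?K)" for y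
        using smooth_gderiv[OF Poly_smooth[OF q(1)[OF P(1)[OF K]]], of y]
        by (auto simp: gderiv_def intro: has_derivative_at_withinI)
      show "onorm (\<lambda>h. h \<bullet> grad (q ?K) y) \<le> s ?K / diameter ?K" if "y \<in> ?K" for y
      proof (rule onorm_bound)
        show "0 \<le> s ?K / diameter ?K" using s0[OF P(1)[OF K]] d by simp
        fix h
        have "\<bar>h \<bullet> grad (q ?K) y\<bar> \<le> norm h * norm (grad (q ?K) y)" by (rule Cauchy_Schwarz_ineq2)
        also have "\<dots> \<le> norm h * (s ?K / diameter ?K)" using grad_le[OF P(1)[OF K] that] by (intro mult_left_mono) auto
        finally show "norm (h \<bullet> grad (q ?K) y) \<le> s ?K / diameter ?K * norm h" by (simp add: mult.commute)
      qed
      show "x \<in> ?K" "z K \<in> ?K" using x z[OF K] P(2)[OF K] by auto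
    qed
    also have "\<dots> \<le> (s ?K / diameter ?K) * (\<sigma> * diameter ?K)"
    proof (rule mult_left_mono)
      have "dist x (z K) \<le> diameter K"
        by (rule diameter_bounded_bound[OF compact_imp_bounded[OF element(1)[OF K]] x z[OF K]])
      then show "norm (x - z K) \<le> \<sigma> * diameter ?K" using P(3)[OF K] by (simp add: dist_norm)
    qed (use s0[OF P(1)[OF K]] d in simp)
    also have "\<dots> = \<sigma> * s ?K" using d by simp
    finally show ?thesis by simp
  qed
  define v where "v = glue (\<lambda>K x. q (P K) (z K))"
  have vP: "v \<in> pw_poly T 0" unfolding v_def by (rule glue_pw_poly[OF Poly_const])
  have vK: "AE x in lebesgue_on K. v x = q (P K) (z K)" if "K \<in> T" for K
    unfolding v_def by (rule glue_AE[OF that])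
  have "AE x in lebesgue_on K. adv_pw \<Omega> T b v x = 0" if K: "K \<in> T" for K
    using adv_pw_props(2)[OF vP K smooth_const vK[OF K]] by simp
  then have adv0: "AE x in lebesgue_on \<Omega>. adv_pw \<Omega> T b v x = 0" by (rule AE_dom_from_elements)
  \<comment> \<open>Quantifying over all coarse elements containing the point removes the parent
    from the statement. It can then be passed from subgrid elements to \<Omega> and from there to
    each coarse element.\<close>
  have "AE x in lebesgue_on K. \<forall>K'\<in>T'. x \<in> K' \<longrightarrow> \<bar>g x - v x\<bar> \<le> \<sigma> * s K'" if K: "K \<in> T" for K
  proof -
    have 1: "AE x in lebesgue_on K. g x = q (P K) x"
      by (rule AE_on_subset[OF q(2)[OF P(1)[OF K]] P(2)[OF K] C.element_sets[OF P(1)[OF K]] element_sets[OF K]])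
    have "AE x in lebesgue. \<forall>K'\<in>T'. K' \<noteq> P K \<longrightarrow> x \<notin> P K \<inter> K'"
      by (intro AE_finite_allI C.finite_T) (use AE_not_negligible[OF C.inter_T[OF P(1)[OF K]]] in fastforce)
    then have 2: "AE x in lebesgue_on K. x \<in> K \<and> (\<forall>K'\<in>T'. K' \<noteq> P K \<longrightarrow> x \<notin> P K \<inter> K')"
      using element_sets[OF K] by (auto simp: AE_on_iff elim: eventually_mono)
    show ?thesis using 1 2 vK[OF K]
    proof eventually_elim
      case (elim x)
      show ?case
      proof (intro ballI impI)
        fix K' assume "K' \<in> T'" "x \<in> K'"
        then have "K' = P K" using elim P(2)[OF K] by blast
        then show "\<bar>g x - v x\<bar> \<le> \<sigma> * s K'" using osc[OF K, of x] elim by simp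
      qed
    qed
  qed
  then have "AE x in lebesgue_on \<Omega>. \<forall>K'\<in>T'. x \<in> K' \<longrightarrow> \<bar>g x - v x\<bar> \<le> \<sigma> * s K'" by (rule AE_dom_from_elements)
  then have bnd: "AE x in lebesgue_on K'. \<bar>g x - v x\<bar> \<le> \<sigma> * s K'" if K': "K' \<in> T'" for K'
  proof -
    assume "AE x in lebesgue_on \<Omega>. \<forall>K'\<in>T'. x \<in> K' \<longrightarrow> \<bar>g x - v x\<bar> \<le> \<sigma> * s K'"
    from C.AE_element_from_dom[OF K' this]
    have "AE x in lebesgue_on K'. x \<in> K' \<longrightarrow> \<bar>g x - v x\<bar> \<le> \<sigma> * s K'" by eventually_elim (use K' in blast)
    then show ?thesis using C.element_sets[OF K'] by (simp add: AE_on_iff)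
  qed
  have gv: "(\<lambda>x. g x - v x) \<in> L2 \<Omega>" by (rule L2_diff[OF g2 pw_poly_L2[OF vP]])
  have "norm_L2 \<Omega> (\<lambda>x. g x - v x) \<le> A * \<sigma> * norm_L2 \<Omega> g"
  proof (rule C.norm_L2_elementwise[OF gv g2])
    show "0 \<le> A * \<sigma>" using A(1) \<sigma> by simp
    fix K' assume K': "K' \<in> T'"
    have "AE x in lebesgue_on K'. (g x - v x)\<^sup>2 \<le> (\<sigma> * s K')\<^sup>2"
      using bnd[OF K']
    proof eventually_elim
      case (elim x) then show ?case using power_mono[of "\<bar>g x - v x\<bar>" "\<sigma> * s K'" 2] by simp
    qed
    from C.LINT_element_sq_le[OF K' gv this]
    have "(LINT x|lebesgue_on K'. (g x - v x)\<^sup>2) \<le> (\<sigma> * s K')\<^sup>2 * measure lebesgue K'" .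
    also have "\<dots> = (A * \<sigma>)\<^sup>2 * J K'" unfolding power_mult_distrib s2[OF K'] using mpos[OF K'] by simp
    finally show "(LINT x|lebesgue_on K'. (g x - v x)\<^sup>2) \<le> (A * \<sigma>)\<^sup>2 * (LINT x|lebesgue_on K'. (g x)\<^sup>2)"
      by (simp add: J_def)
  qed
  then show ?thesis using vP adv0 by blast
qed

lemma pw_poly_vec_Linf:
  assumes "bt \<in> pw_poly_vec T m" shows "bt \<in> Linf \<Omega>"
proof -
  have "(\<lambda>x. bt x $ i *\<^sub>R axis i (1::real)) \<in> Linf \<Omega>" for i
  proof -
    have h: "(\<lambda>x. bt x $ i) \<in> Linf \<Omega>" using assms pw_poly_Linf by (auto simp: pw_poly_vec_def)
    have "AE x in lebesgue_on \<Omega>. norm (bt x $ i *\<^sub>R axis i (1::real) :: real^'n) \<le> norm_Linf \<Omega> (\<lambda>x. bt x $ i)"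
      using Linf_AE[OF h] by eventually_elim (simp add: norm_axis_1)
    then show ?thesis using Linf_measurable[OF h] unfolding Linf_iff by auto
  qed
  then have "(\<lambda>x. \<Sum>i\<in>UNIV. bt x $ i *\<^sub>R axis i (1::real)) \<in> Linf \<Omega>" by (auto intro: Linf_sum)
  moreover have "(\<Sum>i\<in>UNIV. bt x $ i *\<^sub>R axis i (1::real)) = bt x" for x
    by (simp add: basis_expansion flip: vector_scalar_commute scalar_mult_eq_scaleR)
  ultimately show ?thesis by simp
qed

text \<open>With g = ct u + bt . grad w - ft, the difference is (c - ct) u + (b - bt) . grad w - (f
  - ft). The inverse inequality bounds the gradient of \<open>w\<close> at the price of one
  diameter, which the hypothesis on \<open>b - bt\<close> pays back.\<close>

lemma residual_near_polynomial:
  assumes A: "0 \<le> A" "\<forall>(K :: (real^'n) set) p. fat \<eta> K \<longrightarrow> p \<in> Poly mw \<longrightarrow> (\<forall>x\<in>K.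
     (diameter K * norm (grad p x))\<^sup>2 * measure lebesgue K \<le> A\<^sup>2 * (LINT x|lebesgue_on K. (p x)\<^sup>2))"
    and \<eta>: "0 < \<eta>" and fat: "\<And>K. K \<in> T \<Longrightarrow> fat \<eta> K"
    and u: "u \<in> pw_poly T mu" and w: "w \<in> Hb \<Omega> b" "w \<in> pw_poly T mw"
    and c: "c \<in> Linf \<Omega>" and f: "f \<in> L2 \<Omega>"
    and ct: "ct \<in> pw_poly T mc" and bt: "bt \<in> pw_poly_vec T mb" and ft: "ft \<in> pw_poly T mf"
    and \<delta>: "\<And>K. K \<in> T \<Longrightarrow> norm_Linf K (\<lambda>x. b x - bt x) \<le> \<delta> * diameter K" "0 \<le> \<delta>"
  shows "\<exists>g\<in>pw_poly T (mc + mu + mb + mw + mf).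
     norm_L2 \<Omega> (\<lambda>x. (c x * u x + adv \<Omega> b w x - f x) - g x)
       \<le> norm_Linf \<Omega> (\<lambda>x. c x - ct x) * norm_L2 \<Omega> u + \<delta> * A * norm_L2 \<Omega> w + norm_L2 \<Omega> (\<lambda>x. f x - ft x)"
proof -
  let ?M = "mc + mu + mb + mw + mf"
  obtain pc where pc: "\<And>K. K \<in> T \<Longrightarrow> pc K \<in> Poly mc" "\<And>K. K \<in> T \<Longrightarrow> AE x in lebesgue_on K. ct x = pc K x"
    using pw_polyE[OF ct] by blast
  obtain pu where pu: "\<And>K. K \<in> T \<Longrightarrow> pu K \<in> Poly mu" "\<And>K. K \<in> T \<Longrightarrow> AE x in lebesgue_on K. u x = pu K x"
    using pw_polyE[OF u] by blast
  obtain p where p: "\<And>K. K \<in> T \<Longrightarrow> p K \<in> Poly mw" "\<And>K. K \<in> T \<Longrightarrow> AE x in lebesgue_on K. w x = p K x"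
    using pw_polyE[OF w(2)] by blast
  obtain pf where pf: "\<And>K. K \<in> T \<Longrightarrow> pf K \<in> Poly mf" "\<And>K. K \<in> T \<Longrightarrow> AE x in lebesgue_on K. ft x = pf K x"
    using pw_polyE[OF ft] by blast
  have "\<forall>i. \<forall>K\<in>T. \<exists>q. q \<in> Poly mb \<and> (AE x in lebesgue_on K. bt x $ i = q x)"
    using bt by (auto simp: pw_poly_vec_def pw_poly_def)
  then obtain pb where pb: "\<And>i K. K \<in> T \<Longrightarrow> pb i K \<in> Poly mb" "\<And>i K. K \<in> T \<Longrightarrow> AE x in lebesgue_on K. bt x $ i = pb i K x"
    by metis
  define q where "q K = (\<lambda>x. (pc K x * pu K x + (\<Sum>i\<in>UNIV. pb i K x * grad (p K) x $ i)) - pf K x)" for K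
  have qP: "q K \<in> Poly ?M" if K: "K \<in> T" for K
    unfolding q_def
  proof (intro Poly_diff Poly_add Poly_sum)
    show "(\<lambda>x. pc K x * pu K x) \<in> Poly ?M" by (rule Poly_mono[OF Poly_mult[OF pc(1)[OF K] pu(1)[OF K]]]) simp
    show "(\<lambda>x. pb i K x * grad (p K) x $ i) \<in> Poly ?M" for i
      by (rule Poly_mono[OF Poly_mult[OF pb(1)[OF K] Poly_grad(1)[OF p(1)[OF K]]]]) simp
    show "pf K \<in> Poly ?M" by (rule Poly_mono[OF pf(1)[OF K]]) simp
  qed
  define g where "g = glue q"
  have gP: "g \<in> pw_poly T ?M" unfolding g_def by (rule glue_pw_poly[OF qP])
  have gK: "AE x in lebesgue_on K. g x = q K x" if "K \<in> T" for K unfolding g_def by (rule glue_AE[OF that])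
  let ?G = "glue (\<lambda>K. grad (p K))"
  have GK: "AE x in lebesgue_on K. ?G x = grad (p K) x" if "K \<in> T" for K by (rule glue_AE[OF that])
  have GL: "?G \<in> Linf \<Omega>" by (intro glue_Linf smooth_grad_continuous Poly_smooth[OF p(1)])
  have bbt: "(\<lambda>x. b x - bt x) \<in> Linf \<Omega>" by (rule Linf_diff[OF b_Linf pw_poly_vec_Linf[OF bt]])
  define zz where "zz = (\<lambda>x. (b x - bt x) \<bullet> ?G x)"
  have zL: "zz \<in> L2 \<Omega>" unfolding zz_def by (rule Linf_L2[OF Linf_inner[OF bbt GL] dom_lmeasurable])
  have u2: "u \<in> L2 \<Omega>" and w2: "w \<in> L2 \<Omega>" using pw_poly_L2 u w(2) by blast+
  have ccL: "(\<lambda>x. c x - ct x) \<in> Linf \<Omega>" by (rule Linf_diff[OF c pw_poly_Linf[OF ct]])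
  have cuL: "(\<lambda>x. u x * (c x - ct x)) \<in> L2 \<Omega>" by (rule L2_mult_Linf[OF u2 ccL])
  have ffL: "(\<lambda>x. f x - ft x) \<in> L2 \<Omega>" by (rule L2_diff[OF f pw_poly_L2[OF ft]])
  have "AE x in lebesgue_on \<Omega>. (c x * u x + adv \<Omega> b w x - f x) - g x = (u x * (c x - ct x) + zz x) - (f x - ft x)"
  proof (rule AE_dom_from_elements)
    fix K assume K: "K \<in> T"
    have bts: "AE x in lebesgue_on K. \<forall>i\<in>UNIV. bt x $ i = pb i K x"
      by (intro AE_finite_allI) (use pb(2)[OF K] in auto)
    show "AE x in lebesgue_on K. (c x * u x + adv \<Omega> b w x - f x) - g x = (u x * (c x - ct x) + zz x) - (f x - ft x)"
      using adv_eq_classical[OF K w(1) Poly_smooth[OF p(1)[OF K]] p(2)[OF K]] gK[OF K] GK[OF K] pc(2)[OF K] pu(2)[OF K] pf(2)[OF K] bts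
    proof eventually_elim
      case (elim x)
      have "bt x \<bullet> grad (p K) x = (\<Sum>i\<in>UNIV. pb i K x * grad (p K) x $ i)"
        using elim by (simp add: inner_vec_def)
      then show ?case using elim by (simp add: q_def zz_def inner_diff_left algebra_simps)
    qed
  qed
  then have "norm_L2 \<Omega> (\<lambda>x. (c x * u x + adv \<Omega> b w x - f x) - g x) = norm_L2 \<Omega> (\<lambda>x. (u x * (c x - ct x) + zz x) - (f x - ft x))"
  proof (rule norm_L2_AE_cong[rotated 2])
    show "(\<lambda>x. (c x * u x + adv \<Omega> b w x - f x) - g x) \<in> L2 \<Omega>"
      using L2_diff[OF L2_diff[OF L2_add[OF L2_mult_Linf[OF u2 c] adv_props(1)[OF w(1)]] f] pw_poly_L2[OF gP]]
      by (simp add: mult.commute)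
    show "(\<lambda>x. (u x * (c x - ct x) + zz x) - (f x - ft x)) \<in> L2 \<Omega>" by (intro L2_diff[OF L2_add[OF cuL zL] ffL])
  qed
  also have "\<dots> \<le> norm_L2 \<Omega> (\<lambda>x. u x * (c x - ct x)) + norm_L2 \<Omega> zz + norm_L2 \<Omega> (\<lambda>x. f x - ft x)"
    using norm_L2_diff[OF L2_add[OF cuL zL] ffL] norm_L2_add[OF cuL zL] by linarith
  also have "norm_L2 \<Omega> (\<lambda>x. u x * (c x - ct x)) \<le> norm_Linf \<Omega> (\<lambda>x. c x - ct x) * norm_L2 \<Omega> u"
    by (rule norm_L2_mult_le[OF u2 ccL _ norm_Linf_nonneg]) (use Linf_AE[OF ccL] in simp)
  also have "norm_L2 \<Omega> zz \<le> \<delta> * A * norm_L2 \<Omega> w"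
  proof (rule norm_L2_elementwise[OF zL w2])
    show "0 \<le> \<delta> * A" using A(1) \<delta>(2) by simp
    fix K assume K: "K \<in> T"
    define J where "J = (LINT x|lebesgue_on K. (w x)\<^sup>2)"
    have Jp: "J = (LINT x|lebesgue_on K. (p K x)\<^sup>2)"
      unfolding J_def by (rule LINT_element_cong[OF K w2 Poly_continuous[OF p(1)[OF K]] p(2)[OF K]])
    have mpos: "0 < measure lebesgue K" using fat_measure_pos[OF fat[OF K] \<eta>] .
    have xK: "AE x in lebesgue_on K. x \<in> K" using element_sets[OF K] by (simp add: AE_on_iff)
    have "AE x in lebesgue_on K. (zz x)\<^sup>2 \<le> (\<delta> * A)\<^sup>2 * J / measure lebesgue K"
      using Linf_AE[OF Linf_element[OF K bbt]] GK[OF K] xK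
    proof eventually_elim
      case (elim x)
      have "\<bar>zz x\<bar> \<le> norm (b x - bt x) * norm (grad (p K) x)"
        unfolding zz_def using Cauchy_Schwarz_ineq2[of "b x - bt x" "?G x"] elim by simp
      also have "\<dots> \<le> (\<delta> * diameter K) * norm (grad (p K) x)"
        using elim \<delta>(1)[OF K] by (intro mult_right_mono) auto
      finally have "\<bar>zz x\<bar>\<^sup>2 \<le> (\<delta> * (diameter K * norm (grad (p K) x)))\<^sup>2"
        by (intro power_mono) (auto simp: mult.assoc)
      also have "\<dots> = \<delta>\<^sup>2 * (diameter K * norm (grad (p K) x))\<^sup>2" by (simp add: power_mult_distrib)
      also have "\<dots> \<le> \<delta>\<^sup>2 * (A\<^sup>2 * J / measure lebesgue K)"
      proof (rule mult_left_mono)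
        have "(diameter K * norm (grad (p K) x))\<^sup>2 * measure lebesgue K \<le> A\<^sup>2 * J"
          unfolding Jp using A(2)[THEN spec, THEN spec, THEN mp, OF fat[OF K], THEN mp, OF p(1)[OF K], THEN bspec, OF elim(3)] .
        then show "(diameter K * norm (grad (p K) x))\<^sup>2 \<le> A\<^sup>2 * J / measure lebesgue K"
          using mpos by (simp add: pos_le_divide_eq)
      qed simp
      finally show ?case by (simp add: power_mult_distrib mult.assoc)
    qed
    from LINT_element_sq_le[OF K zL this] mpos
    show "(LINT x|lebesgue_on K. (zz x)\<^sup>2) \<le> (\<delta> * A)\<^sup>2 * (LINT x|lebesgue_on K. (w x)\<^sup>2)" by (simp add: J_def)
  qed
  finally show ?thesis using gP by (intro bexI[of _ g]) auto
qed

end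

section \<open>The two-sided estimate\<close>

context transport_mesh
begin

text \<open>The residual identity is solved for the integral of \<open>e\<close> against the
  advective derivative of \<open>v\<close>, which is |e|^2 up to a small defect. The common factor
  |e| is kept, since it may vanish; it is divided out in \<open>reliability_arith\<close>.\<close>

lemma streamline_residual_estimate:
  fixes r e :: "real^'n \<Rightarrow> real"
  assumes u: "u \<in> L2 \<Omega>" and w: "w \<in> Hb \<Omega> b" and c: "c \<in> Linf \<Omega>" and f: "f \<in> L2 \<Omega>"
    and R: "residual_rep \<Omega> T m b c f u w R" and v: "v \<in> pw_poly T m"
    and D: "AE x in lebesgue_on \<Omega>. \<bar>wdiv \<Omega> b x\<bar> \<le> D" "0 \<le> D"
    and r_def: "r = (\<lambda>x. c x * u x + adv \<Omega> b w x - f x)" and e_def: "e = (\<lambda>x. w x - u x)"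
    and le: "norm_L2 \<Omega> v \<le> a1 * norm_L2 \<Omega> e" "norm_L2 \<Omega> (adv_pw \<Omega> T b v) \<le> a2 * norm_L2 \<Omega> e"
      "norm_L2 \<Omega> (\<lambda>x. adv_pw \<Omega> T b v x - e x) \<le> a3 * norm_L2 \<Omega> e"
  shows "norm_L2 \<Omega> e * norm_L2 \<Omega> e \<le> (a3 * norm_L2 \<Omega> e + norm_Hb_pw \<Omega> T b R * (a1 + a2)
     + norm_L2 \<Omega> r * a1 + D * a1 * norm_L2 \<Omega> e) * norm_L2 \<Omega> e"
proof -
  let ?A = "adv_pw \<Omega> T b v" and ?E = "norm_L2 \<Omega> e"
  have Rp: "R \<in> pw_poly T m" using R by (simp add: residual_rep_def)
  have w2: "w \<in> L2 \<Omega>" using w by (simp add: Hb_def)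
  have e2: "e \<in> L2 \<Omega>" unfolding e_def by (rule L2_diff[OF w2 u])
  have r2: "r \<in> L2 \<Omega>" unfolding r_def
    using L2_diff[OF L2_add[OF L2_mult_Linf[OF u c] adv_props(1)[OF w]] f] by (simp add: mult.commute)
  have v2: "v \<in> L2 \<Omega>" by (rule pw_poly_L2[OF v])
  have A2: "?A \<in> L2 \<Omega>" by (rule adv_pw_props(1)[OF v])
  have vd: "(\<lambda>x. v x * wdiv \<Omega> b x) \<in> L2 \<Omega>" by (rule L2_mult_Linf[OF v2 wdiv_Linf])
  have Ae: "(\<lambda>x. ?A x - e x) \<in> L2 \<Omega>" by (rule L2_diff[OF A2 e2])
  note I = L2_prod_integrable[OF e2 vd] L2_prod_integrable[OF e2 A2] L2_prod_integrable[OF e2 e2] L2_prod_integrable[OF e2 Ae]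
  have 1: "inner_Hb_pw \<Omega> T b R v = (LINT x|lebesgue_on \<Omega>. r x * v x)
      + ((LINT x|lebesgue_on \<Omega>. e x * (v x * wdiv \<Omega> b x)) + (LINT x|lebesgue_on \<Omega>. e x * ?A x))"
    using residual_eq[OF u w c f R v] I(1,2) by (simp add: r_def[symmetric] e_def[symmetric] distrib_left fun_cong[OF r_def, symmetric] fun_cong[OF e_def, symmetric])
  have 2: "(LINT x|lebesgue_on \<Omega>. e x * ?A x) = ?E * ?E + (LINT x|lebesgue_on \<Omega>. e x * (?A x - e x))"
  proof -
    have "(LINT x|lebesgue_on \<Omega>. e x * ?A x) = (LINT x|lebesgue_on \<Omega>. e x * e x + e x * (?A x - e x))"
      by (simp add: right_diff_distrib)
    also have "\<dots> = (LINT x|lebesgue_on \<Omega>. e x * e x) + (LINT x|lebesgue_on \<Omega>. e x * (?A x - e x))"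
      by (rule Bochner_Integration.integral_add[OF I(3,4)])
    finally show ?thesis using norm_L2_sq[of \<Omega> e] by (simp add: power2_eq_square)
  qed
  have 3: "\<bar>LINT x|lebesgue_on \<Omega>. e x * (?A x - e x)\<bar> \<le> ?E * (a3 * ?E)"
    using L2_Cauchy_Schwarz[OF e2 Ae] mult_left_mono[OF le(3) norm_L2_nonneg[of \<Omega> e]] by linarith
  have "norm_L2 \<Omega> (\<lambda>x. v x * wdiv \<Omega> b x) \<le> D * (a1 * ?E)"
    using norm_L2_mult_le[OF v2 wdiv_Linf D] mult_left_mono[OF le(1) D(2)] by linarith
  then have 4: "\<bar>LINT x|lebesgue_on \<Omega>. e x * (v x * wdiv \<Omega> b x)\<bar> \<le> ?E * (D * (a1 * ?E))"
    using L2_Cauchy_Schwarz[OF e2 vd] mult_left_mono[of _ _ ?E] norm_L2_nonneg[of \<Omega> e] by fastforce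
  have 5: "\<bar>LINT x|lebesgue_on \<Omega>. r x * v x\<bar> \<le> norm_L2 \<Omega> r * (a1 * ?E)"
    using L2_Cauchy_Schwarz[OF r2 v2] mult_left_mono[OF le(1) norm_L2_nonneg[of \<Omega> r]] by linarith
  have 6: "\<bar>inner_Hb_pw \<Omega> T b R v\<bar> \<le> norm_Hb_pw \<Omega> T b R * (a1 * ?E + a2 * ?E)"
    using inner_Hb_pw_le[OF Rp v] mult_left_mono[OF add_mono[OF le(1,2)] norm_Hb_pw_nonneg[of R]] by linarith
  have "?E * ?E \<le> norm_Hb_pw \<Omega> T b R * (a1 * ?E + a2 * ?E) + norm_L2 \<Omega> r * (a1 * ?E) + ?E * (D * (a1 * ?E)) + ?E * (a3 * ?E)"
    using 1 2 3 4 5 6 by linarith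
  then show ?thesis by (simp add: algebra_simps)
qed

text \<open>As \<open>v\<close> has no advective derivative, \<open>e\<close> enters only through
  the divergence term. The interpolation error absorbs half of |g|^2, which gives one factor 2; the
  other comes from |v| <= 2 |g|.\<close>

lemma piecewise_constant_residual_estimate:
  fixes r e :: "real^'n \<Rightarrow> real"
  assumes u: "u \<in> L2 \<Omega>" and w: "w \<in> Hb \<Omega> b" and c: "c \<in> Linf \<Omega>" and f: "f \<in> L2 \<Omega>"
    and R: "residual_rep \<Omega> T m b c f u w R" and v: "v \<in> pw_poly T m"
    and D: "AE x in lebesgue_on \<Omega>. \<bar>wdiv \<Omega> b x\<bar> \<le> D" "0 \<le> D"
    and r_def: "r = (\<lambda>x. c x * u x + adv \<Omega> b w x - f x)" and e_def: "e = (\<lambda>x. w x - u x)"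
    and g: "g \<in> L2 \<Omega>" and v0: "AE x in lebesgue_on \<Omega>. adv_pw \<Omega> T b v x = 0"
    and le: "norm_L2 \<Omega> (\<lambda>x. g x - v x) \<le> k * norm_L2 \<Omega> g" "k \<le> 1 / 2"
  shows "norm_L2 \<Omega> g \<le> 4 * (norm_Hb_pw \<Omega> T b R + norm_L2 \<Omega> (\<lambda>x. r x - g x) + D * norm_L2 \<Omega> e)"
proof -
  let ?A = "adv_pw \<Omega> T b v" and ?E = "norm_L2 \<Omega> e" and ?Q = "norm_L2 \<Omega> g"
  let ?O = "norm_L2 \<Omega> (\<lambda>x. r x - g x)" and ?N = "norm_Hb_pw \<Omega> T b R"
  have Rp: "R \<in> pw_poly T m" using R by (simp add: residual_rep_def)
  have w2: "w \<in> L2 \<Omega>" using w by (simp add: Hb_def)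
  have e2: "e \<in> L2 \<Omega>" unfolding e_def by (rule L2_diff[OF w2 u])
  have r2: "r \<in> L2 \<Omega>" unfolding r_def
    using L2_diff[OF L2_add[OF L2_mult_Linf[OF u c] adv_props(1)[OF w]] f] by (simp add: mult.commute)
  have v2: "v \<in> L2 \<Omega>" by (rule pw_poly_L2[OF v])
  have A2: "?A \<in> L2 \<Omega>" by (rule adv_pw_props(1)[OF v])
  have vd: "(\<lambda>x. v x * wdiv \<Omega> b x) \<in> L2 \<Omega>" by (rule L2_mult_Linf[OF v2 wdiv_Linf])
  have gv: "(\<lambda>x. g x - v x) \<in> L2 \<Omega>" by (rule L2_diff[OF g v2])
  have rg: "(\<lambda>x. r x - g x) \<in> L2 \<Omega>" by (rule L2_diff[OF r2 g])
  have zero2: "(\<lambda>x. 0) \<in> L2 \<Omega>" using L2_cmult[OF v2, of 0] by simp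
  have A0: "norm_L2 \<Omega> ?A = 0"
    using norm_L2_AE_cong[OF A2 zero2 v0] by (simp add: norm_L2_def)
  have Q0: "0 \<le> ?Q" by (rule norm_L2_nonneg)
  have kQ: "k * ?Q \<le> ?Q / 2" using mult_right_mono[OF le(2) Q0] by simp
  have vQ: "norm_L2 \<Omega> v \<le> 2 * ?Q"
    using norm_L2_diff[OF g gv] le(1) kQ Q0 by simp
  have 1: "inner_Hb_pw \<Omega> T b R v = (LINT x|lebesgue_on \<Omega>. r x * v x) + (LINT x|lebesgue_on \<Omega>. e x * (v x * wdiv \<Omega> b x))"
  proof -
    have "(LINT x|lebesgue_on \<Omega>. e x * (v x * wdiv \<Omega> b x + ?A x)) = (LINT x|lebesgue_on \<Omega>. e x * (v x * wdiv \<Omega> b x))"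
      by (rule integral_cong_AE)
        (use v0 borel_measurable_integrable[OF L2_prod_integrable[OF e2 vd]] borel_measurable_integrable[OF L2_prod_integrable[OF e2 L2_add[OF vd A2]]]
         in \<open>auto elim: eventually_mono\<close>)
    then show ?thesis using residual_eq[OF u w c f R v] by (simp add: fun_cong[OF r_def, symmetric] fun_cong[OF e_def, symmetric])
  qed
  \<comment> \<open>Splitting of g^2 into interpolation error, oscillation, and the part that the
    discrete residual sees.\<close>
  have 2: "?Q * ?Q = (LINT x|lebesgue_on \<Omega>. g x * (g x - v x)) - (LINT x|lebesgue_on \<Omega>. (r x - g x) * v x) + (LINT x|lebesgue_on \<Omega>. r x * v x)"
  proof -
    have "?Q * ?Q = (LINT x|lebesgue_on \<Omega>. g x * (g x - v x) - (r x - g x) * v x + r x * v x)"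
      using norm_L2_sq[of \<Omega> g] by (simp add: power2_eq_square algebra_simps)
    then show ?thesis using L2_prod_integrable[OF g gv] L2_prod_integrable[OF rg v2] L2_prod_integrable[OF r2 v2] by simp
  qed
  have 3: "\<bar>LINT x|lebesgue_on \<Omega>. g x * (g x - v x)\<bar> \<le> ?Q * (?Q / 2)"
    using L2_Cauchy_Schwarz[OF g gv] mult_left_mono[OF order_trans[OF le(1) kQ] Q0] by linarith
  have 4: "\<bar>LINT x|lebesgue_on \<Omega>. (r x - g x) * v x\<bar> \<le> ?O * (2 * ?Q)"
    using L2_Cauchy_Schwarz[OF rg v2] mult_left_mono[OF vQ norm_L2_nonneg[of \<Omega> "\<lambda>x. r x - g x"]] by linarith
  have "norm_L2 \<Omega> (\<lambda>x. v x * wdiv \<Omega> b x) \<le> D * (2 * ?Q)"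
    using norm_L2_mult_le[OF v2 wdiv_Linf D] mult_left_mono[OF vQ D(2)] by linarith
  then have "?E * norm_L2 \<Omega> (\<lambda>x. v x * wdiv \<Omega> b x) \<le> ?E * (D * (2 * ?Q))"
    by (rule mult_left_mono[OF _ norm_L2_nonneg])
  then have 5: "\<bar>LINT x|lebesgue_on \<Omega>. e x * (v x * wdiv \<Omega> b x)\<bar> \<le> ?E * (D * (2 * ?Q))"
    using L2_Cauchy_Schwarz[OF e2 vd] by linarith
  have 6: "\<bar>inner_Hb_pw \<Omega> T b R v\<bar> \<le> ?N * (2 * ?Q)"
    using inner_Hb_pw_le[OF Rp v] mult_left_mono[OF vQ norm_Hb_pw_nonneg[of R]] A0 by simp
  have "?Q * ?Q \<le> ?Q * (?Q / 2) + ?O * (2 * ?Q) + ?E * (D * (2 * ?Q)) + ?N * (2 * ?Q)"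
    using 1 2 3 4 5 6 by linarith
  then have "?Q * ?Q \<le> (4 * (?N + ?O + D * ?E)) * ?Q" by (simp add: algebra_simps)
  moreover have "0 \<le> 4 * (?N + ?O + D * ?E)"
    using norm_Hb_pw_nonneg[of R] norm_L2_nonneg[of \<Omega> "\<lambda>x. r x - g x"] norm_L2_nonneg[of \<Omega> e] D(2) by simp
  ultimately show ?thesis using Q0 by (cases "?Q = 0") (auto simp: mult_le_cancel_right)
qed

lemma pw_poly_mono: "v \<in> pw_poly T m \<Longrightarrow> m \<le> m' \<Longrightarrow> v \<in> pw_poly T m'"
  unfolding pw_poly_def using Poly_mono by blast

lemma pw_poly_diff: "v \<in> pw_poly T m \<Longrightarrow> z \<in> pw_poly T m \<Longrightarrow> (\<lambda>x. v x - z x) \<in> pw_poly T m"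
  unfolding pw_poly_def
proof (rule CollectI, rule ballI)
  fix K assume v: "v \<in> {u. \<forall>K\<in>T. \<exists>p\<in>Poly m. AE x in lebesgue_on K. u x = p x}"
    and z: "z \<in> {u. \<forall>K\<in>T. \<exists>p\<in>Poly m. AE x in lebesgue_on K. u x = p x}" and K: "K \<in> T"
  then obtain p q where p: "p \<in> Poly m" "AE x in lebesgue_on K. v x = p x" and q: "q \<in> Poly m" "AE x in lebesgue_on K. z x = q x"
    by blast
  have "AE x in lebesgue_on K. v x - z x = p x - q x" using p(2) q(2) by eventually_elim simp
  then show "\<exists>p\<in>Poly m. AE x in lebesgue_on K. v x - z x = p x" using Poly_diff[OF p(1) q(1)]
    by (intro bexI[of _ "\<lambda>x. p x - q x"])
qed

lemma pw_poly_refine: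
  assumes "triangulation \<Omega> T'" "refinement_of T T'" "v \<in> pw_poly T' m" shows "v \<in> pw_poly T m"
  unfolding pw_poly_def
proof (rule CollectI, rule ballI)
  interpret C: triangulation \<Omega> T' by fact
  fix K assume K: "K \<in> T"
  then obtain K' where K': "K' \<in> T'" "K \<subseteq> K'" using assms(2) by (auto simp: refinement_of_def)
  then obtain p where "p \<in> Poly m" "AE x in lebesgue_on K'. v x = p x" using assms(3) by (auto simp: pw_poly_def)
  then show "\<exists>p\<in>Poly m. AE x in lebesgue_on K. v x = p x"
    using AE_on_subset[OF _ K'(2) C.element_sets[OF K'(1)] element_sets[OF K]] by blast
qed

end

text \<open>Here \<open>N\<close> stands for the estimator and \<open>w\<close> for the oscillation.
  Inserting r <= 4 N + 5 w + 4 D E, the coefficient of \<open>E\<close> on the right becomes (a3 + 5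
  D a1) \<sigma>, four units from \<open>r\<close> and one from the divergence term. It is at most
  1/2 and is absorbed, doubling the rest.\<close>

lemma reliability_arith:
  fixes E Q r w N D a1 a2 a3 \<sigma> :: real
  assumes nn: "0 \<le> E" "0 \<le> w" "0 \<le> N" "0 \<le> D" "0 \<le> a1" "0 \<le> a2" "0 \<le> a3" "0 \<le> \<sigma>" "\<sigma> \<le> 1"
    and E: "E * E \<le> (a3 * \<sigma> * E + N * (a1 * \<sigma> + a2) + r * (a1 * \<sigma>) + D * (a1 * \<sigma>) * E) * E"
    and r: "r \<le> Q + w" and Q: "Q \<le> 4 * (N + w + D * E)"
    and small: "(a3 + 5 * D * a1) * \<sigma> \<le> 1 / 2"
  shows "E \<le> 2 * (5 * a1 + a2) * N + 10 * a1 * w"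
proof (cases "E = 0")
  case True
  then show ?thesis using nn by simp
next
  case False
  then have "E \<le> a3 * \<sigma> * E + N * (a1 * \<sigma> + a2) + r * (a1 * \<sigma>) + D * (a1 * \<sigma>) * E"
    using E nn(1) by (simp add: mult_le_cancel_right)
  moreover have "r * (a1 * \<sigma>) \<le> (4 * N + 5 * w + 4 * D * E) * (a1 * \<sigma>)"
    using r Q nn by (intro mult_right_mono) auto
  moreover have "(a3 + 5 * D * a1) * \<sigma> * E \<le> 1 / 2 * E" using small nn(1) by (rule mult_right_mono)
  ultimately have "E \<le> 2 * (N * (a1 * \<sigma> + a2) + (4 * N + 5 * w) * (a1 * \<sigma>))"
    by (simp add: algebra_simps)
  also have "\<dots> = 2 * ((5 * (a1 * \<sigma>) + a2) * N + 5 * (a1 * \<sigma>) * w)" by (simp add: algebra_simps)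
  also have "\<dots> \<le> 2 * ((5 * a1 + a2) * N + 5 * a1 * w)"
  proof -
    have "a1 * \<sigma> \<le> a1" using nn by (simp add: mult_left_le)
    then have "(5 * (a1 * \<sigma>) + a2) * N \<le> (5 * a1 + a2) * N" "(5 * (a1 * \<sigma>)) * w \<le> (5 * a1) * w"
      using nn by (intro mult_right_mono; simp)+
    then show ?thesis by simp
  qed
  finally show ?thesis by (simp add: algebra_simps)
qed

section \<open>Consequences of membership in the mesh family\<close>

lemma mesh_family_partition:
  assumes "mesh_family \<Omega> Tbot rul TT sub" "T \<in> TT"
  shows "simplicial_partition (closure \<Omega>) T" "sub T \<in> TT" "refinement_of (sub T) T"
  using assms obtained_from_partition[of rul Tbot T "closure \<Omega>"] by (auto simp: mesh_family_def)

text \<open>\<open>mesh_sigma\<close> is a supremum of reals, an upper bound only once the family is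
  known to be bounded; boundedness of \<Omega> and monotonicity of the diameter provide
  that.\<close>

lemma mesh_family_sizes:
  fixes \<Omega> :: "(real^'n) set"
  assumes mesh: "mesh_family \<Omega> Tbot rul TT sub" and bnd: "bounded \<Omega>" and T: "T \<in> TT" and K': "K' \<in> T"
  shows "diameter K' \<le> mesh_sigma TT sub"
    and "K \<in> sub T \<Longrightarrow> K \<subseteq> K' \<Longrightarrow> diameter K \<le> mesh_sigma TT sub * diameter K'"
proof -
  define \<phi> where "\<phi> S L = max (MAX K\<in>{K \<in> sub S. K \<subseteq> L}. diameter K / diameter L) (diameter L)" for S and L :: "(real^'n) set"
  have part: "simplicial_partition (closure \<Omega>) S" if "S \<in> TT" for S
    using mesh_family_partition(1)[OF mesh that] .
  have fin: "finite S" "finite (sub S)" if "S \<in> TT" for S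
    using part[OF that] part[OF mesh_family_partition(2)[OF mesh that]] by (auto simp: simplicial_partition_def)
  \<comment> \<open>Quotients are at most 1 and diameters at most that of the closure.
    \<open>Max {}\<close> is a fixed unspecified real; including it covers index sets not excluded
    here from being empty.\<close>
  define B where "B = max (max 1 (Max {} :: real)) (diameter (closure \<Omega>))"
  have \<phi>B: "\<phi> S L \<le> B" if S: "S \<in> TT" and L: "L \<in> S" for S L
  proof -
    have sub: "L \<subseteq> closure \<Omega>" and sim: "int CARD('n) simplex L" using part[OF S] L by (auto simp: simplicial_partition_def)
    have "diameter L \<le> diameter (closure \<Omega>)" by (rule diameter_subset[OF sub bounded_closure[OF bnd]])
    moreover have "(MAX K\<in>{K \<in> sub S. K \<subseteq> L}. diameter K / diameter L) \<le> max 1 (Max {})"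
    proof (cases "{K \<in> sub S. K \<subseteq> L} = {}")
      case True then show ?thesis unfolding True by simp
    next
      case False
      have "diameter K / diameter L \<le> 1" if "K \<subseteq> L" for K
        using diameter_subset[OF that compact_imp_bounded[OF simplex_props(1)[OF sim]]] simplex_props(5)[OF sim] by simp
      then have "(MAX K\<in>{K \<in> sub S. K \<subseteq> L}. diameter K / diameter L) \<le> 1"
        using False fin(2)[OF S] by (subst Max_le_iff) auto
      then show ?thesis by simp
    qed
    ultimately show ?thesis unfolding \<phi>_def B_def by (auto simp: le_max_iff_disj)
  qed
  have "(MAX L\<in>S. \<phi> S L) \<le> B" if S: "S \<in> TT" for S
  proof (cases "S = {}")
    case True then show ?thesis by (simp add: B_def)
  next
    case False then show ?thesis using \<phi>B[OF S] fin(1)[OF S] by (subst Max_le_iff) auto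
  qed
  then have bdd: "bdd_above ((\<lambda>S. MAX L\<in>S. \<phi> S L) ` TT)" by (auto simp: bdd_above_def)
  have "\<phi> T K' \<le> (MAX L\<in>T. \<phi> T L)" using fin(1)[OF T] K' by (intro Max_ge) auto
  also have "\<dots> \<le> (SUP S\<in>TT. MAX L\<in>S. \<phi> S L)" by (rule cSUP_upper[OF T bdd])
  also have "\<dots> = mesh_sigma TT sub" by (simp add: mesh_sigma_def \<phi>_def)
  finally have le: "\<phi> T K' \<le> mesh_sigma TT sub" .
  then show "diameter K' \<le> mesh_sigma TT sub" by (simp add: \<phi>_def)
  assume K: "K \<in> sub T" "K \<subseteq> K'"
  have d: "0 < diameter K'" using part[OF T] K' simplex_props(5) by (auto simp: simplicial_partition_def)
  have "diameter K / diameter K' \<le> (MAX K\<in>{K \<in> sub T. K \<subseteq> K'}. diameter K / diameter K')"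
    using K fin(2)[OF T] by (intro Max_ge) auto
  also have "\<dots> \<le> \<phi> T K'" by (simp add: \<phi>_def)
  finally have "diameter K / diameter K' \<le> mesh_sigma TT sub" using le by simp
  then show "diameter K \<le> mesh_sigma TT sub * diameter K'" using d by (simp add: pos_divide_le_eq)
qed

theorem theorem4p1:
  fixes mw mu mv mb mc mf :: nat
    and rho_bd binv_bd b_bd c_bd Binv_bd :: real
  assumes "1 \<le> mw"
    and "max (mw + max mc (max 1 (mb - 1))) (max (mu + max mc 1) mf) \<le> mv"
  shows "\<exists>\<sigma>s>0. \<forall>C0>0. \<forall>\<kappa>>0. \<forall>\<sigma>. 0 < \<sigma> \<and> \<sigma> \<le> \<sigma>s \<longrightarrow> (\<exists>C>0.
    \<forall>(\<Omega> :: (real^'n) set) b c Tbot rul TT sub T f bt ct ft u w R.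
      transport_data \<Omega> b c
    \<and> mesh_family \<Omega> Tbot rul TT sub
    \<and> family_shape TT \<le> rho_bd
    \<and> mesh_sigma TT sub = \<sigma>
    \<and> mesh_ratio TT sub \<ge> \<kappa> * \<sigma>
    \<and> norm_Linf \<Omega> (\<lambda>x. 1 / norm (b x)) \<le> binv_bd
    \<and> B_Lis \<Omega> b c
    \<and> norm_Binv \<Omega> b c \<le> Binv_bd
    \<and> T \<in> TT
    \<and> (\<forall>K'\<in>T. (\<forall>i. (\<lambda>x. b x $ i) \<in> W1inf (interior K')) \<and> c \<in> W1inf (interior K'))
    \<and> (MAX K'\<in>T. norm_W1inf_vec (interior K') b) \<le> b_bd
    \<and> (MAX K'\<in>T. norm_W1inf (interior K') c) \<le> c_bd
    \<and> f \<in> L2 \<Omega>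
    \<and> best_approx (norm_Linf \<Omega>) (pw_poly_vec T mb) b bt
    \<and> best_approx (norm_Linf \<Omega>) (pw_poly T mc) c ct
    \<and> best_approx (norm_L2 \<Omega>) (pw_poly T mf) f ft
    \<and> (u, w) \<in> U_discrete \<Omega> b T mu mw
    \<and> max (norm_L2 \<Omega> u) (norm_L2 \<Omega> w) \<le> C0 * norm_L2 \<Omega> f
    \<and> residual_rep \<Omega> (sub T) mv b c f u w R
    \<longrightarrow> (let uex = Binv \<Omega> b c f;
             err = norm_U \<Omega> b (\<lambda>x. uex x - u x) (\<lambda>x. uex x - w x);
             est = norm_Hb_pw \<Omega> (sub T) b R
         in est \<le> C * err \<and> err \<le> C * (est + osc \<Omega> T b bt c ct f ft)))"
proof -
  \<comment> \<open>The prescribed bounds are arbitrary reals. Enlarging each to at least 0 or 1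
    keeps it a bound and fixes the signs of all later constants.\<close>
  define \<rho> where "\<rho> = max 1 rho_bd"
  define \<eta> where "\<eta> = 1 / (4 * \<rho>)"
  define \<beta> where "\<beta> = max 1 binv_bd"
  define M where "M = max 0 b_bd"
  define Cc where "Cc = max 0 c_bd"
  define Bi where "Bi = max 0 Binv_bd"
  define L where "L = (CARD('n))\<^sup>2 * M"
  define D where "D = CARD('n) * M"
  \<comment> \<open>\<open>m\<close> is the degree of w - u, and \<open>N\<close> dominates the
    degrees of all terms in ct u + bt . grad w - ft.\<close>
  define m where "m = max mu mw"
  define N where "N = mc + mu + mb + mw + mf"
  have pos: "0 < \<eta>" "1 \<le> \<rho>" "0 < \<beta>" "0 \<le> M" "0 \<le> Cc" "0 \<le> Bi" "0 \<le> L" "0 \<le> D"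
    by (auto simp: \<rho>_def \<eta>_def \<beta>_def M_def Cc_def Bi_def L_def D_def)
  obtain C where C: "0 \<le> C" "\<forall>(K :: (real^'n) set) \<beta> e. fat \<eta> K \<longrightarrow> \<beta> \<noteq> 0 \<longrightarrow> e \<in> Poly m \<longrightarrow>
     (\<exists>v\<in>Poly (m + 1). (\<forall>x. grad v x \<bullet> \<beta> = e x) \<and>
        (LINT x|lebesgue_on K. (v x)\<^sup>2) \<le> (C * diameter K / norm \<beta>)\<^sup>2 * (LINT x|lebesgue_on K. (e x)\<^sup>2) \<and>
        (\<forall>x\<in>K. (norm (grad v x))\<^sup>2 * measure lebesgue K \<le> (C / norm \<beta>)\<^sup>2 * (LINT x|lebesgue_on K. (e x)\<^sup>2)))"
    using Poly_advection_solvable[OF pos(1), of m, where 'n='n] by (elim exE conjE) (rule that; assumption)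
  obtain A where A: "0 \<le> A" "\<forall>(K :: (real^'n) set) p. fat \<eta> K \<longrightarrow> p \<in> Poly N \<longrightarrow> (\<forall>x\<in>K.
     (diameter K * norm (grad p x))\<^sup>2 * measure lebesgue K \<le> A\<^sup>2 * (LINT x|lebesgue_on K. (p x)\<^sup>2))"
    using Poly_grad_bound[OF pos(1), of N, where 'n='n] by (elim exE conjE) (rule that; assumption)
  obtain A' where A': "0 \<le> A'" "\<forall>(K :: (real^'n) set) p. fat \<eta> K \<longrightarrow> p \<in> Poly mw \<longrightarrow> (\<forall>x\<in>K.
     (diameter K * norm (grad p x))\<^sup>2 * measure lebesgue K \<le> A'\<^sup>2 * (LINT x|lebesgue_on K. (p x)\<^sup>2))"
    using Poly_grad_bound[OF pos(1), of mw, where 'n='n] by (elim exE conjE) (rule that; assumption)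
  \<comment> \<open>Relative to |e|, the streamline test function has norm a1 * \<sigma>, advective
    derivative a2 and defect a3 * \<sigma>. The \<open>D\<close> in \<open>a2\<close> bounds |b|,
    besides bounding the divergence: both are at most n times \<open>M\<close>.\<close>
  define a1 where "a1 = 2 * \<beta> * C"
  define a2 where "a2 = D * (2 * \<beta> * C)"
  define a3 where "a3 = L * (2 * \<beta> * C)"
  have apos: "0 \<le> a1" "0 \<le> a2" "0 \<le> a3" using pos C(1) by (auto simp: a1_def a2_def a3_def)
  \<comment> \<open>The threshold is 1 / X. One sum dominates every smallness demand: interpolation
    by piecewise constants, absorption of |e|, \<gamma> staying away from 0, and \<sigma> <= 1. It
    is fixed before \<open>C0\<close> and \<kappa> are.\<close>
  define X where "X = 1 + 2 * A + 2 * (a3 + 5 * D * a1) + 2 * \<beta> * L"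
  have X: "1 \<le> X" "2 * A \<le> X" "2 * (a3 + 5 * D * a1) \<le> X" "2 * \<beta> * L \<le> X"
    using pos apos A(1) by (auto simp: X_def)
  show ?thesis
  proof (rule exI[of _ "1 / X"], intro conjI allI impI)
    show "0 < 1 / X" using X by simp
    fix C0 \<kappa> \<sigma> :: real
    assume C0: "0 < C0" and "0 < \<kappa>" and \<sigma>: "0 < \<sigma> \<and> \<sigma> \<le> 1 / X"
    have small: "Y * \<sigma> \<le> 1 / 2" if "2 * Y \<le> X" for Y
    proof -
      have "2 * Y * \<sigma> \<le> X * \<sigma>" using that \<sigma> by (intro mult_right_mono) auto
      also have "\<dots> \<le> 1" using \<sigma> X by (simp add: field_simps)
      finally show ?thesis by simp
    qed
    have \<sigma>1: "\<sigma> \<le> 1" using \<sigma> X by (metis divide_le_eq_1 less_le_trans order_trans zero_less_one)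
    \<comment> \<open>\<open>k\<close> adds the oscillation of f, of c and of b, the latter two
      using |u|, |w| <= C0 |f|. \<open>CE\<close> comes from \<open>reliability_arith\<close>, and
      \<open>CR\<close> from inserting it into |r| <= 4 (est + O' + D E) + O'. In
      \<open>Cfin\<close> the first group is the efficiency constant, the second the reliability
      constant.\<close>
    define k where "k = 1 + C0 + A' * C0"
    define CE where "CE = 2 * (5 * a1 + a2) + 10 * a1 * k"
    define CR where "CR = 4 + 5 * k + 4 * D * CE"
    define Cfin where "Cfin = (Cc + 1 + 2 * (D + 1)) + (2 * Bi * (CR + Cc * CE) + CE)"
    have kpos: "0 \<le> k" "0 \<le> CE" "0 \<le> CR" using C0 A'(1) apos pos by (auto simp: k_def CE_def CR_def)
    have Cfin: "0 < Cfin" "Cc + 1 + 2 * (D + 1) \<le> Cfin" "2 * Bi * (CR + Cc * CE) + CE \<le> Cfin"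
    proof -
      have "0 < Cc + 1 + 2 * (D + 1)" "0 \<le> 2 * Bi * (CR + Cc * CE) + CE" using pos kpos by (auto intro: add_nonneg_pos)
      then show "0 < Cfin" "Cc + 1 + 2 * (D + 1) \<le> Cfin" "2 * Bi * (CR + Cc * CE) + CE \<le> Cfin" by (auto simp: Cfin_def)
    qed
    have main: "norm_Hb_pw \<Omega> (sub T) b R \<le> Cfin * norm_U \<Omega> b (\<lambda>x. Binv \<Omega> b c f x - u x) (\<lambda>x. Binv \<Omega> b c f x - w x) \<and>
        norm_U \<Omega> b (\<lambda>x. Binv \<Omega> b c f x - u x) (\<lambda>x. Binv \<Omega> b c f x - w x)
          \<le> Cfin * (norm_Hb_pw \<Omega> (sub T) b R + osc \<Omega> T b bt c ct f ft)"
      if data: "transport_data \<Omega> b c" and mesh: "mesh_family \<Omega> Tbot rul TT sub" and shape: "family_shape TT \<le> rho_bd"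
        and ms: "mesh_sigma TT sub = \<sigma>" and binv: "norm_Linf \<Omega> (\<lambda>x. 1 / norm (b x)) \<le> binv_bd"
        and Lis: "B_Lis \<Omega> b c" and Bb: "norm_Binv \<Omega> b c \<le> Binv_bd" and T: "T \<in> TT"
        and W: "\<forall>K'\<in>T. (\<forall>i. (\<lambda>x. b x $ i) \<in> W1inf (interior K')) \<and> c \<in> W1inf (interior K')"
        and bW: "(MAX K'\<in>T. norm_W1inf_vec (interior K') b) \<le> b_bd"
        and cW: "(MAX K'\<in>T. norm_W1inf (interior K') c) \<le> c_bd"
        and f: "f \<in> L2 \<Omega>" and bt: "bt \<in> pw_poly_vec T mb" and ct: "ct \<in> pw_poly T mc" and ft: "ft \<in> pw_poly T mf"
        and uw: "(u, w) \<in> U_discrete \<Omega> b T mu mw" and uwf: "max (norm_L2 \<Omega> u) (norm_L2 \<Omega> w) \<le> C0 * norm_L2 \<Omega> f"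
        and R: "residual_rep \<Omega> (sub T) mv b c f u w R"
      for \<Omega> :: "(real^'n) set" and b c Tbot rul TT sub T f bt ct ft u w R
    proof -
      have dom: "open \<Omega>" "bounded \<Omega>" "interior (closure \<Omega>) = \<Omega>"
        using data by (auto simp: transport_data_def polytopal_domain_def)
      have bL: "b \<in> Linf \<Omega>" "\<exists>d\<in>Linf \<Omega>. weak_div \<Omega> b d" and cL: "c \<in> Linf \<Omega>"
        and b0: "AE x in lebesgue_on \<Omega>. b x \<noteq> 0" and biL: "(\<lambda>x. 1 / norm (b x)) \<in> Linf \<Omega>"
        using data by (auto simp: transport_data_def)
      note MT = mesh_family_partition[OF mesh T]
      note MS = mesh_family_partition[OF mesh MT(2)]
      interpret C: transport_mesh \<Omega> T b by unfold_locales (use dom MT(1) bL in auto)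
      interpret F: transport_mesh \<Omega> "sub T" b by unfold_locales (use dom MS(1) bL in auto)
      have fat: "fat \<eta> K" if "S \<in> TT" "K \<in> S" for S K
      proof -
        have "K \<in> \<Union>TT" using that by blast
        then have "shape_const K \<le> family_shape TT" unfolding family_shape_def
          using mesh by (intro cSUP_upper) (auto simp: mesh_family_def)
        then have "shape_const K \<le> \<rho>" using shape by (simp add: \<rho>_def)
        moreover have "int CARD('n) simplex K"
          using mesh_family_partition(1)[OF mesh that(1)] that(2) by (simp add: simplicial_partition_def)
        ultimately show ?thesis unfolding \<eta>_def using pos(2) by (intro shape_const_fat)
      qed
      have Cfat: "fat \<eta> K" if "K \<in> T" for K by (rule fat[OF T that])
      have Ffat: "fat \<eta> K" if "K \<in> sub T" for K by (rule fat[OF MT(2) that])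
      have par: "\<exists>K'\<in>T. K \<subseteq> K' \<and> diameter K \<le> \<sigma> * diameter K'" if "K \<in> sub T" for K
        using MT(3) that mesh_family_sizes(2)[OF mesh dom(2) T] ms unfolding refinement_of_def by blast
      have diam: "diameter K \<le> \<sigma>" if "K \<in> sub T" for K
        using mesh_family_sizes(1)[OF mesh dom(2) MT(2) that] ms by simp
      have Wb: "(\<lambda>x. b x $ i) \<in> W1inf (interior K)" "norm_W1inf_vec (interior K) b \<le> M" if "K \<in> T" for K i
      proof -
        show "(\<lambda>x. b x $ i) \<in> W1inf (interior K)" using W that by blast
        have "norm_W1inf_vec (interior K) b \<le> (MAX K'\<in>T. norm_W1inf_vec (interior K') b)"
          using C.finite_T that by (intro Max_ge) auto
        then show "norm_W1inf_vec (interior K) b \<le> M" using bW by (simp add: M_def)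
      qed
      have divb: "AE x in lebesgue_on \<Omega>. \<bar>wdiv \<Omega> b x\<bar> \<le> D"
        unfolding D_def
        by (rule C.AE_dom_from_elements, rule C.AE_element_from_interior, assumption,
            rule wdiv_bound[OF dom(1,2) open_interior C.interior_subset_dom bL(2)]) (use Wb in auto)
      have bb: "AE x in lebesgue_on \<Omega>. norm (b x) \<le> D"
      proof (rule C.AE_dom_from_elements, rule C.AE_element_from_interior, assumption)
        fix K assume K: "K \<in> T"
        have "AE x in lebesgue_on (interior K). \<bar>b x $ i\<bar> \<le> M" for i
        proof -
          have "(\<lambda>x. b x $ i) \<in> Linf (interior K)" using Wb(1)[OF K, of i] by (simp add: W1inf_def)
          from Linf_AE[OF this] show ?thesis
            by eventually_elim (use wpartial_props(4)[OF Wb(1)[OF K, of i]] norm_W1inf_component_le[of "interior K" b i] Wb(2)[OF K] in simp)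
        qed
        then have "AE x in lebesgue_on (interior K). \<forall>i\<in>UNIV. \<bar>b x $ i\<bar> \<le> M" by (intro AE_finite_allI) auto
        then show "AE x in lebesgue_on (interior K). norm (b x) \<le> D"
        proof eventually_elim
          case (elim x)
          have "(\<Sum>i\<in>UNIV. \<bar>b x $ i\<bar>) \<le> (\<Sum>i\<in>(UNIV::'n set). M)" by (rule sum_mono) (use elim in auto)
          then show ?case using norm_le_l1_cart[of "b x"] by (simp add: D_def)
        qed
      qed
      have blow: "AE x in lebesgue_on \<Omega>. 1 / \<beta> \<le> norm (b x)"
        using Linf_AE[OF biL] b0
      proof eventually_elim
        case (elim x)
        then have "1 / norm (b x) \<le> \<beta>" using binv by (simp add: \<beta>_def)
        then show ?case using elim pos(3) by (simp add: field_simps)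
      qed
      have cb: "AE x in lebesgue_on \<Omega>. \<bar>c x\<bar> \<le> Cc"
      proof (rule C.AE_dom_from_elements, rule C.AE_element_from_interior, assumption)
        fix K assume K: "K \<in> T"
        have cK: "c \<in> W1inf (interior K)" using W K by blast
        have "norm_W1inf (interior K) c \<le> (MAX K'\<in>T. norm_W1inf (interior K') c)"
          using C.finite_T K by (intro Max_ge) auto
        then have le: "norm_Linf (interior K) c \<le> Cc" using wpartial_props(4)[OF cK] cW by (simp add: Cc_def)
        have "c \<in> Linf (interior K)" using cK by (simp add: W1inf_def)
        from Linf_AE[OF this] show "AE x in lebesgue_on (interior K). \<bar>c x\<bar> \<le> Cc"
          by eventually_elim (use le in simp)
      qed
      have near: "\<exists>\<gamma>. AE x in lebesgue_on K. norm (b x - \<gamma>) \<le> L * diameter K" if K: "K \<in> sub T" for K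
      proof -
        obtain K' where K': "K' \<in> T" "K \<subseteq> K'" using par[OF K] by blast
        show ?thesis unfolding L_def
          by (rule F.W1inf_near_const[OF K interior_mono[OF K'(2)] Wb(1)[OF K'(1)] Wb(2)[OF K'(1)]])
      qed
      have uP: "u \<in> pw_poly T mu" and wH0: "w \<in> H0b \<Omega> b" and wP: "w \<in> pw_poly T mw"
        using uw by (auto simp: U_discrete_def)
      have wH: "w \<in> Hb \<Omega> b" using wH0 by (simp add: H0b_def)
      have u2: "u \<in> L2 \<Omega>" and w2: "w \<in> L2 \<Omega>" using C.pw_poly_L2 uP wP by blast+
      define e where "e = (\<lambda>x. w x - u x)"
      define r where "r = (\<lambda>x. c x * u x + adv \<Omega> b w x - f x)"
      define uex where "uex = Binv \<Omega> b c f"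
      have e2: "e \<in> L2 \<Omega>" unfolding e_def by (rule L2_diff[OF w2 u2])
      have r2: "r \<in> L2 \<Omega>" unfolding r_def
        using L2_diff[OF L2_add[OF L2_mult_Linf[OF u2 cL] C.adv_props(1)[OF wH]] f] by (simp add: mult.commute)
      define E where "E = norm_L2 \<Omega> e"
      define est where "est = norm_Hb_pw \<Omega> (sub T) b R"
      define os where "os = osc \<Omega> T b bt c ct f ft"
      define err where "err = norm_U \<Omega> b (\<lambda>x. uex x - u x) (\<lambda>x. uex x - w x)"
      define nf where "nf = norm_L2 \<Omega> f"
      have nf0: "0 \<le> nf" by (simp add: nf_def norm_L2_nonneg)
      have E0: "0 \<le> E" and est0: "0 \<le> est" by (simp_all add: E_def est_def norm_L2_nonneg F.norm_Hb_pw_nonneg)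
      have eP: "e \<in> pw_poly (sub T) m"
      proof -
        have "u \<in> pw_poly T m" "w \<in> pw_poly T m" using C.pw_poly_mono uP wP by (auto simp: m_def)
        then have "e \<in> pw_poly T m" unfolding e_def using C.pw_poly_diff by blast
        then show ?thesis by (rule F.pw_poly_refine[OF C.triangulation_axioms MT(3)])
      qed
      have Ls: "L * \<sigma> \<le> 1 / (2 * \<beta>)"
      proof -
        have "(\<beta> * L) * \<sigma> \<le> 1 / 2" by (rule small) (use X(4) in simp)
        then show ?thesis using pos(3) by (simp add: field_simps)
      qed
      obtain v where v: "v \<in> pw_poly (sub T) (m + 1)" "norm_L2 \<Omega> v \<le> (a1 * \<sigma>) * norm_L2 \<Omega> e"
        "norm_L2 \<Omega> (adv_pw \<Omega> (sub T) b v) \<le> a2 * norm_L2 \<Omega> e"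
        "norm_L2 \<Omega> (\<lambda>x. adv_pw \<Omega> (sub T) b v x - e x) \<le> (a3 * \<sigma>) * norm_L2 \<Omega> e"
      proof -
        have "\<exists>v\<in>pw_poly (sub T) (m + 1). norm_L2 \<Omega> v \<le> 2 * \<beta> * C * \<sigma> * norm_L2 \<Omega> e \<and>
         norm_L2 \<Omega> (adv_pw \<Omega> (sub T) b v) \<le> D * (2 * \<beta> * C) * norm_L2 \<Omega> e \<and>
         norm_L2 \<Omega> (\<lambda>x. adv_pw \<Omega> (sub T) b v x - e x) \<le> L * \<sigma> * (2 * \<beta> * C) * norm_L2 \<Omega> e"
          by (rule F.streamline_test_function[OF pos(1) C Ffat diam _ near pos(7) bb pos(8) blow pos(3) Ls eP]) (use \<sigma> in auto)
        then show ?thesis using that unfolding a1_def a2_def a3_def by (auto simp: mult_ac)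
      qed
      \<comment> \<open>The streamline test function has one degree more than \<open>e\<close>; the
        1 inside both maxima of the degree condition pays for it.\<close>
      have mv: "m + 1 \<le> mv" using assms by (auto simp: m_def)
      have Eineq: "E * E \<le> (a3 * \<sigma> * E + est * (a1 * \<sigma> + a2) + norm_L2 \<Omega> r * (a1 * \<sigma>) + D * (a1 * \<sigma>) * E) * E"
        unfolding E_def est_def
        by (rule F.streamline_residual_estimate[OF u2 wH cL f R F.pw_poly_mono[OF v(1) mv] divb pos(8) r_def e_def v(2-4)])
      \<comment> \<open>The maximum with 0 makes nonnegativity immediate. \<delta> still stays below
        the weight in \<open>osc\<close>, which also dominates a nonnegative norm.\<close>
      define \<delta> where "\<delta> = max 0 (MAX K\<in>T. norm_Linf K (\<lambda>x. b x - bt x) / diameter K)"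
      have \<delta>: "norm_Linf K (\<lambda>x. b x - bt x) \<le> \<delta> * diameter K" if K: "K \<in> T" for K
      proof -
        have "norm_Linf K (\<lambda>x. b x - bt x) / diameter K \<le> \<delta>" unfolding \<delta>_def
          using C.finite_T K by (intro max.coboundedI2 Max_ge) auto
        then show ?thesis using C.element(5)[OF K] by (simp add: pos_divide_le_eq)
      qed
      obtain g where g: "g \<in> pw_poly T N" "norm_L2 \<Omega> (\<lambda>x. r x - g x)
         \<le> norm_Linf \<Omega> (\<lambda>x. c x - ct x) * norm_L2 \<Omega> u + \<delta> * A' * norm_L2 \<Omega> w + norm_L2 \<Omega> (\<lambda>x. f x - ft x)"
        using C.residual_near_polynomial[OF A' pos(1) Cfat uP wH wP cL f ct bt ft \<delta>]
        unfolding N_def r_def by (auto simp: \<delta>_def)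
      define O' where "O' = norm_L2 \<Omega> (\<lambda>x. r x - g x)"
      have O0: "0 \<le> O'" by (simp add: O'_def norm_L2_nonneg)
      \<comment> \<open>Here |u| and |w| are traded for |f| through \<open>C0\<close>, because the
        coefficient terms of \<open>osc\<close> are weighted with the norm of
        \<open>f\<close>.\<close>
      have Ole: "O' \<le> k * os"
      proof -
        have 1: "norm_L2 \<Omega> (\<lambda>x. f x - ft x) \<le> os" by (simp add: os_def osc_def)
        have 2: "norm_Linf \<Omega> (\<lambda>x. c x - ct x) * nf \<le> os"
        proof -
          have "norm_Linf \<Omega> (\<lambda>x. c x - ct x) * nf \<le> max (norm_Linf \<Omega> (\<lambda>x. c x - ct x)) (MAX K\<in>T. norm_Linf K (\<lambda>x. b x - bt x) / diameter K) * nf"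
            using nf0 by (intro mult_right_mono) auto
          also have "\<dots> \<le> os" by (simp add: os_def osc_def nf_def)
          finally show ?thesis .
        qed
        have 3: "\<delta> * nf \<le> os"
        proof -
          have "\<delta> \<le> max (norm_Linf \<Omega> (\<lambda>x. c x - ct x)) (MAX K\<in>T. norm_Linf K (\<lambda>x. b x - bt x) / diameter K)"
            unfolding \<delta>_def using norm_Linf_nonneg[of \<Omega> "\<lambda>x. c x - ct x"] by auto
          then have "\<delta> * nf \<le> max (norm_Linf \<Omega> (\<lambda>x. c x - ct x)) (MAX K\<in>T. norm_Linf K (\<lambda>x. b x - bt x) / diameter K) * nf"
            using nf0 by (intro mult_right_mono) auto
          also have "\<dots> \<le> os" by (simp add: os_def osc_def nf_def)
          finally show ?thesis .
        qed
        have u': "norm_L2 \<Omega> u \<le> C0 * nf" and w': "norm_L2 \<Omega> w \<le> C0 * nf" using uwf by (auto simp: nf_def)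
        have "norm_Linf \<Omega> (\<lambda>x. c x - ct x) * norm_L2 \<Omega> u \<le> norm_Linf \<Omega> (\<lambda>x. c x - ct x) * (C0 * nf)"
          by (rule mult_left_mono[OF u' norm_Linf_nonneg])
        also have "\<dots> \<le> C0 * os" using mult_left_mono[OF 2, of C0] C0 by (simp add: mult_ac)
        finally have i: "norm_Linf \<Omega> (\<lambda>x. c x - ct x) * norm_L2 \<Omega> u \<le> C0 * os" .
        have "\<delta> * A' * norm_L2 \<Omega> w \<le> \<delta> * A' * (C0 * nf)"
          by (rule mult_left_mono[OF w']) (use A'(1) in \<open>simp add: \<delta>_def\<close>)
        also have "\<dots> \<le> A' * C0 * os" using mult_left_mono[OF 3, of "A' * C0"] C0 A'(1) by (simp add: mult_ac)
        finally have ii: "\<delta> * A' * norm_L2 \<Omega> w \<le> A' * C0 * os" .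
        have "O' \<le> C0 * os + A' * C0 * os + os" unfolding O'_def using g(2) i ii 1 by linarith
        then show ?thesis by (simp add: k_def algebra_simps)
      qed
      have os0: "0 \<le> os" using norm_L2_nonneg[of \<Omega> "\<lambda>x. f x - ft x"] by (simp add: os_def osc_def le_max_iff_disj)
      obtain v' where v': "v' \<in> pw_poly (sub T) 0" "AE x in lebesgue_on \<Omega>. adv_pw \<Omega> (sub T) b v' x = 0"
        "norm_L2 \<Omega> (\<lambda>x. g x - v' x) \<le> A * \<sigma> * norm_L2 \<Omega> g"
        using F.piecewise_constant_test_function[OF C.triangulation_axioms A pos(1) Cfat _ par g(1)] \<sigma> by auto
      have g2: "g \<in> L2 \<Omega>" by (rule C.pw_poly_L2[OF g(1)])
      have Q: "norm_L2 \<Omega> g \<le> 4 * (est + O' + D * E)"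
        unfolding est_def O'_def E_def
        by (rule F.piecewise_constant_residual_estimate[OF u2 wH cL f R F.pw_poly_mono[OF v'(1)] divb pos(8) r_def e_def g2 v'(2,3) small[OF X(2)]]) simp
      have rQ: "norm_L2 \<Omega> r \<le> norm_L2 \<Omega> g + O'"
        unfolding O'_def using norm_L2_add[OF g2 L2_diff[OF r2 g2]] by simp
      have Ele: "E \<le> 2 * (5 * a1 + a2) * est + 10 * a1 * O'"
        by (rule reliability_arith[OF E0 O0 est0 pos(8) apos _ \<sigma>1 Eineq rQ Q small[OF X(3)]]) (use \<sigma> in simp)
      define Z where "Z = est + os"
      have Z: "est \<le> Z" "os \<le> Z" "0 \<le> Z" using est0 os0 by (auto simp: Z_def)
      have OZ: "O' \<le> k * Z" using Ole mult_left_mono[OF Z(2) kpos(1)] by linarith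
      have EZ: "E \<le> CE * Z"
      proof -
        have "2 * (5 * a1 + a2) * est \<le> 2 * (5 * a1 + a2) * Z" "10 * a1 * O' \<le> 10 * a1 * (k * Z)"
          using Z OZ apos by (auto intro!: mult_left_mono)
        then show ?thesis using Ele by (simp add: CE_def algebra_simps)
      qed
      have rZ: "norm_L2 \<Omega> r \<le> CR * Z"
      proof -
        have "D * E \<le> D * (CE * Z)" by (rule mult_left_mono[OF EZ pos(8)])
        then have "norm_L2 \<Omega> r \<le> 4 * Z + 5 * (k * Z) + 4 * (D * (CE * Z))" using rQ Q OZ Z(1) by simp
        then show ?thesis by (simp add: CR_def algebra_simps)
      qed
      have uexp: "uex \<in> H0b \<Omega> b" "AE x in lebesgue_on \<Omega>. Bop \<Omega> b c uex x = f x"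
        unfolding uex_def by (rule C.Binv_props[OF Lis f])+
      have uexH: "uex \<in> Hb \<Omega> b" and uex2: "uex \<in> L2 \<Omega>" using uexp by (auto simp: H0b_def Hb_def)
      have uw2: "(\<lambda>x. uex x - u x) \<in> L2 \<Omega>" "(\<lambda>x. uex x - w x) \<in> L2 \<Omega>" by (intro L2_diff uex2 u2 w2)+
      have ce2: "(\<lambda>x. e x * c x) \<in> L2 \<Omega>" by (rule L2_mult_Linf[OF e2 cL])
      have w_err: "norm_Hb \<Omega> b (\<lambda>x. uex x - w x) \<le> Bi * ((CR + Cc * CE) * Z)"
      proof -
        have "norm_Hb \<Omega> b (\<lambda>x. uex x - w x) \<le> norm_Binv \<Omega> b c * norm_L2 \<Omega> (\<lambda>x. f x - Bop \<Omega> b c w x)"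
          unfolding uex_def by (rule C.error_le_residual[OF Lis cL f wH0])
        also have "\<dots> \<le> Bi * norm_L2 \<Omega> (\<lambda>x. f x - Bop \<Omega> b c w x)"
          using Bb by (intro mult_right_mono norm_L2_nonneg) (simp add: Bi_def)
        also have "(\<lambda>x. f x - Bop \<Omega> b c w x) = (\<lambda>x. - (r x + e x * c x))"
          by (auto simp: Bop_def r_def e_def algebra_simps)
        also have "norm_L2 \<Omega> \<dots> = norm_L2 \<Omega> (\<lambda>x. r x + e x * c x)" by (rule norm_L2_uminus)
        also have "\<dots> \<le> norm_L2 \<Omega> r + Cc * E"
          using norm_L2_add[OF r2 ce2] norm_L2_mult_le[OF e2 cL cb pos(5)] by (simp add: E_def)
        also have "\<dots> \<le> (CR + Cc * CE) * Z"
          using rZ mult_left_mono[OF EZ pos(5)] by (simp add: algebra_simps)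
        finally show ?thesis using pos(6) by (simp add: mult_left_mono)
      qed
      have u_err: "norm_L2 \<Omega> (\<lambda>x. uex x - u x) \<le> norm_Hb \<Omega> b (\<lambda>x. uex x - w x) + E"
        using norm_L2_add[OF uw2(2) e2] C.norm_L2_le_norm_Hb(1)[of "\<lambda>x. uex x - w x"] by (simp add: e_def E_def)
      have err_le: "err \<le> norm_L2 \<Omega> (\<lambda>x. uex x - u x) + norm_Hb \<Omega> b (\<lambda>x. uex x - w x)"
        unfolding err_def norm_U_def by (intro sqrt_sum_squares_le_sum norm_L2_nonneg C.norm_Hb_nonneg)
      have err_ge: "norm_L2 \<Omega> (\<lambda>x. uex x - u x) \<le> err" "norm_Hb \<Omega> b (\<lambda>x. uex x - w x) \<le> err"
        unfolding err_def norm_U_def by (intro real_le_rsqrt; simp)+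
      have err0: "0 \<le> err" using err_ge(1) norm_L2_nonneg order_trans by blast
      have "err \<le> (2 * Bi * (CR + Cc * CE) + CE) * Z"
        using err_le u_err w_err EZ by (simp add: algebra_simps)
      also have "\<dots> \<le> Cfin * Z" using Cfin(3) Z(3) by (rule mult_right_mono)
      finally have upper: "err \<le> Cfin * Z" .
      \<comment> \<open>Subtracting the equation satisfied by \<open>uex\<close> from
        \<open>r\<close> leaves only errors: c (u - uex) and the advective derivative of w -
        uex.\<close>
      have r_le: "norm_L2 \<Omega> r \<le> (Cc + 1) * err"
      proof -
        have ad: "adv \<Omega> b (\<lambda>x. uex x - w x) \<in> L2 \<Omega>" by (rule C.adv_props(1)[OF C.adv_diff(1)[OF uexH wH]])
        have cu: "(\<lambda>x. (uex x - u x) * c x) \<in> L2 \<Omega>" by (rule L2_mult_Linf[OF uw2(1) cL])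
        have "AE x in lebesgue_on \<Omega>. r x = - ((uex x - u x) * c x + adv \<Omega> b (\<lambda>x. uex x - w x) x)"
          using uexp(2) C.adv_diff(2)[OF uexH wH] by eventually_elim (auto simp: r_def Bop_def algebra_simps)
        then have "norm_L2 \<Omega> r = norm_L2 \<Omega> (\<lambda>x. - ((uex x - u x) * c x + adv \<Omega> b (\<lambda>x. uex x - w x) x))"
          by (intro norm_L2_AE_cong r2) (use L2_cmult[OF L2_add[OF cu ad], of "-1"] in simp)
        also have "\<dots> \<le> Cc * norm_L2 \<Omega> (\<lambda>x. uex x - u x) + norm_L2 \<Omega> (adv \<Omega> b (\<lambda>x. uex x - w x))"
          unfolding norm_L2_uminus using norm_L2_add[OF cu ad] norm_L2_mult_le[OF uw2(1) cL cb pos(5)] by linarith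
        also have "\<dots> \<le> Cc * err + err"
          using mult_left_mono[OF err_ge(1) pos(5)] C.norm_L2_le_norm_Hb(2)[of "\<lambda>x. uex x - w x"] err_ge(2) by linarith
        finally show ?thesis by (simp add: algebra_simps)
      qed
      have E_le: "E \<le> 2 * err"
      proof -
        have "E = norm_L2 \<Omega> (\<lambda>x. (uex x - u x) - (uex x - w x))" by (simp add: E_def e_def)
        also have "\<dots> \<le> norm_L2 \<Omega> (\<lambda>x. uex x - u x) + norm_L2 \<Omega> (\<lambda>x. uex x - w x)" by (rule norm_L2_diff[OF uw2])
        finally show ?thesis using err_ge C.norm_L2_le_norm_Hb(1)[of "\<lambda>x. uex x - w x"] by linarith
      qed
      have "est \<le> norm_L2 \<Omega> r + (D + 1) * E"
        unfolding est_def r_def E_def e_def by (rule F.estimator_le_residuals[OF u2 wH cL f R divb pos(8)])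
      also have "\<dots> \<le> (Cc + 1) * err + (D + 1) * (2 * err)"
        using r_le mult_left_mono[OF E_le, of "D + 1"] pos(8) by linarith
      also have "\<dots> = (Cc + 1 + 2 * (D + 1)) * err" by (simp add: algebra_simps)
      also have "\<dots> \<le> Cfin * err" using Cfin(2) err0 by (rule mult_right_mono)
      finally have "est \<le> Cfin * err" .
      then show ?thesis using upper by (simp add: est_def err_def uex_def Z_def os_def)
    qed
    show "\<exists>C>0. \<forall>(\<Omega> :: (real^'n) set) b c Tbot rul TT sub T f bt ct ft u w R.
      transport_data \<Omega> b c
    \<and> mesh_family \<Omega> Tbot rul TT sub
    \<and> family_shape TT \<le> rho_bd
    \<and> mesh_sigma TT sub = \<sigma>
    \<and> mesh_ratio TT sub \<ge> \<kappa> * \<sigma>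
    \<and> norm_Linf \<Omega> (\<lambda>x. 1 / norm (b x)) \<le> binv_bd
    \<and> B_Lis \<Omega> b c
    \<and> norm_Binv \<Omega> b c \<le> Binv_bd
    \<and> T \<in> TT
    \<and> (\<forall>K'\<in>T. (\<forall>i. (\<lambda>x. b x $ i) \<in> W1inf (interior K')) \<and> c \<in> W1inf (interior K'))
    \<and> (MAX K'\<in>T. norm_W1inf_vec (interior K') b) \<le> b_bd
    \<and> (MAX K'\<in>T. norm_W1inf (interior K') c) \<le> c_bd
    \<and> f \<in> L2 \<Omega>
    \<and> best_approx (norm_Linf \<Omega>) (pw_poly_vec T mb) b bt
    \<and> best_approx (norm_Linf \<Omega>) (pw_poly T mc) c ct
    \<and> best_approx (norm_L2 \<Omega>) (pw_poly T mf) f ft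
    \<and> (u, w) \<in> U_discrete \<Omega> b T mu mw
    \<and> max (norm_L2 \<Omega> u) (norm_L2 \<Omega> w) \<le> C0 * norm_L2 \<Omega> f
    \<and> residual_rep \<Omega> (sub T) mv b c f u w R
    \<longrightarrow> (let uex = Binv \<Omega> b c f;
             err = norm_U \<Omega> b (\<lambda>x. uex x - u x) (\<lambda>x. uex x - w x);
             est = norm_Hb_pw \<Omega> (sub T) b R
         in est \<le> C * err \<and> err \<le> C * (est + osc \<Omega> T b bt c ct f ft))"
    proof (intro exI[of _ Cfin] conjI[OF Cfin(1)] allI impI, unfold Let_def, elim conjE)
    qed (rule main; (assumption | simp add: best_approx_def))
  qed
qed

end
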